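(* Let $d>0$ and $\Omega=\mathbb{R}\times(0,d)$. There are constants $C_4,C_5,C_6>0$, independent of $V$, such that for any $V\ge 0$ (integrable on bounded subsets of $\Omega$) $$ N_-(q)\le 1+ C_6\left(\sum_{\{k\in\mathbb{Z}\,:\,\beta_k >C_4\}}\sqrt{\beta_k}+ \sum_{\{k\in\mathbb{Z}\,:\,\mathcal{C}_k>C_5\}}\mathcal{C}_k\right), $$ where $q$ is the quadratic form $$ q[u] = \int_{\Omega}\Big(|\nabla u|^2 -\frac{\pi^2}{4d^2}|u|^2\Big)\,dx\,dy - \int_{\Omega}V|u|^2\,dx\,dy $$ of the operator $-\Delta-\frac{\pi^2}{4d^2}-V$ on $L^2(\Omega)$ with Dirichlet condition at $y=0$ and Neumann condition at $y=d$, and $N_-(q)$, $\beta_k$, $\mathcal{C}_k$ are as defined in the context.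
   Context: $V:\Omega\to[0,\infty)$ is measurable and integrable on bounded subsets of $\Omega=\mathbb{R}\times(0,d)$. The domain of $q$ is $D(q)=\{u\in W^1_2(\Omega): u(x,0)=0\}\cap L^2(\Omega,V\,dx\,dy)$, with $u(x,0)=0$ in the trace sense (the Neumann condition $\partial u/\partial\mathbf n(x,d)=0$ is the natural boundary condition). $N_-(q)=\sup\{\dim M : M \text{ a linear subspace of } D(q),\ q[u]<0\ \forall u\in M\setminus\{0\}\}$; this is the number of negative eigenvalues, counted with multiplicity, of the associated operator when that operator is lower semi-bounded, self-adjoint and has no essential spectrum in $(-\infty,0)$. Dyadic intervals: $I_k=[2^{k-1},2^k]$ for $k>0$, $I_0=[-1,1]$, $I_k=[-2^{|k|},-2^{|k|-1}]$ for $k<0$. Unit intervals: $J_k=(k,k+1)$, $k\in\mathbb{Z}$, and $I=(0,d)$. Set $$\beta_0=\frac{2}{d}\int_{I_0}\int_0^d V(x,y)\sin^2\Big(\frac{\pi}{2d}y\Big)\,dy\,dx,\qquad \beta_k=\frac{2}{d}\int_{I_k}\int_0^d |x|\,V(x,y)\sin^2\Big(\frac{\pi}{2d}y\Big)\,dy\,dx\quad(k\ne0),$$ $$\mathcal{C}_k=\|V\|_{L_1(J_k,L_\psi(I))}.$$ Orlicz norm: let $\phi(s)=e^{|s|}-1-|s|$ and $\psi(t)=(1+|t|)\ln(1+|t|)-|t|$ (complementary $N$-functions). For an interval $I_2$ of finite length $|I_2|$, $$\|f\|^{(av)}_{\psi,I_2}=\sup\Big\{\Big|\int_{I_2}fg\,dy\Big|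 : \int_{I_2}\phi(g)\,dy\le |I_2|\Big\},$$ and for $f:I_1\times I_2\to\mathbb{R}$, $\|f\|_{L_1(I_1,L_\psi(I_2))}=\int_{I_1}\|f(x,\cdot)\|^{(av)}_{\psi,I_2}\,dx$. *)

theory Defs
  imports "HOL-Analysis.Analysis" "HOL-Library.Function_Algebras"
begin

section \<open>Sobolev space on planar domains\<close>

text \<open>\<open>F i j\<close> is the mixed partial derivative of \<open>f\<close> of order \<open>i\<close> in the first and
  \<open>j\<close> in the second variable.\<close>

definition smooth :: "(real \<times> real \<Rightarrow> complex) \<Rightarrow> bool" where
  "smooth f \<longleftrightarrow> (\<exists>F :: nat \<Rightarrow> nat \<Rightarrow> real \<times> real \<Rightarrow> complex. F 0 0 = f \<and>
     (\<forall>i j z. (F i j has_derivative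
        (\<lambda>(h, k). h *\<^sub>R F (Suc i) j z + k *\<^sub>R F i (Suc j) z)) (at z)))"

definition test_functions :: "(real \<times> real) set \<Rightarrow> (real \<times> real \<Rightarrow> complex) set" where
  "test_functions \<Omega> = {\<phi>. smooth \<phi> \<and> compact (closure {z. \<phi> z \<noteq> 0}) \<and> closure {z. \<phi> z \<noteq> 0} \<subseteq> \<Omega>}"

text \<open>Elements of \<open>L\<^sub>2\<close> and of the Sobolev space are represented by functions on the whole plane,
  of which only the values on \<open>\<Omega>\<close> matter; they are not identified when equal almost everywhere.\<close>

definition L2 :: "'a::euclidean_space set \<Rightarrow> ('a \<Rightarrow> complex) set" where
  "L2 \<Omega> = {u. u \<in> borel_measurable (lebesgue_on \<Omega>) \<and>
               integrable (lebesgue_on \<Omega>) (\<lambda>z. (cmod (u z))\<^sup>2)}"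

definition is_weak_deriv ::
  "(real \<times> real) set \<Rightarrow> real \<times> real \<Rightarrow> (real \<times> real \<Rightarrow> complex) \<Rightarrow> (real \<times> real \<Rightarrow> complex) \<Rightarrow> bool" where
  "is_weak_deriv \<Omega> e u v \<longleftrightarrow> (\<forall>\<phi>\<in>test_functions \<Omega>.
     (LINT z|lebesgue_on \<Omega>. u z * frechet_derivative \<phi> (at z) e) =
     - (LINT z|lebesgue_on \<Omega>. v z * \<phi> z))"

definition W12 :: "(real \<times> real) set \<Rightarrow> (real \<times> real \<Rightarrow> complex) set" where
  "W12 \<Omega> = {u \<in> L2 \<Omega>. \<forall>e\<in>Basis. \<exists>v\<in>L2 \<Omega>. is_weak_deriv \<Omega> e u v}"

text \<open>For open \<open>\<Omega>\<close> and \<open>u \<in> W12 \<Omega>\<close> the weak derivatives exist and are unique up to null sets, so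
  the choice below is immaterial.\<close>

definition weak_deriv ::
  "(real \<times> real) set \<Rightarrow> real \<times> real \<Rightarrow> (real \<times> real \<Rightarrow> complex) \<Rightarrow> real \<times> real \<Rightarrow> complex" where
  "weak_deriv \<Omega> e u = (SOME v. v \<in> L2 \<Omega> \<and> is_weak_deriv \<Omega> e u v)"

definition grad_sq :: "(real \<times> real) set \<Rightarrow> (real \<times> real \<Rightarrow> complex) \<Rightarrow> real \<times> real \<Rightarrow> real" where
  "grad_sq \<Omega> u z = (\<Sum>e\<in>Basis. (cmod (weak_deriv \<Omega> e u z))\<^sup>2)"

definition W12_norm :: "(real \<times> real) set \<Rightarrow> (real \<times> real \<Rightarrow> complex) \<Rightarrow> real" where
  "W12_norm \<Omega> u = sqrt (LINT z|lebesgue_on \<Omega>. grad_sq \<Omega> u z + (cmod (u z))\<^sup>2)"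

section \<open>The form and its negative index\<close>

definition strip :: "real \<Rightarrow> (real \<times> real) set" where
  "strip d = UNIV \<times> {0<..<d}"

text \<open>The trace on \<open>y = 0\<close> is the continuous extension of \<open>w \<mapsto> w(\<cdot>, 0)\<close> from restrictions of
  functions in \<open>C\<^sub>c\<^sup>\<infinity>(\<real>\<^sup>2)\<close>, which are dense in the Sobolev space of the strip, to a map into
  \<open>L\<^sub>2(\<real>)\<close>.\<close>

definition has_trace :: "real \<Rightarrow> (real \<times> real \<Rightarrow> complex) \<Rightarrow> (real \<Rightarrow> complex) \<Rightarrow> bool" where
  "has_trace d u g \<longleftrightarrow> g \<in> L2 UNIV \<and>
     (\<exists>w :: nat \<Rightarrow> real \<times> real \<Rightarrow> complex. (\<forall>n. w n \<in> test_functions UNIV) \<and>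
        (\<lambda>n. W12_norm (strip d) (w n - u)) \<longlonglongrightarrow> 0 \<and>
        (\<lambda>n. LINT x|lebesgue. (cmod (w n (x, 0) - g x))\<^sup>2) \<longlonglongrightarrow> 0)"

definition form_domain :: "real \<Rightarrow> (real \<times> real \<Rightarrow> real) \<Rightarrow> (real \<times> real \<Rightarrow> complex) set" where
  "form_domain d V = {u \<in> W12 (strip d). has_trace d u (\<lambda>x. 0) \<and>
     integrable (lebesgue_on (strip d)) (\<lambda>z. V z * (cmod (u z))\<^sup>2)}"

definition qform :: "real \<Rightarrow> (real \<times> real \<Rightarrow> real) \<Rightarrow> (real \<times> real \<Rightarrow> complex) \<Rightarrow> real" where
  "qform d V u =
     (LINT z|lebesgue_on (strip d). grad_sq (strip d) u z - pi\<^sup>2 / (4 * d\<^sup>2) * (cmod (u z))\<^sup>2)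
     - (LINT z|lebesgue_on (strip d). V z * (cmod (u z))\<^sup>2)"

definition cscale :: "complex \<Rightarrow> ('a \<Rightarrow> complex) \<Rightarrow> 'a \<Rightarrow> complex" where
  "cscale c f = (\<lambda>z. c * f z)"

interpretation cfun: vector_space "cscale :: complex \<Rightarrow> ('a \<Rightarrow> complex) \<Rightarrow> 'a \<Rightarrow> complex"
  by unfold_locales (auto simp: cscale_def fun_eq_iff algebra_simps)

text \<open>The library dimension of an infinite-dimensional space is \<open>0\<close>, hence the case distinction.\<close>

definition edim :: "('a \<Rightarrow> complex) set \<Rightarrow> enat" where
  "edim M = (if \<exists>B. finite B \<and> M \<subseteq> cfun.span B then enat (cfun.dim M) else \<infinity>)"

text \<open>Here \<open>M\<close> is a space of representatives. Since \<open>qform d V\<close> vanishes on functions that are null on the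
  strip, the condition forces \<open>M\<close> to contain no such function except \<open>0\<close>, so \<open>M\<close> is isomorphic
  to its image among the equivalence classes; conversely every subspace of classes lifts to such
  an \<open>M\<close>.\<close>

definition N_minus :: "real \<Rightarrow> (real \<times> real \<Rightarrow> real) \<Rightarrow> enat" where
  "N_minus d V = (SUP M \<in> {M. cfun.subspace M \<and> M \<subseteq> form_domain d V \<and> (\<forall>u\<in>M - {0}. qform d V u < 0)}.
     edim M)"

section \<open>Orlicz norm and the quantities in the estimate\<close>

text \<open>The N-function complementary to \<open>\<psi>(t) = (1 + \<bar>t\<bar>) ln (1 + \<bar>t\<bar>) - \<bar>t\<bar>\<close>; it is
  \<open>\<phi>\<close>, not \<open>\<psi>\<close>, that enters the norm of \<open>L\<^sub>\<psi>\<close>.\<close>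

definition phi :: "real \<Rightarrow> real" where
  "phi s = exp \<bar>s\<bar> - 1 - \<bar>s\<bar>"

text \<open>A \<open>g\<close> for which \<open>f g\<close> is not integrable contributes \<open>0\<close>; truncations of \<open>sgn f \<bar>g\<bar>\<close> then
  make the supremum infinite, as it should be.\<close>

definition L_psi_norm_av :: "real set \<Rightarrow> (real \<Rightarrow> real) \<Rightarrow> ennreal" where
  "L_psi_norm_av J f = (SUP g \<in> {g. g \<in> borel_measurable (lebesgue_on J) \<and>
       (\<integral>\<^sup>+ y. ennreal (phi (g y)) \<partial>lebesgue_on J) \<le> emeasure lebesgue J}.
     ennreal \<bar>LINT y|lebesgue_on J. f y * g y\<bar>)"

definition L1_L_psi_norm :: "real set \<Rightarrow> real set \<Rightarrow> (real \<times> real \<Rightarrow> real) \<Rightarrow> ennreal" where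
  "L1_L_psi_norm I\<^sub>1 I\<^sub>2 f = (\<integral>\<^sup>+ x. L_psi_norm_av I\<^sub>2 (\<lambda>y. f (x, y)) \<partial>lebesgue_on I\<^sub>1)"

definition dyadic :: "int \<Rightarrow> real set" where
  "dyadic k = (if k = 0 then {-1..1}
     else if k > 0 then {2 powi (k - 1)..2 powi k}
     else {- (2 powi \<bar>k\<bar>)..- (2 powi (\<bar>k\<bar> - 1))})"

definition beta :: "real \<Rightarrow> (real \<times> real \<Rightarrow> real) \<Rightarrow> int \<Rightarrow> real" where
  "beta d V k = 2 / d * (LINT x|lebesgue_on (dyadic k). LINT y|lebesgue_on {0<..<d}.
     (if k = 0 then 1 else \<bar>x\<bar>) * V (x, y) * (sin (pi / (2 * d) * y))\<^sup>2)"

definition C_norm :: "real \<Rightarrow> (real \<times> real \<Rightarrow> real) \<Rightarrow> int \<Rightarrow> ennreal" where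
  "C_norm d V k = L1_L_psi_norm {real_of_int k<..<real_of_int k + 1} {0<..<d} V"

definition admissible_potential :: "real \<Rightarrow> (real \<times> real \<Rightarrow> real) \<Rightarrow> bool" where
  "admissible_potential d V \<longleftrightarrow>
     V \<in> borel_measurable (lebesgue_on (strip d)) \<and> (\<forall>z\<in>strip d. V z \<ge> 0) \<and>
     (\<forall>B\<in>sets lebesgue. B \<subseteq> strip d \<longrightarrow> bounded B \<longrightarrow> integrable (lebesgue_on B) V)"

end

theory Submission
  imports Defs
begin

text \<open>
  A negative subspace of the form is at most \<open>n\<close>-dimensional once there are \<open>n\<close> linear functionals such that
  the form is nonnegative where all of them vanish (\<open>span_of_common_kernel\<close>, \<open>N_minus_le_rank\<close>). The functionals are
  obtained from an approximation: it is enough that \<open>\<integral>V\<bar>w - \<Phi> w\<bar>\<^sup>2\<close>, with \<open>\<Phi>\<close> of rank \<open>n\<close>, is bounded by the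
  unperturbed form \<open>\<integral>\<bar>\<nabla>w\<bar>\<^sup>2 - \<omega>\<^sup>2\<bar>w\<bar>\<^sup>2\<close>, \<open>\<omega> = \<pi>/(2d)\<close>, plus an error that involves the trace of \<open>w\<close> on \<open>y = 0\<close>. For
  smooth \<open>w\<close> such a bound can be proved pointwise in one variable, and it passes to the form domain by Fatou's lemma,
  because the trace is the limit of boundary values of smooth functions (\<open>form_nonneg_on_kernel\<close>).

  Let \<open>s(y) = sqrt (2/d) sin (\<omega>y)\<close> be the ground state of the transversal operator. Write \<open>w(x, y) = s(y) f(x) + r(x, y)\<close>
  with \<open>r(x, \<cdot>)\<close> orthogonal to \<open>s\<close>. The first transversal eigenvalue is \<open>\<omega>\<^sup>2\<close> and the second is larger, so the
  unperturbed form controls \<open>\<integral>\<bar>f'\<bar>\<^sup>2\<close> and the full Sobolev norm of \<open>r\<close> on the strip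
  (\<open>gap\<close>, \<open>transverse\<close>, \<open>form_decomposition\<close>). The two parts of \<open>w\<close> are then treated separately.

  The longitudinal part meets the weight \<open>\<rho>(x) = \<integral>V(x, y) s(y)\<^sup>2 dy\<close> on the line, whose masses on dyadic intervals are
  governed by \<open>\<beta>\<^sub>k\<close>. On the intervals with small \<open>\<beta>\<^sub>k\<close> one global average suffices, by a discrete Hardy inequality; this
  is the summand \<open>1\<close> in the estimate. An interval with large \<open>\<beta>\<^sub>k\<close> is divided into \<open>O(sqrt \<beta>\<^sub>k)\<close> pieces on each of which
  length times mass is small (\<open>longitudinal\<close>).

  The remainder is treated on the unit rectangles \<open>[k, k + 1) \<times> [0, d)\<close>. On a rectangle, possibly with a dyadic
  subrectangle removed, \<open>\<integral>V\<bar>r - c\<bar>\<^sup>2\<close> is at most a constant times the \<open>L\<^sub>1(L\<^sub>\<psi>)\<close> norm of \<open>V\<close> times the Dirichlet integral: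
  on vertical segments \<open>\<bar>r - c\<bar>\<^sup>2\<close> divided by the Dirichlet integral is exponentially integrable, which is what the
  norm dual to \<open>\<phi>\<close> requires (\<open>pointwise\<close>, \<open>local_bound\<close>). If \<open>\<C>\<^sub>k\<close> is small, the Sobolev norm absorbs
  the average as well and no functional is needed. If it is large, a stopping time argument that uses the exact
  superadditivity of the norm divides the rectangle into \<open>O(\<C>\<^sub>k)\<close> such regions (\<open>covering\<close>).
\<close>

section \<open>Dyadic cells and averages\<close>

definition idx :: "real \<Rightarrow> real \<Rightarrow> nat \<Rightarrow> real \<Rightarrow> int" where
  "idx c l i x = \<lfloor>(x - c) * 2 ^ i / l\<rfloor>"

text \<open>The \<open>a\<close>-th half-open interval of length \<open>l / 2 ^ i\<close>, counted from \<open>c\<close>.\<close>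
definition cell :: "real \<Rightarrow> real \<Rightarrow> nat \<Rightarrow> int \<Rightarrow> real set" where
  "cell c l i a = {x. idx c l i x = a}"

lemma cell_eq:
  assumes "l > 0"
  shows "cell c l i a = {c + l * a / 2 ^ i ..< c + l * (a + 1) / 2 ^ i}"
  using assms unfolding cell_def idx_def
  by (auto simp: floor_eq_iff field_simps)

lemma idx_div2: "idx c l (Suc i) x div 2 = idx c l i x"
proof -
  have "(x - c) * 2 ^ i / l = ((x - c) * 2 ^ Suc i / l) / real_of_int 2" by simp
  then show ?thesis unfolding idx_def by (simp only: floor_divide_real_eq_div)
qed

lemma idx_mono_eq:
  assumes "idx c l i x = idx c l i y" "j \<le> i"
  shows "idx c l j x = idx c l j y"
  using assms(2,1)
proof (induction rule: inc_induct)
  case (step n)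
  then show ?case by (metis idx_div2)
qed simp

lemma mem_cell: "x \<in> cell c l i a \<longleftrightarrow> idx c l i x = a"
  by (simp add: cell_def)

lemma cell_borel [measurable]: "cell c l i a \<in> sets borel"
  unfolding cell_def idx_def by measurable

lemma measure_cell: "l > 0 \<Longrightarrow> measure lborel (cell c l i a) = l / 2 ^ i"
  by (simp add: cell_eq divide_right_mono field_simps)

lemma emeasure_cell: "l > 0 \<Longrightarrow> emeasure lborel (cell c l i a) = ennreal (l / 2 ^ i)"
  by (simp add: cell_eq divide_right_mono field_simps)

lemma cell_bounded [simp]: "l > 0 \<Longrightarrow> bounded (cell c l i a)"
  by (simp add: cell_eq bounded_subset[OF bounded_closed_interval] bounded_subset[OF bounded_cbox])

lemma cell_0: "l > 0 \<Longrightarrow> cell c l 0 0 = {c..<c+l}"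
  by (simp add: cell_eq)

text \<open>One of the two halves of the cell of \<open>x\<close> at level \<open>i\<close>. It is chosen so as not to contain \<open>\<xi>\<close>; when \<open>\<xi>\<close> is
  taken inside a hole, these halves stay away from the hole.\<close>
definition sibling :: "real \<Rightarrow> real \<Rightarrow> real \<Rightarrow> nat \<Rightarrow> real \<Rightarrow> real set" where
  "sibling c l \<xi> i x = cell c l (Suc i)
     (if idx c l (Suc i) \<xi> = 2 * idx c l i x then 2 * idx c l i x + 1 else 2 * idx c l i x)"

lemma sibling_subset: "sibling c l \<xi> i x \<subseteq> cell c l i (idx c l i x)"
proof
  fix y assume "y \<in> sibling c l \<xi> i x"
  then have "idx c l (Suc i) y = 2 * idx c l i x \<or> idx c l (Suc i) y = 2 * idx c l i x + 1"
    by (auto simp: sibling_def mem_cell split: if_splits)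
  then have "idx c l (Suc i) y div 2 = idx c l i x" by auto
  then show "y \<in> cell c l i (idx c l i x)" by (simp add: idx_div2 mem_cell)
qed

lemma sibling_avoids: "i < m \<Longrightarrow> sibling c l \<xi> i x \<inter> cell c l m (idx c l m \<xi>) = {}"
proof (safe, goal_cases)
  case (1 y)
  then have "idx c l m y = idx c l m \<xi>" by (simp add: mem_cell)
  then have *: "idx c l (Suc i) y = idx c l (Suc i) \<xi>" using idx_mono_eq 1(1) Suc_leI by metis
  with 1 show ?case by (auto simp: sibling_def mem_cell split: if_splits)
qed

lemma sibling_cong: "idx c l i x = idx c l i y \<Longrightarrow> sibling c l \<xi> i x = sibling c l \<xi> i y"
  by (simp add: sibling_def)

lemma measure_sibling: "l > 0 \<Longrightarrow> measure lborel (sibling c l \<xi> i x) = l / 2 ^ Suc i"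
  unfolding sibling_def by (simp only: measure_cell)

lemma sibling_borel [measurable]: "sibling c l \<xi> i x \<in> sets borel"
  unfolding sibling_def by measurable

lemma sibling_bounded [simp]: "l > 0 \<Longrightarrow> bounded (sibling c l \<xi> i x)"
  unfolding sibling_def by simp

definition C1 :: "(real \<times> real \<Rightarrow> complex) \<Rightarrow> (real \<times> real \<Rightarrow> complex) \<Rightarrow> (real \<times> real \<Rightarrow> complex) \<Rightarrow> bool" where
  "C1 w p q \<longleftrightarrow> continuous_on UNIV w \<and> continuous_on UNIV p \<and> continuous_on UNIV q \<and>
     (\<forall>x y. ((\<lambda>x. w (x, y)) has_vector_derivative p (x, y)) (at x)) \<and>
     (\<forall>x y. ((\<lambda>y. w (x, y)) has_vector_derivative q (x, y)) (at y))"

lemma set_integrable_continuous: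
  fixes g :: "'a::euclidean_space \<Rightarrow> 'b::{banach,second_countable_topology}"
  assumes "continuous_on UNIV g" "bounded S" "S \<in> sets borel"
  shows "set_integrable lborel S g"
proof -
  have "compact (closure S)" using assms(2) by (simp add: compact_closure)
  then have "set_integrable lborel (closure S) g"
    unfolding set_integrable_def
    by (intro borel_integrable_compact continuous_on_subset[OF assms(1)]) auto
  then show ?thesis
    by (rule set_integrable_subset) (use assms closure_subset in auto)
qed

lemma set_integral_subset_le:
  fixes f :: "'a \<Rightarrow> real"
  assumes "set_integrable M B f" "A \<in> sets M" "A \<subseteq> B" "\<And>x. x \<in> B \<Longrightarrow> 0 \<le> f x"
  shows "(LINT x:A|M. f x) \<le> (LINT x:B|M. f x)"
  using assms set_integrable_subset[OF assms(1-3)] unfolding set_lebesgue_integral_def set_integrable_def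
  by (intro integral_mono) (auto simp: indicator_def)

lemma iter_integral:
  fixes g :: "real \<times> real \<Rightarrow> 'b::{banach,second_countable_topology}"
  assumes "continuous_on UNIV g" "bounded A" "A \<in> sets borel" "bounded B" "B \<in> sets borel"
  shows "(LINT x:A|lborel. LINT y:B|lborel. g (x, y)) = (LINT z:A\<times>B|lborel. g z)"
    and "(LINT y:B|lborel. LINT x:A|lborel. g (x, y)) = (LINT z:A\<times>B|lborel. g z)"
    and "set_integrable lborel A (\<lambda>x. LINT y:B|lborel. g (x, y))"
proof -
  have AB: "A \<times> B \<in> sets borel" using assms by (simp add: borel_Times)
  have i: "set_integrable lborel (A \<times> B) g"
    using assms AB by (intro set_integrable_continuous) (auto simp: bounded_Times)
  then have i': "integrable (lborel \<Otimes>\<^sub>M lborel) (\<lambda>(x,y). indicator A x *\<^sub>R indicator B y *\<^sub>R g (x, y))"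
    unfolding set_integrable_def lborel_prod
    by (rule Bochner_Integration.integrable_cong[THEN iffD1, rotated -1]) (auto simp: indicator_def)
  have e: "(LINT z:A\<times>B|lborel. g z) = integral\<^sup>L (lborel \<Otimes>\<^sub>M lborel) (\<lambda>(x,y). indicator A x *\<^sub>R indicator B y *\<^sub>R g (x, y))"
    unfolding set_lebesgue_integral_def lborel_prod
    by (rule Bochner_Integration.integral_cong) (auto simp: indicator_def)
  show "(LINT x:A|lborel. LINT y:B|lborel. g (x, y)) = (LINT z:A\<times>B|lborel. g z)"
    unfolding e lborel_pair.integral_fst'[OF i', symmetric]
    by (simp add: set_lebesgue_integral_def flip: scaleR_scaleR)
  show "(LINT y:B|lborel. LINT x:A|lborel. g (x, y)) = (LINT z:A\<times>B|lborel. g z)"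
    unfolding e lborel_pair.integral_snd[OF i', symmetric]
    by (simp add: set_lebesgue_integral_def scaleR_left_commute[of "indicat_real A _" "indicat_real B _"] flip: scaleR_scaleR)
  show "set_integrable lborel A (\<lambda>x. LINT y:B|lborel. g (x, y))"
    using lborel_pair.integrable_fst'[OF i'] by (simp add: set_lebesgue_integral_def set_integrable_def flip: scaleR_scaleR)
qed

definition avg :: "'a::euclidean_space set \<Rightarrow> ('a \<Rightarrow> complex) \<Rightarrow> complex" where
  "avg A g = (LINT x:A|lborel. g x) / measure lborel A"

lemma avg_close:
  assumes "set_integrable lborel A g" "A \<in> sets borel" "bounded A" "measure lborel A > 0"
    and "\<And>x. x \<in> A \<Longrightarrow> cmod (g x - k) \<le> D"
  shows "cmod (avg A g - k) \<le> D"
proof -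
  let ?m = "measure lborel A"
  have fin: "emeasure lborel A < \<infinity>" by (rule emeasure_bounded_finite[OF assms(3)])
  have ck: "set_integrable lborel A (\<lambda>_. k)" "set_integrable lborel A (\<lambda>_. D)"
    using fin assms(2) by (auto simp: set_integrable_def intro!: integrable_scaleR_left)
  have ik: "(LINT x:A|lborel. k) = ?m * k"
    unfolding set_lebesgue_integral_def using fin assms(2) by (simp add: scaleR_conv_of_real)
  have "avg A g - k = (LINT x:A|lborel. g x - k) / ?m"
    using assms(4) by (simp add: avg_def set_integral_diff(2)[OF assms(1) ck(1)] ik field_simps)
  also have "cmod ... \<le> (LINT x:A|lborel. D) / ?m"
  proof -
    have "cmod (LINT x:A|lborel. g x - k) \<le> (LINT x:A|lborel. cmod (g x - k))"
      using set_integral_diff(1)[OF assms(1) ck(1)] by (rule set_integral_norm_bound)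
    also have "... \<le> (LINT x:A|lborel. D)"
      by (intro set_integral_mono set_integrable_norm set_integral_diff ck assms)
    finally show ?thesis using assms(4) by (simp add: norm_divide divide_right_mono)
  qed
  also have "... = D" using assms(4) fin assms(2) by (simp add: set_lebesgue_integral_def)
  finally show ?thesis .
qed

lemma diff_le_integral_deriv:
  fixes g :: "real \<Rightarrow> complex"
  assumes d: "\<And>x. (g has_vector_derivative g' x) (at x)" and c: "continuous_on UNIV g'"
    and s: "s \<in> {a..b}" and t: "t \<in> {a..b}"
  shows "cmod (g s - g t) \<le> (LINT x:{a..<b}|lborel. cmod (g' x))"
proof -
  have m [measurable]: "(\<lambda>x. cmod (g' x)) \<in> borel_measurable borel"
    by (intro borel_measurable_continuous_onI continuous_on_norm c)
  have main: "cmod (g v - g u) \<le> (LINT x:{a..<b}|lborel. cmod (g' x))" if "u \<le> v" "a \<le> u" "v \<le> b" for u v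
  proof -
    have "(LBINT x:{u..v}. g' x) = g v - g u"
      unfolding set_lebesgue_integral_def
      using integral_FTC_Icc[OF that(1), of g g'] d c
      by (metis (no_types, lifting) continuous_on_subset has_vector_derivative_at_within subset_UNIV)
    then have "cmod (g v - g u) \<le> (LINT x:{u..v}|lborel. cmod (g' x))"
      using set_integral_norm_bound[OF set_integrable_continuous[OF c, of "{u..v}"]] by simp
    also have "... \<le> (LINT x:{a..b}|lborel. cmod (g' x))"
      using that by (intro set_integral_subset_le set_integrable_norm set_integrable_continuous c) auto
    also have "... = (LINT x:{a..<b}|lborel. cmod (g' x))"
      unfolding set_lebesgue_integral_def
      apply (rule integral_cong_AE)
      subgoal using m by simp
      subgoal using m by simp
      subgoal using AE_lborel_singleton[of b] by (auto elim!: eventually_mono simp: indicator_def)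
      done
    finally show ?thesis .
  qed
  show ?thesis using main[of s t] main[of t s] s t by (cases "s \<le> t") (auto simp: norm_minus_commute)
qed

lemma bounded_Ico_real [simp]: "bounded {a..<b::real}"
  by (rule bounded_subset[OF bounded_closed_interval[of a b]]) auto

lemma avg_diff_le:
  fixes g :: "real \<Rightarrow> complex"
  assumes d: "\<And>x. (g has_vector_derivative g' x) (at x)" and c: "continuous_on UNIV g'"
    and A: "A \<in> sets borel" "A \<subseteq> {a..<b}" "measure lborel A > 0"
    and B: "B \<in> sets borel" "B \<subseteq> {a..<b}" "measure lborel B > 0"
  shows "cmod (avg A g - avg B g) \<le> (LINT x:{a..<b}|lborel. cmod (g' x))"
proof (rule avg_close)
  have cg: "continuous_on UNIV g"
    using d by (metis continuous_at_imp_continuous_on has_vector_derivative_continuous)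
  have bd: "bounded A" "bounded B"
    using A B by (meson bounded_subset bounded_Ico_real)+
  show "set_integrable lborel A g" using cg bd A by (intro set_integrable_continuous) auto
  have iB: "set_integrable lborel B g" using cg bd B by (intro set_integrable_continuous) auto
  fix x assume x: "x \<in> A"
  have "cmod (avg B g - g x) \<le> (LINT x:{a..<b}|lborel. cmod (g' x))"
    using B A x bd by (intro avg_close iB diff_le_integral_deriv d c) auto
  then show "cmod (g x - avg B g) \<le> (LINT x:{a..<b}|lborel. cmod (g' x))"
    by (simp add: norm_minus_commute)
qed (use A in \<open>auto intro: bounded_subset[OF bounded_Ico_real]\<close>)

lemma measure_Times_real:
  assumes "A \<in> sets borel" "B \<in> sets borel"
  shows "measure lborel (A \<times> B) = measure lborel (A::real set) * measure lborel (B::real set)"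
  using assms unfolding lborel_prod[symmetric] measure_def
  by (simp add: lborel.emeasure_pair_measure_Times enn2real_mult)

lemma avg_Times:
  fixes g :: "real \<times> real \<Rightarrow> complex"
  assumes g: "continuous_on UNIV g" and "bounded A" "A \<in> sets borel" "bounded B" "B \<in> sets borel"
  shows "avg (A \<times> B) g = avg A (\<lambda>x. avg B (\<lambda>y. g (x, y)))"
    and "avg (A \<times> B) g = avg B (\<lambda>y. avg A (\<lambda>x. g (x, y)))"
  unfolding avg_def set_integral_divide_zero
  unfolding iter_integral(1,2)[OF assms] measure_Times_real[OF assms(3,5)] by (simp_all add: mult.commute)

lemma avg_column_diff:
  assumes w: "C1 w p q" and A: "A \<in> sets borel" "bounded A" "measure lborel A > 0"
    and B: "B \<in> sets borel" "B \<subseteq> {a..<b}" "measure lborel B > 0"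
    and B': "B' \<in> sets borel" "B' \<subseteq> {a..<b}" "measure lborel B' > 0"
  shows "cmod (avg (A \<times> B) w - avg (A \<times> B') w) \<le> (LINT z:A\<times>{a..<b}|lborel. cmod (q z)) / measure lborel A"
proof -
  have bd: "bounded B" "bounded B'" using B B' by (meson bounded_subset bounded_Ico_real)+
  have cw: "continuous_on UNIV w" "continuous_on UNIV q" using w by (auto simp: C1_def)
  have cq: "continuous_on UNIV (\<lambda>y. q (x, y))" for x
    by (rule continuous_on_compose2[OF cw(2)]) (auto intro: continuous_intros)
  have i: "set_integrable lborel A (\<lambda>x. avg S (\<lambda>y. w (x, y)))" if "S \<in> sets borel" "bounded S" for S
    unfolding avg_def using iter_integral(3)[OF cw(1) A(2,1) that(2,1)] by (rule set_integrable_divide)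
  have "avg (A \<times> B) w - avg (A \<times> B') w = (LINT x:A|lborel. avg B (\<lambda>y. w (x, y)) - avg B' (\<lambda>y. w (x, y))) / measure lborel A"
    using A B B' bd cw by (simp add: avg_Times(1) avg_def[of A] set_integral_diff i diff_divide_distrib)
  also have "cmod ... \<le> (LINT x:A|lborel. LINT y:{a..<b}|lborel. cmod (q (x, y))) / measure lborel A"
  proof -
    have "cmod (LINT x:A|lborel. avg B (\<lambda>y. w (x, y)) - avg B' (\<lambda>y. w (x, y)))
      \<le> (LINT x:A|lborel. cmod (avg B (\<lambda>y. w (x, y)) - avg B' (\<lambda>y. w (x, y))))"
      using A B B' bd by (intro set_integral_norm_bound set_integral_diff i)
    also have "... \<le> (LINT x:A|lborel. LINT y:{a..<b}|lborel. cmod (q (x, y)))"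
    proof (rule set_integral_mono)
      show "set_integrable lborel A (\<lambda>x. LINT y:{a..<b}|lborel. cmod (q (x, y)))"
        using A by (intro iter_integral(3) continuous_intros cw) auto
      fix x
      show "cmod (avg B (\<lambda>y. w (x, y)) - avg B' (\<lambda>y. w (x, y))) \<le> (LINT y:{a..<b}|lborel. cmod (q (x, y)))"
        using w B B' by (intro avg_diff_le cq) (auto simp: C1_def)
    qed (use A B B' bd in \<open>intro set_integrable_norm set_integral_diff i\<close>)
    finally show ?thesis by (simp add: norm_divide divide_right_mono)
  qed
  also have "(LINT x:A|lborel. LINT y:{a..<b}|lborel. cmod (q (x, y))) = (LINT z:A\<times>{a..<b}|lborel. cmod (q z))"
    using A by (intro iter_integral continuous_intros cw) auto
  finally show ?thesis .
qed

lemma C1_swap: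
  assumes "C1 w p q"
  shows "C1 (\<lambda>z. w (prod.swap z)) (\<lambda>z. q (prod.swap z)) (\<lambda>z. p (prod.swap z))"
proof -
  have c: "continuous_on UNIV (\<lambda>z. f (prod.swap z))" if "continuous_on UNIV f" for f :: "real \<times> real \<Rightarrow> complex"
    by (rule continuous_on_compose2[OF that]) (auto intro: continuous_on_swap)
  show ?thesis using assms unfolding C1_def by (auto intro!: c)
qed

lemma avg_row_diff:
  assumes w: "C1 w p q" and A: "A \<in> sets borel" "bounded A" "measure lborel A > 0"
    and B: "B \<in> sets borel" "B \<subseteq> {a..<b}" "measure lborel B > 0"
    and B': "B' \<in> sets borel" "B' \<subseteq> {a..<b}" "measure lborel B' > 0"
  shows "cmod (avg (B \<times> A) w - avg (B' \<times> A) w) \<le> (LINT z:{a..<b}\<times>A|lborel. cmod (p z)) / measure lborel A"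
proof -
  have bd: "bounded B" "bounded B'" using B B' by (meson bounded_subset bounded_Ico_real)+
  have c: "continuous_on UNIV w" "continuous_on UNIV p" using w by (auto simp: C1_def)
  have c': "continuous_on UNIV (\<lambda>z. w (prod.swap z))" "continuous_on UNIV (\<lambda>z. p (prod.swap z))"
    using C1_swap[OF w] by (auto simp: C1_def)
  have "avg (A \<times> S) (\<lambda>z. w (prod.swap z)) = avg (S \<times> A) w" if "S \<in> sets borel" "bounded S" for S
    unfolding avg_Times(1)[OF c'(1) A(2,1) that(2,1)] avg_Times(2)[OF c(1) that(2,1) A(2,1)] by simp
  moreover have "(LINT z:A\<times>{a..<b}|lborel. cmod (p (prod.swap z))) = (LINT z:{a..<b}\<times>A|lborel. cmod (p z))"
    using A c c' iter_integral(1)[of "\<lambda>z. cmod (p (prod.swap z))" A "{a..<b}"] iter_integral(2)[of "\<lambda>z. cmod (p z)" "{a..<b}" A]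
    by (simp add: continuous_on_norm)
  ultimately show ?thesis
    using avg_column_diff[OF C1_swap[OF w] A B B'] B B' bd by simp
qed

section \<open>Exponential integrability outside a dyadic hole\<close>

lemma Cauchy_Schwarz_set_integral:
  fixes f g :: "'a \<Rightarrow> real"
  assumes [measurable]: "f \<in> borel_measurable M" "g \<in> borel_measurable M" "S \<in> sets M"
    and nn: "\<And>x. 0 \<le> f x" "\<And>x. 0 \<le> g x"
    and i: "set_integrable M S (\<lambda>x. f x * g x)" "set_integrable M S (\<lambda>x. (f x)\<^sup>2)" "set_integrable M S (\<lambda>x. (g x)\<^sup>2)"
  shows "(LINT x:S|M. f x * g x)\<^sup>2 \<le> (LINT x:S|M. (f x)\<^sup>2) * (LINT x:S|M. (g x)\<^sup>2)"
proof -
  have e: "ennreal (LINT x:S|M. h x) = (\<integral>\<^sup>+x. ennreal (indicator S x * h x) \<partial>M)"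
    if "set_integrable M S h" "\<And>x. 0 \<le> h x" for h :: "'a \<Rightarrow> real"
    unfolding set_lebesgue_integral_def using that
    by (subst nn_integral_eq_integral) (auto simp: set_integrable_def)
  have "ennreal (LINT x:S|M. f x * g x) = (\<integral>\<^sup>+x. ennreal (indicator S x * f x) * ennreal (indicator S x * g x) \<partial>M)"
    using nn i by (subst e) (auto intro!: nn_integral_cong simp: indicator_def ennreal_mult)
  moreover have "0 \<le> (LINT x:S|M. f x * g x)"
    unfolding set_lebesgue_integral_def using nn by (auto intro!: integral_nonneg_AE)
  ultimately have "ennreal ((LINT x:S|M. f x * g x)\<^sup>2) = (\<integral>\<^sup>+x. ennreal (indicator S x * f x) * ennreal (indicator S x * g x) \<partial>M)\<^sup>2"
    by (simp flip: ennreal_power)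
  also have "... \<le> (\<integral>\<^sup>+x. ennreal (indicator S x * f x) ^ 2 \<partial>M) * (\<integral>\<^sup>+x. ennreal (indicator S x * g x) ^ 2 \<partial>M)"
    by (rule Cauchy_Schwarz_nn_integral) auto
  also have "(\<integral>\<^sup>+x. ennreal (indicator S x * f x) ^ 2 \<partial>M) = ennreal (LINT x:S|M. (f x)\<^sup>2)"
    using nn i by (subst e) (auto intro!: nn_integral_cong simp: indicator_def ennreal_power)
  also have "(\<integral>\<^sup>+x. ennreal (indicator S x * g x) ^ 2 \<partial>M) = ennreal (LINT x:S|M. (g x)\<^sup>2)"
    using nn i by (subst e) (auto intro!: nn_integral_cong simp: indicator_def ennreal_power)
  finally show ?thesis
    using nn by (simp add: set_lebesgue_integral_def flip: ennreal_mult)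
qed

lemma set_integrable_sum_fin:
  fixes f :: "'i \<Rightarrow> 'a \<Rightarrow> real"
  assumes "\<And>i. i \<in> J \<Longrightarrow> set_integrable M S (f i)"
  shows "set_integrable M S (\<lambda>x. \<Sum>i\<in>J. f i x)"
    and "(LINT x:S|M. \<Sum>i\<in>J. f i x) = (\<Sum>i\<in>J. LINT x:S|M. f i x)"
  using assms by (auto simp: set_integrable_def set_lebesgue_integral_def sum_distrib_left)

text \<open>A rectangle from which \<open>R1 \<times> R2\<close> is removed. The assumption on the hole says that at each level either the cell
  of a remaining point avoids the hole, or both its chosen halves avoid the projections of the hole. In either case the
  average over the product of the halves and the segments between consecutive averages stay outside the hole.\<close>
locale dyadic_hole =
  fixes c1 l1 c2 l2 :: real and w p q :: "real \<times> real \<Rightarrow> complex" and R1 R2 :: "real set" and \<xi> \<eta> :: real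
  assumes l: "l1 > 0" "l2 > 0" and w: "C1 w p q"
    and R [measurable]: "R1 \<in> sets borel" "R2 \<in> sets borel"
    and hole: "\<And>i x y. \<lbrakk>idx c1 l1 0 x = 0; idx c2 l2 0 y = 0; (x, y) \<notin> R1 \<times> R2\<rbrakk> \<Longrightarrow>
      (cell c1 l1 i (idx c1 l1 i x) \<times> cell c2 l2 i (idx c2 l2 i y)) \<inter> R1 \<times> R2 = {} \<or>
      (sibling c1 l1 \<xi> i x \<inter> R1 = {} \<and> sibling c2 l2 \<eta> i y \<inter> R2 = {})"
begin

definition F where "F z = cmod (p z) + cmod (q z)"
definition U where "U = cell c1 l1 0 0 \<times> cell c2 l2 0 0 - R1 \<times> R2"
definition Q where "Q i z = cell c1 l1 i (idx c1 l1 i (fst z)) \<times> cell c2 l2 i (idx c2 l2 i (snd z))"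
definition m where "m i z = avg (sibling c1 l1 \<xi> i (fst z) \<times> sibling c2 l2 \<eta> i (snd z)) w"

lemma cont: "continuous_on UNIV w" "continuous_on UNIV p" "continuous_on UNIV q" "continuous_on UNIV F"
  using w by (auto simp: C1_def F_def[abs_def] intro!: continuous_intros)

lemma F_meas [measurable]: "F \<in> borel_measurable borel"
  using cont by (intro borel_measurable_continuous_onI)

lemma F_nonneg: "0 \<le> F z" and F_ge: "cmod (p z) \<le> F z" "cmod (q z) \<le> F z"
  by (auto simp: F_def)

lemma Q_borel [measurable]: "Q i z \<in> sets borel" and U_borel [measurable]: "U \<in> sets borel"
  unfolding Q_def U_def by (auto intro!: borel_Times sets.Diff)

lemma bounded_Q [simp]: "bounded (Q i z)" and bounded_U [simp]: "bounded U"
  unfolding Q_def U_def using l by (auto intro!: bounded_Times bounded_subset[OF bounded_Times Diff_subset])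

lemma Q_0: "z \<in> U \<Longrightarrow> Q 0 z = cell c1 l1 0 0 \<times> cell c2 l2 0 0"
  by (auto simp: U_def Q_def mem_cell)

lemma F_int: "bounded S \<Longrightarrow> S \<in> sets borel \<Longrightarrow> set_integrable lborel S F"
  and F2_int: "bounded S \<Longrightarrow> S \<in> sets borel \<Longrightarrow> set_integrable lborel S (\<lambda>z. (F z)\<^sup>2)"
  by (auto intro!: set_integrable_continuous cont continuous_on_power)

lemma measure_Q: "measure lborel (Q i z) = l1 * l2 / 4 ^ i"
  unfolding Q_def by (simp add: measure_Times_real measure_cell l flip: power_mult_distrib)

lemma F_le_free:
  assumes "z \<in> U" "S \<in> sets borel" "S \<subseteq> Q i z" "S \<inter> R1 \<times> R2 = {}"
    and f: "continuous_on UNIV f" "\<And>z. 0 \<le> f z" "\<And>z. f z \<le> F z"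
  shows "(LINT v:S|lborel. f v) \<le> (LINT v:Q i z \<inter> U|lborel. F v)"
proof -
  have Q: "Q i z \<subseteq> Q 0 z" unfolding Q_def by (auto simp: mem_cell intro: idx_mono_eq)
  then have S: "S \<subseteq> Q i z \<inter> U" using assms Q_0[OF assms(1)] by (auto simp: U_def)
  have bS: "bounded S" using assms(3) bounded_Q bounded_subset by blast
  have "(LINT v:S|lborel. f v) \<le> (LINT v:S|lborel. F v)"
    using assms bS by (intro set_integral_mono set_integrable_continuous F_int) auto
  also have "... \<le> (LINT v:Q i z \<inter> U|lborel. F v)"
    using S assms F_nonneg by (intro set_integral_subset_le F_int) (auto simp: bounded_Int)
  finally show ?thesis .
qed

text \<open>One factor is changed at a time. The difference of averages over \<open>S \<times> B\<close> and \<open>S \<times> B'\<close> is the average over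
  \<open>x \<in> S\<close> of differences along vertical lines, hence at most \<open>\<integral>\<bar>q\<bar> / \<bar>S\<bar>\<close>; no Poincare inequality on a two-dimensional
  domain is used, and only points of \<open>U\<close> are met.\<close>
lemma sibling_step:
  assumes z: "z \<in> U"
  shows "cmod (m (Suc i) z - m i z) \<le> (4 / l1 + 4 / l2) * 2 ^ i * (LINT v:Q i z \<inter> U|lborel. F v)"
proof -
  obtain x y where xy: "z = (x, y)" by force
  define I where "I = (LINT v:Q i z \<inter> U|lborel. F v)"
  define A where "A = sibling c1 l1 \<xi> i x"
  define A' where "A' = sibling c1 l1 \<xi> (Suc i) x"
  define B where "B = sibling c2 l2 \<eta> i y"
  define B' where "B' = sibling c2 l2 \<eta> (Suc i) y"
  define X where "X = cell c1 l1 i (idx c1 l1 i x)"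
  define Y where "Y = cell c2 l2 i (idx c2 l2 i y)"
  obtain a b where Xab: "X = {a..<b}" using cell_eq[OF l(1)] unfolding X_def by blast
  obtain a' b' where Yab: "Y = {a'..<b'}" using cell_eq[OF l(2)] unfolding Y_def by blast
  have Qz: "Q i z = X \<times> Y" by (simp add: Q_def X_def Y_def xy)
  have I0: "I \<ge> 0" unfolding I_def set_lebesgue_integral_def using F_nonneg by (auto intro!: integral_nonneg_AE)
  have z0: "idx c1 l1 0 x = 0" "idx c2 l2 0 y = 0" "(x, y) \<notin> R1 \<times> R2"
    using z by (auto simp: U_def xy mem_cell)
  have sub: "cell c1 l1 (Suc i) (idx c1 l1 (Suc i) x) \<subseteq> X" "cell c2 l2 (Suc i) (idx c2 l2 (Suc i) y) \<subseteq> Y"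
    unfolding X_def Y_def by (simp_all add: subset_iff mem_cell) (metis idx_div2)+
  have s: "A \<subseteq> X" "A' \<subseteq> X" "B \<subseteq> Y" "B' \<subseteq> Y"
    using sibling_subset sub unfolding A_def A'_def B_def B'_def X_def Y_def by blast+
  have bor [measurable]: "A \<in> sets borel" "A' \<in> sets borel" "B \<in> sets borel" "B' \<in> sets borel" "X \<in> sets borel" "Y \<in> sets borel"
    unfolding A_def A'_def B_def B'_def X_def Y_def by auto
  have bdd: "bounded A" "bounded A'" "bounded B" "bounded B'"
    unfolding A_def A'_def B_def B'_def using l by auto
  have me: "measure lborel A = l1 / 2 ^ Suc i" "measure lborel A' = l1 / 2 ^ Suc (Suc i)"
     "measure lborel B = l2 / 2 ^ Suc i" "measure lborel B' = l2 / 2 ^ Suc (Suc i)"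
    unfolding A_def A'_def B_def B'_def using l measure_sibling by blast+
  have col: "cmod (avg (S \<times> B') w - avg (S \<times> B) w) \<le> 4 / l1 * 2 ^ i * I"
    if S: "S = A \<or> S = A'" "S \<inter> R1 = {} \<or> Y \<inter> R2 = {}" for S
  proof -
    have S': "S \<subseteq> X" "S \<in> sets borel" "bounded S" "measure lborel S \<ge> l1 / 2 ^ Suc (Suc i)"
      using S s bor bdd me l by (auto simp: field_simps)
    then have Sp: "measure lborel S > 0" using l by (smt (verit) divide_pos_pos zero_less_power)
    have "cmod (avg (S \<times> B') w - avg (S \<times> B) w) \<le> (LINT z:S\<times>Y|lborel. cmod (q z)) / measure lborel S"
      unfolding Yab using S' Sp s bor bdd me l Yab by (intro avg_column_diff[OF w]) auto
    also have "... \<le> I / measure lborel S"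
      unfolding I_def using S' S s z bor Sp
      by (intro divide_right_mono F_le_free) (auto simp: Qz borel_Times cont F_ge intro!: continuous_intros)
    also have "... \<le> I / (l1 / 2 ^ Suc (Suc i))"
      using I0 S' l Sp by (intro divide_left_mono) auto
    finally show ?thesis using l by (simp add: field_simps)
  qed
  have row: "cmod (avg (A' \<times> S) w - avg (A \<times> S) w) \<le> 4 / l2 * 2 ^ i * I"
    if S: "S = B \<or> S = B'" "X \<inter> R1 = {} \<or> S \<inter> R2 = {}" for S
  proof -
    have S': "S \<subseteq> Y" "S \<in> sets borel" "bounded S" "measure lborel S \<ge> l2 / 2 ^ Suc (Suc i)"
      using S s bor bdd me l by (auto simp: field_simps)
    then have Sp: "measure lborel S > 0" using l by (smt (verit) divide_pos_pos zero_less_power)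
    have "cmod (avg (A' \<times> S) w - avg (A \<times> S) w) \<le> (LINT z:X\<times>S|lborel. cmod (p z)) / measure lborel S"
      unfolding Xab using S' Sp s bor bdd me l Xab by (intro avg_row_diff[OF w]) auto
    also have "... \<le> I / measure lborel S"
      unfolding I_def using S' S s z bor Sp
      by (intro divide_right_mono F_le_free) (auto simp: Qz borel_Times cont F_ge intro!: continuous_intros)
    also have "... \<le> I / (l2 / 2 ^ Suc (Suc i))"
      using I0 S' l Sp by (intro divide_left_mono) auto
    finally show ?thesis using l by (simp add: field_simps)
  qed
  have mm: "m (Suc i) z = avg (A' \<times> B') w" "m i z = avg (A \<times> B) w"
    by (simp_all add: m_def xy A_def A'_def B_def B'_def)
  have via_A': ?thesis if "A' \<inter> R1 = {} \<or> Y \<inter> R2 = {}" "X \<inter> R1 = {} \<or> B \<inter> R2 = {}"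
    using norm_triangle_ineq[of "avg (A' \<times> B') w - avg (A' \<times> B) w" "avg (A' \<times> B) w - avg (A \<times> B) w"]
      col[of A'] row[of B] that unfolding mm I_def[symmetric] by (simp add: distrib_right)
  have via_A: ?thesis if "A \<inter> R1 = {} \<or> Y \<inter> R2 = {}" "X \<inter> R1 = {} \<or> B' \<inter> R2 = {}"
    using norm_triangle_ineq[of "avg (A' \<times> B') w - avg (A \<times> B') w" "avg (A \<times> B') w - avg (A \<times> B) w"]
      col[of A] row[of B'] that unfolding mm I_def[symmetric] by (simp add: distrib_right)
  have free': "A' \<inter> R1 = {} \<or> B' \<inter> R2 = {}"
    using hole[OF z0, of "Suc i"] sibling_subset unfolding A'_def B'_def by blast
  consider "X \<inter> R1 = {} \<or> Y \<inter> R2 = {}" | "A \<inter> R1 = {}" "B \<inter> R2 = {}"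
    using hole[OF z0, of i] unfolding A_def B_def X_def Y_def by blast
  then show ?thesis
  proof cases
    case 1
    then show ?thesis using via_A' s by blast
  next
    case 2
    then show ?thesis using via_A' via_A free' by blast
  qed
qed

lemma m_0: "z \<in> U \<Longrightarrow> m 0 z = avg (sibling c1 l1 \<xi> 0 c1 \<times> sibling c2 l2 \<eta> 0 c2) w"
proof -
  assume "z \<in> U"
  then have "idx c1 l1 0 (fst z) = 0" "idx c2 l2 0 (snd z) = 0" by (auto simp: U_def mem_cell)
  moreover have "idx c1 l1 0 c1 = 0" "idx c2 l2 0 c2 = 0" by (auto simp: idx_def)
  ultimately show ?thesis unfolding m_def by (metis sibling_cong)
qed

lemma telescope:
  assumes z: "z \<in> U"
  shows "cmod (m L z - m 0 z) \<le> (4 / l1 + 4 / l2) * (\<Sum>i<L. 2 ^ i * (LINT v:Q i z \<inter> U|lborel. F v))"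
proof (induction L)
  case (Suc L)
  have "cmod (m (Suc L) z - m 0 z) \<le> cmod (m (Suc L) z - m L z) + cmod (m L z - m 0 z)"
    by norm
  then show ?case using Suc sibling_step[OF z, of L] by (simp add: algebra_simps)
qed simp

text \<open>The cells shrink to the point \<open>z\<close> and \<open>w\<close> is continuous.\<close>
lemma m_tendsto:
  assumes z: "z \<in> U" and e: "e > 0"
  shows "\<exists>L. cmod (w z - m L z) \<le> e"
proof -
  obtain x y where xy: "z = (x, y)" by force
  have "isCont w z" using cont(1) unfolding continuous_on_eq_continuous_at[OF open_UNIV] by blast
  then obtain d where d: "d > 0" "\<And>v. dist v z < d \<Longrightarrow> dist (w v) (w z) < e"
    unfolding continuous_at_eps_delta using e by metis
  obtain L where L: "(l1 + l2) / d < 2 ^ L" using real_arch_pow[of 2] by auto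
  then have L': "l1 / 2 ^ L + l2 / 2 ^ L < d" using d(1) by (simp add: field_simps)
  have "cmod (m L z - w z) \<le> e"
    unfolding m_def
  proof (rule avg_close)
    let ?S = "sibling c1 l1 \<xi> L (fst z) \<times> sibling c2 l2 \<eta> L (snd z)"
    show "set_integrable lborel ?S w"
      by (intro set_integrable_continuous cont bounded_Times borel_Times) (auto simp: l)
    show "?S \<in> sets borel" "bounded ?S" by (auto intro!: borel_Times bounded_Times simp: l)
    show "measure lborel ?S > 0" using l by (simp add: measure_Times_real measure_sibling)
    fix v assume "v \<in> ?S"
    then have v: "fst v \<in> cell c1 l1 L (idx c1 l1 L x)" "snd v \<in> cell c2 l2 L (idx c2 l2 L y)"
      using sibling_subset xy by auto (metis in_mono sibling_subset)+
    have c: "x \<in> cell c1 l1 L (idx c1 l1 L x)" "y \<in> cell c2 l2 L (idx c2 l2 L y)" by (auto simp: mem_cell)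
    have a1: "\<bar>fst v - x\<bar> \<le> l1 / 2 ^ L" using v(1) c(1) l(1) unfolding cell_eq[OF l(1)]
      by (auto simp: distrib_left add_divide_distrib)
    have a2: "\<bar>snd v - y\<bar> \<le> l2 / 2 ^ L" using v(2) c(2) l(2) unfolding cell_eq[OF l(2)]
      by (auto simp: distrib_left add_divide_distrib)
    have "dist v z \<le> \<bar>fst v - x\<bar> + \<bar>snd v - y\<bar>"
      unfolding xy dist_prod_def using real_sqrt_sum_squares_triangle_ineq[of "fst v - x" 0 0 "snd v - y"]
      by (simp add: dist_real_def)
    then have "dist v z < d" using a1 a2 L' by linarith
    then show "cmod (w v - w z) \<le> e" using d(2) by (simp add: dist_norm less_imp_le)
  qed
  then show ?thesis by (metis norm_minus_commute)
qed


text \<open>\<open>e i z\<close> is the energy near \<open>z\<close> at scale \<open>2 ^ (- i)\<close>, and \<open>I i z\<close> the corresponding \<open>L\<^sub>1\<close> quantity.\<close>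
definition e where "e i z = (LINT v:Q i z \<inter> U|lborel. (F v)\<^sup>2)"
definition E where "E = (LINT v:U|lborel. (F v)\<^sup>2)"
definition I where "I i z = (LINT v:Q i z \<inter> U|lborel. F v)"

lemma e_nonneg: "0 \<le> e i z" and E_nonneg: "0 \<le> E" and I_nonneg: "0 \<le> I i z"
  unfolding e_def E_def I_def set_lebesgue_integral_def using F_nonneg by (auto intro!: integral_nonneg_AE)

lemma e_le_E: "e i z \<le> E"
  unfolding e_def E_def by (intro set_integral_subset_le F2_int) auto

lemma I_le: "2 ^ i * I i z \<le> sqrt (l1 * l2) * sqrt (e i z)"
proof -
  have "(LINT v:Q i z \<inter> U|lborel. 1 * F v)\<^sup>2 \<le> (LINT v:Q i z \<inter> U|lborel. 1\<^sup>2) * (LINT v:Q i z \<inter> U|lborel. (F v)\<^sup>2)"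
    using F_nonneg F_int F2_int by (intro Cauchy_Schwarz_set_integral set_integrable_continuous) (auto simp: bounded_Int intro!: cont continuous_on_power)
  also have "(LINT v:Q i z \<inter> U|lborel. 1\<^sup>2) = (LINT v:Q i z \<inter> U|lborel. 1::real)" by simp
  also have "... \<le> (LINT v:Q i z|lborel. 1)"
    by (intro set_integral_subset_le set_integrable_continuous) auto
  also have "... = l1 * l2 / 4 ^ i"
    using measure_Q by (simp add: set_lebesgue_integral_def)
  finally have "(I i z)\<^sup>2 \<le> l1 * l2 / 4 ^ i * e i z"
    by (simp add: I_def e_def mult_right_mono e_nonneg[unfolded e_def])
  then have "(2 ^ i * I i z)\<^sup>2 \<le> l1 * l2 * e i z"
    using power_mult_distrib[of "2::real" 2 i]
    by (simp add: power_mult_distrib field_simps) (simp add: power2_eq_square)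
  then show ?thesis
    by (metis real_le_rsqrt real_sqrt_mult)
qed

text \<open>The kernel \<open>\<Sum>i<N. 2 ^ i * indicator (Q i z)\<close> has an \<open>L\<^sub>2\<close> norm of order \<open>sqrt N\<close> only: the cells around \<open>z\<close> are
  nested, so the square of the sum is comparable with the sum of the squares, and each of the \<open>N\<close> scales contributes equally.
  This is the logarithmic divergence of the critical Sobolev embedding in the plane.\<close>
lemma low_part:
  assumes z: "z \<in> U"
  shows "(\<Sum>i<N. 2 ^ i * I i z)\<^sup>2 \<le> 3 * real N * (l1 * l2) * E"
proof -
  define k :: "real \<times> real \<Rightarrow> real" where "k v = (\<Sum>i<N. 2 ^ i * indicator (Q i z) v)" for v :: "real \<times> real"
  have k2: "(k v)\<^sup>2 \<le> (\<Sum>i<N. 3 * 4 ^ i * indicator (Q i z) v)" for v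
    unfolding k_def
  proof (induction N)
    case (Suc N)
    have "(\<Sum>i<N. 2 ^ i * indicator (Q i z) v) \<le> (\<Sum>i<N. (2::real) ^ i)"
      by (intro sum_mono) (auto simp: indicator_def)
    also have "... \<le> 2 ^ N" using sum_gp_strict[of "2::real" N] by simp
    finally have "(\<Sum>i<N. 2 ^ i * indicator (Q i z) v) \<le> (2::real) ^ N" .
    then have "2 * (\<Sum>i<N. 2 ^ i * indicator (Q i z) v) * 2 ^ N \<le> 2 * (2::real) ^ N * 2 ^ N"
      by (intro mult_right_mono mult_left_mono) auto
    also have "... = 2 * 4 ^ N" by (simp add: flip: power_mult_distrib)
    finally have "2 * (\<Sum>i<N. 2 ^ i * indicator (Q i z) v) * 2 ^ N \<le> 2 * (4::real) ^ N" .
    moreover have "(2 ^ N)\<^sup>2 = (4::real) ^ N" by (simp add: power2_eq_square flip: power_mult_distrib)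
    ultimately show ?case using Suc by (cases "v \<in> Q N z") (simp_all add: power2_sum)
  qed simp
  have [measurable]: "k \<in> borel_measurable borel" unfolding k_def by measurable
  have k0: "0 \<le> k v" for v unfolding k_def by (intro sum_nonneg) auto
  have iQ: "set_integrable lborel U (\<lambda>v. c * indicator (Q i z) v)" for c :: real and i
  proof -
    have "set_integrable lborel (U \<inter> Q i z) (\<lambda>v. c)" by (intro set_integrable_continuous) (auto simp: bounded_Int)
    then show ?thesis unfolding set_integrable_def
      by (rule Bochner_Integration.integrable_cong[THEN iffD1, rotated -1]) (auto simp: indicator_def)
  qed
  have i2: "set_integrable lborel U (\<lambda>v. (\<Sum>i<N. (3::real) * 4 ^ i * indicator (Q i z) v))"
    by (intro set_integrable_sum_fin iQ)
  have ik2: "set_integrable lborel U (\<lambda>v. (k v)\<^sup>2)"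
    using i2 unfolding set_integrable_def
    by (rule Bochner_Integration.integrable_bound) (use k2 in \<open>auto simp: indicator_def intro!: order_trans[OF k2]\<close>)
  have IF: "set_integrable lborel U (\<lambda>v. 2 ^ i * indicator (Q i z) v * F v)"
      "(LINT v:U|lborel. 2 ^ i * indicator (Q i z) v * F v) = 2 ^ i * I i z" for i
  proof -
    have "set_integrable lborel (Q i z \<inter> U) (\<lambda>v. 2 ^ i * F v)"
      by (intro set_integrable_mult_right F_int) (auto simp: bounded_Int)
    then show "set_integrable lborel U (\<lambda>v. 2 ^ i * indicator (Q i z) v * F v)" unfolding set_integrable_def
      by (rule Bochner_Integration.integrable_cong[THEN iffD1, rotated -1]) (auto simp: indicator_def)
    have "(LINT v:U|lborel. 2 ^ i * indicator (Q i z) v * F v) = (LINT v:Q i z \<inter> U|lborel. 2 ^ i * F v)"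
      unfolding set_lebesgue_integral_def
      by (rule Bochner_Integration.integral_cong) (auto simp: indicator_def)
    then show "(LINT v:U|lborel. 2 ^ i * indicator (Q i z) v * F v) = 2 ^ i * I i z" by (simp add: I_def)
  qed
  have ikF: "set_integrable lborel U (\<lambda>v. k v * F v)"
    unfolding k_def sum_distrib_right by (intro set_integrable_sum_fin IF)
  have "(\<Sum>i<N. 2 ^ i * I i z) = (LINT v:U|lborel. k v * F v)"
    unfolding k_def sum_distrib_right by (subst set_integrable_sum_fin) (use IF in auto)
  also have "...\<^sup>2 \<le> (LINT v:U|lborel. (k v)\<^sup>2) * (LINT v:U|lborel. (F v)\<^sup>2)"
    using k0 F_nonneg by (intro Cauchy_Schwarz_set_integral ik2 ikF F2_int) auto
  also have "(LINT v:U|lborel. (k v)\<^sup>2) \<le> (LINT v:U|lborel. (\<Sum>i<N. (3::real) * 4 ^ i * indicator (Q i z) v))"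
    by (intro set_integral_mono ik2 i2 k2)
  also have "... = (\<Sum>i<N. LINT v:U|lborel. (3::real) * 4 ^ i * indicator (Q i z) v)"
    by (intro set_integrable_sum_fin iQ)
  also have "... \<le> (\<Sum>i<N. 3 * (l1 * l2))"
  proof (rule sum_mono)
    fix i
    have "(LINT v:U|lborel. (3::real) * 4 ^ i * indicator (Q i z) v) = (LINT v:Q i z \<inter> U|lborel. (3::real) * 4 ^ i)"
      unfolding set_lebesgue_integral_def
      by (rule Bochner_Integration.integral_cong) (auto simp: indicator_def)
    also have "... \<le> (LINT v:Q i z|lborel. (3::real) * 4 ^ i)"
      by (intro set_integral_subset_le set_integrable_continuous) auto
    also have "... = 3 * (l1 * l2)"
      using measure_Q by (simp add: set_lebesgue_integral_def)
    finally show "(LINT v:U|lborel. (3::real) * 4 ^ i * indicator (Q i z) v) \<le> 3 * (l1 * l2)" .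
  qed
  finally show ?thesis using E_nonneg by (simp add: E_def mult_right_mono mult_ac)
qed

text \<open>Beyond level \<open>N\<close> the sum is bounded by a weighted sum of the local energies. The weights \<open>(3/2) ^ i\<close> grow slower
  than \<open>2 ^ i\<close>, so that the sum remains integrable along vertical lines.\<close>
lemma high_part:
  "(\<Sum>i=N..<L. 2 ^ i * I i z)\<^sup>2 \<le> 3 * (2/3) ^ N * (l1 * l2) * (\<Sum>i<L. (3/2) ^ i * e i z)"
proof -
  have "(\<Sum>i=N..<L. 2 ^ i * I i z) \<le> (\<Sum>i=N..<L. sqrt (l1 * l2) * (sqrt ((2/3) ^ i) * sqrt ((3/2) ^ i * e i z)))"
  proof (rule sum_mono)
    fix i
    have "sqrt ((2/3) ^ i) * sqrt ((3/2) ^ i * e i z) = sqrt (e i z)"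
      by (simp flip: real_sqrt_mult power_mult_distrib mult.assoc)
    then show "2 ^ i * I i z \<le> sqrt (l1 * l2) * (sqrt ((2/3) ^ i) * sqrt ((3/2) ^ i * e i z))"
      using I_le[of i z] by simp
  qed
  then have "(\<Sum>i=N..<L. 2 ^ i * I i z)\<^sup>2 \<le> (sqrt (l1 * l2) * (\<Sum>i=N..<L. sqrt ((2/3) ^ i) * sqrt ((3/2) ^ i * e i z)))\<^sup>2"
    by (intro power_mono) (auto simp: sum_distrib_left intro!: sum_nonneg mult_nonneg_nonneg I_nonneg)
  also have "... = (l1 * l2) * (\<Sum>i=N..<L. sqrt ((2/3) ^ i) * sqrt ((3/2) ^ i * e i z))\<^sup>2"
    using l by (simp add: power_mult_distrib)
  also have "... \<le> (l1 * l2) * ((\<Sum>i=N..<L. (2/3) ^ i) * (\<Sum>i=N..<L. (3/2) ^ i * e i z))"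
    using l Cauchy_Schwarz_ineq_sum[of "\<lambda>i. sqrt ((2/3) ^ i)" "\<lambda>i. sqrt ((3/2) ^ i * e i z)" "{N..<L}"]
    by (intro mult_left_mono) (auto simp: e_nonneg)
  also have "... \<le> (l1 * l2) * ((3 * (2/3) ^ N) * (\<Sum>i<L. (3/2) ^ i * e i z))"
  proof (intro mult_left_mono mult_mono)
    have "(\<Sum>i=N..<L. (2/3) ^ i) \<le> 3 * (2/3) ^ N - 3 * (2/3::real) ^ (max N L)"
    proof (induction L)
      case (Suc L)
      then show ?case by (cases "N \<le> L") (auto simp: max_def not_le)
    qed simp
    then show "(\<Sum>i=N..<L. (2/3::real) ^ i) \<le> 3 * (2/3) ^ N"
      by (smt (verit) zero_le_power divide_nonneg_nonneg)
  qed (use l in \<open>auto intro!: sum_mono2 sum_nonneg mult_nonneg_nonneg e_nonneg\<close>)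
  finally show ?thesis by (simp add: mult_ac)
qed

text \<open>The averages \<open>m i z\<close> are telescoped. Up to level \<open>N\<close> the increments are bounded by the total energy, beyond it by local energies.\<close>
lemma pointwise:
  assumes z: "z \<in> U" and M: "\<And>L. (\<Sum>i<L. (3/2) ^ i * e i z) \<le> M"
  shows "(cmod (w z - m 0 z))\<^sup>2 \<le> 6 * (4 / l1 + 4 / l2)\<^sup>2 * (l1 * l2) * (N * E + (2/3) ^ N * M)"
proof -
  let ?K = "4 / l1 + 4 / l2"
  have K: "?K > 0" using l by (simp add: add_pos_pos)
  let ?R = "6 * ?K\<^sup>2 * (l1 * l2) * (N * E + (2/3) ^ N * M)"
  have M0: "0 \<le> M" using M[of 0] by simp
  have R0: "0 \<le> ?R" using l E_nonneg M0 by simp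
  have bd: "(cmod (m L z - m 0 z))\<^sup>2 \<le> ?R" for L
  proof -
    define S where "S = (\<Sum>i<N. 2 ^ i * I i z)"
    define T where "T = (\<Sum>i=N..<L. 2 ^ i * I i z)"
    have ST: "0 \<le> S" "0 \<le> T" unfolding S_def T_def by (auto intro!: sum_nonneg mult_nonneg_nonneg I_nonneg)
    have "(\<Sum>i<L. 2 ^ i * I i z) \<le> (\<Sum>i\<in>{..<N} \<union> {N..<L}. 2 ^ i * I i z)"
      by (intro sum_mono2) (auto intro!: mult_nonneg_nonneg I_nonneg)
    also have "... = S + T" unfolding S_def T_def by (rule sum.union_disjoint) auto
    finally have "cmod (m L z - m 0 z) \<le> ?K * (S + T)"
      using telescope[OF z, of L] K unfolding I_def[symmetric] by (meson mult_left_mono less_imp_le order_trans)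
    then have "(cmod (m L z - m 0 z))\<^sup>2 \<le> (?K * (S + T))\<^sup>2" by (intro power_mono) auto
    also have "... \<le> ?K\<^sup>2 * (2 * S\<^sup>2 + 2 * T\<^sup>2)"
      unfolding power_mult_distrib using sum_squares_bound[of S T]
      by (intro mult_left_mono zero_le_power2) (simp add: power2_sum)
    also have "... \<le> ?K\<^sup>2 * (2 * (3 * real N * (l1 * l2) * E) + 2 * (3 * (2/3) ^ N * (l1 * l2) * M))"
    proof (intro mult_left_mono add_mono zero_le_power2)
      show "S\<^sup>2 \<le> 3 * real N * (l1 * l2) * E" unfolding S_def by (rule low_part[OF z])
      have "T\<^sup>2 \<le> 3 * (2/3) ^ N * (l1 * l2) * (\<Sum>i<L. (3/2) ^ i * e i z)" unfolding T_def by (rule high_part)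
      also have "... \<le> 3 * (2/3) ^ N * (l1 * l2) * M" using l by (intro mult_left_mono M) auto
      finally show "T\<^sup>2 \<le> 3 * (2/3) ^ N * (l1 * l2) * M" .
    qed auto
    also have "... = ?R" by (simp add: algebra_simps)
    finally show ?thesis .
  qed
  have "cmod (w z - m 0 z) \<le> sqrt ?R + \<epsilon>" if "\<epsilon> > 0" for \<epsilon>
  proof -
    obtain L where "cmod (w z - m L z) \<le> \<epsilon>" using m_tendsto[OF z \<open>\<epsilon> > 0\<close>] by blast
    moreover have "cmod (m L z - m 0 z) \<le> sqrt ?R" using bd[of L] by (simp add: real_le_rsqrt)
    ultimately show ?thesis using norm_triangle_ineq[of "w z - m L z" "m L z - m 0 z"] by simp
  qed
  then have "cmod (w z - m 0 z) \<le> sqrt ?R" by (rule field_le_epsilon)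
  then have "(cmod (w z - m 0 z))\<^sup>2 \<le> (sqrt ?R)\<^sup>2" by (intro power_mono) auto
  then show ?thesis using R0 by (simp only: real_sqrt_pow2)
qed

end

text \<open>For \<open>S = I \<times> J\<close> this is the norm in \<open>L\<^sub>1(I, L\<^sub>\<psi>(J))\<close>; the form given here makes sense for every planar set.\<close>
definition J_norm :: "(real \<times> real \<Rightarrow> real) \<Rightarrow> (real \<times> real) set \<Rightarrow> ennreal" where
  "J_norm V S = (\<integral>\<^sup>+x. L_psi_norm_av {y. (x, y) \<in> S} (\<lambda>y. V (x, y)) \<partial>lborel)"

lemma nn_integral_lebesgue_on:
  assumes "S \<in> sets borel"
  shows "(\<integral>\<^sup>+y. f y \<partial>lebesgue_on S) = (\<integral>\<^sup>+y. f y * indicator S y \<partial>lborel)"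
  using assms by (simp add: nn_integral_restrict_space nn_integral_completion)

lemma nn_integral_plane:
  fixes f :: "real \<times> real \<Rightarrow> ennreal"
  assumes "f \<in> borel_measurable borel"
  shows "(\<integral>\<^sup>+z. f z \<partial>lborel) = (\<integral>\<^sup>+x. \<integral>\<^sup>+y. f (x, y) \<partial>lborel \<partial>lborel)"
  using assms unfolding lborel_prod[symmetric] by (subst lborel.nn_integral_fst) (auto simp: lborel_prod)

lemma phi_scale_le:
  assumes "0 \<le> \<theta>" "\<theta> \<le> 1" "0 \<le> t"
  shows "phi (\<theta> * t) \<le> \<theta> * exp t"
proof -
  have "exp (\<theta> * t) \<le> 1 - \<theta> + \<theta> * exp t"
    using convex_onD[OF exp_convex, of \<theta> 0 t] assms by simp
  moreover have "0 \<le> \<theta> * t" using assms by simp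
  moreover from this have "phi (\<theta> * t) = exp (\<theta> * t) - 1 - \<theta> * t" by (simp add: phi_def del: zero_le_mult_iff)
  ultimately show ?thesis using assms by linarith
qed

text \<open>The norm is a supremum over absolute values of integrals. For bounded nonnegative \<open>g\<close> the product is integrable, and the
  integral is one of the competitors.\<close>
lemma L_psi_norm_av_bound:
  assumes S [measurable]: "S \<in> sets borel" and f: "f \<in> borel_measurable borel" "\<And>y. y \<in> S \<Longrightarrow> 0 \<le> f y"
    and fin: "(\<integral>\<^sup>+y\<in>S. ennreal (f y) \<partial>lborel) < \<infinity>"
    and g [measurable]: "g \<in> borel_measurable borel" and g0: "\<And>y. y \<in> S \<Longrightarrow> 0 \<le> g y" "\<And>y. y \<in> S \<Longrightarrow> g y \<le> G"
    and phi: "(\<integral>\<^sup>+y\<in>S. ennreal (phi (g y)) \<partial>lborel) \<le> emeasure lborel S"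
  shows "(\<integral>\<^sup>+y\<in>S. ennreal (f y * g y) \<partial>lborel) \<le> L_psi_norm_av S f"
proof -
  have sp: "space (lebesgue_on S) = S" by simp
  have m: "f \<in> borel_measurable (lebesgue_on S)" "g \<in> borel_measurable (lebesgue_on S)"
    using f(1) g by (auto intro!: measurable_restrict_space1 measurable_completion)
  have le: "(\<integral>\<^sup>+y. ennreal (f y * g y) \<partial>lebesgue_on S) \<le> (\<integral>\<^sup>+y. ennreal (f y) * ennreal G \<partial>lebesgue_on S)"
    using f g0 by (intro nn_integral_mono) (auto simp flip: ennreal_mult' intro!: ennreal_leI mult_left_mono)
  also have "... = (\<integral>\<^sup>+y. ennreal (f y) \<partial>lebesgue_on S) * ennreal G"
    using m by (intro nn_integral_multc) auto
  also have "... < \<infinity>" using fin by (simp add: nn_integral_lebesgue_on ennreal_mult_less_top)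
  finally have i: "integrable (lebesgue_on S) (\<lambda>y. f y * g y)"
    using m f g0 by (intro integrableI_nonneg) (auto intro!: AE_I2)
  have "(\<integral>\<^sup>+y\<in>S. ennreal (f y * g y) \<partial>lborel) = (\<integral>\<^sup>+y. ennreal (f y * g y) \<partial>lebesgue_on S)"
    by (simp add: nn_integral_lebesgue_on)
  also have "... = ennreal (LINT y|lebesgue_on S. f y * g y)"
    using f g0 by (intro nn_integral_eq_integral i) (auto intro!: AE_I2)
  also have "... \<le> ennreal \<bar>LINT y|lebesgue_on S. f y * g y\<bar>" by (simp add: ennreal_leI)
  also have "... \<le> L_psi_norm_av S f"
    unfolding L_psi_norm_av_def using phi m by (intro SUP_upper) (auto simp: nn_integral_lebesgue_on)
  finally show ?thesis .
qed

context dyadic_hole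
begin

definition A where "A = 6 * (4 / l1 + 4 / l2)\<^sup>2 * (l1 * l2)"

lemma A_pos: "A > 0"
proof -
  have "4 / l1 + 4 / l2 > 0" using l by (simp add: add_pos_pos)
  then show ?thesis using l unfolding A_def by (simp only: zero_less_mult_iff zero_less_power) simp
qed

definition M where "M z = (\<Sum>i. ennreal ((3/2) ^ i * e i z))"

text \<open>The level \<open>N\<close> in \<open>pointwise\<close> is free. Balancing its two terms makes \<open>\<bar>w - m\<bar>\<^sup>2 / E\<close> logarithmic in \<open>M / E\<close>, so
  that its exponential is linear in \<open>M\<close>.\<close>
lemma exp_bound:
  assumes z: "z \<in> U" and E: "E > 0"
  shows "ennreal (exp (ln (3/2) * (cmod (w z - m 0 z))\<^sup>2 / (A * E))) \<le> ennreal (9/4) * (1 + M z / ennreal E)"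
proof (cases "M z")
  case (real r)
  have r: "(\<Sum>i<L. (3/2) ^ i * e i z) \<le> r" for L
  proof -
    have "ennreal (\<Sum>i<L. (3/2) ^ i * e i z) = (\<Sum>i<L. ennreal ((3/2) ^ i * e i z))"
      by (intro sum_ennreal[symmetric]) (auto intro!: mult_nonneg_nonneg e_nonneg)
    also have "... \<le> M z" unfolding M_def by (intro sum_le_suminf) auto
    finally show ?thesis using real by simp
  qed
  define \<mu> where "\<mu> = r / E"
  have mu: "0 \<le> \<mu>" "r = \<mu> * E" using real E by (auto simp: \<mu>_def)
  \<comment> \<open>The level at which \<open>(2/3) ^ n * (1 + \<mu>)\<close> drops below \<open>1\<close>.\<close>
  define n where "n = nat \<lceil>log (3/2) (1 + \<mu>)\<rceil>"
  have lg: "0 \<le> log (3/2) (1 + \<mu>)" using mu by simp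
  have n: "log (3/2) (1 + \<mu>) \<le> n" "n \<le> log (3/2) (1 + \<mu>) + 1"
    using lg unfolding n_def by linarith+
  have "1 + \<mu> = (3/2) powr log (3/2) (1 + \<mu>)" using mu by simp
  also have "... \<le> (3/2) powr n" using n by (intro powr_mono) auto
  also have "... = (3/2) ^ n" by (simp add: powr_realpow)
  finally have "(2/3) ^ n * (1 + \<mu>) \<le> (2/3) ^ n * (3/2) ^ n" by (intro mult_left_mono) auto
  then have "(2/3) ^ n * (1 + \<mu>) \<le> 1" by (simp flip: power_mult_distrib)
  then have "(2/3) ^ n * \<mu> \<le> 1" by (smt (verit) mult_left_mono zero_le_power divide_nonneg_nonneg)
  then have "(2/3) ^ n * r \<le> 1 * E" unfolding mu(2) using E by (metis mult.assoc mult_right_mono less_imp_le)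
  then have "(cmod (w z - m 0 z))\<^sup>2 \<le> A * (n * E + E)"
    using pointwise[OF z r, of n] A_pos unfolding A_def[symmetric]
    by (smt (verit) mult_left_mono)
  then have "(cmod (w z - m 0 z))\<^sup>2 / (A * E) \<le> n + 1"
    using A_pos E by (simp add: field_simps)
  then have "ln (3/2) * ((cmod (w z - m 0 z))\<^sup>2 / (A * E)) \<le> ln (3/2) * (log (3/2) (1 + \<mu>) + 2)"
    using n by (intro mult_left_mono) auto
  also have "... = ln (1 + \<mu>) + ln ((3/2) ^ 2)"
    by (simp add: distrib_left log_def ln_realpow)
  also have "... = ln ((1 + \<mu>) * (9/4))" using mu by (subst ln_mult) (auto simp: power2_eq_square)
  finally have "exp (ln (3/2) * (cmod (w z - m 0 z))\<^sup>2 / (A * E)) \<le> exp (ln ((1 + \<mu>) * (9/4)))" by simp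
  also have "... = 9/4 * (1 + \<mu>)" using mu by (subst exp_ln) auto
  finally have "ennreal (exp (ln (3/2) * (cmod (w z - m 0 z))\<^sup>2 / (A * E))) \<le> ennreal (9/4 * (1 + \<mu>))"
    by (rule ennreal_leI)
  also have "... = ennreal (9/4) * (ennreal 1 + ennreal \<mu>)"
    using mu by (subst ennreal_mult', simp, subst ennreal_plus) auto
  also have "ennreal \<mu> = M z / ennreal E"
    using real E by (simp add: \<mu>_def divide_ennreal)
  finally show ?thesis by simp
qed (use E in \<open>simp add: ennreal_top_divide ennreal_mult_top\<close>)

lemma e_nn: "ennreal (e i z) = (\<integral>\<^sup>+v. ennreal ((F v)\<^sup>2) * indicator U v * indicator (Q i z) v \<partial>lborel)"
proof -
  have "set_integrable lborel (Q i z \<inter> U) (\<lambda>v. (F v)\<^sup>2)" by (intro F2_int) (auto simp: bounded_Int)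
  then show ?thesis unfolding e_def set_lebesgue_integral_def set_integrable_def
    by (subst nn_integral_eq_integral[symmetric]) (auto intro!: nn_integral_cong simp: indicator_def)
qed

lemma E_nn: "ennreal E = (\<integral>\<^sup>+v. ennreal ((F v)\<^sup>2) * indicator U v \<partial>lborel)"
proof -
  have "set_integrable lborel U (\<lambda>v. (F v)\<^sup>2)" by (intro F2_int) auto
  then show ?thesis unfolding E_def set_lebesgue_integral_def set_integrable_def
    by (subst nn_integral_eq_integral[symmetric]) (auto intro!: nn_integral_cong simp: indicator_def)
qed

lemma Q_iff: "v \<in> Q i z \<longleftrightarrow> idx c1 l1 i (fst v) = idx c1 l1 i (fst z) \<and> idx c2 l2 i (snd v) = idx c2 l2 i (snd z)"
  by (cases v) (auto simp: Q_def mem_cell)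

lemma idx_meas [measurable]: "idx c l i \<in> measurable borel (count_space UNIV)"
  unfolding idx_def by measurable

lemma Q_pred [measurable]: "(\<lambda>(y, v). indicator (Q i (x, y)) v :: ennreal) \<in> borel_measurable (lborel \<Otimes>\<^sub>M lborel)"
proof -
  have c: "(\<lambda>u. idx c l i (f u)) \<in> measurable borel (count_space UNIV)"
    if "continuous_on UNIV f" for f :: "real \<times> real \<times> real \<Rightarrow> real" and c l
    by (rule measurable_compose[OF borel_measurable_continuous_onI[OF that] idx_meas])
  have [measurable]: "(\<lambda>u::real \<times> real \<times> real. idx c1 l1 i (fst (snd u))) \<in> measurable borel (count_space UNIV)"
      "(\<lambda>u::real \<times> real \<times> real. idx c2 l2 i (snd (snd u))) \<in> measurable borel (count_space UNIV)"
      "(\<lambda>u::real \<times> real \<times> real. idx c2 l2 i (fst u)) \<in> measurable borel (count_space UNIV)"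
    by (intro c continuous_intros)+
  have "(\<lambda>u::real \<times> real \<times> real. if idx c1 l1 i (fst (snd u)) = idx c1 l1 i x \<and> idx c2 l2 i (snd (snd u)) = idx c2 l2 i (fst u) then 1 else 0 :: ennreal)
     \<in> borel_measurable borel"
    by measurable
  moreover have "(\<lambda>(y, v). indicator (Q i (x, y)) v :: ennreal) =
     (\<lambda>u. if idx c1 l1 i (fst (snd u)) = idx c1 l1 i x \<and> idx c2 l2 i (snd (snd u)) = idx c2 l2 i (fst u) then 1 else 0)"
    by (auto simp: fun_eq_iff indicator_def Q_iff)
  ultimately show ?thesis unfolding lborel_prod by simp
qed

lemma e_meas [measurable]: "(\<lambda>y. ennreal (e i (x, y))) \<in> borel_measurable lborel"
  unfolding e_nn by measurable

lemma M_meas [measurable]: "(\<lambda>y. M (x, y)) \<in> borel_measurable lborel"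
proof -
  have "M = (\<lambda>z. \<Sum>i. ennreal ((3/2) ^ i) * ennreal (e i z))"
    unfolding M_def by (simp add: ennreal_mult')
  then show ?thesis by simp
qed

text \<open>Exchange the order of integration: a point lies in \<open>Q i (x, y)\<close> only for \<open>y\<close> in an interval of length \<open>l2 / 2 ^ i\<close>.\<close>
lemma e_section: "(\<integral>\<^sup>+y. ennreal (e i (x, y)) \<partial>lborel) \<le> ennreal (l2 / 2 ^ i) * ennreal E"
proof -
  have "(\<integral>\<^sup>+y. ennreal (e i (x, y)) \<partial>lborel) = (\<integral>\<^sup>+v. \<integral>\<^sup>+y. ennreal ((F v)\<^sup>2) * indicator U v * indicator (Q i (x, y)) v \<partial>lborel \<partial>lborel)"
    unfolding e_nn by (subst lborel_pair.Fubini') auto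
  also have "... \<le> (\<integral>\<^sup>+v. ennreal ((F v)\<^sup>2) * indicator U v * ennreal (l2 / 2 ^ i) \<partial>lborel)"
  proof (rule nn_integral_mono)
    fix v
    have "(\<integral>\<^sup>+y. ennreal ((F v)\<^sup>2) * indicator U v * indicator (Q i (x, y)) v \<partial>lborel)
      \<le> (\<integral>\<^sup>+y. ennreal ((F v)\<^sup>2) * indicator U v * indicator (cell c2 l2 i (idx c2 l2 i (snd v))) y \<partial>lborel)"
      by (intro nn_integral_mono mult_left_mono) (auto simp: indicator_def Q_iff mem_cell)
    also have "... = ennreal ((F v)\<^sup>2) * indicator U v * ennreal (l2 / 2 ^ i)"
      using l by (simp add: nn_integral_cmult emeasure_cell)
    finally show "(\<integral>\<^sup>+y. ennreal ((F v)\<^sup>2) * indicator U v * indicator (Q i (x, y)) v \<partial>lborel) \<le> ..." .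
  qed
  also have "... = ennreal (l2 / 2 ^ i) * ennreal E"
    unfolding E_nn by (subst nn_integral_multc) (simp_all add: mult.commute)
  finally show ?thesis .
qed

lemma M_section: "(\<integral>\<^sup>+y. M (x, y) \<partial>lborel) \<le> ennreal (4 * l2 * E)"
proof -
  have "(\<integral>\<^sup>+y. M (x, y) \<partial>lborel) = (\<Sum>i. ennreal ((3/2) ^ i) * (\<integral>\<^sup>+y. ennreal (e i (x, y)) \<partial>lborel))"
    unfolding M_def by (simp add: nn_integral_suminf ennreal_mult' nn_integral_cmult)
  also have "... \<le> (\<Sum>i. ennreal ((3/2) ^ i) * (ennreal (l2 / 2 ^ i) * ennreal E))"
    by (intro suminf_le mult_left_mono e_section) auto
  also have "... = (\<Sum>i. ennreal ((3/4) ^ i * (l2 * E)))"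
    using l E_nonneg by (intro suminf_cong) (simp flip: ennreal_mult add: power_divide field_simps, simp add: mult.commute flip: power_mult_distrib)
  also have "... = ennreal (4 * l2 * E)"
  proof (rule suminf_ennreal_eq)
    have "(\<lambda>i. (3/4::real) ^ i) sums (1 / (1 - 3/4))" by (intro geometric_sums) auto
    from sums_mult2[OF this, of "l2 * E"] show "(\<lambda>i. (3/4) ^ i * (l2 * E)) sums (4 * l2 * E)" by (simp add: mult.assoc)
  qed (use l E_nonneg in auto)
  finally show ?thesis .
qed

text \<open>With the exponent divided by \<open>23\<close> the test function satisfies the constraint in the Orlicz norm: the integral of the exponential
  over the vertical section is at most \<open>9/4 * 5 * l2\<close>, which is \<open>45/2\<close> times \<open>l2 / 2\<close>, a lower bound for the length of the section.\<close>
lemma section_bound: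
  assumes x: "idx c1 l1 0 x = 0" and half: "ennreal (l2 / 2) \<le> emeasure lborel {y. (x, y) \<in> U}" and E: "E > 0"
    and V [measurable]: "V \<in> borel_measurable borel" "\<And>z. 0 \<le> V z"
    and fin: "(\<integral>\<^sup>+y. ennreal (V (x, y)) * indicator U (x, y) \<partial>lborel) < \<infinity>"
  shows "(\<integral>\<^sup>+y. ennreal (V (x, y) * (cmod (w (x, y) - m 0 (x, y)))\<^sup>2 * (ln (3/2) / (23 * A * E))) * indicator U (x, y) \<partial>lborel)
    \<le> L_psi_norm_av {y. (x, y) \<in> U} (\<lambda>y. V (x, y))"
proof -
  define S where "S = {y. (x, y) \<in> U}"
  define k where "k = avg (sibling c1 l1 \<xi> 0 c1 \<times> sibling c2 l2 \<eta> 0 c2) w"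
  define g where "g y = ln (3/2) * (cmod (w (x, y) - k))\<^sup>2 / (23 * A * E)" for y
  have mk: "m 0 (x, y) = k" if "y \<in> S" for y using that m_0 by (simp add: S_def k_def)
  have [measurable]: "w \<in> borel_measurable borel" by (intro borel_measurable_continuous_onI cont)
  have Sm [measurable]: "S \<in> sets borel"
  proof -
    have "S = (\<lambda>y. (x, y)) -` U \<inter> space borel" by (auto simp: S_def)
    also have "... \<in> sets borel" by (rule measurable_sets[of _ _ borel]) auto
    finally show ?thesis .
  qed
  have iS: "indicator U (x, y) = indicator S y" for y by (simp add: S_def indicator_def)
  have Vx: "(\<lambda>y. V (x, y)) \<in> borel_measurable borel" by measurable
  have gm: "g \<in> borel_measurable borel" unfolding g_def by measurable
  have c: "23 * A * E > 0" using A_pos E by simp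
  have "compact (closure U)" using bounded_U by (simp add: compact_closure)
  then have "bounded (w ` closure U)"
    by (intro compact_imp_bounded compact_continuous_image continuous_on_subset[OF cont(1)]) auto
  then obtain W where W: "\<And>z. z \<in> U \<Longrightarrow> cmod (w z) \<le> W" using closure_subset unfolding bounded_iff by blast
  have gG: "g y \<le> ln (3/2) * (W + cmod k)\<^sup>2 / (23 * A * E)" if "y \<in> S" for y
    unfolding g_def using c that W[of "(x,y)"] norm_triangle_ineq4[of "w (x,y)" k]
    by (intro divide_right_mono mult_left_mono power_mono) (auto simp: S_def)
  have "(\<integral>\<^sup>+y\<in>S. ennreal (phi (g y)) \<partial>lborel) \<le> (\<integral>\<^sup>+y\<in>S. ennreal (1/23) * (ennreal (9/4) * (1 + M (x, y) / ennreal E)) \<partial>lborel)"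
  proof (rule nn_integral_mono, goal_cases)
    case (1 y)
    show ?case
    proof (cases "y \<in> S")
      case True
      have "phi (g y) = phi (1/23 * (ln (3/2) * (cmod (w (x, y) - k))\<^sup>2 / (A * E)))" by (simp add: g_def mult.assoc)
      also have "... \<le> 1/23 * exp (ln (3/2) * (cmod (w (x, y) - k))\<^sup>2 / (A * E))"
        using A_pos E by (intro phi_scale_le) auto
      finally have "ennreal (phi (g y)) \<le> ennreal (1/23 * exp (ln (3/2) * (cmod (w (x, y) - m 0 (x, y)))\<^sup>2 / (A * E)))"
        using True by (simp add: mk ennreal_leI)
      also have "... = ennreal (1/23) * ennreal (exp (ln (3/2) * (cmod (w (x, y) - m 0 (x, y)))\<^sup>2 / (A * E)))"
        by (rule ennreal_mult') simp
      also have "... \<le> ennreal (1/23) * (ennreal (9/4) * (1 + M (x, y) / ennreal E))"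
        using True E by (intro mult_left_mono exp_bound) (auto simp: S_def)
      finally show ?thesis using True by simp
    qed simp
  qed
  also have "... \<le> (\<integral>\<^sup>+y. ennreal (1/23) * (ennreal (9/4) * (indicator (cell c2 l2 0 0) y + M (x, y) / ennreal E)) \<partial>lborel)"
  proof (rule nn_integral_mono, goal_cases)
    case (1 y)
    have "indicator S y \<le> (indicator (cell c2 l2 0 0) y :: ennreal)" by (auto simp: indicator_def S_def U_def)
    then show ?case by (cases "y \<in> S") (auto simp: indicator_def split: if_splits)
  qed
  also have "... = ennreal (1/23) * (ennreal (9/4) * (ennreal l2 + (\<integral>\<^sup>+y. M (x, y) \<partial>lborel) / ennreal E))"
    using l by (simp add: nn_integral_cmult nn_integral_add nn_integral_divide emeasure_cell)
  also have "... \<le> ennreal (1/23) * (ennreal (9/4) * (ennreal l2 + ennreal (4 * l2 * E) / ennreal E))"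
    by (intro mult_left_mono add_left_mono divide_right_mono_ennreal M_section) auto
  also have "... = ennreal (45/92 * l2)"
    using l E by (simp add: divide_ennreal flip: ennreal_plus ennreal_mult')
  also have "... \<le> ennreal (l2 / 2)" using l by (intro ennreal_leI) auto
  also have "... \<le> emeasure lborel S" using half by (simp add: S_def)
  finally have phi: "(\<integral>\<^sup>+y\<in>S. ennreal (phi (g y)) \<partial>lborel) \<le> emeasure lborel S" .
  have "(\<integral>\<^sup>+y\<in>S. ennreal (V (x, y) * g y) \<partial>lborel) \<le> L_psi_norm_av S (\<lambda>y. V (x, y))"
    using fin phi c unfolding iS by (intro L_psi_norm_av_bound[OF Sm Vx _ _ gm _ gG]) (auto simp: V g_def)
  moreover have "(\<integral>\<^sup>+y. ennreal (V (x, y) * (cmod (w (x, y) - m 0 (x, y)))\<^sup>2 * (ln (3/2) / (23 * A * E))) * indicator U (x, y) \<partial>lborel)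
     = (\<integral>\<^sup>+y\<in>S. ennreal (V (x, y) * g y) \<partial>lborel)"
    unfolding iS by (intro nn_integral_cong) (auto simp: indicator_def mk g_def mult_ac)
  ultimately show ?thesis by (simp add: S_def)
qed

text \<open>Integration of \<open>section_bound\<close> over \<open>x\<close>. The average \<open>m 0\<close> is the same for all points of \<open>U\<close>.\<close>
theorem local_bound:
  assumes half: "\<And>x. idx c1 l1 0 x = 0 \<Longrightarrow> ennreal (l2 / 2) \<le> emeasure lborel {y. (x, y) \<in> U}"
    and V [measurable]: "V \<in> borel_measurable borel" "\<And>z. 0 \<le> V z"
    and fin: "(\<integral>\<^sup>+z. ennreal (V z) * indicator U z \<partial>lborel) < \<infinity>"
  shows "(\<integral>\<^sup>+z. ennreal (V z * (cmod (w z - avg (sibling c1 l1 \<xi> 0 c1 \<times> sibling c2 l2 \<eta> 0 c2) w))\<^sup>2) * indicator U z \<partial>lborel)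
    \<le> ennreal (23 * A / ln (3/2)) * J_norm V U * ennreal E"
proof -
  define k where "k = avg (sibling c1 l1 \<xi> 0 c1 \<times> sibling c2 l2 \<eta> 0 c2) w"
  have mk: "m 0 z = k" if "z \<in> U" for z using that m_0 by (simp add: k_def)
  have [measurable]: "w \<in> borel_measurable borel" by (intro borel_measurable_continuous_onI cont)
  show ?thesis
  proof (cases "E > 0")
    case False
    then have E0: "E = 0" using E_nonneg by simp
    have "V z * (cmod (w z - k))\<^sup>2 = 0" if z: "z \<in> U" for z
    proof -
      have "e i z = 0" for i using e_le_E[of i z] e_nonneg[of i z] E0 by simp
      then show ?thesis using pointwise[OF z, of 0 0] E0 by (simp add: mk[OF z])
    qed
    then have "ennreal (V z * (cmod (w z - k))\<^sup>2) * indicator U z = 0" for z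
      by (cases "z \<in> U") (simp_all only: indicator_simps(2) ennreal_0 mult_zero_left mult_zero_right not_False_eq_True)
    then have "(\<integral>\<^sup>+z. ennreal (V z * (cmod (w z - k))\<^sup>2) * indicator U z \<partial>lborel) = 0"
      by (simp only: nn_integral_const mult_zero_left)
    then show ?thesis unfolding k_def by (simp only: zero_le)
  next
    case True
    define c where "c = ln (3/2) / (23 * A * E)"
    have c: "c > 0" using True A_pos by (simp add: c_def)
    have UN: "AE x in lborel. (\<integral>\<^sup>+y. ennreal (V (x, y)) * indicator U (x, y) \<partial>lborel) \<noteq> \<infinity>"
      using fin by (intro nn_integral_PInf_AE) (auto simp: nn_integral_plane)
    have "(\<integral>\<^sup>+z. ennreal (V z * (cmod (w z - k))\<^sup>2 * c) * indicator U z \<partial>lborel)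
      = (\<integral>\<^sup>+x. \<integral>\<^sup>+y. ennreal (V (x, y) * (cmod (w (x, y) - k))\<^sup>2 * c) * indicator U (x, y) \<partial>lborel \<partial>lborel)"
      by (intro nn_integral_plane) measurable
    also have "... \<le> J_norm V U"
      unfolding J_norm_def
    proof (rule nn_integral_mono_AE, use UN in eventually_elim)
      fix x assume f: "(\<integral>\<^sup>+y. ennreal (V (x, y)) * indicator U (x, y) \<partial>lborel) \<noteq> \<infinity>"
      show "(\<integral>\<^sup>+y. ennreal (V (x, y) * (cmod (w (x, y) - k))\<^sup>2 * c) * indicator U (x, y) \<partial>lborel) \<le> L_psi_norm_av {y. (x, y) \<in> U} (\<lambda>y. V (x, y))"
      proof (cases "idx c1 l1 0 x = 0")
        case x0: True
        have "(\<integral>\<^sup>+y. ennreal (V (x, y) * (cmod (w (x, y) - k))\<^sup>2 * c) * indicator U (x, y) \<partial>lborel)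
          = (\<integral>\<^sup>+y. ennreal (V (x, y) * (cmod (w (x, y) - m 0 (x, y)))\<^sup>2 * c) * indicator U (x, y) \<partial>lborel)"
          by (intro nn_integral_cong) (auto simp: indicator_def mk)
        then show ?thesis
          using section_bound[OF x0 half[OF x0] True V] f by (simp add: c_def less_top)
      next
        case False
        then have "(x, y) \<notin> U" for y by (auto simp: U_def mem_cell)
        then show ?thesis by simp
      qed
    qed
    finally have *: "(\<integral>\<^sup>+z. ennreal (V z * (cmod (w z - k))\<^sup>2 * c) * indicator U z \<partial>lborel) \<le> J_norm V U" .
    have "(\<integral>\<^sup>+z. ennreal (V z * (cmod (w z - k))\<^sup>2) * indicator U z \<partial>lborel)
       = (\<integral>\<^sup>+z. ennreal (1 / c) * (ennreal (V z * (cmod (w z - k))\<^sup>2 * c) * indicator U z) \<partial>lborel)"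
      using c V by (intro nn_integral_cong) (simp add: mult.assoc[symmetric] flip: ennreal_mult')
    also have "... = ennreal (1 / c) * (\<integral>\<^sup>+z. ennreal (V z * (cmod (w z - k))\<^sup>2 * c) * indicator U z \<partial>lborel)"
      by (intro nn_integral_cmult) auto
    also have "... \<le> ennreal (1 / c) * J_norm V U" by (intro mult_left_mono *) auto
    also have "ennreal (1 / c) = ennreal (23 * A / ln (3/2)) * ennreal E"
      using A_pos True by (simp add: c_def flip: ennreal_mult')
    finally show ?thesis by (simp add: k_def mult_ac)
  qed
qed

end

section \<open>Superadditivity of the Orlicz norm\<close>

lemma phi_0 [simp]: "phi 0 = 0" and phi_abs [simp]: "phi \<bar>s\<bar> = phi s"
  by (auto simp: phi_def)

lemma SUP_add_SUP_le:
  fixes f :: "'a \<Rightarrow> ennreal" and g :: "'b \<Rightarrow> ennreal"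
  assumes ne: "I \<noteq> {}" "J \<noteq> {}" and le: "\<And>i j. i \<in> I \<Longrightarrow> j \<in> J \<Longrightarrow> f i + g j \<le> c"
  shows "(SUP i\<in>I. f i) + (SUP j\<in>J. g j) \<le> c"
proof -
  have 1: "(SUP i\<in>I. f i) + g j \<le> c" if "j \<in> J" for j
    unfolding ennreal_SUP_add_left[OF ne(1), symmetric] using le that by (intro SUP_least) auto
  show ?thesis
    unfolding add.commute[of "Sup (f ` I)"] ennreal_SUP_add_left[OF ne(2), symmetric]
    using 1 by (intro SUP_least) (simp add: add.commute)
qed

text \<open>Test functions on the two disjoint parts are glued to a test function on the union; the constraint compares with the total length,
  so the gluing respects it. This is why the averaged norm is superadditive without a constant.\<close>
lemma L_psi_norm_av_superadd:
  assumes S: "S \<in> sets borel" "S \<subseteq> Z" and T: "T \<in> sets borel" "T \<subseteq> Z" and ST: "S \<inter> T = {}"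
    and Z: "Z \<in> sets borel" and f: "\<And>y. y \<in> Z \<Longrightarrow> 0 \<le> f y"
  shows "L_psi_norm_av S f + L_psi_norm_av T f \<le> L_psi_norm_av Z f"
proof -
  define G where "G X = {g. g \<in> borel_measurable (lebesgue_on X) \<and>
       (\<integral>\<^sup>+ y. ennreal (phi (g y)) \<partial>lebesgue_on X) \<le> emeasure lebesgue X}" for X :: "real set"
  have G0: "(\<lambda>_. 0) \<in> G X" for X unfolding G_def by simp
  have sl: "S \<in> sets lebesgue" "T \<in> sets lebesgue" "Z \<in> sets lebesgue"
    using S T Z by (auto intro: sets_completionI_sets)
  have main: "ennreal \<bar>LINT y|lebesgue_on S. f y * g y\<bar> + ennreal \<bar>LINT y|lebesgue_on T. f y * h y\<bar> \<le> L_psi_norm_av Z f"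
    if g: "g \<in> G S" and h: "h \<in> G T" for g h
  proof -
    have red: "\<exists>g'\<in>G X. integrable (lebesgue_on X) (\<lambda>y. f y * g' y) \<and>
       \<bar>LINT y|lebesgue_on X. f y * g y\<bar> = \<bar>LINT y|lebesgue_on X. f y * g' y\<bar>" if "g \<in> G X" for g X
    proof (cases "integrable (lebesgue_on X) (\<lambda>y. f y * g y)")
      case False
      then show ?thesis using G0 by (intro bexI[of _ "\<lambda>_. 0"]) (auto simp: not_integrable_integral_eq)
    qed (use that in auto)
    obtain g' where g': "g' \<in> G S" "integrable (lebesgue_on S) (\<lambda>y. f y * g' y)"
       "\<bar>LINT y|lebesgue_on S. f y * g y\<bar> = \<bar>LINT y|lebesgue_on S. f y * g' y\<bar>" using red[OF g] by blast
    obtain h' where h': "h' \<in> G T" "integrable (lebesgue_on T) (\<lambda>y. f y * h' y)"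
       "\<bar>LINT y|lebesgue_on T. f y * h y\<bar> = \<bar>LINT y|lebesgue_on T. f y * h' y\<bar>" using red[OF h] by blast
    define u where "u y = (if y \<in> S then \<bar>g' y\<bar> else 0)" for y
    define v where "v y = (if y \<in> T then \<bar>h' y\<bar> else 0)" for y
    define k where "k y = u y + v y" for y
    have um: "u \<in> borel_measurable lebesgue" "v \<in> borel_measurable lebesgue"
      unfolding u_def v_def using g'(1) h'(1) sl by (auto intro!: borel_measurable_if_I simp: G_def)
    then have km: "k \<in> borel_measurable (lebesgue_on Z)"
      unfolding k_def by (intro borel_measurable_add measurable_restrict_space1)
    have sup: "u y = 0 \<or> v y = 0" for y using ST by (auto simp: u_def v_def)
    have pk: "ennreal (phi (k y)) = ennreal (phi (u y)) + ennreal (phi (v y))" for y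
      using sup[of y] by (auto simp: k_def)
    have pm: "(\<lambda>y. ennreal (phi (u y))) \<in> borel_measurable lebesgue" "(\<lambda>y. ennreal (phi (v y))) \<in> borel_measurable lebesgue"
      using um unfolding phi_def by measurable
    have nu: "(\<integral>\<^sup>+ y. ennreal (phi (u y)) \<partial>lebesgue) = (\<integral>\<^sup>+ y. ennreal (phi (g' y)) \<partial>lebesgue_on S)"
      using sl by (subst nn_integral_restrict_space) (auto intro!: nn_integral_cong simp: u_def indicator_def)
    have nv: "(\<integral>\<^sup>+ y. ennreal (phi (v y)) \<partial>lebesgue) = (\<integral>\<^sup>+ y. ennreal (phi (h' y)) \<partial>lebesgue_on T)"
      using sl by (subst nn_integral_restrict_space) (auto intro!: nn_integral_cong simp: v_def indicator_def)
    have "(\<integral>\<^sup>+ y. ennreal (phi (k y)) \<partial>lebesgue_on Z) \<le> (\<integral>\<^sup>+ y. ennreal (phi (k y)) \<partial>lebesgue)"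
      using sl by (subst nn_integral_restrict_space) (auto intro!: nn_integral_mono simp: indicator_def)
    also have "... = (\<integral>\<^sup>+ y. ennreal (phi (u y)) \<partial>lebesgue) + (\<integral>\<^sup>+ y. ennreal (phi (v y)) \<partial>lebesgue)"
      unfolding pk using pm by (rule nn_integral_add)
    also have "... \<le> emeasure lebesgue S + emeasure lebesgue T"
      unfolding nu nv using g'(1) h'(1) by (intro add_mono) (auto simp: G_def)
    also have "... = emeasure lebesgue (S \<union> T)" using sl ST by (intro plus_emeasure) auto
    also have "... \<le> emeasure lebesgue Z" using S T sl by (intro emeasure_mono) auto
    finally have kG: "k \<in> G Z" using km by (simp add: G_def)
    have iu: "integrable lebesgue (\<lambda>y. indicator S y *\<^sub>R \<bar>f y * g' y\<bar>)" "integrable lebesgue (\<lambda>y. indicator T y *\<^sub>R \<bar>f y * h' y\<bar>)"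
      using g'(2) h'(2) sl integrable_abs[of lebesgue "\<lambda>x. indicator S x * (f x * g' x)"]
        integrable_abs[of lebesgue "\<lambda>x. indicator T x * (f x * h' x)"]
      by (auto simp: integrable_restrict_space abs_mult)
    have fk: "indicator Z y *\<^sub>R (f y * k y) = indicator S y *\<^sub>R \<bar>f y * g' y\<bar> + indicator T y *\<^sub>R \<bar>f y * h' y\<bar>" for y
      using S T f[of y] ST by (auto simp: indicator_def k_def u_def v_def abs_mult)
    have "\<bar>LINT y|lebesgue_on S. f y * g' y\<bar> + \<bar>LINT y|lebesgue_on T. f y * h' y\<bar>
      \<le> (LINT y|lebesgue_on S. \<bar>f y * g' y\<bar>) + (LINT y|lebesgue_on T. \<bar>f y * h' y\<bar>)"
      by (intro add_mono integral_abs_bound)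
    also have "... = (LINT y|lebesgue. indicator Z y *\<^sub>R (f y * k y))"
      unfolding fk using sl iu by (simp add: integral_restrict_space)
    also have "... = (LINT y|lebesgue_on Z. f y * k y)" using sl by (simp add: integral_restrict_space)
    also have "... \<le> \<bar>LINT y|lebesgue_on Z. f y * k y\<bar>" by simp
    finally have "ennreal (\<bar>LINT y|lebesgue_on S. f y * g' y\<bar> + \<bar>LINT y|lebesgue_on T. f y * h' y\<bar>) \<le> ennreal \<bar>LINT y|lebesgue_on Z. f y * k y\<bar>"
      by (rule ennreal_leI)
    also have "... \<le> L_psi_norm_av Z f"
      unfolding L_psi_norm_av_def G_def[symmetric] using kG by (rule SUP_upper)
    finally show ?thesis unfolding g'(3) h'(3) by simp
  qed
  have ne: "G S \<noteq> {}" "G T \<noteq> {}" using G0 by auto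
  show ?thesis
    unfolding L_psi_norm_av_def[of S] L_psi_norm_av_def[of T] G_def[symmetric]
    using ne main by (rule SUP_add_SUP_le)
qed

text \<open>The integral of an arbitrary function is the supremum over its simple minorants. This is used for the Orlicz norms
  of the sections as functions of the abscissa, whose measurability is not clear.\<close>
lemma nn_integral_superadd:
  assumes "\<And>x. f x + g x \<le> h x"
  shows "nn_integral M f + nn_integral M g \<le> nn_integral M h"
proof -
  let ?G = "\<lambda>f. {g. simple_function M g \<and> g \<le> f}"
  have main: "integral\<^sup>S M a + integral\<^sup>S M b \<le> nn_integral M h" if "a \<in> ?G f" "b \<in> ?G g" for a b
  proof -
    have "integral\<^sup>S M a + integral\<^sup>S M b = integral\<^sup>S M (\<lambda>x. a x + b x)"
      using that by (intro simple_integral_add[symmetric]) auto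
    also have "... \<le> nn_integral M h"
      unfolding nn_integral_def using that
      by (intro SUP_upper) (auto simp: le_fun_def intro!: order_trans[OF add_mono assms])
    finally show ?thesis .
  qed
  have ne: "?G f \<noteq> {}" "?G g \<noteq> {}" by (auto intro!: exI[of _ "\<lambda>_. 0"] simp: le_fun_def)
  show ?thesis
    unfolding nn_integral_def[of M f] nn_integral_def[of M g]
    using ne main by (rule SUP_add_SUP_le)
qed

lemma section_borel [measurable]:
  fixes S :: "(real \<times> real) set"
  assumes "S \<in> sets borel" shows "{y. (x, y) \<in> S} \<in> sets borel"
proof -
  have "{y. (x, y) \<in> S} = (\<lambda>y. (x, y)) -` S \<inter> space borel" by auto
  also have "... \<in> sets borel" by (rule measurable_sets[OF _ assms]) simp
  finally show ?thesis .
qed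

lemma J_norm_superadd:
  assumes "S \<in> sets borel" "S \<subseteq> Z" "T \<in> sets borel" "T \<subseteq> Z" "S \<inter> T = {}" "Z \<in> sets borel"
    and V: "\<And>z. 0 \<le> V z"
  shows "J_norm V S + J_norm V T \<le> J_norm V Z"
  unfolding J_norm_def using assms
  by (intro nn_integral_superadd L_psi_norm_av_superadd section_borel) auto

abbreviation energy :: "(real \<times> real \<Rightarrow> complex) \<Rightarrow> (real \<times> real \<Rightarrow> complex) \<Rightarrow> (real \<times> real) set \<Rightarrow> ennreal" where
  "energy p q X \<equiv> (\<integral>\<^sup>+z. ennreal ((cmod (p z) + cmod (q z))\<^sup>2) * indicator X z \<partial>lborel)"

abbreviation deviation :: "(real \<times> real \<Rightarrow> real) \<Rightarrow> (real \<times> real \<Rightarrow> complex) \<Rightarrow> (real \<times> real \<Rightarrow> complex) \<Rightarrow> (real \<times> real) set \<Rightarrow> ennreal" where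
  "deviation V w \<Phi> X \<equiv> (\<integral>\<^sup>+z. ennreal (V z * (cmod (w z - \<Phi> z))\<^sup>2) * indicator X z \<partial>lborel)"

definition rect_in :: "real \<Rightarrow> (real \<times> real) set \<Rightarrow> bool" where
  "rect_in d B \<longleftrightarrow> (\<exists>S T. B = S \<times> T \<and> S \<in> sets borel \<and> T \<in> sets borel \<and> bounded S \<and> bounded T \<and> T \<subseteq> {0..<d} \<and>
     measure lborel S > 0 \<and> measure lborel T > 0)"

text \<open>On \<open>X\<close>, every \<open>w\<close> is approximated in \<open>L\<^sub>2(V)\<close> by a function that takes \<open>n\<close> averages of \<open>w\<close> as values; \<open>j\<close> tells
  which of them is used where.\<close>
definition controlled :: "real \<Rightarrow> (real \<times> real \<Rightarrow> real) \<Rightarrow> real \<Rightarrow> nat \<Rightarrow> (real \<times> real) set \<Rightarrow> bool" where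
  "controlled d V \<kappa> n X \<longleftrightarrow> (\<exists>B j. (\<forall>i<n. rect_in d (B i)) \<and> j \<in> measurable borel (count_space UNIV) \<and> (\<forall>z\<in>X. j z < n) \<and>
     (\<forall>w p q. C1 w p q \<longrightarrow> deviation V w (\<lambda>z. avg (B (j z)) w) X \<le> ennreal \<kappa> * energy p q X))"

lemma controlled_Un:
  assumes X: "controlled d V \<kappa> n X" and Y: "controlled d V \<kappa> m Y" and XY: "X \<inter> Y = {}"
    and [measurable]: "X \<in> sets borel" "Y \<in> sets borel" "V \<in> borel_measurable borel"
  shows "controlled d V \<kappa> (n + m) (X \<union> Y)"
proof -
  obtain B j where Bj: "\<And>i. i < n \<Longrightarrow> rect_in d (B i)" "j \<in> measurable borel (count_space UNIV)" "\<And>z. z \<in> X \<Longrightarrow> j z < n"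
     "\<And>w p q. C1 w p q \<Longrightarrow> deviation V w (\<lambda>z. avg (B (j z)) w) X \<le> ennreal \<kappa> * energy p q X"
    using X unfolding controlled_def by blast
  obtain B' j' where Bj': "\<And>i. i < m \<Longrightarrow> rect_in d (B' i)" "j' \<in> measurable borel (count_space UNIV)" "\<And>z. z \<in> Y \<Longrightarrow> j' z < m"
     "\<And>w p q. C1 w p q \<Longrightarrow> deviation V w (\<lambda>z. avg (B' (j' z)) w) Y \<le> ennreal \<kappa> * energy p q Y"
    using Y unfolding controlled_def by blast
  note [measurable] = Bj(2) Bj'(2)
  define C where "C i = (if i < n then B i else B' (i - n))" for i
  define k where "k z = (if z \<in> X then j z else n + j' z)" for z
  have km [measurable]: "k \<in> measurable borel (count_space UNIV)" unfolding k_def by measurable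
  show ?thesis
    unfolding controlled_def
  proof (intro exI conjI allI impI ballI)
    fix w p q assume w: "C1 w p q"
    have [measurable]: "w \<in> borel_measurable borel" using w by (auto simp: C1_def intro: borel_measurable_continuous_onI)
    have [measurable]: "p \<in> borel_measurable borel" "q \<in> borel_measurable borel" using w by (auto simp: C1_def intro: borel_measurable_continuous_onI)
    have "deviation V w (\<lambda>z. avg (C (k z)) w) (X \<union> Y) = deviation V w (\<lambda>z. avg (C (k z)) w) X + deviation V w (\<lambda>z. avg (C (k z)) w) Y"
      using XY by (subst nn_integral_add[symmetric]) (auto intro!: nn_integral_cong simp: indicator_def)
    also have "deviation V w (\<lambda>z. avg (C (k z)) w) X = deviation V w (\<lambda>z. avg (B (j z)) w) X"
      using Bj(3) by (intro nn_integral_cong) (auto simp: indicator_def k_def C_def)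
    also have "deviation V w (\<lambda>z. avg (C (k z)) w) Y = deviation V w (\<lambda>z. avg (B' (j' z)) w) Y"
      using XY by (intro nn_integral_cong) (auto simp: indicator_def k_def C_def)
    also have "deviation V w (\<lambda>z. avg (B (j z)) w) X + deviation V w (\<lambda>z. avg (B' (j' z)) w) Y
       \<le> ennreal \<kappa> * energy p q X + ennreal \<kappa> * energy p q Y"
      by (intro add_mono Bj(4) Bj'(4) w)
    also have "... = ennreal \<kappa> * (energy p q X + energy p q Y)" by (simp add: distrib_left)
    also have "energy p q X + energy p q Y = energy p q (X \<union> Y)"
      using XY by (subst nn_integral_add[symmetric]) (auto intro!: nn_integral_cong simp: indicator_def)
    finally show "deviation V w (\<lambda>z. avg (C (k z)) w) (X \<union> Y) \<le> ennreal \<kappa> * energy p q (X \<union> Y)" .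
  next
    show "rect_in d (C i)" if "i < n + m" for i using that Bj(1) Bj'(1) by (auto simp: C_def)
    show "k z < n + m" if "z \<in> X \<union> Y" for z using that Bj(3)[of z] Bj'(3)[of z] by (auto simp: k_def)
  qed (rule km)
qed

lemma controlled_empty: "controlled d V \<kappa> 0 {}"
  unfolding controlled_def by (auto intro!: exI[of _ "\<lambda>_. 0"])

text \<open>The constant of \<open>local_bound\<close> for rectangles of proportion \<open>1 : d\<close>. It does not depend on their size because the
  Dirichlet integral is invariant under dilations of the plane.\<close>
definition K_loc :: "real \<Rightarrow> real" where
  "K_loc d = 23 * (6 * (16 * (1 + 1 / d)\<^sup>2 * d)) / ln (3/2)"

lemma K_loc_pos: "d > 0 \<Longrightarrow> K_loc d > 0"
  unfolding K_loc_def by (intro divide_pos_pos mult_pos_pos zero_less_power) (auto simp: add_pos_pos)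

lemma K_loc_eq:
  assumes "d > 0" "l > 0"
  shows "23 * (6 * (4 / l + 4 / (d * l))\<^sup>2 * (l * (d * l))) / ln (3/2) = K_loc d"
proof -
  have "(4 / l + 4 / (d * l))\<^sup>2 * (l * (d * l)) = 16 * (1 + 1 / d)\<^sup>2 * d"
    using assms by (simp add: field_simps power2_eq_square)
  then have "6 * (4 / l + 4 / (d * l))\<^sup>2 * (l * (d * l)) = 6 * (16 * (1 + 1 / d)\<^sup>2 * d)"
    by (simp only: mult.assoc)
  then show ?thesis unfolding K_loc_def by (simp only:)
qed

locale potential =
  fixes d t :: real and V :: "real \<times> real \<Rightarrow> real"
  assumes d: "d > 0" and t: "t > 0" and V [measurable]: "V \<in> borel_measurable borel" and V0: "\<And>z. 0 \<le> V z"
    and Vfin: "\<And>S. S \<in> sets borel \<Longrightarrow> bounded S \<Longrightarrow> (\<integral>\<^sup>+z. ennreal (V z) * indicator S z \<partial>lborel) < \<infinity>"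
begin

abbreviation "\<kappa> \<equiv> K_loc d * t"

definition sq :: "real \<Rightarrow> real \<Rightarrow> real \<Rightarrow> nat \<Rightarrow> int \<Rightarrow> int \<Rightarrow> (real \<times> real) set" where
  "sq c1 c2 l m a b = cell c1 l m a \<times> cell c2 (d * l) m b"

definition ref :: "real \<Rightarrow> real \<Rightarrow> real \<Rightarrow> real \<Rightarrow> real \<Rightarrow> (real \<times> real) set" where
  "ref c1 c2 l \<xi> \<eta> = sibling c1 l \<xi> 0 c1 \<times> sibling c2 (d * l) \<eta> 0 c2"

lemma sq_borel [measurable]: "sq c1 c2 l m a b \<in> sets borel"
  unfolding sq_def by (intro borel_Times) auto

lemma local_bound_le:
  assumes hole: "dyadic_hole c1 l c2 (d * l) w p q RX RY \<xi> \<eta>" and lpos: "l > 0"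
    and U: "U = sq c1 c2 l 0 0 0 - RX \<times> RY"
    and J: "J_norm V U \<le> ennreal t"
    and half: "\<And>x. idx c1 l 0 x = 0 \<Longrightarrow> sibling c2 (d * l) \<eta> 0 c2 \<subseteq> {y. (x, y) \<in> U}"
  shows "deviation V w (\<lambda>_. avg (ref c1 c2 l \<xi> \<eta>) w) U \<le> ennreal \<kappa> * energy p q U"
proof -
  interpret dyadic_hole c1 l c2 "d * l" w p q RX RY \<xi> \<eta> by fact
  have U': "local.U = U" by (simp add: U_def U sq_def)
  have dl: "d * l > 0" using d lpos by simp
  have h: "ennreal (d * l / 2) \<le> emeasure lborel {y. (x, y) \<in> local.U}" if "idx c1 l 0 x = 0" for x
  proof -
    have "ennreal (d * l / 2) = emeasure lborel (sibling c2 (d * l) \<eta> 0 c2)"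
      using dl emeasure_cell[OF dl, of c2 "Suc 0"] by (simp add: sibling_def)
    also have "... \<le> emeasure lborel {y. (x, y) \<in> local.U}"
      using half[OF that] unfolding U' by (intro emeasure_mono) (auto simp flip: U')
    finally show ?thesis .
  qed
  have fin: "(\<integral>\<^sup>+z. ennreal (V z) * indicator local.U z \<partial>lborel) < \<infinity>" by (intro Vfin) auto
  have "deviation V w (\<lambda>_. avg (ref c1 c2 l \<xi> \<eta>) w) U \<le> ennreal (23 * A / ln (3/2)) * J_norm V U * ennreal E"
    using local_bound[OF h V V0 fin] unfolding U' ref_def .
  also have "... \<le> ennreal (23 * A / ln (3/2)) * ennreal t * ennreal E"
    by (intro mult_right_mono mult_left_mono J) auto
  also have "23 * A / ln (3/2) = K_loc d" unfolding A_def by (rule K_loc_eq[OF d lpos])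
  also have "ennreal (K_loc d) * ennreal t = ennreal \<kappa>" using K_loc_pos[OF d] by (simp add: ennreal_mult')
  also have "ennreal E = energy p q U" unfolding E_nn U' F_def ..
  finally show ?thesis .
qed

lemma no_hole_bound:
  assumes w: "C1 w p q" and l: "l > 0" and J: "J_norm V (sq c1 c2 l 0 0 0) \<le> ennreal t"
  shows "deviation V w (\<lambda>_. avg (ref c1 c2 l c1 c2) w) (sq c1 c2 l 0 0 0) \<le> ennreal \<kappa> * energy p q (sq c1 c2 l 0 0 0)"
proof (rule local_bound_le[where RX="{}" and RY="{}"])
  show "dyadic_hole c1 l c2 (d * l) w p q {} {} c1 c2"
    using w l d by unfold_locales auto
  fix x assume "idx c1 l 0 x = 0"
  then show "sibling c2 (d * l) c2 0 c2 \<subseteq> {y. (x, y) \<in> sq c1 c2 l 0 0 0}"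
    using sibling_subset[of c2 "d * l" c2 0 c2] by (auto simp: sq_def mem_cell idx_def)
qed (use l J in auto)

text \<open>The hole is the dyadic cell of \<open>(\<xi>, \<eta>)\<close> at level \<open>m\<close>. At a level below \<open>m\<close> the chosen halves avoid it; from level \<open>m\<close> on,
  cells are either contained in it or disjoint from it.\<close>
lemma hole_bound:
  assumes w: "C1 w p q" and l: "l > 0" and m: "m > 0"
    and J: "J_norm V (sq c1 c2 l 0 0 0 - sq c1 c2 l m (idx c1 l m \<xi>) (idx c2 (d * l) m \<eta>)) \<le> ennreal t" (is "J_norm V ?U \<le> _")
  shows "deviation V w (\<lambda>_. avg (ref c1 c2 l \<xi> \<eta>) w) ?U \<le> ennreal \<kappa> * energy p q ?U"
proof (rule local_bound_le)
  show "dyadic_hole c1 l c2 (d * l) w p q (cell c1 l m (idx c1 l m \<xi>)) (cell c2 (d * l) m (idx c2 (d * l) m \<eta>)) \<xi> \<eta>"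
  proof
    fix i x y assume out: "(x, y) \<notin> cell c1 l m (idx c1 l m \<xi>) \<times> cell c2 (d * l) m (idx c2 (d * l) m \<eta>)"
    show "cell c1 l i (idx c1 l i x) \<times> cell c2 (d * l) i (idx c2 (d * l) i y) \<inter>
        cell c1 l m (idx c1 l m \<xi>) \<times> cell c2 (d * l) m (idx c2 (d * l) m \<eta>) = {} \<or>
        sibling c1 l \<xi> i x \<inter> cell c1 l m (idx c1 l m \<xi>) = {} \<and>
        sibling c2 (d * l) \<eta> i y \<inter> cell c2 (d * l) m (idx c2 (d * l) m \<eta>) = {}"
    proof (cases "i < m")
      case False
      have False if "idx c1 l i u = idx c1 l i x" "idx c2 (d * l) i v = idx c2 (d * l) i y"
        "idx c1 l m u = idx c1 l m \<xi>" "idx c2 (d * l) m v = idx c2 (d * l) m \<eta>" for u v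
        using that out False idx_mono_eq[OF that(1), of m] idx_mono_eq[OF that(2), of m] by (auto simp: mem_cell)
      then show ?thesis by (auto simp: mem_cell)
    qed (simp add: sibling_avoids)
  qed (use w l d in auto)
  fix x assume x: "idx c1 l 0 x = 0"
  show "sibling c2 (d * l) \<eta> 0 c2 \<subseteq> {y. (x, y) \<in> ?U}"
    using sibling_subset[of c2 "d * l" \<eta> 0 c2] sibling_avoids[OF m, of c2 "d * l" \<eta> c2] x
    by (auto simp: sq_def mem_cell idx_def)
qed (use l J in \<open>auto simp: sq_def\<close>)

end

lemma L_psi_norm_av_empty: "L_psi_norm_av {} f = 0"
  unfolding L_psi_norm_av_def by (intro antisym SUP_least) (auto simp: integral_restrict_space)

lemma J_norm_empty [simp]: "J_norm V {} = 0"
  by (simp add: J_norm_def L_psi_norm_av_empty)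

lemma cell_Suc: "cell c l i a = cell c l (Suc i) (2 * a) \<union> cell c l (Suc i) (2 * a + 1)"
proof (rule set_eqI)
  fix x
  have "idx c l (Suc i) x div 2 = a \<longleftrightarrow> idx c l (Suc i) x = 2 * a \<or> idx c l (Suc i) x = 2 * a + 1" by presburger
  then show "x \<in> cell c l i a \<longleftrightarrow> x \<in> cell c l (Suc i) (2 * a) \<union> cell c l (Suc i) (2 * a + 1)"
    by (simp add: mem_cell idx_div2)
qed

lemma cell_disjoint: "a \<noteq> b \<Longrightarrow> cell c l i a \<inter> cell c l i b = {}"
  by (auto simp: cell_def)

lemma idx_corner: "l > 0 \<Longrightarrow> idx c l i (c + l * a / 2 ^ i) = a"
  by (simp add: idx_def)

lemma cell_corner: "l > 0 \<Longrightarrow> cell c l i a = cell (c + l * a / 2 ^ i) (l / 2 ^ i) 0 0"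
  by (simp add: cell_eq field_simps)

context potential
begin

lemma sq_corner: "l > 0 \<Longrightarrow> sq c1 c2 l m a b = sq (c1 + l * a / 2 ^ m) (c2 + d * l * b / 2 ^ m) (l / 2 ^ m) 0 0 0"
  unfolding sq_def using d cell_corner[of l c1 m a] cell_corner[of "d * l" c2 m b] by simp

lemma sq_disjoint: "(a, b) \<noteq> (a', b') \<Longrightarrow> sq c1 c2 l m a b \<inter> sq c1 c2 l m a' b' = {}"
  using cell_disjoint[of a a'] cell_disjoint[of b b'] unfolding sq_def by blast

lemma sq_split: "sq c1 c2 l m a b = (sq c1 c2 l (Suc m) (2*a) (2*b) \<union> sq c1 c2 l (Suc m) (2*a+1) (2*b)) \<union>
    (sq c1 c2 l (Suc m) (2*a) (2*b+1) \<union> sq c1 c2 l (Suc m) (2*a+1) (2*b+1))"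
  unfolding sq_def using cell_Suc[of c1 l m a] cell_Suc[of c2 "d * l" m b] by blast

lemma emeasure_sq: "l > 0 \<Longrightarrow> emeasure lborel (sq c1 c2 l m a b) = ennreal (l * (d * l) / 4 ^ m)"
  using d unfolding sq_def lborel_prod[symmetric]
  by (simp add: lborel.emeasure_pair_measure_Times emeasure_cell flip: ennreal_mult power_mult_distrib)

lemma rect_in_ref:
  assumes "l > 0" "0 \<le> c2" "c2 + d * l \<le> d"
  shows "rect_in d (ref c1 c2 l \<xi> \<eta>)"
proof -
  have dl: "d * l > 0" using d assms by simp
  have "sibling c2 (d * l) \<eta> 0 c2 \<subseteq> {0..<d}"
    using sibling_subset[of c2 "d * l" \<eta> 0 c2] cell_0[OF dl, of c2] assms by (auto simp: idx_def)
  then show ?thesis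
    unfolding rect_in_def ref_def
    by (intro exI[of _ "sibling c1 l \<xi> 0 c1"] exI[of _ "sibling c2 (d * l) \<eta> 0 c2"])
       (use assms dl in \<open>auto simp: measure_sibling\<close>)
qed

lemma controlledI:
  assumes "rect_in d B" "\<And>w p q. C1 w p q \<Longrightarrow> deviation V w (\<lambda>_. avg B w) X \<le> ennreal \<kappa> * energy p q X"
  shows "controlled d V \<kappa> 1 X"
  unfolding controlled_def using assms by (intro exI[of _ "\<lambda>_. B"] exI[of _ "\<lambda>_. 0"]) auto

lemma energy_mono: "X \<subseteq> Y \<Longrightarrow> energy p q X \<le> energy p q Y"
  by (intro nn_integral_mono) (auto simp: indicator_def)

text \<open>The squares outside which the potential is light shrink to a null set. The reference rectangle depends
  on the first step of the descent only, so the bounds outside these squares all involve the same average, and they pass to the limit.\<close>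
lemma chain_controlled:
  assumes l: "l > 0" "0 \<le> c2" "c2 + d * l \<le> d"
    and f: "\<And>n. J_norm V (sq c1 c2 l 0 0 0 - sq c1 c2 l n (fst (f n)) (snd (f n))) \<le> ennreal t"
    and nxt: "\<And>n. fst (f (Suc n)) div 2 = fst (f n)" "\<And>n. snd (f (Suc n)) div 2 = snd (f n)"
  shows "controlled d V \<kappa> 1 (sq c1 c2 l 0 0 0)"
proof -
  define S where "S = sq c1 c2 l 0 0 0"
  define R where "R n = sq c1 c2 l n (fst (f n)) (snd (f n))" for n
  define \<xi> where "\<xi> n = c1 + l * fst (f n) / 2 ^ n" for n
  define \<eta> where "\<eta> n = c2 + d * l * snd (f n) / 2 ^ n" for n
  have dl: "d * l > 0" using d l by simp
  have ix: "idx c1 l n (\<xi> n) = fst (f n)" "idx c2 (d * l) n (\<eta> n) = snd (f n)" for n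
    using idx_corner[OF l(1)] idx_corner[OF dl] by (auto simp: \<xi>_def \<eta>_def)
  have ix': "idx c1 l j (\<xi> n) = fst (f j) \<and> idx c2 (d * l) j (\<eta> n) = snd (f j)" if "j \<le> n" for j n
    using that
  proof (induction rule: inc_induct)
    case base
    then show ?case by (simp add: ix)
  next
    case (step k)
    then show ?case using idx_div2[of c1 l k "\<xi> n"] idx_div2[of c2 "d * l" k "\<eta> n"] nxt[of k] by simp
  qed
  have ref: "ref c1 c2 l (\<xi> (Suc n)) (\<eta> (Suc n)) = ref c1 c2 l (\<xi> 1) (\<eta> 1)" for n
    unfolding ref_def sibling_def using ix'[of 1 "Suc n"] ix'[of 1 1] by simp
  have dec: "R (Suc n) \<subseteq> R n" for n
    unfolding R_def sq_def by (auto simp: mem_cell) (metis idx_div2 nxt)+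
  have [measurable]: "S \<in> sets borel" "R n \<in> sets borel" for n by (auto simp: S_def R_def)
  have null: "AE z in lborel. z \<notin> (\<Inter>n. R n)"
  proof (rule AE_not_in, rule null_setsI)
    have le: "emeasure lborel (\<Inter>n. R n) \<le> ennreal (l * (d * l) * (1/4) ^ n)" for n
    proof -
      have "emeasure lborel (\<Inter>n. R n) \<le> emeasure lborel (R n)" by (intro emeasure_mono) auto
      then show ?thesis using emeasure_sq[OF l(1)] by (simp add: R_def power_divide)
    qed
    have "(\<lambda>n. ennreal (l * (d * l) * (1/4) ^ n)) \<longlonglongrightarrow> ennreal (l * (d * l) * 0)"
      by (intro tendsto_ennrealI tendsto_mult_left LIMSEQ_power_zero) auto
    then have "emeasure lborel (\<Inter>n. R n) \<le> ennreal (l * (d * l) * 0)"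
      by (rule LIMSEQ_le_const) (use le in auto)
    then show "emeasure lborel (\<Inter>n. R n) = 0" by simp
  qed simp
  show ?thesis
  proof (rule controlledI)
    show "rect_in d (ref c1 c2 l (\<xi> 1) (\<eta> 1))" using l by (rule rect_in_ref)
    fix w p q assume w: "C1 w p q"
    have [measurable]: "w \<in> borel_measurable borel" using w by (auto simp: C1_def intro: borel_measurable_continuous_onI)
    define k where "k = avg (ref c1 c2 l (\<xi> 1) (\<eta> 1)) w"
    define h where "h z = ennreal (V z * (cmod (w z - k))\<^sup>2)" for z
    have [measurable]: "h \<in> borel_measurable borel" unfolding h_def by measurable
    have inc: "incseq (\<lambda>n z. h z * indicator (S - R (Suc n)) z)"
      using dec by (intro incseq_SucI) (auto simp: le_fun_def indicator_def)
    have "(\<integral>\<^sup>+z. h z * indicator S z \<partial>lborel) = (\<integral>\<^sup>+z. (SUP n. h z * indicator (S - R (Suc n)) z) \<partial>lborel)"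
    proof (rule nn_integral_cong_AE, use null in eventually_elim)
      fix z assume "z \<notin> (\<Inter>n. R n)"
      then obtain n where n: "z \<notin> R (Suc n)" using dec by blast
      show "h z * indicator S z = (SUP n. h z * indicator (S - R (Suc n)) z)"
      proof (rule antisym)
        have "h z * indicator S z = h z * indicator (S - R (Suc n)) z" using n by (simp add: indicator_def)
        then show "h z * indicator S z \<le> (SUP n. h z * indicator (S - R (Suc n)) z)"
          by (metis (mono_tags, lifting) SUP_upper UNIV_I)
        show "(SUP n. h z * indicator (S - R (Suc n)) z) \<le> h z * indicator S z"
          by (intro SUP_least) (auto simp: indicator_def)
      qed
    qed
    also have "... = (SUP n. \<integral>\<^sup>+z. h z * indicator (S - R (Suc n)) z \<partial>lborel)"
      by (rule nn_integral_monotone_convergence_SUP[OF inc]) simp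
    also have "... \<le> ennreal \<kappa> * energy p q S"
    proof (rule SUP_least)
      fix n
      have eq: "S - R (Suc n) = sq c1 c2 l 0 0 0 - sq c1 c2 l (Suc n) (idx c1 l (Suc n) (\<xi> (Suc n))) (idx c2 (d * l) (Suc n) (\<eta> (Suc n)))"
        unfolding ix S_def R_def ..
      have "(\<integral>\<^sup>+z. h z * indicator (S - R (Suc n)) z \<partial>lborel) \<le> ennreal \<kappa> * energy p q (S - R (Suc n))"
        unfolding h_def k_def ref[of n, symmetric] eq
        using f[of "Suc n"] by (intro hole_bound[OF w l(1)]) (simp_all add: ix)
      also have "... \<le> ennreal \<kappa> * energy p q S" by (intro mult_left_mono energy_mono) auto
      finally show "(\<integral>\<^sup>+z. h z * indicator (S - R (Suc n)) z \<partial>lborel) \<le> ennreal \<kappa> * energy p q S" .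
    qed
    finally show "deviation V w (\<lambda>_. avg (ref c1 c2 l (\<xi> 1) (\<eta> 1)) w) (sq c1 c2 l 0 0 0) \<le> ennreal \<kappa> * energy p q (sq c1 c2 l 0 0 0)"
      unfolding h_def k_def S_def .
  qed
qed

text \<open>If the norm is at most \<open>t\<close>, one average suffices. Otherwise descend through dyadic squares whose complement is light.
  If the descent never stops, one average suffices again. If it stops at a square \<open>R\<close>, then the complement of \<open>R\<close> needs
  one average, and the complement of each of the four children is heavy, so by superadditivity each child has norm less than the
  total minus \<open>t\<close>. Induction on the norm divided by \<open>t\<close> gives the linear count. The summand \<open>- 3\<close> strengthens
  the claim so that the extra average is absorbed.\<close>
lemma covering:
  assumes "l > 0" "0 \<le> c2" "c2 + d * l \<le> d" "J_norm V (sq c1 c2 l 0 0 0) \<le> ennreal (real n * t)"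
  shows "\<exists>N. controlled d V \<kappa> N (sq c1 c2 l 0 0 0) \<and>
    (enn2real (J_norm V (sq c1 c2 l 0 0 0)) / t \<le> 1 \<longrightarrow> N \<le> 1) \<and>
    (enn2real (J_norm V (sq c1 c2 l 0 0 0)) / t > 1 \<longrightarrow> real N \<le> 8 * (enn2real (J_norm V (sq c1 c2 l 0 0 0)) / t) - 3)"
  using assms
proof (induction n arbitrary: c1 c2 l)
  case 0
  then have J: "J_norm V (sq c1 c2 l 0 0 0) = 0" by simp
  then have "controlled d V \<kappa> 1 (sq c1 c2 l 0 0 0)"
    using 0 by (intro controlledI[OF rect_in_ref no_hole_bound]) auto
  then show ?case using J t by auto
next
  case (Suc n)
  define S where "S = sq c1 c2 l 0 0 0"
  define T where "T = enn2real (J_norm V S)"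
  have JS: "J_norm V S = ennreal T"
    using Suc.prems(4) unfolding T_def S_def by (metis ennreal_enn2real ennreal_less_top order_le_less_trans)
  have T0: "T \<ge> 0" by (simp add: T_def)
  have Tn: "T \<le> (real n + 1) * t"
    using Suc.prems(4) t unfolding JS[unfolded S_def] by (simp add: ennreal_le_iff add.commute)
  have Sm [measurable]: "S \<in> sets borel" by (simp add: S_def)
  note l = Suc.prems(1-3)
  have ?case if ctrl: "controlled d V \<kappa> 1 S"
  proof -
    have "T / t > 1 \<Longrightarrow> 1 \<le> 8 * (T / t) - 3" by linarith
    then show ?thesis using ctrl unfolding S_def[symmetric] T_def[symmetric] by (intro exI[of _ 1]) auto
  qed note one = this
  \<comment> \<open>\<open>P m (a, b)\<close>: little of the potential lies outside the square with index \<open>(a, b)\<close> at level \<open>m\<close>.\<close>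
  define P where "P m ab \<longleftrightarrow> sq c1 c2 l m (fst ab) (snd ab) \<subseteq> S \<and> J_norm V (S - sq c1 c2 l m (fst ab) (snd ab)) \<le> ennreal t" for m ab
  show ?case
  proof (cases "T \<le> t")
    case True
    then have "controlled d V \<kappa> 1 S"
      using l JS unfolding S_def by (intro controlledI[OF rect_in_ref no_hole_bound]) (auto intro: ennreal_leI)
    then show ?thesis by (rule one)
  next
    case False
    have P0: "P 0 (0, 0)" by (simp add: P_def S_def)
    have "(\<exists>m a b. P m (a, b) \<and> (\<forall>a' b'. a' div 2 = a \<and> b' div 2 = b \<longrightarrow> \<not> P (Suc m) (a', b'))) \<or>
       (\<exists>f. \<forall>n. P n (f n) \<and> fst (f (Suc n)) div 2 = fst (f n) \<and> snd (f (Suc n)) div 2 = snd (f n))"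
    proof (subst disj_commute, rule disjCI)
      assume *: "\<nexists>m a b. P m (a, b) \<and> (\<forall>a' b'. a' div 2 = a \<and> b' div 2 = b \<longrightarrow> \<not> P (Suc m) (a', b'))"
      have step: "\<exists>y. P (Suc n) y \<and> fst y div 2 = fst x \<and> snd y div 2 = snd x" if "P n x" for x n
      proof -
        obtain a b where "x = (a, b)" by force
        with that * obtain a' b' where "a' div 2 = a" "b' div 2 = b" "P (Suc n) (a', b')" by blast
        with \<open>x = (a, b)\<close> show ?thesis by (intro exI[of _ "(a', b')"]) simp
      qed
      show "\<exists>f. \<forall>n. P n (f n) \<and> fst (f (Suc n)) div 2 = fst (f n) \<and> snd (f (Suc n)) div 2 = snd (f n)"
        using dependent_nat_choice[of P "\<lambda>n x y. fst y div 2 = fst x \<and> snd y div 2 = snd x"] P0 step by blast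
    qed
    then show ?thesis
    proof (elim disjE exE conjE)
      fix f assume f: "\<forall>n. P n (f n) \<and> fst (f (Suc n)) div 2 = fst (f n) \<and> snd (f (Suc n)) div 2 = snd (f n)"
      then have "controlled d V \<kappa> 1 S"
        using l unfolding S_def by (intro chain_controlled[of l c2 c1 f]) (auto simp: P_def S_def)
      then show ?thesis by (rule one)
    next
      fix m a b assume Pm: "P m (a, b)" and stop: "\<forall>a' b'. a' div 2 = a \<and> b' div 2 = b \<longrightarrow> \<not> P (Suc m) (a', b')"
      define C where "C e e' = sq c1 c2 l (Suc m) (2 * a + e) (2 * b + e')" for e e' :: int
      define R where "R = sq c1 c2 l m a b"
      have RS: "R \<subseteq> S" and JR: "J_norm V (S - R) \<le> ennreal t" using Pm by (auto simp: P_def R_def)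
      have [measurable]: "R \<in> sets borel" "C e e' \<in> sets borel" for e e' by (auto simp: R_def C_def)
      have split: "R = (C 0 0 \<union> C 1 0) \<union> (C 0 1 \<union> C 1 1)" unfolding R_def C_def using sq_split[of c1 c2 l m a b] by simp
      have disj: "C 0 0 \<inter> C 1 0 = {}" "C 0 1 \<inter> C 1 1 = {}" "(C 0 0 \<union> C 1 0) \<inter> (C 0 1 \<union> C 1 1) = {}"
        unfolding C_def by (auto simp: Int_Un_distrib Int_Un_distrib2 sq_disjoint)
      have CS: "C e e' \<subseteq> S" if "e \<in> {0, 1}" "e' \<in> {0, 1}" for e e' using that split RS by auto
      define ok where "ok N Y \<longleftrightarrow> controlled d V \<kappa> N Y \<and> (enn2real (J_norm V Y) / t \<le> 1 \<longrightarrow> N \<le> 1) \<and>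
          (enn2real (J_norm V Y) / t > 1 \<longrightarrow> real N \<le> 8 * (enn2real (J_norm V Y) / t) - 3) \<and>
          enn2real (J_norm V Y) / t \<le> T / t - 1 \<and> J_norm V Y \<noteq> \<infinity>" for N :: nat and Y
      \<comment> \<open>A child carries at least \<open>t\<close> less than \<open>S\<close>, since its complement carries more than \<open>t\<close>.\<close>
      have rec: "\<exists>N. ok N (C e e')"
        if e: "e \<in> {0, 1}" "e' \<in> {0, 1}" for e e'
      proof -
        have "\<not> P (Suc m) (2 * a + e, 2 * b + e')" using e stop by auto
        then have big: "ennreal t < J_norm V (S - C e e')" using CS[OF e] unfolding P_def C_def by (auto simp: not_le)
        have add: "J_norm V (C e e') + J_norm V (S - C e e') \<le> ennreal T"
          unfolding JS[symmetric] using CS[OF e] V0 by (intro J_norm_superadd) auto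
        then have "J_norm V (C e e') + ennreal t \<le> ennreal T"
          using big by (meson add_left_mono less_imp_le order_trans)
        then obtain r where r: "J_norm V (C e e') = ennreal r" "r \<ge> 0" "r + t \<le> T"
          using t T0 by (cases "J_norm V (C e e')") (auto simp: top_unique simp flip: ennreal_plus)
        have nt: "r \<le> real n * t" using r Tn by (simp add: algebra_simps)
        have cor: "C e e' = sq (c1 + l * (2 * a + e) / 2 ^ Suc m) (c2 + d * l * (2 * b + e') / 2 ^ Suc m) (l / 2 ^ Suc m) 0 0 0"
          unfolding C_def using sq_corner[OF l(1), of c1 c2 "Suc m"] by (metis of_int_add of_int_mult of_int_numeral)
        define c where "c = c2 + d * l * (2 * b + e') / 2 ^ Suc m"
        have sub: "{c..<c + d * (l / 2 ^ Suc m)} \<subseteq> {c2..<c2 + d * l}"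
        proof -
          have "C e e' = {c1 + l * (2 * a + e) / 2 ^ Suc m..<c1 + l * (2 * a + e) / 2 ^ Suc m + l / 2 ^ Suc m} \<times> {c..<c + d * (l / 2 ^ Suc m)}"
            unfolding cor sq_def c_def using l d by (subst (1 2) cell_0) auto
          moreover have "S = {c1..<c1 + l} \<times> {c2..<c2 + d * l}"
            unfolding S_def sq_def using l d by (subst (1 2) cell_0) auto
          moreover have "{c1 + l * (2 * a + e) / 2 ^ Suc m..<c1 + l * (2 * a + e) / 2 ^ Suc m + l / 2 ^ Suc m} \<noteq> {}" using l by simp
          moreover have "Y \<subseteq> B" if "X \<times> Y \<subseteq> A \<times> B" "X \<noteq> {}" for X Y A B :: "real set" using that by blast
          ultimately show ?thesis using CS[OF e] by metis
        qed
        have pos: "d * (l / 2 ^ Suc m) > 0" using d l by simp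
        have c: "0 \<le> c" "c + d * (l / 2 ^ Suc m) \<le> d"
          using sub pos l by (auto simp: atLeastLessThan_subset_iff)
        have "l / 2 ^ Suc m > 0" using l by simp
        from Suc.IH[OF this c, of "c1 + l * (2 * a + e) / 2 ^ Suc m"]
        show ?thesis using nt r t unfolding ok_def c_def cor[symmetric] r(1)
          by (auto simp: field_simps intro: ennreal_leI)
      qed
      obtain N1 N2 N3 N4 where ok: "ok N1 (C 0 0)" "ok N2 (C 1 0)" "ok N3 (C 0 1)" "ok N4 (C 1 1)"
        using rec[of 0 0] rec[of 1 0] rec[of 0 1] rec[of 1 1] by auto
      note N1 = ok(1)[unfolded ok_def] and N2 = ok(2)[unfolded ok_def] and N3 = ok(3)[unfolded ok_def] and N4 = ok(4)[unfolded ok_def]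
      have "controlled d V \<kappa> 1 (S - R)"
      proof (cases "m = 0")
        case True
        have "R \<noteq> {}" using emeasure_sq[OF l(1), of c1 c2 m a b] l d by (auto simp: R_def)
        then have "(a, b) = (0, 0)"
          using sq_disjoint[of a b 0 0 c1 c2 l 0] RS True unfolding S_def R_def by blast
        then have "S - R = {}" using True by (simp add: R_def S_def)
        moreover have "controlled d V \<kappa> 1 {}" by (rule controlledI[OF rect_in_ref[OF l, of c1 c1 c2]]) simp
        ultimately show ?thesis by (simp only:)
      next
        case False
        have dl: "d * l > 0" using d l by simp
        show ?thesis
          using l JR False idx_corner[OF l(1), of c1 m a] idx_corner[OF dl, of c2 m b] unfolding S_def R_def
          by (intro controlledI[OF rect_in_ref[where \<xi>="c1 + l * a / 2 ^ m" and \<eta>="c2 + d * l * b / 2 ^ m"]])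
             (use hole_bound[of _ _ _ l m c1 c2 "c1 + l * a / 2 ^ m" "c2 + d * l * b / 2 ^ m"] in auto)
      qed
      then have "controlled d V \<kappa> (1 + ((N1 + N2) + (N3 + N4))) ((S - R) \<union> R)"
        unfolding split using N1 N2 N3 N4 disj
        by (intro controlled_Un) (auto simp flip: split)
      moreover have "(S - R) \<union> R = S" using RS by auto
      moreover have "real (1 + ((N1 + N2) + (N3 + N4))) \<le> 8 * (T / t) - 3"
      proof -
        have real_sum: "(enn2real x1 + enn2real x2) + (enn2real x3 + enn2real x4) \<le> T"
          if "(x1 + x2) + (x3 + x4) \<le> ennreal T" "x1 \<noteq> \<infinity>" "x2 \<noteq> \<infinity>" "x3 \<noteq> \<infinity>" "x4 \<noteq> \<infinity>" for x1 x2 x3 x4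
          using that T0 by (cases x1; cases x2; cases x3; cases x4) (auto simp flip: ennreal_plus)
        have "(J_norm V (C 0 0) + J_norm V (C 1 0)) + (J_norm V (C 0 1) + J_norm V (C 1 1)) \<le> J_norm V (C 0 0 \<union> C 1 0) + J_norm V (C 0 1 \<union> C 1 1)"
          using disj V0 by (intro add_mono J_norm_superadd) auto
        also have "... \<le> J_norm V S" using disj V0 RS split by (intro J_norm_superadd) auto
        finally have "(enn2real (J_norm V (C 0 0)) + enn2real (J_norm V (C 1 0))) + (enn2real (J_norm V (C 0 1)) + enn2real (J_norm V (C 1 1))) \<le> T"
          unfolding JS using N1 N2 N3 N4 by (intro real_sum) blast+
        from divide_right_mono[OF this, of t] have sum: "(enn2real (J_norm V (C 0 0)) / t + enn2real (J_norm V (C 1 0)) / t) + (enn2real (J_norm V (C 0 1)) / t + enn2real (J_norm V (C 1 1)) / t) \<le> T / t"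
          using t by (simp add: add_divide_distrib)
        have "T / t > 1" using False t by (simp add: field_simps)
        moreover have "0 \<le> enn2real (J_norm V (C e e')) / t" for e e' using t by simp
        moreover have "real N1 \<le> 1 \<or> real N1 \<le> 8 * (enn2real (J_norm V (C 0 0)) / t) - 3 \<and> enn2real (J_norm V (C 0 0)) / t > 1"
          "real N2 \<le> 1 \<or> real N2 \<le> 8 * (enn2real (J_norm V (C 1 0)) / t) - 3 \<and> enn2real (J_norm V (C 1 0)) / t > 1"
          "real N3 \<le> 1 \<or> real N3 \<le> 8 * (enn2real (J_norm V (C 0 1)) / t) - 3 \<and> enn2real (J_norm V (C 0 1)) / t > 1"
          "real N4 \<le> 1 \<or> real N4 \<le> 8 * (enn2real (J_norm V (C 1 1)) / t) - 3 \<and> enn2real (J_norm V (C 1 1)) / t > 1"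
          using N1 N2 N3 N4 by linarith+
        moreover have "enn2real (J_norm V (C 0 0)) / t \<le> T / t - 1" "enn2real (J_norm V (C 1 0)) / t \<le> T / t - 1"
          "enn2real (J_norm V (C 0 1)) / t \<le> T / t - 1" "enn2real (J_norm V (C 1 1)) / t \<le> T / t - 1"
          using N1 N2 N3 N4 by blast+
        ultimately show ?thesis using sum by (smt (verit) of_nat_add of_nat_1)
      qed
      ultimately show ?thesis
        using False t unfolding S_def[symmetric] T_def[symmetric]
        by (intro exI[of _ "1 + ((N1 + N2) + (N3 + N4))"]) (auto simp: field_simps)
    qed
  qed
qed

end

section \<open>Bump functions\<close>

text \<open>The derivatives of \<open>exp (- c / t)\<close>, extended by \<open>0\<close> to \<open>t \<le> 0\<close>, are combinations of these functions.\<close>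
definition flat :: "real \<Rightarrow> nat \<Rightarrow> real \<Rightarrow> real" where
  "flat c k t = (if t > 0 then exp (- c / t) / t ^ k else 0)"

lemma flat_bound:
  assumes "c > 0"
  shows "\<bar>flat c k t\<bar> \<le> (real (k + 2) / c) ^ (k + 2) * t\<^sup>2"
proof (cases "t > 0")
  case True
  define n where "n = k + 2"
  have n: "real n > 0" by (simp add: n_def)
  have "(c / (n * t)) ^ n \<le> exp (c / (n * t)) ^ n"
    using assms True n exp_ge_add_one_self[of "c / (n * t)"] by (intro power_mono) (linarith, simp)
  also have "... = exp (c / t)" using n True by (simp flip: exp_of_nat_mult)
  finally have "exp (- c / t) \<le> (n * t / c) ^ n"
    using assms True n by (simp add: exp_minus field_simps power_divide)
  then have "exp (- c / t) / t ^ k \<le> (n * t / c) ^ n / t ^ k"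
    using True by (intro divide_right_mono) auto
  also have "... = (n / c) ^ n * t\<^sup>2"
    using True by (simp add: n_def power_add power_mult_distrib power_divide power2_eq_square)
  finally show ?thesis using True by (simp add: flat_def n_def)
qed (use assms in \<open>simp add: flat_def\<close>)

lemma flat_deriv:
  assumes c: "c > 0"
  shows "(flat c k has_real_derivative (c * flat c (k + 2) t - k * flat c (k + 1) t)) (at t)"
proof -
  consider "t > 0" | "t < 0" | "t = 0" by linarith
  then show ?thesis
  proof cases
    case 1
    have "((\<lambda>t. exp (- c / t) / t ^ k) has_real_derivative (c * flat c (k + 2) t - k * flat c (k + 1) t)) (at t)"
      using 1 by (auto intro!: derivative_eq_intros simp: flat_def field_simps power2_eq_square)
        (cases k; simp add: field_simps)
    then show ?thesis
      by (rule has_field_derivative_transform_within_open[where S="{0<..}"]) (use 1 in \<open>auto simp: flat_def\<close>)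
  next
    case 2
    have "((\<lambda>t. 0) has_real_derivative (c * flat c (k + 2) t - k * flat c (k + 1) t)) (at t)"
      using 2 by (simp add: flat_def)
    then show ?thesis
      by (rule has_field_derivative_transform_within_open[where S="{..<0}"]) (use 2 in \<open>auto simp: flat_def\<close>)
  next
    case 3
    let ?C = "(real (k + 2) / c) ^ (k + 2)"
    have "((\<lambda>h. flat c k h / h) \<longlongrightarrow> 0) (at 0)"
    proof (rule Lim_null_comparison)
      show "\<forall>\<^sub>F h in at 0. norm (flat c k h / h) \<le> ?C * \<bar>h\<bar>"
      proof (intro always_eventually allI)
        fix h :: real
        have "norm (flat c k h / h) \<le> (?C * h\<^sup>2) / \<bar>h\<bar>"
          using divide_right_mono[OF flat_bound[OF c, of k h], of "\<bar>h\<bar>"] by simp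
        also have "... = ?C * (\<bar>h\<bar> * \<bar>h\<bar> / \<bar>h\<bar>)" by (simp add: power2_eq_square)
        also have "\<bar>h\<bar> * \<bar>h\<bar> / \<bar>h\<bar> = \<bar>h\<bar>" by (cases "h = 0") (auto simp: abs_if)
        finally show "norm (flat c k h / h) \<le> ?C * \<bar>h\<bar>" .
      qed
      show "((\<lambda>h. ?C * \<bar>h\<bar>) \<longlongrightarrow> 0) (at 0)"
        by (rule tendsto_eq_intros refl | simp)+
    qed
    then show ?thesis using 3 by (simp add: has_field_derivative_iff flat_def)
  qed
qed

definition smooth1 :: "(real \<Rightarrow> real) \<Rightarrow> bool" where
  "smooth1 f \<longleftrightarrow> (\<exists>D :: nat \<Rightarrow> real \<Rightarrow> real. D 0 = f \<and> (\<forall>n t. (D n has_real_derivative D (Suc n) t) (at t)))"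

text \<open>An algebra closed under differentiation; all its elements are therefore smooth.\<close>
inductive_set bump_algebra :: "real \<Rightarrow> real \<Rightarrow> real \<Rightarrow> (real \<Rightarrow> real) set" for c a b where
  left: "(\<lambda>t. flat c k (t - a)) \<in> bump_algebra c a b"
| right: "(\<lambda>t. flat c k (b - t)) \<in> bump_algebra c a b"
| add: "f \<in> bump_algebra c a b \<Longrightarrow> g \<in> bump_algebra c a b \<Longrightarrow> (\<lambda>t. f t + g t) \<in> bump_algebra c a b"
| scale: "f \<in> bump_algebra c a b \<Longrightarrow> (\<lambda>t. r * f t) \<in> bump_algebra c a b"
| mult: "f \<in> bump_algebra c a b \<Longrightarrow> g \<in> bump_algebra c a b \<Longrightarrow> (\<lambda>t. f t * g t) \<in> bump_algebra c a b"

lemma bump_algebra_deriv: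
  assumes c: "c > 0"
  shows "f \<in> bump_algebra c a b \<Longrightarrow> \<exists>f'\<in>bump_algebra c a b. \<forall>t. (f has_real_derivative f' t) (at t)"
proof (induction rule: bump_algebra.induct)
  case (left k)
  show ?case
  proof (intro bexI allI)
    show "(\<lambda>t. c * flat c (k + 2) (t - a) + (- real k) * flat c (k + 1) (t - a)) \<in> bump_algebra c a b"
      by (intro bump_algebra.intros)
    show "((\<lambda>t. flat c k (t - a)) has_real_derivative c * flat c (k + 2) (t - a) + (- real k) * flat c (k + 1) (t - a)) (at t)" for t
      using DERIV_chain2[where g="\<lambda>t. t - a" and x=t and s=UNIV, OF flat_deriv[OF c, of k "t - a"] DERIV_diff[OF DERIV_ident DERIV_const]]
      by simp
  qed
next
  case (right k)
  show ?case
  proof (intro bexI allI)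
    show "(\<lambda>t. (- c) * flat c (k + 2) (b - t) + real k * flat c (k + 1) (b - t)) \<in> bump_algebra c a b"
      by (intro bump_algebra.intros)
    show "((\<lambda>t. flat c k (b - t)) has_real_derivative (- c) * flat c (k + 2) (b - t) + real k * flat c (k + 1) (b - t)) (at t)" for t
      using DERIV_chain2[where g="\<lambda>t. b - t" and x=t and s=UNIV, OF flat_deriv[OF c, of k "b - t"] DERIV_diff[OF DERIV_const DERIV_ident]]
      by simp
  qed
next
  case (add f g)
  then obtain f' g' where "f' \<in> bump_algebra c a b" "g' \<in> bump_algebra c a b"
     "\<And>t. (f has_real_derivative f' t) (at t)" "\<And>t. (g has_real_derivative g' t) (at t)" by blast
  then show ?case by (intro bexI[of _ "\<lambda>t. f' t + g' t"]) (auto intro!: bump_algebra.intros DERIV_add)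
next
  case (scale f r)
  then obtain f' where "f' \<in> bump_algebra c a b" "\<And>t. (f has_real_derivative f' t) (at t)" by blast
  then show ?case by (intro bexI[of _ "\<lambda>t. r * f' t"]) (auto intro!: bump_algebra.intros DERIV_cmult)
next
  case (mult f g)
  then obtain f' g' where "f' \<in> bump_algebra c a b" "g' \<in> bump_algebra c a b"
     "\<And>t. (f has_real_derivative f' t) (at t)" "\<And>t. (g has_real_derivative g' t) (at t)" by blast
  then show ?case using mult.hyps
    by (intro bexI[of _ "\<lambda>t. f' t * g t + g' t * f t"]) (auto intro!: bump_algebra.intros DERIV_mult)
qed

text \<open>As \<open>c\<close> tends to \<open>0\<close> this tends to the indicator function of \<open>{a<..<b}\<close>, boundedly.\<close>
definition bump :: "real \<Rightarrow> real \<Rightarrow> real \<Rightarrow> real \<Rightarrow> real" where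
  "bump c a b t = flat c 0 (t - a) * flat c 0 (b - t)"

lemma smooth1_bump:
  assumes c: "c > 0"
  shows "smooth1 (bump c a b)"
proof -
  have "bump c a b \<in> bump_algebra c a b"
    unfolding bump_def by (intro bump_algebra.mult bump_algebra.left bump_algebra.right)
  then obtain D where D: "\<And>n. D n \<in> bump_algebra c a b" "D 0 = bump c a b" "\<And>n t. (D n has_real_derivative D (Suc n) t) (at t)"
    using dependent_nat_choice[of "\<lambda>n f. f \<in> bump_algebra c a b \<and> (n = 0 \<longrightarrow> f = bump c a b)" "\<lambda>n f f'. \<forall>t. (f has_real_derivative f' t) (at t)"]
      bump_algebra_deriv[OF c] by (metis nat.distinct(1))
  then show ?thesis unfolding smooth1_def by blast
qed

lemma smooth_tensor:
  assumes "smooth1 f" "smooth1 g"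
  shows "smooth (\<lambda>(x, y). complex_of_real (f x * g y))"
proof -
  obtain D E where D: "D 0 = f" "\<And>n t. (D n has_real_derivative D (Suc n) t) (at t)"
    and E: "E 0 = g" "\<And>n t. (E n has_real_derivative E (Suc n) t) (at t)"
    using assms unfolding smooth1_def by blast
  define F where "F i j = (\<lambda>(x, y). complex_of_real (D i x * E j y))" for i j
  have "(F i j has_derivative (\<lambda>(h, k). h *\<^sub>R F (Suc i) j z + k *\<^sub>R F i (Suc j) z)) (at z)" for i j z
  proof -
    obtain x y where z: "z = (x, y)" by force
    have d: "((\<lambda>u. D i (fst u)) has_derivative (\<lambda>u. D (Suc i) x * fst u)) (at (x, y))"
      using has_derivative_compose[of fst fst "(x, y)" UNIV "D i" "(*) (D (Suc i) x)"] D(2)[of i x]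
      by (simp add: has_field_derivative_def has_derivative_fst[OF has_derivative_ident])
    have e: "((\<lambda>u. E j (snd u)) has_derivative (\<lambda>u. E (Suc j) y * snd u)) (at (x, y))"
      using has_derivative_compose[of snd snd "(x, y)" UNIV "E j" "(*) (E (Suc j) y)"] E(2)[of j y]
      by (simp add: has_field_derivative_def has_derivative_snd[OF has_derivative_ident])
    have "((\<lambda>u. complex_of_real (D i (fst u) * E j (snd u))) has_derivative
       (\<lambda>u. complex_of_real (D i x * (E (Suc j) y * snd u) + D (Suc i) x * fst u * E j y))) (at (x, y))"
      using has_derivative_of_real[OF has_derivative_mult[OF d e]] by simp
    then show ?thesis
      unfolding F_def z by (simp add: case_prod_unfold scaleR_conv_of_real algebra_simps)
  qed
  moreover have "F 0 0 = (\<lambda>(x, y). complex_of_real (f x * g y))" by (simp add: F_def D E)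
  ultimately show ?thesis unfolding smooth_def by blast
qed

lemma bump_nonzero: "c > 0 \<Longrightarrow> bump c a b t \<noteq> 0 \<longleftrightarrow> a < t \<and> t < b"
  by (auto simp: bump_def flat_def)

lemma bump_le_1: "c > 0 \<Longrightarrow> \<bar>bump c a b t\<bar> \<le> 1"
  by (auto simp: bump_def flat_def abs_mult intro!: mult_le_one)

lemma bump_tendsto: "(\<lambda>n. bump (1 / Suc n) a b t) \<longlonglongrightarrow> indicator {a<..<b} t"
proof (cases "a < t \<and> t < b")
  case True
  have "(\<lambda>n. exp (- (1 / real (Suc n)) / (t - a)) * exp (- (1 / real (Suc n)) / (b - t))) \<longlonglongrightarrow> exp (- 0 / (t - a)) * exp (- 0 / (b - t))"
    using True by (intro tendsto_intros LIMSEQ_inverse_real_of_nat[unfolded inverse_eq_divide]) auto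
  then show ?thesis using True by (simp add: bump_def flat_def)
qed (auto simp: bump_def flat_def)

lemma tensor_test:
  assumes c: "c > 0" and sub: "{a1..b1} \<times> {a2..b2} \<subseteq> \<Omega>"
  shows "(\<lambda>(x, y). complex_of_real (bump c a1 b1 x * bump c a2 b2 y)) \<in> test_functions \<Omega>"
proof -
  let ?f = "\<lambda>(x, y). complex_of_real (bump c a1 b1 x * bump c a2 b2 y)"
  have "{z. ?f z \<noteq> 0} \<subseteq> {a1..b1} \<times> {a2..b2}" using bump_nonzero[OF c] by (auto simp: less_imp_le)
  then have cl: "closure {z. ?f z \<noteq> 0} \<subseteq> {a1..b1} \<times> {a2..b2}"
    by (intro closure_minimal closed_Times) auto
  moreover have "compact (closure {z. ?f z \<noteq> 0})"
    using bounded_subset[OF _ cl] by (auto simp: compact_eq_bounded_closed bounded_Times)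
  ultimately show ?thesis
    unfolding test_functions_def using smooth_tensor[OF smooth1_bump[OF c] smooth1_bump[OF c]] sub by auto
qed

section \<open>Uniqueness of weak derivatives\<close>

text \<open>Boxes form a generator of the Borel sets that is stable under intersections, so the positive and the negative part of \<open>f\<close>
  have the same integral over every Borel set.\<close>
lemma AE_zero_of_box_integrals:
  fixes f :: "'a::euclidean_space \<Rightarrow> real"
  assumes f: "integrable lborel f" and z: "\<And>a b. (LINT x:box a b|lborel. f x) = 0"
  shows "AE x in lborel. f x = 0"
proof -
  have [measurable]: "f \<in> borel_measurable borel" using f by auto
  define P where "P x = ennreal (f x)" for x
  define N where "N x = ennreal (- f x)" for x
  have [measurable]: "P \<in> borel_measurable borel" "N \<in> borel_measurable borel" unfolding P_def N_def by measurable
  have finP: "nn_integral lborel P < \<infinity>" and finN: "nn_integral lborel N < \<infinity>"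
    using f unfolding P_def N_def real_integrable_def by (auto simp: less_top)
  let ?E = "range (\<lambda>(a, b). box a b::'a set)"
  have eq: "density lborel P = density lborel N"
  proof (rule measure_eqI_generator_eq)
    show "Int_stable ?E" by (auto simp: Int_stable_def box_Int_box)
    show "?E \<subseteq> Pow UNIV" "sets (density lborel P) = sigma_sets UNIV ?E" "sets (density lborel N) = sigma_sets UNIV ?E"
      by (simp_all add: borel_eq_box)
    let ?A = "\<lambda>n::nat. box (- (real n *\<^sub>R One)) (real n *\<^sub>R One) :: 'a set"
    show "range ?A \<subseteq> ?E" "(\<Union>i. ?A i) = UNIV" unfolding UN_box_eq_UNIV by auto
    show "emeasure (density lborel P) (?A i) \<noteq> \<infinity>" for i
    proof -
      have "emeasure (density lborel P) (?A i) \<le> nn_integral lborel P"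
        by (subst emeasure_density) (auto intro!: nn_integral_mono simp: indicator_def)
      then show ?thesis using finP by (auto simp: top_unique)
    qed
    show "emeasure (density lborel P) X = emeasure (density lborel N) X" if "X \<in> ?E" for X
    proof -
      have [measurable]: "X \<in> sets borel" using that by auto
      have iX: "integrable lborel (\<lambda>x. indicator X x * f x)"
        using integrable_mult_indicator[OF _ f, of X] by simp
      have "0 = enn2real (\<integral>\<^sup>+x. ennreal (indicator X x * f x) \<partial>lborel) - enn2real (\<integral>\<^sup>+x. ennreal (- (indicator X x * f x)) \<partial>lborel)"
        using z that unfolding real_lebesgue_integral_def[OF iX, symmetric] by (auto simp: set_lebesgue_integral_def)
      moreover have "(\<integral>\<^sup>+x. ennreal (indicator X x * f x) \<partial>lborel) = emeasure (density lborel P) X"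
         "(\<integral>\<^sup>+x. ennreal (- (indicator X x * f x)) \<partial>lborel) = emeasure (density lborel N) X"
        by (auto simp: emeasure_density P_def N_def indicator_def intro!: nn_integral_cong)
      moreover have "(\<integral>\<^sup>+x. ennreal (indicator X x * f x) \<partial>lborel) < \<infinity>" "(\<integral>\<^sup>+x. ennreal (- (indicator X x * f x)) \<partial>lborel) < \<infinity>"
        using iX unfolding real_integrable_def by (auto simp: less_top)
      ultimately show ?thesis by (metis diff_eq_diff_eq diff_self ennreal_enn2real infinity_ennreal_def right_minus_eq)
    qed
  qed
  have "AE x in lborel. P x = N x"
    by (rule sigma_finite_measure.density_unique[OF sigma_finite_lborel _ _ eq]) auto
  then show ?thesis
    by eventually_elim (auto simp: P_def N_def ennreal_eq_0_iff split: if_splits, metis ennreal_neg less_eq_real_def ennreal_eq_0_iff linorder_linear neg_le_0_iff_le order_antisym)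
qed


lemma L2_box_integrable:
  fixes v :: "real \<times> real \<Rightarrow> complex"
  assumes v: "v \<in> L2 \<Omega>" and O: "\<Omega> \<in> sets borel" and B: "B \<in> sets borel" "bounded B" "B \<subseteq> \<Omega>"
  shows "integrable lebesgue (\<lambda>z. indicator B z *\<^sub>R v z)"
proof -
  have OL: "\<Omega> \<in> sets lebesgue" "B \<in> sets lebesgue" using O B by (auto intro: sets_completionI_sets)
  have vm: "(\<lambda>z. indicator \<Omega> z *\<^sub>R v z) \<in> borel_measurable lebesgue"
    using v OL by (simp add: L2_def borel_measurable_restrict_space_iff)
  have e: "(\<lambda>z. indicator B z *\<^sub>R v z) = (\<lambda>z. indicator B z *\<^sub>R (indicator \<Omega> z *\<^sub>R v z))"
    using B by (auto simp: fun_eq_iff indicator_def)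
  have v2: "integrable lebesgue (\<lambda>z. indicator \<Omega> z *\<^sub>R (cmod (v z))\<^sup>2)"
    using v OL by (simp add: L2_def integrable_restrict_space)
  have i1: "integrable lebesgue (\<lambda>z. indicator B z :: real)"
    using OL B emeasure_bounded_finite[OF B(2)] by (simp add: integrable_indicator_iff)
  show ?thesis
  proof (rule Bochner_Integration.integrable_bound)
    show "integrable lebesgue (\<lambda>z. indicator \<Omega> z *\<^sub>R (cmod (v z))\<^sup>2 + indicator B z :: real)"
      by (intro Bochner_Integration.integrable_add v2 i1)
    show "(\<lambda>z. indicator B z *\<^sub>R v z) \<in> borel_measurable lebesgue"
      unfolding e by (rule borel_measurable_scaleR[OF borel_measurable_indicator[OF OL(2)] vm])
    have "x \<le> x\<^sup>2 + 1" for x :: real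
    proof -
      have "0 \<le> x\<^sup>2 + 1 - 2 * x" using zero_le_power2[of "x - 1"] by (simp add: power2_diff)
      then show ?thesis using zero_le_power2[of x] by linarith
    qed
    then show "AE z in lebesgue. norm (indicator B z *\<^sub>R v z) \<le> norm (indicator \<Omega> z *\<^sub>R (cmod (v z))\<^sup>2 + indicator B z)"
      using B by (intro AE_I2) (auto simp: indicator_def)
  qed
qed

text \<open>Products of bump functions are test functions, and they converge to indicator functions of boxes.\<close>
lemma L2_eq_zero:
  fixes v :: "real \<times> real \<Rightarrow> complex"
  assumes v: "v \<in> L2 (strip d)" and z: "\<And>\<phi>. \<phi> \<in> test_functions (strip d) \<Longrightarrow> (LINT z|lebesgue_on (strip d). v z * \<phi> z) = 0"
  shows "AE z in lebesgue. z \<in> strip d \<longrightarrow> v z = 0"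
proof -
  have SO: "strip d \<in> sets borel" unfolding strip_def by (auto intro: borel_Times)
  then have SL: "strip d \<in> sets lebesgue" by (auto intro: sets_completionI_sets)
  have box0: "(LINT z|lebesgue. indicator ({a1<..<b1} \<times> {a2<..<b2}) z *\<^sub>R v z) = 0"
    if sub: "0 < a2" "b2 < d" for a1 b1 a2 b2
  proof -
    let ?B = "{a1<..<b1} \<times> {a2<..<b2}"
    have BS: "{a1..b1} \<times> {a2..b2} \<subseteq> strip d" using sub by (auto simp: strip_def)
    have Bb: "?B \<in> sets borel" "bounded ?B" "?B \<subseteq> strip d"
      using sub by (auto simp: strip_def intro!: borel_Times bounded_Times)
    have BL: "?B \<in> sets lebesgue" using Bb by (auto intro: sets_completionI_sets)
    define \<phi> where "\<phi> n z = bump (1 / Suc n) a1 b1 (fst z) * bump (1 / Suc n) a2 b2 (snd z)" for n and z :: "real \<times> real"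
    have iv: "integrable lebesgue (\<lambda>z. indicator ?B z *\<^sub>R v z)" by (rule L2_box_integrable[OF v SO Bb])
    have cphi: "continuous_on UNIV (\<phi> n)" for n
    proof -
      have "continuous_on UNIV (bump (1 / Suc n) a b)" for a b
      proof -
        obtain D where "D 0 = bump (1 / Suc n) a b" "\<And>n t. (D n has_real_derivative D (Suc n) t) (at t)"
          using smooth1_bump[of "1 / Suc n" a b] unfolding smooth1_def by auto
        then show ?thesis by (metis DERIV_isCont continuous_at_imp_continuous_on)
      qed
      then show ?thesis unfolding \<phi>_def by (intro continuous_on_mult continuous_on_compose2[OF _ continuous_on_fst[OF continuous_on_id]] continuous_on_compose2[OF _ continuous_on_snd[OF continuous_on_id]]) auto
    qed
    have mphi: "\<phi> n \<in> borel_measurable lebesgue" for n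
      by (intro measurable_completion) (use borel_measurable_continuous_onI[OF cphi] in simp)
    have eq: "(LINT z|lebesgue. \<phi> n z *\<^sub>R (indicator ?B z *\<^sub>R v z)) = 0" for n
    proof -
      have "(\<lambda>(x, y). complex_of_real (bump (1 / Suc n) a1 b1 x * bump (1 / Suc n) a2 b2 y)) \<in> test_functions (strip d)"
        using BS by (intro tensor_test) auto
      from z[OF this] have "0 = (LINT z|lebesgue. indicator (strip d) z *\<^sub>R (v z * complex_of_real (\<phi> n z)))"
        using SL by (simp add: integral_restrict_space \<phi>_def case_prod_unfold)
      also have "... = (LINT z|lebesgue. \<phi> n z *\<^sub>R (indicator ?B z *\<^sub>R v z))"
      proof (rule Bochner_Integration.integral_cong[OF refl])
        fix z
        have "z \<notin> ?B \<Longrightarrow> \<phi> n z = 0"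
          using bump_nonzero[of "1 / Suc n" a1 b1 "fst z"] bump_nonzero[of "1 / Suc n" a2 b2 "snd z"]
          by (cases z) (auto simp: \<phi>_def)
        then show "indicator (strip d) z *\<^sub>R (v z * complex_of_real (\<phi> n z)) = \<phi> n z *\<^sub>R (indicator ?B z *\<^sub>R v z)"
          using Bb(3) by (cases "z \<in> ?B") (auto simp: scaleR_conv_of_real indicator_def)
      qed
      finally show ?thesis ..
    qed
    have "(\<lambda>n. LINT z|lebesgue. \<phi> n z *\<^sub>R (indicator ?B z *\<^sub>R v z)) \<longlonglongrightarrow> (LINT z|lebesgue. indicator ?B z *\<^sub>R v z)"
    proof (rule integral_dominated_convergence[where w="\<lambda>z. norm (indicator ?B z *\<^sub>R v z)"])
      show "(\<lambda>z. indicator ?B z *\<^sub>R v z) \<in> borel_measurable lebesgue" using iv by auto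
      then show "(\<lambda>z. \<phi> n z *\<^sub>R (indicator ?B z *\<^sub>R v z)) \<in> borel_measurable lebesgue" for n
        by (rule borel_measurable_scaleR[OF mphi])
      show "AE z in lebesgue. norm (\<phi> n z *\<^sub>R (indicator ?B z *\<^sub>R v z)) \<le> norm (indicator ?B z *\<^sub>R v z)" for n
      proof (rule AE_I2)
        fix z
        have "\<bar>\<phi> n z\<bar> \<le> 1" unfolding \<phi>_def abs_mult by (intro mult_le_one bump_le_1) auto
        then have "\<bar>\<phi> n z\<bar> * norm (indicator ?B z *\<^sub>R v z) \<le> 1 * norm (indicator ?B z *\<^sub>R v z)"
          by (intro mult_right_mono) auto
        then show "norm (\<phi> n z *\<^sub>R (indicator ?B z *\<^sub>R v z)) \<le> norm (indicator ?B z *\<^sub>R v z)" by (simp only: norm_scaleR mult_1)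
      qed
      show "AE z in lebesgue. (\<lambda>n. \<phi> n z *\<^sub>R (indicator ?B z *\<^sub>R v z)) \<longlonglongrightarrow> indicator ?B z *\<^sub>R v z"
      proof (rule AE_I2)
        fix z
        have "(\<lambda>n. \<phi> n z *\<^sub>R (indicator ?B z *\<^sub>R v z)) \<longlonglongrightarrow> (indicator {a1<..<b1} (fst z) * indicator {a2<..<b2} (snd z)) *\<^sub>R (indicator ?B z *\<^sub>R v z)"
          unfolding \<phi>_def by (intro tendsto_intros bump_tendsto)
        then show "(\<lambda>n. \<phi> n z *\<^sub>R (indicator ?B z *\<^sub>R v z)) \<longlonglongrightarrow> indicator ?B z *\<^sub>R v z"
          by (cases z) (auto simp: indicator_def split: if_splits)
      qed
      show "integrable lebesgue (\<lambda>z. norm (indicator ?B z *\<^sub>R v z))" using iv by (rule integrable_norm)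
    qed
    then show ?thesis using eq LIMSEQ_unique tendsto_const by (simp add: LIMSEQ_const_iff)
  qed
  have local: "AE z in lebesgue. z \<in> {- real n<..<real n} \<times> {1 / Suc n<..<d - 1 / Suc n} \<longrightarrow> v z = 0" for n
  proof -
    define B where "B = {- real n<..<real n} \<times> {1 / real (Suc n)<..<d - 1 / Suc n}"
    have np: "0 < 1 / real (Suc n)" by simp
    have Bb: "B \<in> sets borel" "bounded B"
      unfolding B_def by (intro borel_Times bounded_Times; simp)+
    have Bs: "B \<subseteq> strip d"
      using np unfolding B_def strip_def by (intro Sigma_mono) (auto simp del: of_nat_Suc simp: greaterThanLessThan_subseteq_greaterThanLessThan)
    note Bb = Bb Bs
    have iv: "integrable lebesgue (\<lambda>z. indicator B z *\<^sub>R v z)" by (rule L2_box_integrable[OF v SO Bb])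
    have part: "AE z in lebesgue. F (indicator B z *\<^sub>R v z) = 0" if F: "F = Re \<or> F = Im" for F :: "complex \<Rightarrow> real"
    proof -
      have Fb: "bounded_linear F" using F bounded_linear_Re bounded_linear_Im by auto
      have iF: "integrable lebesgue (\<lambda>z. F (indicator B z *\<^sub>R v z))" by (rule integrable_bounded_linear[OF Fb iv])
      then obtain g where g: "g \<in> borel_measurable lborel" "AE z in lborel. F (indicator B z *\<^sub>R v z) = g z"
        using completion_ex_borel_measurable_real[of "\<lambda>z. F (indicator B z *\<^sub>R v z)" lborel] by auto
      have gae: "AE z in lebesgue. F (indicator B z *\<^sub>R v z) = g z" using g(2) by (rule AE_completion)
      have gm: "g \<in> borel_measurable lebesgue" using g(1) by (rule measurable_completion)
      have ig': "integrable lebesgue g" by (rule integrable_cong_AE_imp[OF iF gm]) (use gae in \<open>auto elim: AE_mp\<close>)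
      have ig: "integrable lborel g" using ig' g(1) by (simp add: integrable_completion)
      have "AE z in lborel. g z = 0"
      proof (rule AE_zero_of_box_integrals[OF ig])
        fix a b :: "real \<times> real"
        obtain a1 a2 b1 b2 where ab: "a = (a1, a2)" "b = (b1, b2)" by (metis surj_pair)
        have bx: "box a b = {a1<..<b1} \<times> {a2<..<b2}" by (auto simp: ab box_def Basis_prod_def)
        have inter: "box a b \<inter> B = {max a1 (- real n)<..<min b1 (real n)} \<times> {max a2 (1 / Suc n)<..<min b2 (d - 1 / Suc n)}"
          unfolding bx B_def by auto
        have bl: "box a b \<in> sets lebesgue" by (rule sets_completionI_sets) simp
        have "(LINT z:box a b|lborel. g z) = (LINT z|lebesgue. indicator (box a b) z *\<^sub>R g z)"
          unfolding set_lebesgue_integral_def using g(1) by (subst integral_completion) auto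
        also have "... = (LINT z|lebesgue. indicator (box a b) z *\<^sub>R F (indicator B z *\<^sub>R v z))"
          using iF gm gae by (intro integral_cong_AE borel_measurable_scaleR borel_measurable_indicator bl) (auto elim: AE_mp)
        also have "... = (LINT z|lebesgue. F (indicator (box a b \<inter> B) z *\<^sub>R v z))"
          by (intro Bochner_Integration.integral_cong) (auto simp: indicator_def linear_0[OF bounded_linear.linear[OF Fb]])
        also have "... = F (LINT z|lebesgue. indicator (box a b \<inter> B) z *\<^sub>R v z)"
        proof (rule integral_bounded_linear[OF Fb])
          show "integrable lebesgue (\<lambda>z. indicator (box a b \<inter> B) z *\<^sub>R v z)"
            using Bb by (intro L2_box_integrable[OF v SO]) (auto simp: bounded_Int)
        qed
        also have "... = 0"
          unfolding inter using box0[of "max a2 (1 / Suc n)" "min b2 (d - 1 / Suc n)"]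
          by (simp add: linear_0[OF bounded_linear.linear[OF Fb]] max.strict_coboundedI2 min.strict_coboundedI2)
        finally show "(LINT z:box a b|lborel. g z) = 0" .
      qed
      then have "AE z in lebesgue. g z = 0" by (rule AE_completion)
      with gae show ?thesis by eventually_elim simp
    qed
    show ?thesis using part[of Re, simplified] part[of Im, simplified] unfolding B_def[symmetric]
      by eventually_elim (auto simp: complex_eq_iff indicator_def)
  qed
  have "AE z in lebesgue. \<forall>n. z \<in> {- real n<..<real n} \<times> {1 / Suc n<..<d - 1 / Suc n} \<longrightarrow> v z = 0"
    using local by (simp only: AE_all_countable) blast
  then show ?thesis
  proof eventually_elim
    fix z assume h: "\<forall>n. z \<in> {- real n<..<real n} \<times> {1 / Suc n<..<d - 1 / Suc n} \<longrightarrow> v z = 0"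
    show "z \<in> strip d \<longrightarrow> v z = 0"
    proof
      assume "z \<in> strip d"
      then obtain x y where xy: "z = (x, y)" "0 < y" "y < d" by (auto simp: strip_def)
      obtain n1 where n1: "\<bar>x\<bar> < real n1" using reals_Archimedean2 by blast
      obtain n2 where n2: "1 / Suc n2 < min y (d - y)" using xy reals_Archimedean[of "min y (d - y)"] by (auto simp: inverse_eq_divide)
      define n where "n = max n1 n2"
      have "real n1 \<le> real n" "1 / real (Suc n) \<le> 1 / Suc n2" by (auto simp: n_def intro!: divide_left_mono)
      then have "z \<in> {- real n<..<real n} \<times> {1 / Suc n<..<d - 1 / Suc n}"
        using n1 n2 xy by auto
      then show "v z = 0" using h by blast
    qed
  qed
qed

section \<open>Test functions\<close>

lemma test_C1:
  assumes w: "w \<in> test_functions \<Omega>"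
  obtains p q S where "C1 w p q" "\<And>z. frechet_derivative w (at z) = (\<lambda>(h, k). h *\<^sub>R p z + k *\<^sub>R q z)"
    "bounded S" "S \<subseteq> \<Omega>" "\<And>z. z \<notin> S \<Longrightarrow> w z = 0 \<and> p z = 0 \<and> q z = 0"
proof -
  obtain F where F: "F 0 0 = w" "\<And>i j z. (F i j has_derivative (\<lambda>(h, k). h *\<^sub>R F (Suc i) j z + k *\<^sub>R F i (Suc j) z)) (at z)"
    using w unfolding test_functions_def smooth_def by blast
  define p where "p = F 1 0"
  define q where "q = F 0 1"
  have D: "(w has_derivative (\<lambda>(h, k). h *\<^sub>R p z + k *\<^sub>R q z)) (at z)" for z
    using F(2)[of 0 0 z] F(1) by (simp add: p_def q_def)
  have cF: "continuous_on UNIV (F i j)" for i j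
    using F(2) by (meson continuous_at_imp_continuous_on has_derivative_continuous)
  have x: "((\<lambda>x. w (x, y)) has_vector_derivative p (x, y)) (at x)" for x y
  proof -
    have "((\<lambda>x. (x, y)) has_derivative (\<lambda>h. (h, 0))) (at x)"
      by (intro has_derivative_Pair has_derivative_ident has_derivative_const)
    from has_derivative_compose[OF this D] show ?thesis by (simp add: has_vector_derivative_def)
  qed
  have y: "((\<lambda>y. w (x, y)) has_vector_derivative q (x, y)) (at y)" for x y
  proof -
    have "((\<lambda>y. (x, y)) has_derivative (\<lambda>h. (0, h))) (at y)"
      by (intro has_derivative_Pair has_derivative_ident has_derivative_const)
    from has_derivative_compose[OF this D] show ?thesis by (simp add: has_vector_derivative_def)
  qed
  have C: "C1 w p q" unfolding C1_def using cF F(1) x y by (metis p_def q_def)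
  have fd: "frechet_derivative w (at z) = (\<lambda>(h, k). h *\<^sub>R p z + k *\<^sub>R q z)" for z
    using frechet_derivative_at[OF D] by simp
  have out: "w z = 0 \<and> p z = 0 \<and> q z = 0" if "z \<notin> closure {z. w z \<noteq> 0}" for z
  proof -
    let ?O = "- closure {z. w z \<noteq> 0}"
    have w0: "v \<in> ?O \<Longrightarrow> 0 = w v" for v using closure_subset[of "{z. w z \<noteq> 0}"] by (cases "w v = 0") auto
    have "((\<lambda>_. 0) has_derivative (\<lambda>_. 0)) (at z)" by (rule has_derivative_const)
    then have "(w has_derivative (\<lambda>_. 0)) (at z)"
      by (rule has_derivative_transform_within_open[where s="?O", OF _ _ _ w0]) (use that in auto)
    then have "(\<lambda>(h, k). h *\<^sub>R p z + k *\<^sub>R q z) = (\<lambda>_. 0)" using D has_derivative_unique by blast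
    from fun_cong[OF this, of "(1, 0)"] fun_cong[OF this, of "(0, 1)"] show ?thesis
      using that closure_subset[of "{z. w z \<noteq> 0}"] by auto
  qed
  show thesis
    using that[OF C fd _ _ out] w by (auto simp: test_functions_def intro: compact_imp_bounded)
qed

lemma C1_mult:
  assumes "C1 w p q" "C1 w' p' q'"
  shows "C1 (\<lambda>z. w z * w' z) (\<lambda>z. w z * p' z + p z * w' z) (\<lambda>z. w z * q' z + q z * w' z)"
  using assms unfolding C1_def
  by (auto intro!: continuous_intros has_vector_derivative_mult)

lemma integral_partial_eq_0:
  assumes g: "C1 g p q" and b: "bounded S" and S: "\<And>z. z \<notin> S \<Longrightarrow> g z = 0 \<and> p z = 0 \<and> q z = 0"
  shows "(LINT z|lborel. p z) = 0" "(LINT z|lborel. q z) = 0"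
proof -
  obtain r where r: "\<And>z. z \<in> S \<Longrightarrow> norm z \<le> r" using b bounded_iff by blast
  define R where "R = max r 0 + 1"
  have out: "g (x, y) = 0 \<and> p (x, y) = 0 \<and> q (x, y) = 0" if "R \<le> \<bar>x\<bar> \<or> R \<le> \<bar>y\<bar>" for x y
  proof -
    have "max \<bar>x\<bar> \<bar>y\<bar> \<le> norm (x, y)" using norm_fst_le[of x y] norm_snd_le[of y x] by simp
    then have "(x, y) \<notin> S" using r[of "(x, y)"] that by (auto simp: R_def)
    then show ?thesis by (rule S)
  qed
  have R: "-R \<le> R" by (simp add: R_def)
  let ?I = "{-R..R}"
  have c: "continuous_on UNIV g" "continuous_on UNIV p" "continuous_on UNIV q" using g by (auto simp: C1_def)
  have cc: "continuous_on UNIV (\<lambda>x. f (x, y))" "continuous_on UNIV (\<lambda>y. f (x, y))"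
    if "continuous_on UNIV f" for f :: "real \<times> real \<Rightarrow> complex" and x y
    by (auto intro!: continuous_on_compose2[OF that] continuous_intros)
  have red: "(LINT z|lborel. f z) = (LINT z:?I\<times>?I|lborel. f z)" if "f = p \<or> f = q" for f
    unfolding set_lebesgue_integral_def
  proof (rule Bochner_Integration.integral_cong[OF refl])
    fix z :: "real \<times> real"
    have "f z = 0" if "z \<notin> ?I \<times> ?I"
    proof -
      have "R \<le> \<bar>fst z\<bar> \<or> R \<le> \<bar>snd z\<bar>" using that by (cases z) (auto simp: abs_if)
      then show ?thesis using out[of "fst z" "snd z"] \<open>f = p \<or> f = q\<close> by auto
    qed
    then show "f z = indicator (?I \<times> ?I) z *\<^sub>R f z" by (cases "z \<in> ?I \<times> ?I") auto
  qed
  have "(LINT x:?I|lborel. p (x, y)) = 0" for y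
  proof -
    have "(LINT x:?I|lborel. p (x, y)) = g (R, y) - g (-R, y)"
      unfolding set_lebesgue_integral_def using g
      by (intro integral_FTC_Icc[OF R]) (auto simp: C1_def intro: has_vector_derivative_at_within continuous_on_subset[OF cc(1)[OF c(2)]])
    then show ?thesis using out[of R y] out[of "-R" y] by (simp add: R_def)
  qed
  then show "(LINT z|lborel. p z) = 0"
    unfolding red[of p, simplified] using c by (subst iter_integral(2)[symmetric]) auto
  have "(LINT y:?I|lborel. q (x, y)) = 0" for x
  proof -
    have "(LINT y:?I|lborel. q (x, y)) = g (x, R) - g (x, -R)"
      unfolding set_lebesgue_integral_def using g
      by (intro integral_FTC_Icc[OF R]) (auto simp: C1_def intro: has_vector_derivative_at_within continuous_on_subset[OF cc(2)[OF c(3)]])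
    then show ?thesis using out[of x R] out[of x "-R"] by (simp add: R_def)
  qed
  then show "(LINT z|lborel. q z) = 0"
    unfolding red[of q, simplified] using c by (subst iter_integral(1)[symmetric]) auto
qed

lemma strip_borel [measurable]: "strip d \<in> sets borel"
  unfolding strip_def by (auto intro: borel_Times)

lemma strip_lebesgue [simp]: "strip d \<in> sets lebesgue"
  using strip_borel by (rule sets_completionI_sets[of _ lborel, simplified])

lemma lint_strip:
  fixes f :: "real \<times> real \<Rightarrow> 'b::{banach, second_countable_topology}"
  assumes "continuous_on UNIV f"
  shows "(LINT z|lebesgue_on (strip d). f z) = (LINT z:strip d|lborel. f z)"
proof -
  have "(LINT z|lebesgue_on (strip d). f z) = (LINT z|lebesgue. indicator (strip d) z *\<^sub>R f z)"
    by (simp add: integral_restrict_space)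
  also have "... = (LINT z|lborel. indicator (strip d) z *\<^sub>R f z)"
    using borel_measurable_continuous_onI[OF assms] by (intro integral_completion) auto
  finally show ?thesis by (simp add: set_lebesgue_integral_def)
qed

lemma continuous_bounded_support_integrable:
  fixes f :: "real \<times> real \<Rightarrow> 'b::{banach, second_countable_topology}"
  assumes f: "continuous_on UNIV f" and b: "bounded S" and S: "\<And>z. z \<notin> S \<Longrightarrow> f z = 0"
  shows "integrable lborel f"
proof -
  have "set_integrable lborel (closure S) f" using b by (intro set_integrable_continuous f) auto
  then show ?thesis unfolding set_integrable_def
    by (rule Bochner_Integration.integrable_cong[THEN iffD1, rotated -1])
       (use S closure_subset[of S] in \<open>auto simp: indicator_def\<close>)
qed

text \<open>Integration by parts along lines.\<close>
lemma weak_deriv_test: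
  assumes w: "w \<in> test_functions UNIV" and C: "C1 w p q"
  shows "is_weak_deriv (strip d) (1, 0) w p" "is_weak_deriv (strip d) (0, 1) w q"
proof -
  have "(LINT z|lebesgue_on (strip d). w z * frechet_derivative \<phi> (at z) (1, 0)) = - (LINT z|lebesgue_on (strip d). p z * \<phi> z) \<and>
     (LINT z|lebesgue_on (strip d). w z * frechet_derivative \<phi> (at z) (0, 1)) = - (LINT z|lebesgue_on (strip d). q z * \<phi> z)"
    if phi: "\<phi> \<in> test_functions (strip d)" for \<phi>
  proof -
    obtain p' q' S where C': "C1 \<phi> p' q'" and fd: "\<And>z. frechet_derivative \<phi> (at z) = (\<lambda>(h, k). h *\<^sub>R p' z + k *\<^sub>R q' z)"
      and b: "bounded S" and sub: "S \<subseteq> strip d"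
      and out: "\<And>z. z \<notin> S \<Longrightarrow> \<phi> z = 0 \<and> p' z = 0 \<and> q' z = 0"
      using test_C1[OF phi] by metis
    have c: "continuous_on UNIV w" "continuous_on UNIV p" "continuous_on UNIV q"
      "continuous_on UNIV \<phi>" "continuous_on UNIV p'" "continuous_on UNIV q'" using C C' by (auto simp: C1_def)
    have red: "(LINT z:strip d|lborel. f z) = (LINT z|lborel. f z)" if "\<And>z. z \<notin> S \<Longrightarrow> f z = 0" for f :: "real \<times> real \<Rightarrow> complex"
      unfolding set_lebesgue_integral_def using that sub
      by (intro Bochner_Integration.integral_cong) (auto simp: indicator_def)
    have zero: "(LINT z|lborel. w z * p' z + p z * \<phi> z) = 0" "(LINT z|lborel. w z * q' z + q z * \<phi> z) = 0"
      using integral_partial_eq_0[OF C1_mult[OF C C'] b] out by simp_all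
    have i: "integrable lborel (\<lambda>z. w z * p' z)" "integrable lborel (\<lambda>z. p z * \<phi> z)" "integrable lborel (\<lambda>z. w z * q' z)" "integrable lborel (\<lambda>z. q z * \<phi> z)"
      by (rule continuous_bounded_support_integrable[OF continuous_on_mult[OF c(1) c(5)] b], simp add: out)
        (rule continuous_bounded_support_integrable[OF continuous_on_mult[OF c(2) c(4)] b], simp add: out,
         rule continuous_bounded_support_integrable[OF continuous_on_mult[OF c(1) c(6)] b], simp add: out,
         rule continuous_bounded_support_integrable[OF continuous_on_mult[OF c(3) c(4)] b], simp add: out)
    show ?thesis
      using zero i out unfolding fd
      by (simp add: lint_strip continuous_on_mult c red eq_neg_iff_add_eq_0)
  qed
  then show "is_weak_deriv (strip d) (1, 0) w p" "is_weak_deriv (strip d) (0, 1) w q"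
    unfolding is_weak_deriv_def by auto
qed

section \<open>The space of square integrable functions\<close>

lemma L2_lint_mult:
  fixes f g :: "'a::euclidean_space \<Rightarrow> complex"
  assumes "f \<in> L2 S" "g \<in> L2 S"
  shows "integrable (lebesgue_on S) (\<lambda>z. f z * g z)"
proof (rule Bochner_Integration.integrable_bound)
  show "integrable (lebesgue_on S) (\<lambda>z. (cmod (f z))\<^sup>2 + (cmod (g z))\<^sup>2)" using assms by (simp add: L2_def)
  show "(\<lambda>z. f z * g z) \<in> borel_measurable (lebesgue_on S)" using assms by (auto simp: L2_def)
  have "x * y \<le> x\<^sup>2 + y\<^sup>2" if "0 \<le> x" "0 \<le> y" for x y :: real
    using sum_squares_bound[of x y] mult_nonneg_nonneg[OF that] by linarith
  then show "AE z in lebesgue_on S. norm (f z * g z) \<le> norm ((cmod (f z))\<^sup>2 + (cmod (g z))\<^sup>2)"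
    by (intro AE_I2) (simp add: norm_mult)
qed

lemma L2_add:
  assumes "f \<in> L2 S" "g \<in> L2 S" shows "(\<lambda>z. f z + g z) \<in> L2 S"
proof -
  have "integrable (lebesgue_on S) (\<lambda>z. (cmod (f z + g z))\<^sup>2)"
  proof (rule Bochner_Integration.integrable_bound)
    show "integrable (lebesgue_on S) (\<lambda>z. 2 * (cmod (f z))\<^sup>2 + 2 * (cmod (g z))\<^sup>2)" using assms by (simp add: L2_def)
    show "(\<lambda>z. (cmod (f z + g z))\<^sup>2) \<in> borel_measurable (lebesgue_on S)" using assms by (auto simp: L2_def)
    have "(cmod (x + y))\<^sup>2 \<le> 2 * (cmod x)\<^sup>2 + 2 * (cmod y)\<^sup>2" for x y
    proof -
      have "(cmod (x + y))\<^sup>2 \<le> (cmod x + cmod y)\<^sup>2" by (intro power_mono norm_triangle_ineq) auto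
      also have "... \<le> 2 * (cmod x)\<^sup>2 + 2 * (cmod y)\<^sup>2"
        using sum_squares_bound[of "cmod x" "cmod y"] by (simp add: power2_sum)
      finally show ?thesis .
    qed
    then show "AE z in lebesgue_on S. norm ((cmod (f z + g z))\<^sup>2) \<le> norm (2 * (cmod (f z))\<^sup>2 + 2 * (cmod (g z))\<^sup>2)"
      by (intro AE_I2) simp
  qed
  then show ?thesis using assms by (auto simp: L2_def)
qed

lemma L2_scale: "f \<in> L2 S \<Longrightarrow> (\<lambda>z. c * f z) \<in> L2 S"
  by (auto simp: L2_def norm_mult power_mult_distrib)

lemma L2_diff: "f \<in> L2 S \<Longrightarrow> g \<in> L2 S \<Longrightarrow> (\<lambda>z. f z - g z) \<in> L2 S"
  using L2_add[of f S "\<lambda>z. (-1) * g z"] L2_scale[of g S "-1"] by simp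

lemma L2_continuous:
  assumes f: "continuous_on UNIV f" and b: "bounded T" and S: "\<And>z. z \<notin> T \<Longrightarrow> f z = 0"
  shows "f \<in> L2 (strip d)"
proof -
  have "integrable lborel (\<lambda>z. (cmod (f z))\<^sup>2)"
    using S by (intro continuous_bounded_support_integrable[OF _ b] continuous_intros f) auto
  then have "integrable lebesgue (\<lambda>z. (cmod (f z))\<^sup>2)" by (simp add: integrable_completion)
  then have "integrable (lebesgue_on (strip d)) (\<lambda>z. (cmod (f z))\<^sup>2)"
    using integrable_mult_indicator[of "strip d" lebesgue "\<lambda>z. (cmod (f z))\<^sup>2"] by (simp add: integrable_restrict_space)
  then show ?thesis using borel_measurable_continuous_onI[OF f]
    by (auto simp: L2_def intro!: measurable_restrict_space1 measurable_completion)
qed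

lemma test_L2:
  assumes "w \<in> test_functions \<Omega>" "C1 w p q"
  shows "w \<in> L2 (strip d)" "p \<in> L2 (strip d)" "q \<in> L2 (strip d)"
proof -
  obtain p' q' S where C': "C1 w p' q'" and b: "bounded S"
      and out: "\<And>z. z \<notin> S \<Longrightarrow> w z = 0 \<and> p' z = 0 \<and> q' z = 0"
    using test_C1[OF assms(1)] by metis
  have "p' = p" "q' = q"
    using assms(2) C' unfolding C1_def fun_eq_iff by (metis vector_derivative_unique_at surj_pair)+
  note out' = out[unfolded this]
  have c: "continuous_on UNIV w" "continuous_on UNIV p" "continuous_on UNIV q" using assms(2) by (auto simp: C1_def)
  show "w \<in> L2 (strip d)" by (rule L2_continuous[OF c(1) b], simp add: out')
  show "p \<in> L2 (strip d)" by (rule L2_continuous[OF c(2) b], simp add: out')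
  show "q \<in> L2 (strip d)" by (rule L2_continuous[OF c(3) b], simp add: out')
qed

lemma is_weak_deriv_diff:
  assumes u: "u \<in> L2 (strip d)" "v \<in> L2 (strip d)" "is_weak_deriv (strip d) e u v"
    and u': "u' \<in> L2 (strip d)" "v' \<in> L2 (strip d)" "is_weak_deriv (strip d) e u' v'"
    and e: "e = (1, 0) \<or> e = (0, 1)"
  shows "is_weak_deriv (strip d) e (\<lambda>z. u z - u' z) (\<lambda>z. v z - v' z)"
  unfolding is_weak_deriv_def
proof
  fix \<phi> assume phi: "\<phi> \<in> test_functions (strip d)"
  obtain p q where C: "C1 \<phi> p q" and fd: "\<And>z. frechet_derivative \<phi> (at z) = (\<lambda>(h, k). h *\<^sub>R p z + k *\<^sub>R q z)"
    using test_C1[OF phi] by metis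
  note L = test_L2[OF phi C]
  have dL: "(\<lambda>z. frechet_derivative \<phi> (at z) e) \<in> L2 (strip d)" using e L unfolding fd by auto
  show "(LINT z|lebesgue_on (strip d). (u z - u' z) * frechet_derivative \<phi> (at z) e) =
     - (LINT z|lebesgue_on (strip d). (v z - v' z) * \<phi> z)"
    using u u' phi L2_lint_mult[OF _ dL] L2_lint_mult[OF _ L(1)]
    by (simp add: left_diff_distrib is_weak_deriv_def)
qed

lemma weak_deriv_unique:
  assumes "v \<in> L2 (strip d)" "is_weak_deriv (strip d) e u v" "v' \<in> L2 (strip d)" "is_weak_deriv (strip d) e u v'"
  shows "AE z in lebesgue_on (strip d). v z = v' z"
proof -
  have "AE z in lebesgue. z \<in> strip d \<longrightarrow> v z - v' z = 0"
  proof (rule L2_eq_zero[OF L2_diff[OF assms(1,3)]])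
    fix \<phi> assume phi: "\<phi> \<in> test_functions (strip d)"
    obtain p q where C: "C1 \<phi> p q" using test_C1[OF phi] by metis
    note L = test_L2(1)[OF phi C]
    show "(LINT z|lebesgue_on (strip d). (v z - v' z) * \<phi> z) = 0"
      using assms phi L2_lint_mult[OF _ L] by (simp add: left_diff_distrib is_weak_deriv_def)
  qed
  then show ?thesis by (simp add: AE_restrict_space_iff)
qed

lemma Basis_plane: "(Basis :: (real \<times> real) set) = {(1, 0), (0, 1)}"
  by (auto simp: Basis_prod_def)

lemma weak_deriv_props:
  assumes "u \<in> W12 \<Omega>" "e \<in> Basis"
  shows "weak_deriv \<Omega> e u \<in> L2 \<Omega>" "is_weak_deriv \<Omega> e u (weak_deriv \<Omega> e u)"
proof -
  have "\<exists>v. v \<in> L2 \<Omega> \<and> is_weak_deriv \<Omega> e u v" using assms unfolding W12_def by blast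
  from someI_ex[OF this] show "weak_deriv \<Omega> e u \<in> L2 \<Omega>" "is_weak_deriv \<Omega> e u (weak_deriv \<Omega> e u)"
    unfolding weak_deriv_def by auto
qed

text \<open>The weak derivatives are unique, so whichever were chosen for \<open>w - u\<close> agree with the differences.\<close>
lemma W12_norm_diff:
  assumes u: "u \<in> W12 (strip d)" and w: "w \<in> test_functions UNIV" and C: "C1 w p q"
  defines "U1 \<equiv> weak_deriv (strip d) (1, 0) u" and "U2 \<equiv> weak_deriv (strip d) (0, 1) u"
  shows "(W12_norm (strip d) (w - u))\<^sup>2 = (LINT z|lebesgue_on (strip d). (cmod (p z - U1 z))\<^sup>2)
     + (LINT z|lebesgue_on (strip d). (cmod (q z - U2 z))\<^sup>2) + (LINT z|lebesgue_on (strip d). (cmod (w z - u z))\<^sup>2)"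
proof -
  let ?M = "lebesgue_on (strip d)"
  have uL: "u \<in> L2 (strip d)" using u by (simp add: W12_def)
  have U: "U1 \<in> L2 (strip d)" "U2 \<in> L2 (strip d)" "is_weak_deriv (strip d) (1, 0) u U1" "is_weak_deriv (strip d) (0, 1) u U2"
    unfolding U1_def U2_def using weak_deriv_props[OF u] by (auto simp: Basis_plane)
  note wL = test_L2[OF w C]
  have wu: "w - u = (\<lambda>z. w z - u z)" by (simp add: fun_eq_iff)
  have d1: "is_weak_deriv (strip d) (1, 0) (w - u) (\<lambda>z. p z - U1 z)"
    unfolding wu by (rule is_weak_deriv_diff[OF wL(1,2) weak_deriv_test(1)[OF w C] uL U(1,3)]) simp
  have d2: "is_weak_deriv (strip d) (0, 1) (w - u) (\<lambda>z. q z - U2 z)"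
    unfolding wu by (rule is_weak_deriv_diff[OF wL(1,3) weak_deriv_test(2)[OF w C] uL U(2,4)]) simp
  have L: "(\<lambda>z. p z - U1 z) \<in> L2 (strip d)" "(\<lambda>z. q z - U2 z) \<in> L2 (strip d)" "(\<lambda>z. w z - u z) \<in> L2 (strip d)"
    using L2_diff wL U uL by blast+
  have W: "w - u \<in> W12 (strip d)"
    unfolding W12_def Basis_plane using d1 d2 L by (auto simp: wu)
  have a1: "AE z in ?M. weak_deriv (strip d) (1, 0) (w - u) z = p z - U1 z"
    using weak_deriv_unique[OF weak_deriv_props[OF W] L(1) d1] by (simp add: Basis_plane)
  have a2: "AE z in ?M. weak_deriv (strip d) (0, 1) (w - u) z = q z - U2 z"
    using weak_deriv_unique[OF weak_deriv_props[OF W] L(2) d2] by (simp add: Basis_plane)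
  have i: "integrable ?M (\<lambda>z. (cmod (p z - U1 z))\<^sup>2)" "integrable ?M (\<lambda>z. (cmod (q z - U2 z))\<^sup>2)" "integrable ?M (\<lambda>z. (cmod (w z - u z))\<^sup>2)"
    using L by (auto simp: L2_def)
  have m: "weak_deriv (strip d) (1, 0) (w - u) \<in> borel_measurable ?M" "weak_deriv (strip d) (0, 1) (w - u) \<in> borel_measurable ?M"
    using weak_deriv_props(1)[OF W] by (auto simp: Basis_plane L2_def)
  have "(LINT z|?M. grad_sq (strip d) (w - u) z + (cmod ((w - u) z))\<^sup>2)
     = (LINT z|?M. ((cmod (p z - U1 z))\<^sup>2 + (cmod (q z - U2 z))\<^sup>2) + (cmod (w z - u z))\<^sup>2)"
  proof (rule integral_cong_AE)
    show "(\<lambda>z. grad_sq (strip d) (w - u) z + (cmod ((w - u) z))\<^sup>2) \<in> borel_measurable ?M"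
      unfolding grad_sq_def Basis_plane using m borel_measurable_integrable[OF i(3)]
      by (simp add: borel_measurable_add borel_measurable_power measurable_compose[OF _ borel_measurable_norm])
    show "(\<lambda>z. ((cmod (p z - U1 z))\<^sup>2 + (cmod (q z - U2 z))\<^sup>2) + (cmod (w z - u z))\<^sup>2) \<in> borel_measurable ?M"
      using i by auto
    show "AE z in ?M. grad_sq (strip d) (w - u) z + (cmod ((w - u) z))\<^sup>2 = ((cmod (p z - U1 z))\<^sup>2 + (cmod (q z - U2 z))\<^sup>2) + (cmod (w z - u z))\<^sup>2"
      using a1 a2 by eventually_elim (simp add: grad_sq_def Basis_plane)
  qed
  also have "... = (LINT z|?M. (cmod (p z - U1 z))\<^sup>2) + (LINT z|?M. (cmod (q z - U2 z))\<^sup>2) + (LINT z|?M. (cmod (w z - u z))\<^sup>2)"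
    using i by simp
  finally have eq: "(LINT z|?M. grad_sq (strip d) (w - u) z + (cmod ((w - u) z))\<^sup>2) = ..." .
  have "0 \<le> (LINT z|?M. grad_sq (strip d) (w - u) z + (cmod ((w - u) z))\<^sup>2)"
    by (auto intro!: integral_nonneg_AE AE_I2 add_nonneg_nonneg sum_nonneg simp: grad_sq_def)
  then show ?thesis unfolding W12_norm_def eq by simp
qed

section \<open>Limits in square mean\<close>

text \<open>From \<open>\<bar>\<bar>a\<bar>\<^sup>2 - \<bar>b\<bar>\<^sup>2\<bar> \<le> (1 + 1/e) \<bar>a - b\<bar>\<^sup>2 + e \<bar>b\<bar>\<^sup>2\<close> with small \<open>e\<close>.\<close>
lemma L2_limit_norm:
  fixes f :: "nat \<Rightarrow> 'a \<Rightarrow> complex"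
  assumes i: "\<And>n. integrable M (\<lambda>z. (cmod (f n z))\<^sup>2)" "integrable M (\<lambda>z. (cmod (u z))\<^sup>2)" "\<And>n. integrable M (\<lambda>z. (cmod (f n z - u z))\<^sup>2)"
    and lim: "(\<lambda>n. LINT z|M. (cmod (f n z - u z))\<^sup>2) \<longlonglongrightarrow> 0"
  shows "(\<lambda>n. LINT z|M. (cmod (f n z))\<^sup>2) \<longlonglongrightarrow> (LINT z|M. (cmod (u z))\<^sup>2)"
proof (rule LIMSEQ_I)
  fix r :: real assume r: "r > 0"
  define N where "N = (LINT z|M. (cmod (u z))\<^sup>2)"
  have N: "N \<ge> 0" unfolding N_def by (auto intro!: integral_nonneg_AE)
  define e where "e = r / (2 * (N + 1))"
  have e: "e > 0" "e * N < r / 2" using r N by (auto simp: e_def field_simps)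
  have lim0: "(\<lambda>n. (1 + 1 / e) * (LINT z|M. (cmod (f n z - u z))\<^sup>2)) \<longlonglongrightarrow> 0" using tendsto_mult_left[OF lim, of "1 + 1 / e"] by simp
  then obtain n0 where n0: "\<And>n. n \<ge> n0 \<Longrightarrow> norm ((1 + 1 / e) * (LINT z|M. (cmod (f n z - u z))\<^sup>2) - 0) < r / 2"
    using LIMSEQ_D[OF lim0 half_gt_zero[OF r]] by blast
  have pt: "\<bar>(cmod x)\<^sup>2 - (cmod y)\<^sup>2\<bar> \<le> (1 + 1 / e) * (cmod (x - y))\<^sup>2 + e * (cmod y)\<^sup>2" for x y
  proof -
    define a where "a = cmod (x - y)"
    define b where "b = cmod y"
    have ab: "a \<ge> 0" "b \<ge> 0" by (auto simp: a_def b_def)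
    have "\<bar>cmod x - b\<bar> \<le> a" unfolding a_def b_def by (rule norm_triangle_ineq3)
    have "\<bar>(cmod x)\<^sup>2 - b\<^sup>2\<bar> = \<bar>cmod x - b\<bar> * (cmod x + b)"
      using ab by (simp add: power2_eq_square square_diff_square_factored abs_mult mult.commute)
    also have "... \<le> a * (a + 2 * b)"
      using \<open>\<bar>cmod x - b\<bar> \<le> a\<close> ab by (intro mult_mono) auto
    also have "... = a\<^sup>2 + 2 * (a / sqrt e) * (sqrt e * b)" using e by (simp add: power2_eq_square distrib_left)
    also have "... \<le> a\<^sup>2 + ((a / sqrt e)\<^sup>2 + (sqrt e * b)\<^sup>2)" using sum_squares_bound by (intro add_left_mono) blast
    also have "... = (1 + 1 / e) * a\<^sup>2 + e * b\<^sup>2" using e by (simp add: power_divide power_mult_distrib distrib_right)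
    finally show ?thesis by (simp add: a_def b_def)
  qed
  show "\<exists>no. \<forall>n\<ge>no. norm ((LINT z|M. (cmod (f n z))\<^sup>2) - (LINT z|M. (cmod (u z))\<^sup>2)) < r"
  proof (intro exI allI impI)
    fix n assume n: "n \<ge> n0"
    have "norm ((LINT z|M. (cmod (f n z))\<^sup>2) - (LINT z|M. (cmod (u z))\<^sup>2)) = \<bar>LINT z|M. (cmod (f n z))\<^sup>2 - (cmod (u z))\<^sup>2\<bar>"
      using i by simp
    also have "... \<le> (LINT z|M. \<bar>(cmod (f n z))\<^sup>2 - (cmod (u z))\<^sup>2\<bar>)" by (rule integral_abs_bound)
    also have "... \<le> (LINT z|M. (1 + 1 / e) * (cmod (f n z - u z))\<^sup>2 + e * (cmod (u z))\<^sup>2)"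
      using i pt by (intro integral_mono) auto
    also have "... = (1 + 1 / e) * (LINT z|M. (cmod (f n z - u z))\<^sup>2) + e * N" using i by (simp add: N_def)
    also have "... < r" using n0[OF n] e unfolding diff_zero real_norm_def by linarith
    finally show "norm ((LINT z|M. (cmod (f n z))\<^sup>2) - (LINT z|M. (cmod (u z))\<^sup>2)) < r" .
  qed
qed

lemma L2_limit_pairing:
  fixes f :: "nat \<Rightarrow> 'a \<Rightarrow> complex"
  assumes i: "integrable M (\<lambda>z. (cmod (h z))\<^sup>2)" "\<And>n. integrable M (\<lambda>z. (cmod (f n z - u z))\<^sup>2)"
    and fh: "\<And>n. integrable M (\<lambda>z. f n z * h z)" "integrable M (\<lambda>z. u z * h z)"
    and lim: "(\<lambda>n. LINT z|M. (cmod (f n z - u z))\<^sup>2) \<longlonglongrightarrow> 0"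
  shows "(\<lambda>n. LINT z|M. f n z * h z) \<longlonglongrightarrow> (LINT z|M. u z * h z)"
proof (rule LIMSEQ_I)
  fix r :: real assume r: "r > 0"
  define N where "N = (LINT z|M. (cmod (h z))\<^sup>2)"
  have N: "N \<ge> 0" unfolding N_def by (auto intro!: integral_nonneg_AE)
  define e where "e = r / (2 * (N + 1))"
  have e: "e > 0" "e * N < r / 2" using r N by (auto simp: e_def field_simps)
  have lim0: "(\<lambda>n. (1 / e) * (LINT z|M. (cmod (f n z - u z))\<^sup>2)) \<longlonglongrightarrow> 0" using tendsto_mult_left[OF lim, of "1 / e"] by simp
  then obtain n0 where n0: "\<And>n. n \<ge> n0 \<Longrightarrow> norm ((1 / e) * (LINT z|M. (cmod (f n z - u z))\<^sup>2) - 0) < r / 2"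
    using LIMSEQ_D[OF lim0 half_gt_zero[OF r]] by blast
  have pt: "a * b \<le> (1 / e) * a\<^sup>2 + e * b\<^sup>2" if "a \<ge> 0" "b \<ge> 0" for a b :: real
  proof -
    have "2 * (a / sqrt e) * (sqrt e * b) \<le> (a / sqrt e)\<^sup>2 + (sqrt e * b)\<^sup>2" by (rule sum_squares_bound)
    then have "2 * (a * b) \<le> (1 / e) * a\<^sup>2 + e * b\<^sup>2" using e by (simp add: power_divide power_mult_distrib)
    then show ?thesis using mult_nonneg_nonneg[OF that] by linarith
  qed
  show "\<exists>no. \<forall>n\<ge>no. norm ((LINT z|M. f n z * h z) - (LINT z|M. u z * h z)) < r"
  proof (intro exI allI impI)
    fix n assume n: "n \<ge> n0"
    have "norm ((LINT z|M. f n z * h z) - (LINT z|M. u z * h z)) = cmod (LINT z|M. f n z * h z - u z * h z)"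
      using fh by simp
    also have "... \<le> (LINT z|M. cmod (f n z * h z - u z * h z))" by (rule integral_norm_bound)
    also have "... \<le> (LINT z|M. (1 / e) * (cmod (f n z - u z))\<^sup>2 + e * (cmod (h z))\<^sup>2)"
    proof (rule integral_mono)
      show "integrable M (\<lambda>z. cmod (f n z * h z - u z * h z))"
        by (intro integrable_norm Bochner_Integration.integrable_diff fh)
      show "cmod (f n z * h z - u z * h z) \<le> (1 / e) * (cmod (f n z - u z))\<^sup>2 + e * (cmod (h z))\<^sup>2" for z
        using pt[of "cmod (f n z - u z)" "cmod (h z)"] by (simp add: norm_mult flip: left_diff_distrib)
    qed (use i in simp)
    also have "... = (1 / e) * (LINT z|M. (cmod (f n z - u z))\<^sup>2) + e * N" using i by (simp add: N_def)
    also have "... < r" using n0[OF n] e unfolding diff_zero real_norm_def by linarith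
    finally show "norm ((LINT z|M. f n z * h z) - (LINT z|M. u z * h z)) < r" .
  qed
qed

lemma L2_limit_subseq:
  fixes f :: "nat \<Rightarrow> 'a \<Rightarrow> complex"
  assumes i: "\<And>n. integrable M (\<lambda>z. (cmod (f n z - u z))\<^sup>2)"
    and lim: "(\<lambda>n. LINT z|M. (cmod (f n z - u z))\<^sup>2) \<longlonglongrightarrow> 0"
  shows "\<exists>r :: nat \<Rightarrow> nat. strict_mono r \<and> (AE z in M. (\<lambda>n. f (r n) z) \<longlonglongrightarrow> u z)"
proof -
  have "\<exists>r :: nat \<Rightarrow> nat. strict_mono r \<and> (AE z in M. (\<lambda>n. (cmod (f (r n) z - u z))\<^sup>2) \<longlonglongrightarrow> 0)"
    using tendsto_L1_AE_subseq[of M "\<lambda>n z. (cmod (f n z - u z))\<^sup>2"] i lim by auto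
  then obtain r :: "nat \<Rightarrow> nat" where r: "strict_mono r" "AE z in M. (\<lambda>n. (cmod (f (r n) z - u z))\<^sup>2) \<longlonglongrightarrow> 0" by blast
  have "AE z in M. (\<lambda>n. f (r n) z) \<longlonglongrightarrow> u z"
    using r(2)
  proof eventually_elim
    fix z assume "(\<lambda>n. (cmod (f (r n) z - u z))\<^sup>2) \<longlonglongrightarrow> 0"
    from tendsto_real_sqrt[OF this] have "(\<lambda>n. cmod (f (r n) z - u z)) \<longlonglongrightarrow> 0" by simp
    then show "(\<lambda>n. f (r n) z) \<longlonglongrightarrow> u z" by (simp add: tendsto_norm_zero_iff LIM_zero_cancel)
  qed
  with r(1) show ?thesis by blast
qed

section \<open>The spectral gap of the transversal operator\<close>

lemma integral_le_sqrt_length: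
  fixes f :: "real \<Rightarrow> real"
  assumes f: "continuous_on {a..b} f" and ab: "a < b"
  shows "(integral {a..b} f)\<^sup>2 \<le> (b - a) * integral {a..b} (\<lambda>y. (f y)\<^sup>2)"
proof -
  define m where "m = integral {a..b} f / (b - a)"
  have m: "integral {a..b} f = m * (b - a)" using ab by (simp add: m_def)
  have "((\<lambda>y. (f y)\<^sup>2 - 2 * m * f y + m\<^sup>2) has_integral (integral {a..b} (\<lambda>y. (f y)\<^sup>2) - 2 * m * integral {a..b} f + m\<^sup>2 * (b - a))) {a..b}"
    using ab has_integral_const_real[of "m\<^sup>2" a b]
    by (intro has_integral_add has_integral_diff has_integral_mult_right integrable_integral integrable_continuous_real continuous_intros f) (simp add: mult.commute)
  moreover have "(f y)\<^sup>2 - 2 * m * f y + m\<^sup>2 = (f y - m)\<^sup>2" for y by (simp add: power2_diff)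
  ultimately have "0 \<le> integral {a..b} (\<lambda>y. (f y)\<^sup>2) - 2 * m * integral {a..b} f + m\<^sup>2 * (b - a)"
    by (metis (no_types, lifting) has_integral_nonneg zero_le_power2)
  then have "m\<^sup>2 * (b - a) \<le> integral {a..b} (\<lambda>y. (f y)\<^sup>2)" unfolding m by (simp add: power2_eq_square algebra_simps)
  then have "(b - a) * (m\<^sup>2 * (b - a)) \<le> (b - a) * integral {a..b} (\<lambda>y. (f y)\<^sup>2)" using ab by (intro mult_left_mono) auto
  then show ?thesis unfolding m by (simp add: power2_eq_square mult_ac)
qed

locale width =
  fixes d :: real
  assumes d: "d > 0"
begin

definition \<omega> where "\<omega> = pi / (2 * d)"

lemma omega_pos: "\<omega> > 0" using d by (simp add: \<omega>_def)
lemma omega_d: "\<omega> * d = pi / 2" using d by (simp add: \<omega>_def)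

lemma sin_pos: "0 < y \<Longrightarrow> y \<le> d \<Longrightarrow> sin (\<omega> * y) > 0"
  using omega_pos omega_d mult_left_mono[of y d \<omega>] pi_gt_zero by (intro sin_gt_zero) (simp, linarith)

lemma sin_mono: "0 \<le> x \<Longrightarrow> x \<le> y \<Longrightarrow> y \<le> d \<Longrightarrow> sin (\<omega> * x) \<le> sin (\<omega> * y)"
proof -
  assume a: "0 \<le> x" "x \<le> y" "y \<le> d"
  have "\<omega> * y \<le> pi / 2" using mult_left_mono[of y d \<omega>] omega_pos omega_d a by simp
  moreover have "0 \<le> \<omega> * x" "\<omega> * x \<le> \<omega> * y" using a omega_pos by auto
  ultimately show ?thesis by (intro sin_monotone_2pi_le) auto
qed

text \<open>A perturbed Jacobi completion of the square. With \<open>G y = integral {0..y} (z sin)\<close> and \<open>k = G / sin\<close> one has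
  \<open>k' = z - \<omega> cot k\<close>, and the square of \<open>z' - \<omega> cot z + \<gamma> k\<close> equals \<open>z'\<^sup>2 - \<omega>\<^sup>2 z\<^sup>2 - 2 \<gamma> z\<^sup>2 + \<gamma>\<^sup>2 k\<^sup>2\<close> plus a derivative. The
  orthogonality of \<open>z\<close> and \<open>sin\<close> makes the boundary term at \<open>d\<close> vanish, and Cauchy-Schwarz gives \<open>k\<^sup>2 \<le> y \<integral>z\<^sup>2\<close>. The interval
  starts at \<open>\<epsilon>\<close> because the cotangent is singular at \<open>0\<close>.\<close>
lemma gap_truncated:
  fixes z z' :: "real \<Rightarrow> real"
  assumes D: "\<And>y. (z has_real_derivative z' y) (at y)" and c: "continuous_on UNIV z'"
    and z0: "z 0 = 0" and orth: "integral {0..d} (\<lambda>y. z y * sin (\<omega> * y)) = 0"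
    and L: "\<And>y. y \<in> {0..d} \<Longrightarrow> \<bar>z' y\<bar> \<le> L" and \<epsilon>: "0 < \<epsilon>" "\<epsilon> < d"
  shows "0 \<le> integral {\<epsilon>..d} (\<lambda>y. (z' y)\<^sup>2 - \<omega>\<^sup>2 * (z y)\<^sup>2 - 4 / d\<^sup>2 * (z y)\<^sup>2)
     + 2 / d\<^sup>2 * integral {0..d} (\<lambda>y. (z y)\<^sup>2) + L\<^sup>2 * \<epsilon> + 4 / d\<^sup>2 * L\<^sup>2 * \<epsilon> ^ 3"
proof -
  define \<gamma> where "\<gamma> = 2 / d\<^sup>2"
  define Z where "Z = integral {0..d} (\<lambda>y. (z y)\<^sup>2)"
  define G where "G y = integral {0..y} (\<lambda>t. z t * sin (\<omega> * t))" for y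
  define k where "k y = G y / sin (\<omega> * y)" for y
  \<comment> \<open>The boundary term: its derivative is the difference between the completed square and the integrand.\<close>
  define B where "B y = - \<omega> * (cos (\<omega> * y) / sin (\<omega> * y)) * (z y)\<^sup>2 + 2 * \<gamma> * (z y * k y)" for y
  have cz: "continuous_on A z" for A
    using D by (meson DERIV_isCont continuous_at_imp_continuous_on)
  have cz': "continuous_on A z'" for A using c continuous_on_subset by blast
  have czs: "continuous_on A (\<lambda>t. z t * sin (\<omega> * t))" for A by (intro continuous_intros cz)
  have zL: "\<bar>z y\<bar> \<le> L * y" if y: "y \<in> {0..d}" for y
  proof (cases "y = 0")
    case False
    then have "0 < y" using y by auto
    then obtain t where t: "0 < t" "t < y" "z y - z 0 = (y - 0) * z' t"
      using MVT2[of 0 y z z'] D by blast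
    then have "\<bar>z y\<bar> = y * \<bar>z' t\<bar>" using z0 \<open>0 < y\<close> by (simp add: abs_mult)
    also have "... \<le> y * L" using t y by (intro mult_left_mono L) auto
    finally show ?thesis by (simp add: mult.commute)
  qed (simp add: z0)
  have L0: "L \<ge> 0" using L[of 0] d by fastforce
  have GD: "(G has_real_derivative z y * sin (\<omega> * y)) (at y)" if "0 < y" "y < d" for y
  proof -
    have "(G has_real_derivative z y * sin (\<omega> * y)) (at y within {0..d})"
      unfolding G_def by (rule integral_has_real_derivative[OF czs]) (use that in auto)
    then show ?thesis using that at_within_Icc_at[of 0 y d] by simp
  qed
  have cG: "continuous_on {0..d} G"
    unfolding G_def by (intro indefinite_integral_continuous_1 integrable_continuous_real czs)
  have Gd: "G d = 0" using orth by (simp add: G_def)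
  have sp: "sin (\<omega> * y) > 0" if "y \<in> {\<epsilon>..d}" for y using that \<epsilon> by (intro sin_pos) auto
  have ck: "continuous_on {\<epsilon>..d} k"
    unfolding k_def using sp \<epsilon> by (intro continuous_intros continuous_on_subset[OF cG]) force+
  have cB: "continuous_on {\<epsilon>..d} B"
    unfolding B_def using sp by (intro continuous_intros ck cz) force+
  have Gk: "\<bar>G y\<bar> \<le> sin (\<omega> * y) * integral {0..y} (\<lambda>t. \<bar>z t\<bar>)" if y: "y \<in> {\<epsilon>..d}" for y
  proof -
    have "norm (G y) \<le> integral {0..y} (\<lambda>t. sin (\<omega> * y) * \<bar>z t\<bar>)"
      unfolding G_def
    proof (rule integral_norm_bound_integral)
      show "(\<lambda>t. sin (\<omega> * y) * \<bar>z t\<bar>) integrable_on {0..y}"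
        by (intro integrable_continuous_real continuous_intros cz)
      fix t assume t: "t \<in> {0..y}"
      have "0 \<le> sin (\<omega> * t)" "sin (\<omega> * t) \<le> sin (\<omega> * y)"
        using t y \<epsilon> sin_mono[of 0 t] sin_mono[of t y] by auto
      then show "norm (z t * sin (\<omega> * t)) \<le> sin (\<omega> * y) * \<bar>z t\<bar>"
        by (simp add: abs_mult mult.commute mult_left_mono)
    qed (intro integrable_continuous_real czs)
    then show ?thesis by simp
  qed
  have k_abs: "\<bar>k y\<bar> \<le> integral {0..y} (\<lambda>t. \<bar>z t\<bar>)" if y: "y \<in> {\<epsilon>..d}" for y
  proof -
    have "\<bar>k y\<bar> = \<bar>G y\<bar> / sin (\<omega> * y)" using sp[OF y] by (simp add: k_def abs_divide)
    also have "... \<le> integral {0..y} (\<lambda>t. \<bar>z t\<bar>)"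
      using Gk[OF y] by (subst pos_divide_le_eq[OF sp[OF y]]) (simp only: mult.commute)
    finally show ?thesis .
  qed
  have k2: "(k y)\<^sup>2 \<le> y * Z" if y: "y \<in> {\<epsilon>..d}" for y
  proof -
    have "(k y)\<^sup>2 \<le> (integral {0..y} (\<lambda>t. \<bar>z t\<bar>))\<^sup>2"
      using k_abs[OF y] by (simp add: abs_le_square_iff[symmetric])
    also have "... \<le> (y - 0) * integral {0..y} (\<lambda>t. \<bar>z t\<bar>\<^sup>2)"
      using y \<epsilon> by (intro integral_le_sqrt_length continuous_intros cz) auto
    also have "... \<le> y * Z"
      unfolding Z_def using y \<epsilon>
      by (auto intro!: mult_left_mono integral_subset_le integrable_continuous_real continuous_intros cz)
    finally show ?thesis .
  qed
  have Bd: "(B has_vector_derivative ((z' y - \<omega> * (cos (\<omega> * y) / sin (\<omega> * y)) * z y + \<gamma> * k y)\<^sup>2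
       - ((z' y)\<^sup>2 - \<omega>\<^sup>2 * (z y)\<^sup>2 - 2 * \<gamma> * (z y)\<^sup>2 + \<gamma>\<^sup>2 * (k y)\<^sup>2))) (at y)" if y: "y \<in> {\<epsilon><..<d}" for y
  proof -
    have s: "sin (\<omega> * y) \<noteq> 0" using sp[of y] y by auto
    have G': "(G has_real_derivative z y * sin (\<omega> * y)) (at y)" using GD y \<epsilon> by auto
    have cos2: "(cos (\<omega> * y))\<^sup>2 = 1 - (sin (\<omega> * y))\<^sup>2" by (simp add: cos_squared_eq)
    have sD: "((\<lambda>y. sin (\<omega> * y)) has_real_derivative cos (\<omega> * y) * \<omega>) (at y)"
      "((\<lambda>y. cos (\<omega> * y)) has_real_derivative - sin (\<omega> * y) * \<omega>) (at y)"
      by (auto intro!: derivative_eq_intros)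
    have ctD: "((\<lambda>y. cos (\<omega> * y) / sin (\<omega> * y)) has_real_derivative - (\<omega> / (sin (\<omega> * y))\<^sup>2)) (at y)"
    proof -
      have "- sin (\<omega> * y) * \<omega> * sin (\<omega> * y) - cos (\<omega> * y) * (cos (\<omega> * y) * \<omega>)
         = - \<omega> * (cos (\<omega> * y) * cos (\<omega> * y) + sin (\<omega> * y) * sin (\<omega> * y))" by algebra
      also have "... = - \<omega>" by (simp only: sin_cos_squared_add3 mult_1_right)
      finally show ?thesis using DERIV_divide[OF sD(2,1) s] by (simp add: power2_eq_square)
    qed
    have kD: "(k has_real_derivative (z y - \<omega> * cos (\<omega> * y) / sin (\<omega> * y) * k y)) (at y)"
    proof -
      have "(z y * sin (\<omega> * y) * sin (\<omega> * y) - G y * (cos (\<omega> * y) * \<omega>)) / (sin (\<omega> * y) * sin (\<omega> * y))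
        = z y - \<omega> * cos (\<omega> * y) / sin (\<omega> * y) * k y"
        using s by (simp add: k_def diff_divide_distrib mult_ac)
      then show ?thesis using DERIV_divide[OF G' sD(1) s] unfolding k_def[abs_def] by simp
    qed
    have "(B has_real_derivative (\<omega>\<^sup>2 / (sin (\<omega> * y))\<^sup>2 * (z y)\<^sup>2 - \<omega> * (cos (\<omega> * y) / sin (\<omega> * y)) * (2 * z y * z' y)
        + 2 * \<gamma> * (z' y * k y + z y * (z y - \<omega> * cos (\<omega> * y) / sin (\<omega> * y) * k y)))) (at y)"
      unfolding B_def[abs_def]
      by (rule derivative_eq_intros D ctD kD refl)+ (simp add: power2_eq_square algebra_simps)
    moreover have "(\<omega>\<^sup>2 / (sin (\<omega> * y))\<^sup>2 * (z y)\<^sup>2 - \<omega> * (cos (\<omega> * y) / sin (\<omega> * y)) * (2 * z y * z' y)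
        + 2 * \<gamma> * (z' y * k y + z y * (z y - \<omega> * cos (\<omega> * y) / sin (\<omega> * y) * k y)))
       = (z' y - \<omega> * (cos (\<omega> * y) / sin (\<omega> * y)) * z y + \<gamma> * k y)\<^sup>2
       - ((z' y)\<^sup>2 - \<omega>\<^sup>2 * (z y)\<^sup>2 - 2 * \<gamma> * (z y)\<^sup>2 + \<gamma>\<^sup>2 * (k y)\<^sup>2)"
    proof -
      define ct where "ct = cos (\<omega> * y) / sin (\<omega> * y)"
      have e1: "\<omega>\<^sup>2 / (sin (\<omega> * y))\<^sup>2 = \<omega>\<^sup>2 + \<omega>\<^sup>2 * ct\<^sup>2"
        using s by (simp add: ct_def power_divide field_simps) (simp flip: distrib_left)
      have e2: "\<omega> * cos (\<omega> * y) / sin (\<omega> * y) * k y = \<omega> * ct * k y" by (simp add: ct_def)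
      show ?thesis unfolding e1 e2 ct_def[symmetric] by (simp add: power2_eq_square algebra_simps)
    qed
    ultimately show ?thesis by (simp add: has_real_derivative_iff_has_vector_derivative)
  qed
  have "((\<lambda>y. (z' y - \<omega> * (cos (\<omega> * y) / sin (\<omega> * y)) * z y + \<gamma> * k y)\<^sup>2
       - ((z' y)\<^sup>2 - \<omega>\<^sup>2 * (z y)\<^sup>2 - 2 * \<gamma> * (z y)\<^sup>2 + \<gamma>\<^sup>2 * (k y)\<^sup>2)) has_integral (B d - B \<epsilon>)) {\<epsilon>..d}"
    using \<epsilon> Bd cB by (intro fundamental_theorem_of_calculus_interior) auto
  moreover have "((\<lambda>y. (z' y)\<^sup>2 - \<omega>\<^sup>2 * (z y)\<^sup>2 - 2 * \<gamma> * (z y)\<^sup>2) has_integral integral {\<epsilon>..d} (\<lambda>y. (z' y)\<^sup>2 - \<omega>\<^sup>2 * (z y)\<^sup>2 - 2 * \<gamma> * (z y)\<^sup>2)) {\<epsilon>..d}"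
    by (intro integrable_integral integrable_continuous_real continuous_intros cz cz')
  moreover have "((\<lambda>y. \<gamma>\<^sup>2 * (k y)\<^sup>2) has_integral \<gamma>\<^sup>2 * integral {\<epsilon>..d} (\<lambda>y. (k y)\<^sup>2)) {\<epsilon>..d}"
    by (intro has_integral_mult_right integrable_integral integrable_continuous_real continuous_intros ck)
  ultimately have "((\<lambda>y. ((z' y - \<omega> * (cos (\<omega> * y) / sin (\<omega> * y)) * z y + \<gamma> * k y)\<^sup>2
       - ((z' y)\<^sup>2 - \<omega>\<^sup>2 * (z y)\<^sup>2 - 2 * \<gamma> * (z y)\<^sup>2 + \<gamma>\<^sup>2 * (k y)\<^sup>2)) + (((z' y)\<^sup>2 - \<omega>\<^sup>2 * (z y)\<^sup>2 - 2 * \<gamma> * (z y)\<^sup>2) + \<gamma>\<^sup>2 * (k y)\<^sup>2))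
      has_integral ((B d - B \<epsilon>) + (integral {\<epsilon>..d} (\<lambda>y. (z' y)\<^sup>2 - \<omega>\<^sup>2 * (z y)\<^sup>2 - 2 * \<gamma> * (z y)\<^sup>2) + \<gamma>\<^sup>2 * integral {\<epsilon>..d} (\<lambda>y. (k y)\<^sup>2)))) {\<epsilon>..d}"
    by (intro has_integral_add)
  then have main: "0 \<le> (B d - B \<epsilon>) + (integral {\<epsilon>..d} (\<lambda>y. (z' y)\<^sup>2 - \<omega>\<^sup>2 * (z y)\<^sup>2 - 2 * \<gamma> * (z y)\<^sup>2) + \<gamma>\<^sup>2 * integral {\<epsilon>..d} (\<lambda>y. (k y)\<^sup>2))"
    by (rule has_integral_nonneg) simp
  have "cos (\<omega> * d) = 0" using omega_d by (simp only: cos_pi_half)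
  then have Bd0: "B d = 0" using Gd by (simp add: B_def k_def)
  have ik: "integral {\<epsilon>..d} (\<lambda>y. (k y)\<^sup>2) \<le> d\<^sup>2 / 2 * Z"
  proof -
    have Z0: "0 \<le> Z" unfolding Z_def by (intro integral_nonneg integrable_continuous_real continuous_intros cz) auto
    have "integral {\<epsilon>..d} (\<lambda>y. (k y)\<^sup>2) \<le> integral {\<epsilon>..d} (\<lambda>y. y * Z)"
      using k2 by (intro integral_le integrable_continuous_real continuous_intros ck) auto
    also have "... = ((d\<^sup>2 - \<epsilon>\<^sup>2) / 2) * Z"
      using \<epsilon> by (intro integral_unique has_integral_mult_left ident_has_integral) auto
    also have "... \<le> d\<^sup>2 / 2 * Z" using Z0 by (intro mult_right_mono) auto
    finally show ?thesis .
  qed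
  have Be: "- B \<epsilon> \<le> L\<^sup>2 * \<epsilon> + 2 * \<gamma> * L\<^sup>2 * \<epsilon> ^ 3"
  proof -
    have e: "\<epsilon> \<in> {\<epsilon>..d}" "\<epsilon> \<in> {0..d}" using \<epsilon> by auto
    have "\<omega> * \<epsilon> * cos (\<omega> * \<epsilon>) \<le> sin (\<omega> * \<epsilon>)"
    proof -
      have "\<omega> * \<epsilon> < pi / 2" using omega_d omega_pos \<epsilon> by (metis mult_strict_left_mono)
      moreover have "0 < \<omega> * \<epsilon>" using omega_pos \<epsilon> by simp
      ultimately obtain \<theta> where th: "0 < \<theta>" "\<theta> < \<omega> * \<epsilon>" "sin (\<omega> * \<epsilon>) - sin 0 = (\<omega> * \<epsilon> - 0) * cos \<theta>"
        using MVT2[of 0 "\<omega> * \<epsilon>" sin cos] DERIV_sin by blast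
      have "cos (\<omega> * \<epsilon>) \<le> cos \<theta>"
        using th \<open>\<omega> * \<epsilon> < pi / 2\<close> by (intro cos_monotone_0_pi_le) auto
      then have "\<omega> * \<epsilon> * cos (\<omega> * \<epsilon>) \<le> \<omega> * \<epsilon> * cos \<theta>" using \<open>0 < \<omega> * \<epsilon>\<close> by (intro mult_left_mono) auto
      then show ?thesis using th(3) by simp
    qed
    then have ct: "\<omega> * (cos (\<omega> * \<epsilon>) / sin (\<omega> * \<epsilon>)) \<le> 1 / \<epsilon>"
      using sp[OF e(1)] \<epsilon> by (simp add: field_simps)
    have z2: "(z \<epsilon>)\<^sup>2 \<le> (L * \<epsilon>)\<^sup>2" using zL[OF e(2)] L0 \<epsilon> by (simp add: abs_le_square_iff[symmetric])
    have "\<omega> * (cos (\<omega> * \<epsilon>) / sin (\<omega> * \<epsilon>)) * (z \<epsilon>)\<^sup>2 \<le> 1 / \<epsilon> * (z \<epsilon>)\<^sup>2" using ct by (intro mult_right_mono) auto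
    also have "... \<le> 1 / \<epsilon> * (L * \<epsilon>)\<^sup>2" using z2 \<epsilon> by (intro mult_left_mono) auto
    also have "... = L\<^sup>2 * \<epsilon>" using \<epsilon> by (simp add: power2_eq_square)
    finally have 1: "\<omega> * (cos (\<omega> * \<epsilon>) / sin (\<omega> * \<epsilon>)) * (z \<epsilon>)\<^sup>2 \<le> L\<^sup>2 * \<epsilon>" .
    have "integral {0..\<epsilon>} (\<lambda>t. \<bar>z t\<bar>) \<le> integral {0..\<epsilon>} (\<lambda>t. L * \<epsilon>)"
    proof (intro integral_le integrable_continuous_real continuous_intros cz)
      fix t assume t: "t \<in> {0..\<epsilon>}"
      then have "\<bar>z t\<bar> \<le> L * t" using \<epsilon> by (intro zL) auto
      also have "... \<le> L * \<epsilon>" using t L0 by (intro mult_left_mono) auto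
      finally show "\<bar>z t\<bar> \<le> L * \<epsilon>" .
    qed
    then have "\<bar>k \<epsilon>\<bar> \<le> L * \<epsilon>\<^sup>2" using k_abs[OF e(1)] \<epsilon> by (simp add: power2_eq_square mult_ac)
    then have "\<bar>z \<epsilon>\<bar> * \<bar>k \<epsilon>\<bar> \<le> (L * \<epsilon>) * (L * \<epsilon>\<^sup>2)" using zL[OF e(2)] L0 \<epsilon> by (intro mult_mono) auto
    then have "- (z \<epsilon> * k \<epsilon>) \<le> L\<^sup>2 * \<epsilon> ^ 3" by (simp add: power2_eq_square power3_eq_cube abs_mult[symmetric] mult_ac abs_le_iff)
    then have "2 * \<gamma> * (- (z \<epsilon> * k \<epsilon>)) \<le> 2 * \<gamma> * (L\<^sup>2 * \<epsilon> ^ 3)" by (intro mult_left_mono) (auto simp: \<gamma>_def)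
    then show ?thesis using 1 by (simp add: B_def mult_ac)
  qed
  have "\<gamma>\<^sup>2 * integral {\<epsilon>..d} (\<lambda>y. (k y)\<^sup>2) \<le> \<gamma>\<^sup>2 * (d\<^sup>2 / 2 * Z)" by (intro mult_left_mono ik) auto
  also have "... = 2 / d\<^sup>2 * Z" using d by (simp add: \<gamma>_def power2_eq_square)
  finally show ?thesis using main Be unfolding Bd0 Z_def \<gamma>_def by simp
qed

text \<open>The limit \<open>\<epsilon> \<rightarrow> 0\<close> of the preceding estimate.\<close>
lemma gap:
  fixes z z' :: "real \<Rightarrow> real"
  assumes D: "\<And>y. (z has_real_derivative z' y) (at y)" and c: "continuous_on UNIV z'"
    and z0: "z 0 = 0" and orth: "integral {0..d} (\<lambda>y. z y * sin (\<omega> * y)) = 0"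
  shows "2 / d\<^sup>2 * integral {0..d} (\<lambda>y. (z y)\<^sup>2) \<le> integral {0..d} (\<lambda>y. (z' y)\<^sup>2) - \<omega>\<^sup>2 * integral {0..d} (\<lambda>y. (z y)\<^sup>2)"
proof -
  have cz: "continuous_on A z" for A
    using D by (meson DERIV_isCont continuous_at_imp_continuous_on)
  have cz': "continuous_on A z'" for A using c continuous_on_subset by blast
  have "bounded (z' ` {0..d})" by (intro compact_imp_bounded compact_continuous_image cz') auto
  then obtain L where L: "\<And>y. y \<in> {0..d} \<Longrightarrow> \<bar>z' y\<bar> \<le> L" unfolding bounded_iff by force
  define h where "h y = (z' y)\<^sup>2 - \<omega>\<^sup>2 * (z y)\<^sup>2 - 4 / d\<^sup>2 * (z y)\<^sup>2" for y
  define Z where "Z = integral {0..d} (\<lambda>y. (z y)\<^sup>2)"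
  have ih: "h integrable_on {0..d}" unfolding h_def by (intro integrable_continuous_real continuous_intros cz cz')
  have cont: "continuous_on {0..d} (\<lambda>x. integral {x..d} h)" by (rule indefinite_integral_continuous_1'[OF ih])
  define \<epsilon> where "\<epsilon> n = d / real (n + 2)" for n
  have eps: "0 < \<epsilon> n" "\<epsilon> n < d" for n using d by (auto simp: \<epsilon>_def field_simps add_pos_nonneg)
  have e0: "\<epsilon> \<longlonglongrightarrow> 0" unfolding \<epsilon>_def using LIMSEQ_ignore_initial_segment[OF lim_const_over_n[of d], of 2] by simp
  have "(\<lambda>n. integral {\<epsilon> n..d} h) \<longlonglongrightarrow> integral {0..d} h"
    using continuous_on_tendsto_compose[OF cont e0] eps d by (auto intro: less_imp_le always_eventually)
  then have "(\<lambda>n. integral {\<epsilon> n..d} h + 2 / d\<^sup>2 * Z + L\<^sup>2 * \<epsilon> n + 4 / d\<^sup>2 * L\<^sup>2 * \<epsilon> n ^ 3)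
     \<longlonglongrightarrow> integral {0..d} h + 2 / d\<^sup>2 * Z + L\<^sup>2 * 0 + 4 / d\<^sup>2 * L\<^sup>2 * 0 ^ 3"
    by (intro tendsto_intros e0)
  moreover have "0 \<le> integral {\<epsilon> n..d} h + 2 / d\<^sup>2 * Z + L\<^sup>2 * \<epsilon> n + 4 / d\<^sup>2 * L\<^sup>2 * \<epsilon> n ^ 3" for n
    using gap_truncated[OF D c z0 orth L eps, of n] unfolding h_def Z_def by simp
  ultimately have "0 \<le> integral {0..d} h + 2 / d\<^sup>2 * Z + L\<^sup>2 * 0 + 4 / d\<^sup>2 * L\<^sup>2 * 0 ^ 3"
    by (intro LIMSEQ_le_const) auto
  moreover have "integral {0..d} h = integral {0..d} (\<lambda>y. (z' y)\<^sup>2) - \<omega>\<^sup>2 * Z - 4 / d\<^sup>2 * Z"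
    unfolding h_def Z_def
    by (intro integral_unique has_integral_diff has_integral_mult_right integrable_integral integrable_continuous_real continuous_intros cz cz')
  ultimately show ?thesis unfolding Z_def by (simp add: field_simps)
qed


abbreviation I where "I f \<equiv> integral {0..d} f"

definition s where "s y = sqrt (2 / d) * sin (\<omega> * y)"
definition s' where "s' y = sqrt (2 / d) * (\<omega> * cos (\<omega> * y))"

lemma s_deriv: "(s has_real_derivative s' y) (at y)" "(s' has_real_derivative (- \<omega>\<^sup>2 * s y)) (at y)"
  unfolding s_def[abs_def] s'_def[abs_def]
  by (auto intro!: derivative_eq_intros simp: power2_eq_square)

lemma s_cont: "continuous_on A s" "continuous_on A s'"
  unfolding s_def[abs_def] s'_def[abs_def] by (intro continuous_intros)+

lemma s_0: "s 0 = 0" and s'_d: "s' d = 0"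
proof -
  have "cos (\<omega> * d) = 0" using omega_d by (simp only: cos_pi_half)
  then show "s' d = 0" by (simp add: s'_def)
qed (simp add: s_def)

lemma I_linear:
  fixes f g :: "real \<Rightarrow> real"
  assumes "continuous_on {0..d} f" "continuous_on {0..d} g"
  shows "I (\<lambda>y. f y + g y) = I f + I g" "I (\<lambda>y. f y - g y) = I f - I g"
  using assms by (simp_all add: integral_add integral_diff integrable_continuous_real)

lemma s_sq: "I (\<lambda>y. (s y)\<^sup>2) = 1" "I (\<lambda>y. (s' y)\<^sup>2) = \<omega>\<^sup>2"
proof -
  have "((\<lambda>y. y / 2 - sin (\<omega> * y) * cos (\<omega> * y) / (2 * \<omega>)) has_real_derivative (sin (\<omega> * y))\<^sup>2) (at y)" for y
  proof -
    have "((\<lambda>y. y / 2 - sin (\<omega> * y) * cos (\<omega> * y) / (2 * \<omega>)) has_real_derivative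
       (1 / 2 - (cos (\<omega> * y) * \<omega> * cos (\<omega> * y) - sin (\<omega> * y) * \<omega> * sin (\<omega> * y)) / (2 * \<omega>))) (at y)"
      using omega_pos by (auto intro!: derivative_eq_intros simp: field_simps)
    moreover have "(1 / 2 - (cos (\<omega> * y) * \<omega> * cos (\<omega> * y) - sin (\<omega> * y) * \<omega> * sin (\<omega> * y)) / (2 * \<omega>)) = (sin (\<omega> * y))\<^sup>2"
    proof -
      have "cos (\<omega> * y) * \<omega> * cos (\<omega> * y) - sin (\<omega> * y) * \<omega> * sin (\<omega> * y) = \<omega> * (1 - 2 * (sin (\<omega> * y))\<^sup>2)"
        using cos_squared_eq[of "\<omega> * y"] by algebra
      then show ?thesis using omega_pos by (simp add: field_simps)
    qed
    ultimately show ?thesis by simp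
  qed
  then have "((\<lambda>y. (sin (\<omega> * y))\<^sup>2) has_integral ((d / 2 - sin (\<omega> * d) * cos (\<omega> * d) / (2 * \<omega>)) - (0 / 2 - sin (\<omega> * 0) * cos (\<omega> * 0) / (2 * \<omega>)))) {0..d}"
    using d by (intro fundamental_theorem_of_calculus) (auto simp: has_real_derivative_iff_has_vector_derivative intro: has_vector_derivative_at_within)
  then have "((\<lambda>y. (sin (\<omega> * y))\<^sup>2) has_integral (d / 2)) {0..d}"
    unfolding omega_d by simp
  from has_integral_mult_right[OF this, of "2 / d"] have "((\<lambda>y. (s y)\<^sup>2) has_integral 1) {0..d}"
    using d by (simp add: s_def power_mult_distrib)
  then show s1: "I (\<lambda>y. (s y)\<^sup>2) = 1" by (rule integral_unique)
  have "(s' y)\<^sup>2 = 2 / d * \<omega>\<^sup>2 - \<omega>\<^sup>2 * (s y)\<^sup>2" for y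
    using d by (simp add: s_def s'_def power_mult_distrib cos_squared_eq algebra_simps)
  moreover have "((\<lambda>y. 2 / d * \<omega>\<^sup>2 - \<omega>\<^sup>2 * (s y)\<^sup>2) has_integral (2 * \<omega>\<^sup>2 - \<omega>\<^sup>2 * I (\<lambda>y. (s y)\<^sup>2))) {0..d}"
    using has_integral_const_real[of "2 / d * \<omega>\<^sup>2" 0 d] d
    by (intro has_integral_diff has_integral_mult_right integrable_integral integrable_continuous_real continuous_intros s_cont) simp
  ultimately show "I (\<lambda>y. (s' y)\<^sup>2) = \<omega>\<^sup>2" by (simp add: integral_unique s1)
qed

lemma parts_s:
  assumes D: "\<And>y. (z has_real_derivative z' y) (at y)" and c: "continuous_on UNIV z'"
  shows "I (\<lambda>y. z' y * s' y) = \<omega>\<^sup>2 * I (\<lambda>y. z y * s y) - z 0 * s' 0"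
proof -
  have cz: "continuous_on A z" for A
    using D by (meson DERIV_isCont continuous_at_imp_continuous_on)
  have cz': "continuous_on A z'" for A using c continuous_on_subset by blast
  have "((\<lambda>y. z y * s' y) has_real_derivative (z' y * s' y - \<omega>\<^sup>2 * (z y * s y))) (at y)" for y
    by (rule derivative_eq_intros D s_deriv refl)+ (simp add: algebra_simps)
  then have h1: "((\<lambda>y. z' y * s' y - \<omega>\<^sup>2 * (z y * s y)) has_integral (z d * s' d - z 0 * s' 0)) {0..d}"
    using d by (intro fundamental_theorem_of_calculus) (auto simp: has_real_derivative_iff_has_vector_derivative intro: has_vector_derivative_at_within)
  have h2: "((\<lambda>y. z' y * s' y - \<omega>\<^sup>2 * (z y * s y)) has_integral (I (\<lambda>y. z' y * s' y) - \<omega>\<^sup>2 * I (\<lambda>y. z y * s y))) {0..d}"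
    by (intro has_integral_diff has_integral_mult_right integrable_integral integrable_continuous_real continuous_intros s_cont cz cz')
  show ?thesis using has_integral_unique[OF h1 h2] s'_d by simp
qed

lemma projection_sq:
  assumes c: "continuous_on UNIV (v :: real \<Rightarrow> real)"
  shows "I (\<lambda>y. (v y)\<^sup>2) = (I (\<lambda>y. v y * s y))\<^sup>2 + I (\<lambda>y. (v y - I (\<lambda>y. v y * s y) * s y)\<^sup>2)"
proof -
  define a where "a = I (\<lambda>y. v y * s y)"
  have cv: "continuous_on A v" for A using c continuous_on_subset by blast
  have "((\<lambda>y. (v y)\<^sup>2 - 2 * a * (v y * s y) + a\<^sup>2 * (s y)\<^sup>2) has_integral (I (\<lambda>y. (v y)\<^sup>2) - 2 * a * I (\<lambda>y. v y * s y) + a\<^sup>2 * I (\<lambda>y. (s y)\<^sup>2))) {0..d}"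
    by (intro has_integral_add has_integral_diff has_integral_mult_right integrable_integral integrable_continuous_real continuous_intros s_cont cv)
  moreover have "(v y)\<^sup>2 - 2 * a * (v y * s y) + a\<^sup>2 * (s y)\<^sup>2 = (v y - a * s y)\<^sup>2" for y
    by (simp add: power2_eq_square algebra_simps)
  ultimately have "I (\<lambda>y. (v y - a * s y)\<^sup>2) = I (\<lambda>y. (v y)\<^sup>2) - 2 * a * a + a\<^sup>2 * 1" by (simp add: integral_unique s_sq a_def)
  then show ?thesis by (simp add: a_def[symmetric] power2_eq_square)
qed

text \<open>For \<open>z\<close> as in \<open>gap\<close>, the difference on its right-hand side is at least \<open>4 * c\<^sub>0\<close> times \<open>\<integral>z'\<^sup>2 + z\<^sup>2\<close>.
  The factor \<open>4\<close> is spent on the correction by the boundary value.\<close>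
definition c\<^sub>0 where "c\<^sub>0 = 1 / (4 * (1 + \<omega>\<^sup>2 * (d\<^sup>2 / 2) + d\<^sup>2 / 2))"

lemma c0_pos: "c\<^sub>0 > 0" "c\<^sub>0 \<le> 1"
proof -
  define X where "X = 1 + \<omega>\<^sup>2 * (d\<^sup>2 / 2) + d\<^sup>2 / 2"
  have "X \<ge> 1" unfolding X_def by simp
  moreover have "c\<^sub>0 = 1 / (4 * X)" by (simp add: c\<^sub>0_def X_def)
  ultimately show "c\<^sub>0 > 0" "c\<^sub>0 \<le> 1" by (auto simp: divide_le_eq)
qed

text \<open>The gap needs a zero at \<open>0\<close>. After subtraction of the boundary value and of the ground state component, the remaining function
  has it, and the cross terms with the boundary value are absorbed by \<open>\<delta> \<integral>v\<^sup>2\<close> at the price of a large constant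
  in front of \<open>v(0)\<^sup>2\<close>.\<close>
lemma transverse_real:
  assumes \<delta>: "0 < \<delta>"
  shows "\<exists>K\<ge>0. \<forall>v v'. (\<forall>y. (v has_real_derivative v' y) (at y)) \<and> continuous_on UNIV v' \<longrightarrow>
    c\<^sub>0 * (I (\<lambda>y. (v' y - I (\<lambda>y. v y * s y) * s' y)\<^sup>2) + I (\<lambda>y. (v y - I (\<lambda>y. v y * s y) * s y)\<^sup>2))
     \<le> I (\<lambda>y. (v' y)\<^sup>2) - \<omega>\<^sup>2 * I (\<lambda>y. (v y)\<^sup>2) + \<delta> * I (\<lambda>y. (v y)\<^sup>2) + K * (v 0)\<^sup>2"
proof -
  \<comment> \<open>\<open>\<sigma>\<close> is the ground state component of the constant function \<open>1\<close>, and \<open>\<eta>\<close> the weight in the estimate of the cross terms.\<close>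
  define \<sigma> where "\<sigma> = I s"
  define \<eta> where "\<eta> = min (\<delta> / 2) (1 / d ^ 3)"
  have \<eta>: "\<eta> > 0" "2 * \<eta> \<le> \<delta>" "\<eta> * d \<le> 1 / d\<^sup>2"
  proof -
    show "\<eta> > 0" "2 * \<eta> \<le> \<delta>" using \<delta> d by (auto simp: \<eta>_def)
    have "\<eta> * d \<le> 1 / d ^ 3 * d" using d by (intro mult_right_mono) (auto simp: \<eta>_def)
    then show "\<eta> * d \<le> 1 / d\<^sup>2" using d by (simp add: power3_eq_cube power2_eq_square)
  qed
  define E where "E = \<sigma>\<^sup>2 * \<omega>\<^sup>2 + I (\<lambda>y. (1 - \<sigma> * s y)\<^sup>2)"
  have E0: "E \<ge> 0" unfolding E_def
    by (intro add_nonneg_nonneg mult_nonneg_nonneg integral_nonneg integrable_continuous_real continuous_intros s_cont) auto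
  define K where "K = 2 * c\<^sub>0 * E + \<omega> ^ 4 / \<eta> + \<omega> ^ 4 * \<sigma>\<^sup>2 / \<eta> + 2 * d * \<eta> + \<omega>\<^sup>2 * d"
  have K0: "K \<ge> 0" unfolding K_def using E0 c0_pos \<eta> d by (intro add_nonneg_nonneg) (auto intro!: mult_nonneg_nonneg divide_nonneg_pos)
  show ?thesis
  proof (intro exI[of _ K] conjI K0 allI impI, elim conjE)
    fix v v' :: "real \<Rightarrow> real"
    assume D: "\<forall>y. (v has_real_derivative v' y) (at y)" and c: "continuous_on UNIV v'"
    have cv: "continuous_on A v" for A
      using D by (meson DERIV_isCont continuous_at_imp_continuous_on)
    have cv': "continuous_on A v'" for A using c continuous_on_subset by blast
    define v0 where "v0 = v 0"
    define b where "b = I (\<lambda>y. (v y - v0) * s y)"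
    define a where "a = I (\<lambda>y. v y * s y)"
    define z where "z y = v y - v0 - b * s y" for y
    define z' where "z' y = v' y - b * s' y" for y
    have zD: "(z has_real_derivative z' y) (at y)" for y
      unfolding z_def z'_def by (rule derivative_eq_intros D[rule_format] s_deriv refl)+ simp
    have cz: "continuous_on A z" "continuous_on A z'" for A
      unfolding z_def z'_def by (intro continuous_intros cv cv' s_cont)+
    have ab: "a = b + v0 * \<sigma>"
    proof -
      have "I (\<lambda>y. (v y - v0) * s y) = a - v0 * \<sigma>"
        unfolding a_def \<sigma>_def left_diff_distrib
        by (intro integral_unique has_integral_diff has_integral_mult_right integrable_integral integrable_continuous_real continuous_intros cv s_cont)
      then show ?thesis by (simp add: b_def)
    qed
    have zs: "I (\<lambda>y. z y * s y) = 0"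
    proof -
      have "((\<lambda>y. (v y - v0) * s y - b * (s y)\<^sup>2) has_integral (I (\<lambda>y. (v y - v0) * s y) - b * I (\<lambda>y. (s y)\<^sup>2))) {0..d}"
        by (intro has_integral_diff has_integral_mult_right integrable_integral integrable_continuous_real continuous_intros cv s_cont)
      moreover have "(v y - v0) * s y - b * (s y)\<^sup>2 = z y * s y" for y by (simp add: z_def power2_eq_square algebra_simps)
      ultimately show ?thesis by (simp add: integral_unique s_sq b_def)
    qed
    have z0: "z 0 = 0" by (simp add: z_def v0_def s_0)
    have orth: "I (\<lambda>y. z y * sin (\<omega> * y)) = 0"
    proof -
      have "I (\<lambda>y. z y * s y) = sqrt (2 / d) * I (\<lambda>y. z y * sin (\<omega> * y))"
        unfolding s_def by (subst integral_mult_right[symmetric]) (simp add: mult_ac)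
      then show ?thesis using zs d by simp
    qed
    have zps: "I (\<lambda>y. z' y * s' y) = 0" using parts_s[OF zD cz(2)] zs z0 by simp
    define Z where "Z = I (\<lambda>y. (z y)\<^sup>2)"
    define Z' where "Z' = I (\<lambda>y. (z' y)\<^sup>2)"
    define Z1 where "Z1 = I z"
    have Z0: "0 \<le> Z" "0 \<le> Z'" unfolding Z_def Z'_def
      by (intro integral_nonneg integrable_continuous_real continuous_intros cz; simp)+
    have gapz: "2 / d\<^sup>2 * Z \<le> Z' - \<omega>\<^sup>2 * Z"
      unfolding Z_def Z'_def by (rule gap[OF zD cz(2) z0 orth])
    have Z1: "Z1\<^sup>2 \<le> d * Z" unfolding Z1_def Z_def using integral_le_sqrt_length[OF cz(1) d] by simp
    have V': "I (\<lambda>y. (v' y)\<^sup>2) = Z' + \<omega>\<^sup>2 * b\<^sup>2"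
    proof -
      have "((\<lambda>y. (z' y)\<^sup>2 + 2 * b * (z' y * s' y) + b\<^sup>2 * (s' y)\<^sup>2) has_integral (Z' + 2 * b * I (\<lambda>y. z' y * s' y) + b\<^sup>2 * I (\<lambda>y. (s' y)\<^sup>2))) {0..d}"
        unfolding Z'_def
        by (intro has_integral_add has_integral_mult_right integrable_integral integrable_continuous_real continuous_intros s_cont cz)
      moreover have "(z' y)\<^sup>2 + 2 * b * (z' y * s' y) + b\<^sup>2 * (s' y)\<^sup>2 = (v' y)\<^sup>2" for y
        by (simp add: z'_def power2_eq_square algebra_simps)
      ultimately show ?thesis by (simp add: integral_unique mult.commute zps s_sq)
    qed
    have V: "I (\<lambda>y. (v y)\<^sup>2) = Z + v0\<^sup>2 * d + b\<^sup>2 + 2 * v0 * Z1 + 2 * v0 * b * \<sigma>"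
    proof -
      have "((\<lambda>y. (((((z y)\<^sup>2 + v0\<^sup>2) + b\<^sup>2 * (s y)\<^sup>2) + 2 * b * (z y * s y)) + 2 * v0 * z y) + 2 * v0 * b * s y)
         has_integral (((((Z + v0\<^sup>2 * d) + b\<^sup>2 * I (\<lambda>y. (s y)\<^sup>2)) + 2 * b * I (\<lambda>y. z y * s y)) + 2 * v0 * Z1) + 2 * v0 * b * \<sigma>)) {0..d}"
        unfolding Z_def Z1_def \<sigma>_def
        using has_integral_const_real[of "v0\<^sup>2" 0 d] d
        by (intro has_integral_add has_integral_mult_right integrable_integral integrable_continuous_real continuous_intros s_cont cz) (simp add: mult.commute)
      moreover have "(((((z y)\<^sup>2 + v0\<^sup>2) + b\<^sup>2 * (s y)\<^sup>2) + 2 * b * (z y * s y)) + 2 * v0 * z y) + 2 * v0 * b * s y = (v y)\<^sup>2" for y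
        by (simp add: z_def power2_eq_square algebra_simps)
      ultimately show ?thesis by (simp add: integral_unique zs s_sq)
    qed
    have b2: "b\<^sup>2 \<le> 2 * I (\<lambda>y. (v y)\<^sup>2) + 2 * d * v0\<^sup>2"
    proof -
      have "b\<^sup>2 \<le> I (\<lambda>y. (v y - v0)\<^sup>2)"
      proof -
        have "0 \<le> I (\<lambda>y. ((v y - v0) - b * s y)\<^sup>2)"
          by (intro integral_nonneg integrable_continuous_real continuous_intros cv s_cont) auto
        then show ?thesis using projection_sq[of "\<lambda>y. v y - v0"] unfolding b_def[symmetric]
          by (simp add: continuous_on_diff cv)
      qed
      also have "... \<le> I (\<lambda>y. 2 * (v y)\<^sup>2 + 2 * v0\<^sup>2)"
      proof (intro integral_le integrable_continuous_real continuous_intros cv)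
        fix y show "(v y - v0)\<^sup>2 \<le> 2 * (v y)\<^sup>2 + 2 * v0\<^sup>2"
          using zero_le_power2[of "v y + v0"] by (simp add: power2_eq_square algebra_simps)
      qed
      also have "... = 2 * I (\<lambda>y. (v y)\<^sup>2) + 2 * d * v0\<^sup>2"
        using d by (subst I_linear) (auto intro!: continuous_intros cv)
      finally show ?thesis .
    qed
    have young: "2 * \<omega>\<^sup>2 * \<bar>x * t\<bar> \<le> \<omega> ^ 4 / \<eta> * x\<^sup>2 + \<eta> * t\<^sup>2" for x t
    proof -
      have "2 * (\<omega>\<^sup>2 * \<bar>x\<bar> / sqrt \<eta>) * (sqrt \<eta> * \<bar>t\<bar>) \<le> (\<omega>\<^sup>2 * \<bar>x\<bar> / sqrt \<eta>)\<^sup>2 + (sqrt \<eta> * \<bar>t\<bar>)\<^sup>2"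
        by (rule sum_squares_bound)
      then show ?thesis using \<eta>(1) by (simp add: power_mult_distrib power_divide abs_mult mult_ac flip: power_mult)
    qed
    have x1: "2 * \<omega>\<^sup>2 * \<bar>v0 * Z1\<bar> \<le> \<omega> ^ 4 / \<eta> * v0\<^sup>2 + 1 / d\<^sup>2 * Z"
    proof -
      have "\<eta> * Z1\<^sup>2 \<le> \<eta> * (d * Z)" using Z1 \<eta>(1) by (intro mult_left_mono) auto
      also have "... \<le> 1 / d\<^sup>2 * Z" using \<eta>(3) Z0 by (simp only: mult.assoc[symmetric] mult_right_mono)
      finally show ?thesis using young[of v0 Z1] by linarith
    qed
    have x2: "2 * \<omega>\<^sup>2 * \<bar>(v0 * \<sigma>) * b\<bar> \<le> \<omega> ^ 4 * \<sigma>\<^sup>2 / \<eta> * v0\<^sup>2 + \<delta> * I (\<lambda>y. (v y)\<^sup>2) + 2 * d * \<eta> * v0\<^sup>2"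
    proof -
      have "0 \<le> I (\<lambda>y. (v y)\<^sup>2)" by (intro integral_nonneg integrable_continuous_real continuous_intros cv) auto
      then have "2 * \<eta> * I (\<lambda>y. (v y)\<^sup>2) \<le> \<delta> * I (\<lambda>y. (v y)\<^sup>2)" using \<eta>(2) by (intro mult_right_mono)
      moreover have "\<eta> * b\<^sup>2 \<le> \<eta> * (2 * I (\<lambda>y. (v y)\<^sup>2) + 2 * d * v0\<^sup>2)" using b2 \<eta>(1) by (intro mult_left_mono) auto
      moreover have "\<omega> ^ 4 / \<eta> * (v0 * \<sigma>)\<^sup>2 = \<omega> ^ 4 * \<sigma>\<^sup>2 / \<eta> * v0\<^sup>2" by (simp add: power_mult_distrib)
      ultimately show ?thesis using young[of "v0 * \<sigma>" b] by (simp add: algebra_simps)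
    qed
    have Dv: "I (\<lambda>y. (v' y)\<^sup>2) - \<omega>\<^sup>2 * I (\<lambda>y. (v y)\<^sup>2) = (Z' - \<omega>\<^sup>2 * Z) - \<omega>\<^sup>2 * d * v0\<^sup>2 - 2 * \<omega>\<^sup>2 * (v0 * Z1) - 2 * \<omega>\<^sup>2 * ((v0 * \<sigma>) * b)"
      unfolding V V' by (simp add: algebra_simps)
    have low: "(Z' - \<omega>\<^sup>2 * Z) / 2 \<le> I (\<lambda>y. (v' y)\<^sup>2) - \<omega>\<^sup>2 * I (\<lambda>y. (v y)\<^sup>2) + \<delta> * I (\<lambda>y. (v y)\<^sup>2) + (K - 2 * c\<^sub>0 * E) * v0\<^sup>2"
    proof -
      have y1: "2 * \<omega>\<^sup>2 * (v0 * Z1) \<le> 2 * \<omega>\<^sup>2 * \<bar>v0 * Z1\<bar>" by (intro mult_left_mono) auto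
      have y2: "2 * \<omega>\<^sup>2 * ((v0 * \<sigma>) * b) \<le> 2 * \<omega>\<^sup>2 * \<bar>(v0 * \<sigma>) * b\<bar>" by (intro mult_left_mono) auto
      have y3: "(K - 2 * c\<^sub>0 * E) * v0\<^sup>2 = \<omega> ^ 4 / \<eta> * v0\<^sup>2 + \<omega> ^ 4 * \<sigma>\<^sup>2 / \<eta> * v0\<^sup>2 + 2 * d * \<eta> * v0\<^sup>2 + \<omega>\<^sup>2 * d * v0\<^sup>2"
        unfolding K_def by (simp add: algebra_simps)
      have y4: "1 / d\<^sup>2 * Z \<le> (Z' - \<omega>\<^sup>2 * Z) / 2" using gapz by (simp add: mult.commute)
      have combine: "G / 2 \<le> D + dI + K'" if "D = G - c4 - B1 - B2" "A1 \<le> c1 + Zd" "A2 \<le> c2 + dI + c3" "B1 \<le> A1" "B2 \<le> A2"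
          "K' = c1 + c2 + c3 + c4" "Zd \<le> G / 2" for G D dI K' c1 c2 c3 c4 A1 A2 B1 B2 Zd :: real
        using that by linarith
      show ?thesis by (rule combine[OF Dv x1 x2 y1 y2 y3 y4])
    qed
    have zz: "Z' + Z \<le> (1 + \<omega>\<^sup>2 * (d\<^sup>2 / 2) + d\<^sup>2 / 2) * (Z' - \<omega>\<^sup>2 * Z)"
    proof -
      have "d\<^sup>2 / 2 * (2 / d\<^sup>2 * Z) \<le> d\<^sup>2 / 2 * (Z' - \<omega>\<^sup>2 * Z)" by (intro mult_left_mono gapz) simp
      then have q: "Z \<le> d\<^sup>2 / 2 * (Z' - \<omega>\<^sup>2 * Z)" using d by simp
      have "\<omega>\<^sup>2 * Z \<le> \<omega>\<^sup>2 * (d\<^sup>2 / 2 * (Z' - \<omega>\<^sup>2 * Z))" using q by (intro mult_left_mono) auto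
      moreover have "(1 + \<omega>\<^sup>2 * (d\<^sup>2 / 2) + d\<^sup>2 / 2) * X = X + \<omega>\<^sup>2 * (d\<^sup>2 / 2 * X) + d\<^sup>2 / 2 * X" for X
        by (simp only: distrib_right mult.assoc mult_1_left)
      ultimately show ?thesis using q by simp
    qed
    have tilde: "I (\<lambda>y. (v' y - a * s' y)\<^sup>2) + I (\<lambda>y. (v y - a * s y)\<^sup>2) \<le> 2 * (Z' + Z) + 2 * E * v0\<^sup>2"
    proof -
      have sq: "(x + y)\<^sup>2 \<le> 2 * x\<^sup>2 + 2 * y\<^sup>2" for x y :: real
        using sum_squares_bound[of x y] by (simp add: power2_sum)
      have "I (\<lambda>y. (v' y - a * s' y)\<^sup>2) \<le> I (\<lambda>y. 2 * (z' y)\<^sup>2 + 2 * (v0\<^sup>2 * \<sigma>\<^sup>2) * (s' y)\<^sup>2)"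
      proof (intro integral_le integrable_continuous_real continuous_intros cv' s_cont cz)
        fix y
        have "v' y - a * s' y = z' y + (- (v0 * \<sigma> * s' y))" by (simp add: ab z'_def algebra_simps)
        then show "(v' y - a * s' y)\<^sup>2 \<le> 2 * (z' y)\<^sup>2 + 2 * (v0\<^sup>2 * \<sigma>\<^sup>2) * (s' y)\<^sup>2"
          using sq[of "z' y" "- (v0 * \<sigma> * s' y)"] by (simp add: power_mult_distrib)
      qed
      also have "... = 2 * Z' + 2 * (v0\<^sup>2 * \<sigma>\<^sup>2) * \<omega>\<^sup>2"
        unfolding Z'_def s_sq(2)[symmetric]
        by (intro integral_unique has_integral_add has_integral_mult_right integrable_integral integrable_continuous_real continuous_intros s_cont cz)
      finally have t1: "I (\<lambda>y. (v' y - a * s' y)\<^sup>2) \<le> 2 * Z' + 2 * (v0\<^sup>2 * \<sigma>\<^sup>2) * \<omega>\<^sup>2" .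
      have "I (\<lambda>y. (v y - a * s y)\<^sup>2) \<le> I (\<lambda>y. 2 * (z y)\<^sup>2 + 2 * v0\<^sup>2 * (1 - \<sigma> * s y)\<^sup>2)"
      proof (intro integral_le integrable_continuous_real continuous_intros cv s_cont cz)
        fix y
        have "v y - a * s y = z y + v0 * (1 - \<sigma> * s y)" by (simp add: ab z_def algebra_simps)
        then show "(v y - a * s y)\<^sup>2 \<le> 2 * (z y)\<^sup>2 + 2 * v0\<^sup>2 * (1 - \<sigma> * s y)\<^sup>2"
          using sq[of "z y" "v0 * (1 - \<sigma> * s y)"] by (simp add: power_mult_distrib)
      qed
      also have "... = 2 * Z + 2 * v0\<^sup>2 * I (\<lambda>y. (1 - \<sigma> * s y)\<^sup>2)"
        unfolding Z_def
        by (intro integral_unique has_integral_add has_integral_mult_right integrable_integral integrable_continuous_real continuous_intros s_cont cz)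
      finally show ?thesis using t1 by (simp add: E_def algebra_simps)
    qed
    have "c\<^sub>0 * (I (\<lambda>y. (v' y - a * s' y)\<^sup>2) + I (\<lambda>y. (v y - a * s y)\<^sup>2)) \<le> c\<^sub>0 * (2 * (Z' + Z) + 2 * E * v0\<^sup>2)"
      using c0_pos by (intro mult_left_mono tilde) auto
    also have "... \<le> c\<^sub>0 * (2 * ((1 + \<omega>\<^sup>2 * (d\<^sup>2 / 2) + d\<^sup>2 / 2) * (Z' - \<omega>\<^sup>2 * Z)) + 2 * E * v0\<^sup>2)"
      using c0_pos zz by (intro mult_left_mono) auto
    also have "... = (Z' - \<omega>\<^sup>2 * Z) / 2 + 2 * c\<^sub>0 * E * v0\<^sup>2"
    proof -
      have gen: "X > 0 \<Longrightarrow> 1 / (4 * X) * X = 1 / 4" for X :: real by simp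
      have "1 + \<omega>\<^sup>2 * (d\<^sup>2 / 2) + d\<^sup>2 / 2 > 0" by (intro add_pos_nonneg) auto
      then have "c\<^sub>0 * (1 + \<omega>\<^sup>2 * (d\<^sup>2 / 2) + d\<^sup>2 / 2) = 1 / 4"
        unfolding c\<^sub>0_def by (metis (no_types, lifting) gen)
      then have "c\<^sub>0 * (2 * ((1 + \<omega>\<^sup>2 * (d\<^sup>2 / 2) + d\<^sup>2 / 2) * (Z' - \<omega>\<^sup>2 * Z))) = 2 * (1/4) * (Z' - \<omega>\<^sup>2 * Z)"
        by (metis mult.assoc mult.left_commute)
      then show ?thesis by (simp add: distrib_left)
    qed
    also have "... \<le> I (\<lambda>y. (v' y)\<^sup>2) - \<omega>\<^sup>2 * I (\<lambda>y. (v y)\<^sup>2) + \<delta> * I (\<lambda>y. (v y)\<^sup>2) + K * v0\<^sup>2"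
      using low by (simp add: algebra_simps)
    finally show "c\<^sub>0 * (I (\<lambda>y. (v' y - I (\<lambda>y. v y * s y) * s' y)\<^sup>2) + I (\<lambda>y. (v y - I (\<lambda>y. v y * s y) * s y)\<^sup>2))
     \<le> I (\<lambda>y. (v' y)\<^sup>2) - \<omega>\<^sup>2 * I (\<lambda>y. (v y)\<^sup>2) + \<delta> * I (\<lambda>y. (v y)\<^sup>2) + K * (v 0)\<^sup>2"
      by (simp add: a_def v0_def)
  qed
qed

end

lemma integral_Re_Im:
  fixes f :: "real \<Rightarrow> complex"
  assumes "continuous_on {a..b} f"
  shows "Re (integral {a..b} f) = integral {a..b} (\<lambda>y. Re (f y))" "Im (integral {a..b} f) = integral {a..b} (\<lambda>y. Im (f y))"
  using integral_linear[OF integrable_continuous_real[OF assms] bounded_linear_Re]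
    integral_linear[OF integrable_continuous_real[OF assms] bounded_linear_Im] by (simp_all add: o_def)

lemma nn_integral_Ico:
  fixes g :: "real \<Rightarrow> real"
  assumes g: "continuous_on UNIV g" "\<And>y. 0 \<le> g y"
  shows "(\<integral>\<^sup>+y\<in>{a..<b}. ennreal (g y) \<partial>lborel) = ennreal (integral {a..b} g)"
proof -
  have i: "set_integrable lborel {a..<b} g" by (intro set_integrable_continuous g) auto
  have "(\<integral>\<^sup>+y\<in>{a..<b}. ennreal (g y) \<partial>lborel) = (\<integral>\<^sup>+y. ennreal (indicator {a..<b} y *\<^sub>R g y) \<partial>lborel)"
    by (intro nn_integral_cong) (auto simp: indicator_def)
  also have "... = ennreal (LINT y:{a..<b}|lborel. g y)"
    using i g unfolding set_integrable_def set_lebesgue_integral_def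
    by (intro nn_integral_eq_integral) (auto intro!: AE_I2)
  also have "(LINT y:{a..<b}|lborel. g y) = integral {a..<b} g" by (rule set_borel_integral_eq_integral(2)[OF i])
  also have "... = integral {a..b} g"
  proof (rule integral_spike_set)
    show "negligible {x \<in> {a..<b} - {a..b}. g x \<noteq> 0}" by (rule negligible_subset[of "{}"]) auto
    show "negligible {x \<in> {a..b} - {a..<b}. g x \<noteq> 0}" by (rule negligible_subset[of "{b}"]) auto
  qed
  finally show ?thesis .
qed

lemma lint_Ioo:
  fixes g :: "real \<Rightarrow> 'b::euclidean_space"
  assumes g: "continuous_on UNIV g"
  shows "(LINT y:{a<..<b}|lborel. g y) = integral {a..b} g"
proof -
  have i: "set_integrable lborel {a<..<b} g" by (intro set_integrable_continuous g) auto
  then have "(LINT y:{a<..<b}|lborel. g y) = integral {a<..<b} g" by (rule set_borel_integral_eq_integral(2))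
  then show ?thesis by (simp add: integral_open_interval_real)
qed

lemma cont_section:
  fixes f :: "real \<times> real \<Rightarrow> 'b::topological_space"
  assumes "continuous_on UNIV f"
  shows "continuous_on A (\<lambda>y. f (x, y))" "continuous_on A (\<lambda>x. f (x, y))"
  by (auto intro!: continuous_on_compose2[OF assms] continuous_intros)

context width
begin

text \<open>The component of \<open>w(x, \<cdot>)\<close> along the transversal ground state.\<close>
definition mode :: "(real \<times> real \<Rightarrow> complex) \<Rightarrow> real \<Rightarrow> complex" where
  "mode w x = integral {0..d} (\<lambda>y. s y *\<^sub>R w (x, y))"

definition rest :: "(real \<times> real \<Rightarrow> complex) \<Rightarrow> real \<times> real \<Rightarrow> complex" where
  "rest w z = w z - s (snd z) *\<^sub>R mode w (fst z)"

definition rest_y :: "(real \<times> real \<Rightarrow> complex) \<Rightarrow> (real \<times> real \<Rightarrow> complex) \<Rightarrow> real \<times> real \<Rightarrow> complex" where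
  "rest_y w q z = q z - s' (snd z) *\<^sub>R mode w (fst z)"

lemma mode_cont:
  assumes "continuous_on UNIV w" shows "continuous_on A (mode w)"
proof -
  have "continuous_on (UNIV \<times> cbox 0 d) (\<lambda>(x, y). s y *\<^sub>R w (x, y))"
    unfolding case_prod_unfold
    by (intro continuous_intros continuous_on_compose2[OF s_cont(1)[of UNIV]] continuous_on_compose2[OF assms]) auto
  then have "continuous_on UNIV (mode w)"
    unfolding mode_def[abs_def] cbox_interval[symmetric] by (rule integral_continuous_on_param)
  then show ?thesis using continuous_on_subset by blast
qed

lemma mode_deriv:
  assumes C: "C1 w p q"
  shows "(mode w has_vector_derivative mode p x) (at x)"
proof -
  have c: "continuous_on UNIV w" "continuous_on UNIV p" using C by (auto simp: C1_def)
  have "((\<lambda>x. integral (cbox 0 d) (\<lambda>y. s y *\<^sub>R w (x, y))) has_vector_derivative integral (cbox 0 d) (\<lambda>y. s y *\<^sub>R p (x, y))) (at x within UNIV)"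
  proof (rule leibniz_rule_vector_derivative)
    show "((\<lambda>x. s t *\<^sub>R w (x, t)) has_vector_derivative s t *\<^sub>R p (x, t)) (at x within UNIV)" for x t
      using C by (auto simp: C1_def intro!: derivative_eq_intros)
    show "(\<lambda>y. s y *\<^sub>R w (x, y)) integrable_on cbox 0 d" for x
      by (intro integrable_continuous continuous_intros s_cont cont_section c)
    show "continuous_on (UNIV \<times> cbox 0 d) (\<lambda>(x, t). s t *\<^sub>R p (x, t))"
      unfolding case_prod_unfold
      by (intro continuous_intros continuous_on_compose2[OF s_cont(1)[of UNIV]] continuous_on_compose2[OF c(2)]) auto
  qed auto
  then show ?thesis by (simp add: mode_def[abs_def] cbox_interval)
qed

lemma rest_C1:
  assumes C: "C1 w p q"
  shows "C1 (rest w) (rest p) (rest_y w q)"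
proof -
  have c: "continuous_on UNIV w" "continuous_on UNIV p" "continuous_on UNIV q" using C by (auto simp: C1_def)
  have cs: "continuous_on UNIV (\<lambda>z::real\<times>real. s (snd z))" "continuous_on UNIV (\<lambda>z::real\<times>real. s' (snd z))"
    by (auto intro!: continuous_on_compose2[OF s_cont(1)[of UNIV]] continuous_on_compose2[OF s_cont(2)[of UNIV]] continuous_intros)
  have cf: "continuous_on UNIV (\<lambda>z::real\<times>real. mode w (fst z))" "continuous_on UNIV (\<lambda>z::real\<times>real. mode p (fst z))"
    by (auto intro!: continuous_on_compose2[OF mode_cont[of _ UNIV]] continuous_intros c)
  have sD: "(s has_vector_derivative s' y) (at y)" for y
    using s_deriv(1) by (simp add: has_real_derivative_iff_has_vector_derivative)
  have 1: "((\<lambda>x. rest w (x, y)) has_vector_derivative rest p (x, y)) (at x)" for x y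
    unfolding rest_def fst_conv snd_conv using C
    by (auto intro!: derivative_eq_intros mode_deriv[OF C] simp: C1_def)
  have 2: "((\<lambda>y. rest w (x, y)) has_vector_derivative rest_y w q (x, y)) (at y)" for x y
    unfolding rest_def rest_y_def fst_conv snd_conv using C
    by (auto intro!: has_vector_derivative_diff has_vector_derivative_scaleR[OF s_deriv(1) has_vector_derivative_const, THEN has_vector_derivative_eq_rhs] simp: C1_def)
  show ?thesis
    unfolding C1_def using 1 2 by (auto simp: rest_def[abs_def] rest_y_def[abs_def] intro!: continuous_intros c cs cf)
qed

lemma sq_split:
  fixes f :: "real \<Rightarrow> complex"
  assumes "continuous_on {0..d} f"
  shows "I (\<lambda>y. (cmod (f y))\<^sup>2) = I (\<lambda>y. (Re (f y))\<^sup>2) + I (\<lambda>y. (Im (f y))\<^sup>2)"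
  unfolding cmod_power2 by (intro I_linear continuous_intros assms)

lemma Re_Im_mode:
  assumes "continuous_on UNIV w"
  shows "Re (mode w x) = I (\<lambda>y. Re (w (x, y)) * s y)" "Im (mode w x) = I (\<lambda>y. Im (w (x, y)) * s y)"
proof -
  have "continuous_on {0..d} (\<lambda>y. s y *\<^sub>R w (x, y))" by (intro continuous_intros s_cont cont_section assms)
  from integral_Re_Im[OF this] show "Re (mode w x) = I (\<lambda>y. Re (w (x, y)) * s y)" "Im (mode w x) = I (\<lambda>y. Im (w (x, y)) * s y)"
    by (simp_all add: mode_def mult.commute)
qed

lemma pythagoras:
  assumes c: "continuous_on UNIV w"
  shows "I (\<lambda>y. (cmod (w (x, y)))\<^sup>2) = (cmod (mode w x))\<^sup>2 + I (\<lambda>y. (cmod (rest w (x, y)))\<^sup>2)"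
proof -
  have cr: "continuous_on {0..d} (\<lambda>y. rest w (x, y))"
    unfolding rest_def by (simp, intro continuous_intros s_cont cont_section c)
  have cx: "continuous_on UNIV (\<lambda>y. Re (w (x, y)))" "continuous_on UNIV (\<lambda>y. Im (w (x, y)))"
    by (intro continuous_intros cont_section c)+
  have "I (\<lambda>y. (cmod (w (x, y)))\<^sup>2) = I (\<lambda>y. (Re (w (x, y)))\<^sup>2) + I (\<lambda>y. (Im (w (x, y)))\<^sup>2)"
    by (intro sq_split cont_section c)
  also have "... = ((Re (mode w x))\<^sup>2 + I (\<lambda>y. (Re (rest w (x, y)))\<^sup>2)) + ((Im (mode w x))\<^sup>2 + I (\<lambda>y. (Im (rest w (x, y)))\<^sup>2))"
    unfolding projection_sq[OF cx(1)] projection_sq[OF cx(2)] Re_Im_mode[OF c, symmetric]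
    by (simp add: rest_def mult.commute)
  also have "... = (cmod (mode w x))\<^sup>2 + I (\<lambda>y. (cmod (rest w (x, y)))\<^sup>2)"
    unfolding sq_split[OF cr] by (simp add: cmod_power2)
  finally show ?thesis .
qed

lemma transverse:
  assumes "0 < \<delta>"
  shows "\<exists>K\<ge>0. \<forall>w p q x. C1 w p q \<longrightarrow>
    c\<^sub>0 * (I (\<lambda>y. (cmod (rest_y w q (x, y)))\<^sup>2) + I (\<lambda>y. (cmod (rest w (x, y)))\<^sup>2))
     \<le> I (\<lambda>y. (cmod (q (x, y)))\<^sup>2) - \<omega>\<^sup>2 * I (\<lambda>y. (cmod (w (x, y)))\<^sup>2) + \<delta> * I (\<lambda>y. (cmod (w (x, y)))\<^sup>2) + K * (cmod (w (x, 0)))\<^sup>2"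
proof -
  obtain K where K: "K \<ge> 0" and tr: "\<And>v v'. (\<And>y. (v has_real_derivative v' y) (at y)) \<Longrightarrow> continuous_on UNIV v' \<Longrightarrow>
    c\<^sub>0 * (I (\<lambda>y. (v' y - I (\<lambda>y. v y * s y) * s' y)\<^sup>2) + I (\<lambda>y. (v y - I (\<lambda>y. v y * s y) * s y)\<^sup>2))
     \<le> I (\<lambda>y. (v' y)\<^sup>2) - \<omega>\<^sup>2 * I (\<lambda>y. (v y)\<^sup>2) + \<delta> * I (\<lambda>y. (v y)\<^sup>2) + K * (v 0)\<^sup>2"
    using transverse_real[OF assms] by blast
  show ?thesis
  proof (rule exI[of _ K], intro conjI K allI impI)
    fix w p q x assume C: "C1 w p q"
    have c: "continuous_on UNIV w" "continuous_on UNIV p" "continuous_on UNIV q" using C by (auto simp: C1_def)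
    have D: "((\<lambda>y. w (x, y)) has_vector_derivative q (x, y)) (at y)" for y using C by (auto simp: C1_def)
    have DR: "((\<lambda>y. Re (w (x, y))) has_real_derivative Re (q (x, y))) (at y)" "((\<lambda>y. Im (w (x, y))) has_real_derivative Im (q (x, y))) (at y)" for y
      using bounded_linear.has_vector_derivative[OF bounded_linear_Re D] bounded_linear.has_vector_derivative[OF bounded_linear_Im D]
      by (simp_all add: has_real_derivative_iff_has_vector_derivative)
    have cq: "continuous_on UNIV (\<lambda>y. Re (q (x, y)))" "continuous_on UNIV (\<lambda>y. Im (q (x, y)))"
      by (intro continuous_intros cont_section c)+
    have cr: "continuous_on {0..d} (\<lambda>y. rest w (x, y))" "continuous_on {0..d} (\<lambda>y. rest_y w q (x, y))"
      unfolding rest_def rest_y_def by (simp_all, (intro continuous_intros s_cont cont_section c)+)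
    note 1 = tr[OF DR(1) cq(1)] and 2 = tr[OF DR(2) cq(2)]
    have e1: "c\<^sub>0 * (I (\<lambda>y. (Re (rest_y w q (x, y)))\<^sup>2) + I (\<lambda>y. (Re (rest w (x, y)))\<^sup>2))
     \<le> I (\<lambda>y. (Re (q (x, y)))\<^sup>2) - \<omega>\<^sup>2 * I (\<lambda>y. (Re (w (x, y)))\<^sup>2) + \<delta> * I (\<lambda>y. (Re (w (x, y)))\<^sup>2) + K * (Re (w (x, 0)))\<^sup>2"
      using 1 unfolding Re_Im_mode[OF c(1), symmetric] by (simp add: rest_def rest_y_def mult.commute)
    have e2: "c\<^sub>0 * (I (\<lambda>y. (Im (rest_y w q (x, y)))\<^sup>2) + I (\<lambda>y. (Im (rest w (x, y)))\<^sup>2))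
     \<le> I (\<lambda>y. (Im (q (x, y)))\<^sup>2) - \<omega>\<^sup>2 * I (\<lambda>y. (Im (w (x, y)))\<^sup>2) + \<delta> * I (\<lambda>y. (Im (w (x, y)))\<^sup>2) + K * (Im (w (x, 0)))\<^sup>2"
      using 2 unfolding Re_Im_mode[OF c(1), symmetric] by (simp add: rest_def rest_y_def mult.commute)
    show "c\<^sub>0 * (I (\<lambda>y. (cmod (rest_y w q (x, y)))\<^sup>2) + I (\<lambda>y. (cmod (rest w (x, y)))\<^sup>2))
     \<le> I (\<lambda>y. (cmod (q (x, y)))\<^sup>2) - \<omega>\<^sup>2 * I (\<lambda>y. (cmod (w (x, y)))\<^sup>2) + \<delta> * I (\<lambda>y. (cmod (w (x, y)))\<^sup>2) + K * (cmod (w (x, 0)))\<^sup>2"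
      unfolding sq_split[OF cr(1)] sq_split[OF cr(2)] sq_split[OF cont_section(1)[OF c(1)]] sq_split[OF cont_section(1)[OF c(3)]] cmod_power2[of "w (x, 0)"]
      using e1 e2 by (simp add: algebra_simps)
  qed
qed

lemma strip_iter:
  fixes g :: "real \<times> real \<Rightarrow> real"
  assumes g: "continuous_on UNIV g" and b: "bounded S" and S: "\<And>z. z \<notin> S \<Longrightarrow> g z = 0"
  shows "integrable lborel (\<lambda>x. I (\<lambda>y. g (x, y)))" "(LINT z|lebesgue_on (strip d). g z) = (LINT x|lborel. I (\<lambda>y. g (x, y)))"
proof -
  have "integrable lborel g" by (rule continuous_bounded_support_integrable[OF g b S])
  then have "integrable lborel (\<lambda>z. indicator (strip d) z *\<^sub>R g z)" by (intro integrable_mult_indicator) auto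
  then have i: "integrable (lborel \<Otimes>\<^sub>M lborel) (\<lambda>(x, y). indicator {0<..<d} y *\<^sub>R g (x, y))"
    unfolding lborel_prod
    by (rule Bochner_Integration.integrable_cong[THEN iffD1, rotated -1]) (auto simp: strip_def indicator_def)
  have e: "(LINT y|lborel. indicator {0<..<d} y *\<^sub>R g (x, y)) = I (\<lambda>y. g (x, y))" for x
    using lint_Ioo[OF cont_section(1)[OF g], of 0 d x] by (simp add: set_lebesgue_integral_def)
  show "integrable lborel (\<lambda>x. I (\<lambda>y. g (x, y)))"
    using lborel_pair.integrable_fst'[OF i] by (simp add: e[simplified])
  have "(LINT z|lebesgue_on (strip d). g z) = (LINT z:strip d|lborel. g z)" by (rule lint_strip[OF g])
  also have "... = integral\<^sup>L (lborel \<Otimes>\<^sub>M lborel) (\<lambda>(x, y). indicator {0<..<d} y *\<^sub>R g (x, y))"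
    unfolding set_lebesgue_integral_def lborel_prod
    by (rule Bochner_Integration.integral_cong) (auto simp: strip_def indicator_def)
  also have "... = (LINT x|lborel. I (\<lambda>y. g (x, y)))"
    using lborel_pair.integral_fst'[OF i] by (simp add: e[simplified])
  finally show "(LINT z|lebesgue_on (strip d). g z) = (LINT x|lborel. I (\<lambda>y. g (x, y)))" .
qed

definition band :: "(real \<times> real) set" where "band = UNIV \<times> {0..<d}"

lemma band_nn:
  assumes g: "continuous_on UNIV g" "\<And>z. 0 \<le> g z"
  shows "(\<integral>\<^sup>+z. ennreal (g z) * indicator band z \<partial>lborel) = (\<integral>\<^sup>+x. ennreal (I (\<lambda>y. g (x, y))) \<partial>lborel)"
proof -
  have [measurable]: "g \<in> borel_measurable borel" using g by (intro borel_measurable_continuous_onI)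
  have [measurable]: "band \<in> sets borel" unfolding band_def by (auto intro: borel_Times)
  have "(\<integral>\<^sup>+z. ennreal (g z) * indicator band z \<partial>lborel) = (\<integral>\<^sup>+x. \<integral>\<^sup>+y. ennreal (g (x, y)) * indicator band (x, y) \<partial>lborel \<partial>lborel)"
    by (intro nn_integral_plane) measurable
  also have "... = (\<integral>\<^sup>+x. \<integral>\<^sup>+y. ennreal (g (x, y)) * indicator {0..<d} y \<partial>lborel \<partial>lborel)"
    by (intro nn_integral_cong) (auto simp: band_def indicator_def)
  also have "... = (\<integral>\<^sup>+x. ennreal (I (\<lambda>y. g (x, y))) \<partial>lborel)"
    using g by (intro nn_integral_cong nn_integral_Ico cont_section) auto
  finally show ?thesis .
qed

text \<open>Integration of \<open>transverse\<close> over \<open>x\<close>. The component along \<open>s\<close> contributes nothing transversally, so only its longitudinal derivative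
  is left. The nonnegative number \<open>r\<close> is named because \<open>ennreal\<close> would turn a negative upper bound into \<open>0\<close>.\<close>
lemma form_decomposition:
  assumes "0 < \<delta>"
  shows "\<exists>K\<ge>0. \<forall>w p q S. C1 w p q \<longrightarrow> bounded S \<longrightarrow> (\<forall>z. z \<notin> S \<longrightarrow> w z = 0 \<and> p z = 0 \<and> q z = 0) \<longrightarrow>
    (\<exists>r\<ge>0. r = (LINT z|lebesgue_on (strip d). (cmod (p z))\<^sup>2) + (LINT z|lebesgue_on (strip d). (cmod (q z))\<^sup>2)
        - \<omega>\<^sup>2 * (LINT z|lebesgue_on (strip d). (cmod (w z))\<^sup>2) + \<delta> * (LINT z|lebesgue_on (strip d). (cmod (w z))\<^sup>2)
        + K * (LINT x|lborel. (cmod (w (x, 0)))\<^sup>2) \<and>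
    (\<integral>\<^sup>+x. ennreal ((cmod (mode p x))\<^sup>2) \<partial>lborel)
     + ennreal c\<^sub>0 * (\<integral>\<^sup>+z. ennreal ((cmod (rest p z))\<^sup>2 + (cmod (rest_y w q z))\<^sup>2 + (cmod (rest w z))\<^sup>2) * indicator band z \<partial>lborel)
    \<le> ennreal r)"
proof -
  obtain K where K: "K \<ge> 0" and tr: "\<And>w p q x. C1 w p q \<Longrightarrow>
    c\<^sub>0 * (I (\<lambda>y. (cmod (rest_y w q (x, y)))\<^sup>2) + I (\<lambda>y. (cmod (rest w (x, y)))\<^sup>2))
     \<le> I (\<lambda>y. (cmod (q (x, y)))\<^sup>2) - \<omega>\<^sup>2 * I (\<lambda>y. (cmod (w (x, y)))\<^sup>2) + \<delta> * I (\<lambda>y. (cmod (w (x, y)))\<^sup>2) + K * (cmod (w (x, 0)))\<^sup>2"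
    using transverse[OF assms] by blast
  show ?thesis
  proof (rule exI[of _ K], intro conjI K allI impI)
    fix w p q S assume C: "C1 w p q" and b: "bounded S" and out: "\<forall>z. z \<notin> S \<longrightarrow> w z = 0 \<and> p z = 0 \<and> q z = 0"
    have c: "continuous_on UNIV w" "continuous_on UNIV p" "continuous_on UNIV q" using C by (auto simp: C1_def)
    have C': "C1 (rest w) (rest p) (rest_y w q)" by (rule rest_C1[OF C])
    have c': "continuous_on UNIV (rest w)" "continuous_on UNIV (rest p)" "continuous_on UNIV (rest_y w q)" using C' by (auto simp: C1_def)
    have sq: "continuous_on UNIV (\<lambda>z. (cmod (f z))\<^sup>2)" if "continuous_on UNIV f" for f :: "real \<times> real \<Rightarrow> complex"
      by (intro continuous_intros that)
    have P: "integrable lborel (\<lambda>x. I (\<lambda>y. (cmod (p (x, y)))\<^sup>2))" "(LINT z|lebesgue_on (strip d). (cmod (p z))\<^sup>2) = (LINT x|lborel. I (\<lambda>y. (cmod (p (x, y)))\<^sup>2))"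
      using out by (auto intro!: strip_iter[OF sq[OF c(2)] b])
    have Q: "integrable lborel (\<lambda>x. I (\<lambda>y. (cmod (q (x, y)))\<^sup>2))" "(LINT z|lebesgue_on (strip d). (cmod (q z))\<^sup>2) = (LINT x|lborel. I (\<lambda>y. (cmod (q (x, y)))\<^sup>2))"
      using out by (auto intro!: strip_iter[OF sq[OF c(3)] b])
    have W: "integrable lborel (\<lambda>x. I (\<lambda>y. (cmod (w (x, y)))\<^sup>2))" "(LINT z|lebesgue_on (strip d). (cmod (w z))\<^sup>2) = (LINT x|lborel. I (\<lambda>y. (cmod (w (x, y)))\<^sup>2))"
      using out by (auto intro!: strip_iter[OF sq[OF c(1)] b])
    have T: "integrable lborel (\<lambda>x. (cmod (w (x, 0)))\<^sup>2)"
    proof -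
      have "set_integrable lborel (closure (fst ` S)) (\<lambda>x. (cmod (w (x, 0)))\<^sup>2)"
        using bounded_fst[OF b] by (intro set_integrable_continuous continuous_intros cont_section c) auto
      then show ?thesis unfolding set_integrable_def
      proof (rule Bochner_Integration.integrable_cong[THEN iffD1, rotated -1])
        fix x
        have "w (x, 0) = 0" if "x \<notin> closure (fst ` S)"
          using that closure_subset[of "fst ` S"] out by (metis fst_conv image_eqI in_mono)
        then show "indicator (closure (fst ` S)) x *\<^sub>R (cmod (w (x, 0)))\<^sup>2 = (cmod (w (x, 0)))\<^sup>2" by (auto simp: indicator_def)
      qed simp
    qed
    define r where "r x = I (\<lambda>y. (cmod (p (x, y)))\<^sup>2) + I (\<lambda>y. (cmod (q (x, y)))\<^sup>2)
        - \<omega>\<^sup>2 * I (\<lambda>y. (cmod (w (x, y)))\<^sup>2) + \<delta> * I (\<lambda>y. (cmod (w (x, y)))\<^sup>2) + K * (cmod (w (x, 0)))\<^sup>2" for x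
    define G where "G x = c\<^sub>0 * (I (\<lambda>y. (cmod (rest p (x, y)))\<^sup>2 + (cmod (rest_y w q (x, y)))\<^sup>2 + (cmod (rest w (x, y)))\<^sup>2))" for x
    have IG: "I (\<lambda>y. (cmod (rest p (x, y)))\<^sup>2 + (cmod (rest_y w q (x, y)))\<^sup>2 + (cmod (rest w (x, y)))\<^sup>2)
       = I (\<lambda>y. (cmod (rest p (x, y)))\<^sup>2) + I (\<lambda>y. (cmod (rest_y w q (x, y)))\<^sup>2) + I (\<lambda>y. (cmod (rest w (x, y)))\<^sup>2)" for x
      by (subst I_linear I_linear(1)[of "\<lambda>y. (cmod (rest p (x, y)))\<^sup>2"]; (intro continuous_intros cont_section c')?)+ simp
    have nn: "0 \<le> I (\<lambda>y. (cmod (rest p (x, y)))\<^sup>2)" "0 \<le> I (\<lambda>y. (cmod (rest_y w q (x, y)))\<^sup>2)" "0 \<le> I (\<lambda>y. (cmod (rest w (x, y)))\<^sup>2)" for x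
      by (intro integral_nonneg integrable_continuous_real continuous_intros cont_section c'; simp)+
    have G0: "0 \<le> G x" for x unfolding G_def IG using nn c0_pos by (intro mult_nonneg_nonneg add_nonneg_nonneg) auto
    have le: "(cmod (mode p x))\<^sup>2 + G x \<le> r x" for x
    proof -
      have "c\<^sub>0 * I (\<lambda>y. (cmod (rest p (x, y)))\<^sup>2) \<le> 1 * I (\<lambda>y. (cmod (rest p (x, y)))\<^sup>2)"
        using c0_pos nn by (intro mult_right_mono) auto
      then show ?thesis
        using tr[OF C, of x] pythagoras[OF c(2), of x] unfolding r_def G_def IG by (simp add: distrib_left)
    qed
    have r0: "0 \<le> r x" for x using le[of x] G0[of x] by (smt (verit) zero_le_power2)
    have ir: "integrable lborel r" unfolding r_def using P Q W T by simp
    have cfp: "continuous_on UNIV (mode p)" by (rule mode_cont[OF c(2)])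
    have [measurable]: "mode p \<in> borel_measurable borel" using cfp by (intro borel_measurable_continuous_onI)
    have nnband: "(\<integral>\<^sup>+z. ennreal ((cmod (rest p z))\<^sup>2 + (cmod (rest_y w q z))\<^sup>2 + (cmod (rest w z))\<^sup>2) * indicator band z \<partial>lborel)
       = (\<integral>\<^sup>+x. ennreal (I (\<lambda>y. (cmod (rest p (x, y)))\<^sup>2 + (cmod (rest_y w q (x, y)))\<^sup>2 + (cmod (rest w (x, y)))\<^sup>2)) \<partial>lborel)"
      by (intro band_nn continuous_intros c') auto
    have mG: "(\<lambda>x. I (\<lambda>y. (cmod (rest p (x, y)))\<^sup>2 + (cmod (rest_y w q (x, y)))\<^sup>2 + (cmod (rest w (x, y)))\<^sup>2)) \<in> borel_measurable borel"
    proof (intro borel_measurable_continuous_onI)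
      have "continuous_on (UNIV \<times> cbox 0 d) (\<lambda>(x, y). (cmod (rest p (x, y)))\<^sup>2 + (cmod (rest_y w q (x, y)))\<^sup>2 + (cmod (rest w (x, y)))\<^sup>2)"
        unfolding case_prod_unfold prod.collapse by (intro continuous_intros continuous_on_subset[OF c'(1)] continuous_on_subset[OF c'(2)] continuous_on_subset[OF c'(3)]) auto
      from integral_continuous_on_param[OF this]
      show "continuous_on UNIV (\<lambda>x. I (\<lambda>y. (cmod (rest p (x, y)))\<^sup>2 + (cmod (rest_y w q (x, y)))\<^sup>2 + (cmod (rest w (x, y)))\<^sup>2))"
        by (simp add: cbox_interval)
    qed
    have "(\<integral>\<^sup>+x. ennreal ((cmod (mode p x))\<^sup>2) \<partial>lborel)
     + ennreal c\<^sub>0 * (\<integral>\<^sup>+z. ennreal ((cmod (rest p z))\<^sup>2 + (cmod (rest_y w q z))\<^sup>2 + (cmod (rest w z))\<^sup>2) * indicator band z \<partial>lborel)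
      = (\<integral>\<^sup>+x. ennreal ((cmod (mode p x))\<^sup>2) \<partial>lborel) + (\<integral>\<^sup>+x. ennreal (G x) \<partial>lborel)"
      unfolding nnband G_def using c0_pos mG by (simp add: ennreal_mult' nn_integral_cmult)
    also have "... = (\<integral>\<^sup>+x. ennreal ((cmod (mode p x))\<^sup>2) + ennreal (G x) \<partial>lborel)"
      using mG unfolding G_def by (intro nn_integral_add[symmetric]) auto
    also have "... \<le> (\<integral>\<^sup>+x. ennreal (r x) \<partial>lborel)"
      using le G0 by (intro nn_integral_mono) (simp flip: ennreal_plus add: ennreal_leI)
    also have "... = ennreal (LINT x|lborel. r x)" using ir r0 by (intro nn_integral_eq_integral) auto
    finally have main: "(\<integral>\<^sup>+x. ennreal ((cmod (mode p x))\<^sup>2) \<partial>lborel)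
     + ennreal c\<^sub>0 * (\<integral>\<^sup>+z. ennreal ((cmod (rest p z))\<^sup>2 + (cmod (rest_y w q z))\<^sup>2 + (cmod (rest w z))\<^sup>2) * indicator band z \<partial>lborel)
    \<le> ennreal (LINT x|lborel. r x)" .
    have I0: "0 \<le> (LINT x|lborel. r x)" using r0 by (intro integral_nonneg_AE AE_I2) auto
    have eq: "(LINT x|lborel. r x) = (LINT z|lebesgue_on (strip d). (cmod (p z))\<^sup>2) + (LINT z|lebesgue_on (strip d). (cmod (q z))\<^sup>2)
        - \<omega>\<^sup>2 * (LINT z|lebesgue_on (strip d). (cmod (w z))\<^sup>2) + \<delta> * (LINT z|lebesgue_on (strip d). (cmod (w z))\<^sup>2)
        + K * (LINT x|lborel. (cmod (w (x, 0)))\<^sup>2)"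
      unfolding r_def P(2) Q(2) W(2) using P(1) Q(1) W(1) T by simp
    show "\<exists>r\<ge>0. r = (LINT z|lebesgue_on (strip d). (cmod (p z))\<^sup>2) + (LINT z|lebesgue_on (strip d). (cmod (q z))\<^sup>2)
        - \<omega>\<^sup>2 * (LINT z|lebesgue_on (strip d). (cmod (w z))\<^sup>2) + \<delta> * (LINT z|lebesgue_on (strip d). (cmod (w z))\<^sup>2)
        + K * (LINT x|lborel. (cmod (w (x, 0)))\<^sup>2) \<and>
    (\<integral>\<^sup>+x. ennreal ((cmod (mode p x))\<^sup>2) \<partial>lborel)
     + ennreal c\<^sub>0 * (\<integral>\<^sup>+z. ennreal ((cmod (rest p z))\<^sup>2 + (cmod (rest_y w q z))\<^sup>2 + (cmod (rest w z))\<^sup>2) * indicator band z \<partial>lborel)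
    \<le> ennreal r"
      by (intro exI[of _ "LINT x|lborel. r x"] conjI I0 main eq)
  qed
qed

end

section \<open>The longitudinal problem\<close>

definition C1_line :: "(real \<Rightarrow> complex) \<Rightarrow> (real \<Rightarrow> complex) \<Rightarrow> bool" where
  "C1_line f f' \<longleftrightarrow> (\<forall>x. (f has_vector_derivative f' x) (at x)) \<and> continuous_on UNIV f'"

abbreviation energy1 :: "(real \<Rightarrow> complex) \<Rightarrow> real set \<Rightarrow> ennreal" where
  "energy1 f' X \<equiv> (\<integral>\<^sup>+x. ennreal ((cmod (f' x))\<^sup>2) * indicator X x \<partial>lborel)"

lemma C1_line_cont:
  assumes "C1_line f f'" shows "continuous_on A f" "continuous_on A f'"
  using assms unfolding C1_line_def
  by (auto intro: continuous_on_subset continuous_at_imp_continuous_on has_vector_derivative_continuous)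

lemma energy1_eq:
  assumes f: "C1_line f f'" and S: "S \<in> sets borel" "bounded S"
  shows "energy1 f' S = ennreal (LINT x:S|lborel. (cmod (f' x))\<^sup>2)"
proof -
  have "set_integrable lborel S (\<lambda>x. (cmod (f' x))\<^sup>2)"
    using C1_line_cont[OF f] S by (intro set_integrable_continuous continuous_intros) auto
  then show ?thesis unfolding set_integrable_def set_lebesgue_integral_def
    by (subst nn_integral_eq_integral[symmetric]) (auto intro!: nn_integral_cong simp: indicator_def)
qed

lemma l1_le_l2:
  assumes f: "C1_line f f'" and ab: "a < b"
  shows "(LINT x:{a<..b}|lborel. cmod (f' x))\<^sup>2 \<le> (b - a) * (LINT x:{a<..b}|lborel. (cmod (f' x))\<^sup>2)"
proof -
  have c: "continuous_on UNIV f'" using C1_line_cont[OF f] by blast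
  have bd: "bounded {a<..b}" by (rule bounded_subset[OF bounded_closed_interval[of a b]]) auto
  have "(LINT x:{a<..b}|lborel. 1 * cmod (f' x))\<^sup>2 \<le> (LINT x:{a<..b}|lborel. 1\<^sup>2) * (LINT x:{a<..b}|lborel. (cmod (f' x))\<^sup>2)"
    using bd by (intro Cauchy_Schwarz_set_integral set_integrable_continuous continuous_intros c)
      (auto intro!: borel_measurable_continuous_onI continuous_intros c)
  also have "(LINT x:{a<..b}|lborel. 1\<^sup>2) = b - a" using ab by (simp add: set_lebesgue_integral_def)
  finally show ?thesis by simp
qed

lemma lint_Ico_Ioc:
  fixes g :: "real \<Rightarrow> real" shows "g \<in> borel_measurable borel \<Longrightarrow> (LINT x:{a..<b}|lborel. g x) = (LINT x:{a<..b}|lborel. g x)"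
  unfolding set_lebesgue_integral_def
proof (rule integral_cong_AE)
  show "AE x in lborel. indicator {a..<b} x *\<^sub>R g x = indicator {a<..b} x *\<^sub>R g x"
    using AE_lborel_singleton[of a] AE_lborel_singleton[of b] by eventually_elim (auto simp: indicator_def)
qed auto

lemma dev_mean_le:
  assumes f: "C1_line f f'" and P: "P \<in> sets borel" "P \<subseteq> {a..b}" "measure lborel P > 0" and x: "x \<in> {a..b}"
  shows "cmod (f x - avg P f) \<le> (LINT x:{a<..b}|lborel. cmod (f' x))"
proof -
  have bP: "bounded P" using P(2) by (rule bounded_subset[OF bounded_closed_interval])
  have m: "(\<lambda>x. cmod (f' x)) \<in> borel_measurable borel"
    using C1_line_cont[OF f] by (intro borel_measurable_continuous_onI continuous_intros) auto
  have "cmod (avg P f - f x) \<le> (LINT x:{a..<b}|lborel. cmod (f' x))"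
  proof (rule avg_close)
    show "set_integrable lborel P f" by (intro set_integrable_continuous C1_line_cont[OF f] bP P)
    fix t assume "t \<in> P"
    then show "cmod (f t - f x) \<le> (LINT x:{a..<b}|lborel. cmod (f' x))"
      using f P x unfolding C1_line_def by (intro diff_le_integral_deriv) auto
  qed (use P bP in auto)
  then show ?thesis using lint_Ico_Ioc[OF m] by (simp add: norm_minus_commute)
qed

text \<open>The right end points of the dyadic intervals, with index increasing along the whole line.\<close>
definition dyad_end :: "int \<Rightarrow> real" where "dyad_end k = (if k \<ge> 0 then 2 ^ nat k else - (2 ^ nat (- k - 1)))"
definition dyad :: "int \<Rightarrow> real set" where "dyad k = {dyad_end (k - 1)<..dyad_end k}"

lemma dyad_end_less: "dyad_end (k - 1) < dyad_end k"
proof -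
  consider "k > 0" | "k = 0" | "k < 0" by linarith
  then show ?thesis
  proof cases
    case 1
    then have "nat k = Suc (nat (k - 1))" by simp
    then show ?thesis using 1 by (simp add: dyad_end_def)
  next
    case 3
    then have "nat (- (k - 1) - 1) = Suc (nat (- k - 1))" by simp
    then show ?thesis using 3 by (simp add: dyad_end_def)
  qed (simp add: dyad_end_def)
qed

lemma dyad_end_mono: "k \<le> k' \<Longrightarrow> dyad_end k \<le> dyad_end k'"
proof (induction k' rule: int_ge_induct)
  case (step i)
  then show ?case using dyad_end_less[of "i + 1"] by simp
qed simp

lemma dyad_disjoint: "k \<noteq> k' \<Longrightarrow> dyad k \<inter> dyad k' = {}"
proof -
  have "k < k' \<Longrightarrow> dyad k \<inter> dyad k' = {}" for k k'
    using dyad_end_mono[of k "k' - 1"] by (auto simp: dyad_def)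
  then show "k \<noteq> k' \<Longrightarrow> dyad k \<inter> dyad k' = {}" by (metis inf_commute linorder_neqE)
qed

lemma dyad_borel [measurable]: "dyad k \<in> sets borel" and dyad_bounded [simp]: "bounded (dyad k)"
  by (auto simp: dyad_def)

text \<open>Summation by parts in closed form, which replaces an exchange of the order of summation.\<close>
lemma hardy_sum:
  fixes E :: "nat \<Rightarrow> real"
  shows "(\<Sum>k\<le>N. (3/4) ^ k * (\<Sum>j\<le>k. (4/3) ^ j * E j)) = 4 * (\<Sum>j\<le>N. E j) - 3 * (3/4) ^ N * (\<Sum>j\<le>N. (4/3) ^ j * E j)"
proof (induction N)
  case (Suc N)
  have ab: "(3/4::real) ^ N * (4/3) ^ N = 1" by (simp flip: power_mult_distrib)
  have alg: "S + 3/4 * a * (A + 4/3 * b * e) = 4 * (T + e) - 3 * (3/4 * a) * (A + 4/3 * b * e)"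
    if "a * b = 1" "S = 4 * T - 3 * a * A" for S a A b e T :: real
    using that by algebra
  show ?case using alg[OF ab Suc] by simp
qed simp

definition K0 :: "nat \<Rightarrow> real set" where "K0 k = dyad (int k)"

lemma K0_0: "K0 0 = {-1<..1}" and K0_Suc: "K0 (Suc n) = {2 ^ n<..2 ^ Suc n}"
  by (auto simp: K0_def dyad_def dyad_end_def nat_add_distrib Suc_nat_eq_nat_zadd1)

text \<open>The increments of \<open>f\<close> over the dyadic intervals between \<open>[-1, 1]\<close> and \<open>x\<close> are summed with Cauchy-Schwarz, the weights \<open>(3/4) ^ j\<close>
  being chosen between the growth \<open>2 ^ j\<close> of the lengths and the decay \<open>2 ^ (- j)\<close> of the masses.\<close>
lemma dyadic_bound:
  assumes f: "C1_line f f'" and x: "x \<in> {-1..2 ^ k}"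
  defines "E j \<equiv> LINT x:K0 j|lborel. (cmod (f' x))\<^sup>2"
  shows "(cmod (f x - avg {-1..1} f))\<^sup>2 \<le> 6 * (3/2) ^ k * (\<Sum>j\<le>k. (4/3) ^ j * E j)"
proof -
  have c: "continuous_on UNIV (\<lambda>x. cmod (f' x))" using C1_line_cont[OF f] by (intro continuous_intros)
  have E0: "0 \<le> E j" for j unfolding E_def set_lebesgue_integral_def by (intro integral_nonneg_AE AE_I2) auto
  define D where "D k = (LINT x:{-1<..2 ^ k}|lborel. cmod (f' x))" for k :: nat
  have single_interval: "(LINT x:K0 j|lborel. cmod (f' x)) \<le> sqrt ((3/2) ^ j) * sqrt (2 * (4/3) ^ j * E j)" for j
  proof -
    obtain a b where ab: "K0 j = {a<..b}" "a < b" "b - a \<le> 2 * 2 ^ j"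
    proof (cases j)
      case 0
      then show ?thesis using that[of "-1" 1] K0_0 by simp
    next
      case (Suc n)
      then show ?thesis using that[of "2 ^ n" "2 ^ Suc n"] K0_Suc by simp
    qed
    have "(LINT x:K0 j|lborel. cmod (f' x))\<^sup>2 \<le> (b - a) * E j"
      using l1_le_l2[OF f ab(2)] unfolding ab(1) E_def .
    also have "... \<le> 2 * 2 ^ j * E j" using ab E0 by (intro mult_right_mono) auto
    also have "(2::real) ^ j = (3/2) ^ j * (4/3) ^ j" by (simp flip: power_mult_distrib)
    finally have "(LINT x:K0 j|lborel. cmod (f' x)) \<le> sqrt (2 * ((3/2) ^ j * (4/3) ^ j) * E j)" by (rule real_le_rsqrt)
    then show ?thesis by (simp add: real_sqrt_mult mult_ac)
  qed
  have D: "D k \<le> (\<Sum>j\<le>k. sqrt ((3/2) ^ j) * sqrt (2 * (4/3) ^ j * E j))" for k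
  proof (induction k)
    case 0
    then show ?case using single_interval[of 0] by (simp add: D_def K0_0)
  next
    case (Suc k)
    have "{-1<..2 ^ Suc k} = {-1<..2 ^ k} \<union> K0 (Suc k)"
      unfolding K0_Suc by (auto intro: order_trans[of _ "2 ^ k"]) (use zero_less_power[of "2::real" k] in linarith)
    moreover have "{-1<..2 ^ k} \<inter> K0 (Suc k) = {}" unfolding K0_Suc by auto
    ultimately have "D (Suc k) = D k + (LINT x:K0 (Suc k)|lborel. cmod (f' x))"
      unfolding D_def by (simp add: K0_Suc set_integral_Un set_integrable_continuous[OF c])
    then show ?case using Suc single_interval[of "Suc k"] by simp
  qed
  have "cmod (f x - avg {-1..1} f) \<le> D k"
    unfolding D_def using x by (intro dev_mean_le[OF f]) auto
  also have "... \<le> (\<Sum>j\<le>k. sqrt ((3/2) ^ j) * sqrt (2 * (4/3) ^ j * E j))" by (rule D)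
  finally have "(cmod (f x - avg {-1..1} f))\<^sup>2 \<le> (\<Sum>j\<le>k. sqrt ((3/2) ^ j) * sqrt (2 * (4/3) ^ j * E j))\<^sup>2" by (intro power_mono) auto
  also have "... \<le> (\<Sum>j\<le>k. (sqrt ((3/2) ^ j))\<^sup>2) * (\<Sum>j\<le>k. (sqrt (2 * (4/3) ^ j * E j))\<^sup>2)" by (rule Cauchy_Schwarz_ineq_sum)
  also have "(\<Sum>j\<le>k. (sqrt ((3/2) ^ j))\<^sup>2) = (\<Sum>j\<le>k. (3/2::real) ^ j)" by simp
  also have "(\<Sum>j\<le>k. (sqrt (2 * (4/3) ^ j * E j))\<^sup>2) = 2 * (\<Sum>j\<le>k. (4/3) ^ j * E j)"
    using E0 by (simp add: sum_distrib_left mult.assoc)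
  also have "(\<Sum>j\<le>k. (3/2::real) ^ j) * (2 * (\<Sum>j\<le>k. (4/3) ^ j * E j)) \<le> (3 * (3/2) ^ k) * (2 * (\<Sum>j\<le>k. (4/3) ^ j * E j))"
  proof (intro mult_right_mono mult_nonneg_nonneg sum_nonneg)
    show "(\<Sum>j\<le>k. (3/2::real) ^ j) \<le> 3 * (3/2) ^ k" by (induction k) auto
  qed (use E0 in auto)
  finally show ?thesis by simp
qed

text \<open>The decay \<open>2 ^ (- k)\<close> of the masses against the growth \<open>(3/2) ^ k\<close> of \<open>\<bar>f - c\<bar>\<^sup>2\<close> leaves \<open>(3/4) ^ k\<close>, and \<open>hardy_sum\<close>
  bounds the result by the whole energy.\<close>
lemma half_line:
  assumes f: "C1_line f f'" and [measurable]: "\<rho> \<in> borel_measurable borel" and \<rho>0: "\<And>x. 0 \<le> \<rho> x" and C: "C \<ge> 0"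
    and small: "\<And>k. (\<integral>\<^sup>+x. ennreal (\<rho> x) * indicator (K0 k) x \<partial>lborel) \<le> ennreal (2 * C * (1/2) ^ k)"
  shows "(\<integral>\<^sup>+x. ennreal (\<rho> x * (cmod (f x - avg {-1..1} f))\<^sup>2) * indicator {-1<..} x \<partial>lborel) \<le> ennreal (48 * C) * energy1 f' UNIV"
proof -
  define E where "E j = (LINT x:K0 j|lborel. (cmod (f' x))\<^sup>2)" for j
  define u where "u x = \<rho> x * (cmod (f x - avg {-1..1} f))\<^sup>2" for x
  have [measurable]: "f \<in> borel_measurable borel" "f' \<in> borel_measurable borel"
    using C1_line_cont[OF f] by (auto intro: borel_measurable_continuous_onI)
  have [measurable]: "u \<in> borel_measurable borel" unfolding u_def by measurable
  have [measurable]: "K0 j \<in> sets borel" for j by (simp add: K0_def)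
  have E0: "0 \<le> E j" for j unfolding E_def set_lebesgue_integral_def by (intro integral_nonneg_AE AE_I2) auto
  have Een: "ennreal (E j) = energy1 f' (K0 j)" for j unfolding E_def by (rule energy1_eq[OF f, symmetric]) (auto simp: K0_def)
  have disj: "disjoint_family K0" unfolding disjoint_family_on_def K0_def using dyad_disjoint by simp
  have one: "(\<integral>\<^sup>+x. ennreal (u x) * indicator (K0 k) x \<partial>lborel) \<le> ennreal (12 * C * ((3/4) ^ k * (\<Sum>j\<le>k. (4/3) ^ j * E j)))" for k
  proof -
    define A where "A = (\<Sum>j\<le>k. (4/3) ^ j * E j)"
    have A0: "A \<ge> 0" unfolding A_def using E0 by (intro sum_nonneg mult_nonneg_nonneg) auto
    have sub: "K0 k \<subseteq> {-1..2 ^ k}"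
    proof (cases k)
      case (Suc n)
      have "-1 \<le> (2::real) ^ n" using one_le_power[of "2::real" n] by linarith
      then show ?thesis unfolding Suc K0_Suc by auto
    qed (auto simp: K0_0)
    have "(\<integral>\<^sup>+x. ennreal (u x) * indicator (K0 k) x \<partial>lborel) \<le> (\<integral>\<^sup>+x. ennreal (6 * (3/2) ^ k * A) * (ennreal (\<rho> x) * indicator (K0 k) x) \<partial>lborel)"
    proof (rule nn_integral_mono)
      fix x
      have "u x \<le> 6 * (3/2) ^ k * A * \<rho> x" if "x \<in> K0 k"
      proof -
        have "\<rho> x * (cmod (f x - avg {-1..1} f))\<^sup>2 \<le> \<rho> x * (6 * (3/2) ^ k * A)"
            unfolding A_def E_def using that sub by (intro mult_left_mono dyadic_bound[OF f] \<rho>0) auto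
        then show ?thesis by (simp add: u_def mult.commute)
      qed
      then show "ennreal (u x) * indicator (K0 k) x \<le> ennreal (6 * (3/2) ^ k * A) * (ennreal (\<rho> x) * indicator (K0 k) x)"
        using A0 \<rho>0 by (auto simp: indicator_def ennreal_leI simp flip: ennreal_mult)
    qed
    also have "... = ennreal (6 * (3/2) ^ k * A) * (\<integral>\<^sup>+x. ennreal (\<rho> x) * indicator (K0 k) x \<partial>lborel)"
      by (intro nn_integral_cmult) measurable
    also have "... \<le> ennreal (6 * (3/2) ^ k * A) * ennreal (2 * C * (1/2) ^ k)"
      by (intro mult_left_mono small) auto
    also have "... = ennreal (12 * C * ((3/4) ^ k * A))"
    proof -
      have h: "(3/2::real) ^ k * (1/2) ^ k = (3/4) ^ k" by (simp flip: power_mult_distrib)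
      have "ennreal (6 * (3/2) ^ k * A) * ennreal (2 * C * (1/2) ^ k) = ennreal (6 * (3/2) ^ k * A * (2 * C * (1/2) ^ k))"
        using A0 by (intro ennreal_mult'[symmetric]) simp
      also have "6 * (3/2) ^ k * A * (2 * C * (1/2) ^ k) = 12 * C * (((3/2) ^ k * (1/2) ^ k) * A)" by (simp only: mult_ac)
      also have "... = 12 * C * ((3/4) ^ k * A)" unfolding h ..
      finally show ?thesis .
    qed
    finally show ?thesis by (simp add: A_def)
  qed
  have cover: "{-1<..} = (\<Union>k. K0 k)"
  proof (intro antisym subsetI)
    fix x :: real assume x: "x \<in> {-1<..}"
    show "x \<in> (\<Union>k. K0 k)"
    proof (cases "x \<le> 1")
      case False
      obtain n where n: "x \<le> 2 ^ n" using real_arch_pow[of 2 x] by (auto intro: less_imp_le)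
      define N where "N = (LEAST n. x \<le> 2 ^ n)"
      have N: "x \<le> 2 ^ N" unfolding N_def using n by (rule LeastI)
      obtain M where M: "N = Suc M" using N False by (cases N) auto
      have "\<not> x \<le> 2 ^ M" using not_less_Least[of M "\<lambda>n. x \<le> 2 ^ n"] M unfolding N_def by auto
      then have "x \<in> K0 (Suc M)" using N M by (auto simp: K0_Suc)
      then show ?thesis by blast
    qed (use x K0_0 in auto)
  next
    fix x assume "x \<in> (\<Union>k. K0 k)"
    then obtain k where k: "x \<in> K0 k" by blast
    show "x \<in> {-1<..}"
    proof (cases k)
      case (Suc n)
      then show ?thesis using k zero_le_power[of "2::real" n] by (auto simp: K0_Suc intro: less_le_trans[of "-1" 0] less_trans)
    qed (use k K0_0 in auto)
  qed
  have "(\<integral>\<^sup>+x. ennreal (u x) * indicator {-1<..} x \<partial>lborel) = (\<integral>\<^sup>+x. (\<Sum>k. ennreal (u x) * indicator (K0 k) x) \<partial>lborel)"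
    unfolding cover by (intro nn_integral_cong) (simp add: suminf_indicator[OF disj] ennreal_suminf_cmult)
  also have "... = (\<Sum>k. \<integral>\<^sup>+x. ennreal (u x) * indicator (K0 k) x \<partial>lborel)" by (intro nn_integral_suminf) measurable
  also have "... \<le> ennreal (48 * C) * energy1 f' UNIV"
  proof (rule suminf_le_const)
    fix N
    have "(\<Sum>k<N. \<integral>\<^sup>+x. ennreal (u x) * indicator (K0 k) x \<partial>lborel) \<le> (\<Sum>k\<le>N. \<integral>\<^sup>+x. ennreal (u x) * indicator (K0 k) x \<partial>lborel)"
      by (intro sum_mono2) auto
    also have "... \<le> (\<Sum>k\<le>N. ennreal (12 * C * ((3/4) ^ k * (\<Sum>j\<le>k. (4/3) ^ j * E j))))"
      by (intro sum_mono one)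
    also have "... = ennreal (12 * C * (\<Sum>k\<le>N. (3/4) ^ k * (\<Sum>j\<le>k. (4/3) ^ j * E j)))"
      unfolding sum_distrib_left using C E0 by (intro sum_ennreal mult_nonneg_nonneg sum_nonneg) (auto intro!: sum_nonneg mult_nonneg_nonneg simp flip: sum_distrib_left)
    also have "... \<le> ennreal (12 * C * (4 * (\<Sum>j\<le>N. E j)))"
      unfolding hardy_sum using C E0 by (intro ennreal_leI mult_left_mono) (auto intro!: sum_nonneg mult_nonneg_nonneg)
    also have "... = ennreal (48 * C) * ennreal (\<Sum>j\<le>N. E j)" using C by (simp add: mult.assoc flip: ennreal_mult')
    also have "ennreal (\<Sum>j\<le>N. E j) = (\<Sum>j\<le>N. energy1 f' (K0 j))" using E0 by (simp add: Een[symmetric])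
    also have "... = (\<integral>\<^sup>+x. (\<Sum>j\<le>N. ennreal ((cmod (f' x))\<^sup>2) * indicator (K0 j) x) \<partial>lborel)" by (intro nn_integral_sum[symmetric]) measurable
    also have "... \<le> energy1 f' UNIV"
    proof (rule nn_integral_mono)
      fix x
      have "(\<Sum>j\<le>N. indicator (K0 j) x :: ennreal) \<le> (\<Sum>j. indicator (K0 j) x)" by (intro sum_le_suminf) auto
      also have "... \<le> 1" unfolding suminf_indicator[OF disj] by (simp add: indicator_def)
      finally have "ennreal ((cmod (f' x))\<^sup>2) * (\<Sum>j\<le>N. indicator (K0 j) x) \<le> ennreal ((cmod (f' x))\<^sup>2) * 1" by (intro mult_left_mono) auto
      then show "(\<Sum>j\<le>N. ennreal ((cmod (f' x))\<^sup>2) * indicator (K0 j) x) \<le> ennreal ((cmod (f' x))\<^sup>2) * indicator UNIV x"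
        by (simp add: sum_distrib_left)
    qed
    finally show "(\<Sum>k<N. \<integral>\<^sup>+x. ennreal (u x) * indicator (K0 k) x \<partial>lborel) \<le> ennreal (48 * C) * energy1 f' UNIV"
      by (simp add: mult_left_mono)
  qed auto
  finally show ?thesis unfolding u_def .
qed

lemma C1_line_reflect: "C1_line f f' \<Longrightarrow> C1_line (\<lambda>x. f (- x)) (\<lambda>x. - f' (- x))"
proof -
  assume f: "C1_line f f'"
  have "((\<lambda>x. f (- x)) has_vector_derivative - f' (- x)) (at x)" for x
  proof -
    have "(uminus has_vector_derivative (- 1 :: real)) (at x)"
      using has_vector_derivative_minus[OF has_vector_derivative_id, of "at x"] by simp
    from vector_diff_chain_at[OF this, of f "f' (- x)"] f show ?thesis by (simp add: C1_line_def o_def)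
  qed
  moreover have "continuous_on UNIV (\<lambda>x. - f' (- x))"
    using f unfolding C1_line_def
    by (intro continuous_on_minus continuous_on_compose2[of UNIV f' UNIV uminus]) (auto intro!: continuous_intros)
  ultimately show ?thesis by (simp add: C1_line_def)
qed

lemma nn_integral_reflect:
  fixes g :: "real \<Rightarrow> ennreal"
  assumes "g \<in> borel_measurable borel"
  shows "(\<integral>\<^sup>+x. g (- x) \<partial>lborel) = (\<integral>\<^sup>+x. g x \<partial>lborel)"
  using nn_integral_real_affine[of g "-1" 0] assms by simp

lemma avg_reflect:
  shows "avg {-1..1} (\<lambda>x. f (- x)) = avg {-1..1::real} f"
proof -
  have "(LINT x:{-1..1}|lborel. f (- x)) = (LINT x:{-1..1}|lborel. f x)"
    using lborel_integral_real_affine[of "-1" "\<lambda>x. indicator {-1..1} x *\<^sub>R f x" 0]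
    unfolding set_lebesgue_integral_def
    by (simp, intro Bochner_Integration.integral_cong) (auto simp: indicator_def)
  then show ?thesis by (simp add: avg_def)
qed

text \<open>The two half lines share the average over \<open>[-1, 1]\<close>; the left one is reflected.\<close>
lemma whole_line:
  assumes f: "C1_line f f'" and [measurable]: "\<rho> \<in> borel_measurable borel" and \<rho>0: "\<And>x. 0 \<le> \<rho> x" and C: "C \<ge> 0"
    and small: "\<And>k. (\<integral>\<^sup>+x. ennreal (\<rho> x) * indicator (dyad k) x \<partial>lborel) \<le> ennreal (2 * C * (1/2) ^ nat \<bar>k\<bar>)"
  shows "(\<integral>\<^sup>+x. ennreal (\<rho> x * (cmod (f x - avg {-1..1} f))\<^sup>2) \<partial>lborel) \<le> ennreal (96 * C) * energy1 f' UNIV"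
proof -
  define u where "u x = \<rho> x * (cmod (f x - avg {-1..1} f))\<^sup>2" for x
  have [measurable]: "f \<in> borel_measurable borel" "f' \<in> borel_measurable borel"
    using C1_line_cont[OF f] by (auto intro: borel_measurable_continuous_onI)
  have um [measurable]: "u \<in> borel_measurable borel" unfolding u_def by measurable
  have R: "(\<integral>\<^sup>+x. ennreal (u x) * indicator {-1<..} x \<partial>lborel) \<le> ennreal (48 * C) * energy1 f' UNIV"
    unfolding u_def using small[of "int _"] by (intro half_line[OF f _ \<rho>0 C]) (auto simp: K0_def)
  have Lk: "(\<integral>\<^sup>+x. ennreal (\<rho> (- x)) * indicator (K0 k) x \<partial>lborel) \<le> ennreal (2 * C * (1/2) ^ k)" for k
  proof -
    have "(\<integral>\<^sup>+x. ennreal (\<rho> (- x)) * indicator (K0 k) x \<partial>lborel) = (\<integral>\<^sup>+x. (\<lambda>x. ennreal (\<rho> x) * indicator (K0 k) (- x)) (- x) \<partial>lborel)" by simp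
    also have "... = (\<integral>\<^sup>+x. ennreal (\<rho> x) * indicator (K0 k) (- x) \<partial>lborel)"
    proof (rule nn_integral_reflect)
      have [measurable]: "(\<lambda>x. indicator (K0 k) (- x) :: ennreal) \<in> borel_measurable borel"
      proof -
        have "uminus -` K0 k \<in> sets borel" using measurable_sets_borel[of uminus borel "K0 k"] by (simp add: K0_def)
        moreover have "(\<lambda>x. indicator (K0 k) (- x) :: ennreal) = indicator (uminus -` K0 k)" by (auto simp: indicator_def fun_eq_iff)
        ultimately show ?thesis by simp
      qed
      show "(\<lambda>x. ennreal (\<rho> x) * indicator (K0 k) (- x)) \<in> borel_measurable borel" by measurable
    qed
    also have "... = (\<integral>\<^sup>+x. ennreal (\<rho> x) * indicator (dyad (- int k)) x \<partial>lborel)"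
    proof (rule nn_integral_cong_AE, use AE_lborel_singleton[of "dyad_end (- int k)"] AE_lborel_singleton[of "dyad_end (- int k - 1)"] in eventually_elim)
      fix x assume "x \<noteq> dyad_end (- int k)" "x \<noteq> dyad_end (- int k - 1)"
      then have "- x \<in> K0 k \<longleftrightarrow> x \<in> dyad (- int k)"
        by (cases k) (auto simp: K0_0 K0_Suc dyad_def dyad_end_def nat_add_distrib Suc_nat_eq_nat_zadd1)
      then show "ennreal (\<rho> x) * indicator (K0 k) (- x) = ennreal (\<rho> x) * indicator (dyad (- int k)) x" by (simp add: indicator_def)
    qed
    also have "... \<le> ennreal (2 * C * (1/2) ^ k)" using small[of "- int k"] by simp
    finally show ?thesis .
  qed
  have "(\<integral>\<^sup>+x. ennreal (\<rho> (- x) * (cmod (f (- x) - avg {-1..1} (\<lambda>x. f (- x))))\<^sup>2) * indicator {-1<..} x \<partial>lborel)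
      \<le> ennreal (48 * C) * energy1 (\<lambda>x. - f' (- x)) UNIV"
    by (rule half_line[OF C1_line_reflect[OF f] _ _ C Lk]) (auto simp: \<rho>0)
  also have "energy1 (\<lambda>x. - f' (- x)) UNIV = energy1 f' UNIV"
    using nn_integral_reflect[of "\<lambda>x. ennreal ((cmod (f' x))\<^sup>2) * indicator UNIV x"] by simp
  finally have "(\<integral>\<^sup>+x. ennreal (u (- x)) * indicator {-1<..} x \<partial>lborel) \<le> ennreal (48 * C) * energy1 f' UNIV"
    by (simp add: avg_reflect u_def)
  moreover have "(\<integral>\<^sup>+x. ennreal (u (- x)) * indicator {-1<..} x \<partial>lborel) = (\<integral>\<^sup>+x. ennreal (u x) * indicator {..<1} x \<partial>lborel)"
  proof -
    have "(\<integral>\<^sup>+x. ennreal (u (- x)) * indicator {-1<..} x \<partial>lborel) = (\<integral>\<^sup>+x. (\<lambda>x. ennreal (u x) * indicator {..<1} x) (- x) \<partial>lborel)"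
      by (intro nn_integral_cong) (auto simp: indicator_def)
    also have "... = (\<integral>\<^sup>+x. ennreal (u x) * indicator {..<1} x \<partial>lborel)" by (rule nn_integral_reflect) measurable
    finally show ?thesis .
  qed
  ultimately have L: "(\<integral>\<^sup>+x. ennreal (u x) * indicator {..<1} x \<partial>lborel) \<le> ennreal (48 * C) * energy1 f' UNIV" by simp
  have "(\<integral>\<^sup>+x. ennreal (u x) \<partial>lborel) \<le> (\<integral>\<^sup>+x. ennreal (u x) * indicator {-1<..} x + ennreal (u x) * indicator {..<1} x \<partial>lborel)"
    by (intro nn_integral_mono) (auto simp: indicator_def)
  also have "... = (\<integral>\<^sup>+x. ennreal (u x) * indicator {-1<..} x \<partial>lborel) + (\<integral>\<^sup>+x. ennreal (u x) * indicator {..<1} x \<partial>lborel)"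
    by (intro nn_integral_add) measurable
  also have "... \<le> ennreal (48 * C) * energy1 f' UNIV + ennreal (48 * C) * energy1 f' UNIV" by (intro add_mono R L)
  also have "... = ennreal (96 * C) * energy1 f' UNIV" using C by (simp flip: distrib_right ennreal_plus)
  finally show ?thesis unfolding u_def .
qed


text \<open>The analogue of \<open>controlled\<close> for functions on the line.\<close>
definition controlled_line :: "(real \<Rightarrow> real) \<Rightarrow> real \<Rightarrow> nat \<Rightarrow> real set \<Rightarrow> bool" where
  "controlled_line \<rho> \<kappa> n X \<longleftrightarrow> (\<exists>P j. (\<forall>i<n. P i \<in> sets borel \<and> bounded (P i) \<and> measure lborel (P i) > 0) \<and>
     j \<in> measurable borel (count_space UNIV) \<and> (\<forall>x\<in>X. j x < n) \<and>
     (\<forall>f f'. C1_line f f' \<longrightarrow> (\<integral>\<^sup>+x. ennreal (\<rho> x * (cmod (f x - avg (P (j x)) f))\<^sup>2) * indicator X x \<partial>lborel) \<le> ennreal \<kappa> * energy1 f' X))"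

lemma controlled_line_Un:
  assumes X: "controlled_line \<rho> \<kappa> n X" and Y: "controlled_line \<rho> \<kappa> m Y" and XY: "X \<inter> Y = {}"
    and [measurable]: "X \<in> sets borel" "Y \<in> sets borel" "\<rho> \<in> borel_measurable borel"
  shows "controlled_line \<rho> \<kappa> (n + m) (X \<union> Y)"
proof -
  obtain B j where Bj: "\<And>i. i < n \<Longrightarrow> B i \<in> sets borel \<and> bounded (B i) \<and> measure lborel (B i) > 0" "j \<in> measurable borel (count_space UNIV)" "\<And>z. z \<in> X \<Longrightarrow> j z < n"
     "\<And>f f'. C1_line f f' \<Longrightarrow> (\<integral>\<^sup>+x. ennreal (\<rho> x * (cmod (f x - avg (B (j x)) f))\<^sup>2) * indicator X x \<partial>lborel) \<le> ennreal \<kappa> * energy1 f' X"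
    using X unfolding controlled_line_def by blast
  obtain B' j' where Bj': "\<And>i. i < m \<Longrightarrow> B' i \<in> sets borel \<and> bounded (B' i) \<and> measure lborel (B' i) > 0" "j' \<in> measurable borel (count_space UNIV)" "\<And>z. z \<in> Y \<Longrightarrow> j' z < m"
     "\<And>f f'. C1_line f f' \<Longrightarrow> (\<integral>\<^sup>+x. ennreal (\<rho> x * (cmod (f x - avg (B' (j' x)) f))\<^sup>2) * indicator Y x \<partial>lborel) \<le> ennreal \<kappa> * energy1 f' Y"
    using Y unfolding controlled_line_def by blast
  note [measurable] = Bj(2) Bj'(2)
  define C where "C i = (if i < n then B i else B' (i - n))" for i
  define k where "k z = (if z \<in> X then j z else n + j' z)" for z
  have km [measurable]: "k \<in> measurable borel (count_space UNIV)" unfolding k_def by measurable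
  show ?thesis
    unfolding controlled_line_def
  proof (intro exI conjI allI impI ballI)
    fix f f' assume f: "C1_line f f'"
    have [measurable]: "f \<in> borel_measurable borel" "f' \<in> borel_measurable borel"
      using C1_line_cont[OF f] by (auto intro: borel_measurable_continuous_onI)
    let ?d = "\<lambda>\<Phi> X. (\<integral>\<^sup>+x. ennreal (\<rho> x * (cmod (f x - \<Phi> x))\<^sup>2) * indicator X x \<partial>lborel)"
    have "?d (\<lambda>z. avg (C (k z)) f) (X \<union> Y) = ?d (\<lambda>z. avg (C (k z)) f) X + ?d (\<lambda>z. avg (C (k z)) f) Y"
      using XY by (subst nn_integral_add[symmetric]) (auto intro!: nn_integral_cong simp: indicator_def)
    also have "?d (\<lambda>z. avg (C (k z)) f) X = ?d (\<lambda>z. avg (B (j z)) f) X"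
      using Bj(3) by (intro nn_integral_cong) (auto simp: indicator_def k_def C_def)
    also have "?d (\<lambda>z. avg (C (k z)) f) Y = ?d (\<lambda>z. avg (B' (j' z)) f) Y"
      using XY by (intro nn_integral_cong) (auto simp: indicator_def k_def C_def)
    also have "?d (\<lambda>z. avg (B (j z)) f) X + ?d (\<lambda>z. avg (B' (j' z)) f) Y \<le> ennreal \<kappa> * energy1 f' X + ennreal \<kappa> * energy1 f' Y"
      by (intro add_mono Bj(4) Bj'(4) f)
    also have "... = ennreal \<kappa> * (energy1 f' X + energy1 f' Y)" by (simp add: distrib_left)
    also have "energy1 f' X + energy1 f' Y = energy1 f' (X \<union> Y)"
      using XY by (subst nn_integral_add[symmetric]) (auto intro!: nn_integral_cong simp: indicator_def)
    finally show "?d (\<lambda>z. avg (C (k z)) f) (X \<union> Y) \<le> ennreal \<kappa> * energy1 f' (X \<union> Y)" .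
  next
    show "C i \<in> sets borel" "bounded (C i)" "measure lborel (C i) > 0" if "i < n + m" for i
      using that Bj(1)[of i] Bj'(1)[of "i - n"] by (auto simp: C_def)
    show "k z < n + m" if "z \<in> X \<union> Y" for z using that Bj(3)[of z] Bj'(3)[of z] by (auto simp: k_def)
  qed (rule km)
qed

lemma controlled_line_empty: "controlled_line \<rho> \<kappa> 0 {}"
  unfolding controlled_line_def by (auto intro!: exI[of _ "\<lambda>_. 0"])

text \<open>In the application \<open>\<rho> x\<close> is the integral of \<open>V(x, y) s(y)\<^sup>2\<close> over \<open>y\<close>.\<close>
locale weight =
  fixes \<rho> :: "real \<Rightarrow> real" and \<kappa> :: real
  assumes \<kappa>: "\<kappa> > 0" and \<rho>m [measurable]: "\<rho> \<in> borel_measurable borel" and \<rho>0: "\<And>x. 0 \<le> \<rho> x"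
    and \<rho>i: "\<And>S. S \<in> sets borel \<Longrightarrow> bounded S \<Longrightarrow> set_integrable lborel S \<rho>"
begin

definition mass :: "real set \<Rightarrow> real" where "mass S = (LINT x:S|lborel. \<rho> x)"

lemma mass_nonneg: "0 \<le> mass S"
  unfolding mass_def set_lebesgue_integral_def using \<rho>0 by (intro integral_nonneg_AE AE_I2) auto

lemma mass_nn: "S \<in> sets borel \<Longrightarrow> bounded S \<Longrightarrow> (\<integral>\<^sup>+x. ennreal (\<rho> x) * indicator S x \<partial>lborel) = ennreal (mass S)"
  unfolding mass_def using \<rho>i[of S] \<rho>0 unfolding set_integrable_def set_lebesgue_integral_def
  by (subst nn_integral_eq_integral[symmetric]) (auto intro!: nn_integral_cong AE_I2 simp: indicator_def)

lemma mass_split: "a \<le> x \<Longrightarrow> x \<le> b \<Longrightarrow> mass {a<..b} = mass {a<..x} + mass {x<..b}"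
proof -
  assume "a \<le> x" "x \<le> b"
  then have "{a<..b} = {a<..x} \<union> {x<..b}" "{a<..x} \<inter> {x<..b} = {}" by auto
  then show ?thesis unfolding mass_def by (simp add: set_integral_Un \<rho>i)
qed

lemma mass_IVT:
  assumes "a < b" "0 < \<delta>" "\<delta> < mass {a<..b}"
  obtains x where "a < x" "x < b" "mass {a<..x} = \<delta>"
proof -
  have int: "\<rho> integrable_on {a..b}" by (rule set_borel_integral_eq_integral(1)[OF \<rho>i]) auto
  have eq: "mass {a<..x} = integral {a..x} \<rho>" for x
  proof -
    have "mass {a<..x} = integral {a<..x} \<rho>" unfolding mass_def by (rule set_borel_integral_eq_integral(2)[OF \<rho>i]) auto
    also have "... = integral {a..x} \<rho>"
    proof (rule integral_spike_set)
      show "negligible {y \<in> {a<..x} - {a..x}. \<rho> y \<noteq> 0}" by (rule negligible_subset[of "{}"]) auto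
      show "negligible {y \<in> {a..x} - {a<..x}. \<rho> y \<noteq> 0}" by (rule negligible_subset[of "{a}"]) auto
    qed
    finally show ?thesis .
  qed
  have "continuous_on {a..b} (\<lambda>x. integral {a..x} \<rho>)" by (rule indefinite_integral_continuous_1[OF int])
  then obtain x where x: "a \<le> x" "x \<le> b" "integral {a..x} \<rho> = \<delta>"
    using IVT'[of "\<lambda>x. integral {a..x} \<rho>" a \<delta> b] assms eq by auto
  have "x \<noteq> a" using x assms by auto
  moreover have "x \<noteq> b" using x assms eq by auto
  ultimately show thesis using that[of x] x eq by auto
qed

lemma single_interval:
  assumes ab: "a < b" and small: "(b - a) * mass {a<..b} \<le> \<kappa>"
  shows "controlled_line \<rho> \<kappa> 1 {a<..b}"
  unfolding controlled_line_def
proof (intro exI[of _ "\<lambda>_. {a<..b}"] exI[of _ "\<lambda>_. 0"] conjI allI impI ballI)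
  fix f f' assume f: "C1_line f f'"
  define E where "E = (LINT x:{a<..b}|lborel. (cmod (f' x))\<^sup>2)"
  have E0: "E \<ge> 0" unfolding E_def set_lebesgue_integral_def by (intro integral_nonneg_AE AE_I2) auto
  have pt: "(cmod (f x - avg {a<..b} f))\<^sup>2 \<le> (b - a) * E" if "x \<in> {a<..b}" for x
  proof -
    have "cmod (f x - avg {a<..b} f) \<le> (LINT x:{a<..b}|lborel. cmod (f' x))"
      using that ab by (intro dev_mean_le[OF f]) auto
    then have "(cmod (f x - avg {a<..b} f))\<^sup>2 \<le> (LINT x:{a<..b}|lborel. cmod (f' x))\<^sup>2" by (intro power_mono) auto
    also have "... \<le> (b - a) * E" unfolding E_def by (rule l1_le_l2[OF f ab])
    finally show ?thesis .
  qed
  have "(\<integral>\<^sup>+x. ennreal (\<rho> x * (cmod (f x - avg {a<..b} f))\<^sup>2) * indicator {a<..b} x \<partial>lborel)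
    \<le> (\<integral>\<^sup>+x. ennreal ((b - a) * E) * (ennreal (\<rho> x) * indicator {a<..b} x) \<partial>lborel)"
  proof (rule nn_integral_mono)
    fix x
    have "\<rho> x * (cmod (f x - avg {a<..b} f))\<^sup>2 \<le> (b - a) * E * \<rho> x" if "x \<in> {a<..b}"
      using mult_left_mono[OF pt[OF that] \<rho>0[of x]] by (simp add: mult.commute)
    then show "ennreal (\<rho> x * (cmod (f x - avg {a<..b} f))\<^sup>2) * indicator {a<..b} x \<le> ennreal ((b - a) * E) * (ennreal (\<rho> x) * indicator {a<..b} x)"
      using E0 ab \<rho>0 by (auto simp: indicator_def ennreal_leI simp flip: ennreal_mult)
  qed
  also have "... = ennreal ((b - a) * E) * (\<integral>\<^sup>+x. ennreal (\<rho> x) * indicator {a<..b} x \<partial>lborel)"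
    by (intro nn_integral_cmult) measurable
  also have "... = ennreal ((b - a) * mass {a<..b} * E)"
    using E0 ab mass_nonneg by (subst mass_nn) (auto simp: mult_ac simp flip: ennreal_mult)
  also have "... \<le> ennreal (\<kappa> * E)" using small E0 by (intro ennreal_leI mult_right_mono)
  also have "... = ennreal \<kappa> * energy1 f' {a<..b}" using \<kappa> by (simp add: energy1_eq[OF f] E_def ennreal_mult')
  finally show "(\<integral>\<^sup>+x. ennreal (\<rho> x * (cmod (f x - avg {a<..b} f))\<^sup>2) * indicator {a<..b} x \<partial>lborel) \<le> ennreal \<kappa> * energy1 f' {a<..b}" .
qed (use ab in auto)

text \<open>Cut off pieces of mass exactly \<open>\<delta>\<close>. This is possible because \<open>mass\<close> has no atoms.\<close>
lemma split_by_mass: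
  assumes "0 < \<delta>" "\<delta> * len \<le> \<kappa>"
  shows "a < b \<Longrightarrow> b - a \<le> len \<Longrightarrow> mass {a<..b} \<le> real m * \<delta> \<Longrightarrow> \<exists>n. controlled_line \<rho> \<kappa> n {a<..b} \<and> real n \<le> 1 + mass {a<..b} / \<delta>"
proof (induction m arbitrary: a)
  case 0
  then have "mass {a<..b} = 0" using mass_nonneg[of "{a<..b}"] by simp
  then show ?case using single_interval[of a b] 0 \<kappa> by (intro exI[of _ 1]) auto
next
  case (Suc m)
  show ?case
  proof (cases "mass {a<..b} \<le> \<delta>")
    case True
    have "(b - a) * mass {a<..b} \<le> len * \<delta>" using True Suc mass_nonneg[of "{a<..b}"] assms by (intro mult_mono) auto
    then show ?thesis using single_interval[of a b] Suc assms mass_nonneg[of "{a<..b}"] by (intro exI[of _ 1]) (auto simp: mult.commute)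
  next
    case False
    then obtain x where x: "a < x" "x < b" "mass {a<..x} = \<delta>" using mass_IVT[of a b \<delta>] Suc assms by auto
    have sp: "mass {a<..b} = \<delta> + mass {x<..b}" using mass_split[of a x b] x by simp
    have "mass {x<..b} \<le> real m * \<delta>" using Suc.prems(3) sp by (simp add: algebra_simps)
    then obtain n where n: "controlled_line \<rho> \<kappa> n {x<..b}" "real n \<le> 1 + mass {x<..b} / \<delta>"
      using Suc.IH[of x] x Suc.prems by auto
    have "(x - a) * mass {a<..x} \<le> len * \<delta>" using x Suc.prems assms by (intro mult_mono) auto
    also have "... \<le> \<kappa>" using assms by (simp add: mult.commute)
    finally have "controlled_line \<rho> \<kappa> 1 {a<..x}" using x(1) by (intro single_interval)
    then have "controlled_line \<rho> \<kappa> (1 + n) ({a<..x} \<union> {x<..b})" using n by (intro controlled_line_Un) auto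
    moreover have "{a<..x} \<union> {x<..b} = {a<..b}" using x by auto
    moreover have "real (1 + n) \<le> 1 + mass {a<..b} / \<delta>" using n(2) assms(1) unfolding sp by (simp add: add_divide_distrib)
    ultimately show ?thesis by auto
  qed
qed

lemma split_by_length:
  assumes "0 < \<delta>" "0 < len" "\<delta> * len \<le> \<kappa>"
  shows "a < b \<Longrightarrow> b - a \<le> real (Suc m) * len \<Longrightarrow> \<exists>n. controlled_line \<rho> \<kappa> n {a<..b} \<and> real n \<le> real (Suc m) + mass {a<..b} / \<delta>"
proof (induction m arbitrary: a)
  case 0
  obtain k :: nat where "mass {a<..b} / \<delta> \<le> real k" using real_arch_simple by blast
  then have "mass {a<..b} \<le> real k * \<delta>" using assms by (simp add: field_simps)
  then show ?case using split_by_mass[OF assms(1,3), of a b k] 0 by auto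
next
  case (Suc m)
  show ?case
  proof (cases "b - a \<le> len")
    case True
    then have "b - a \<le> real (Suc 0) * len" by simp
    obtain k :: nat where "mass {a<..b} / \<delta> \<le> real k" using real_arch_simple by blast
    then have "mass {a<..b} \<le> real k * \<delta>" using assms by (simp add: field_simps)
    then obtain n where "controlled_line \<rho> \<kappa> n {a<..b}" "real n \<le> 1 + mass {a<..b} / \<delta>"
      using split_by_mass[OF assms(1,3), of a b k] Suc.prems True by auto
    then show ?thesis by (intro exI[of _ n]) auto
  next
    case False
    define x where "x = a + len"
    have x: "a < x" "x < b" using False assms by (auto simp: x_def)
    obtain k :: nat where "mass {a<..x} / \<delta> \<le> real k" using real_arch_simple by blast
    then have "mass {a<..x} \<le> real k * \<delta>" using assms by (simp add: field_simps)
    then obtain n1 where n1: "controlled_line \<rho> \<kappa> n1 {a<..x}" "real n1 \<le> 1 + mass {a<..x} / \<delta>"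
      using split_by_mass[OF assms(1,3), of a x k] x by (auto simp: x_def)
    have "b - x \<le> real (Suc m) * len" using Suc.prems by (simp add: x_def algebra_simps)
    then obtain n2 where n2: "controlled_line \<rho> \<kappa> n2 {x<..b}" "real n2 \<le> real (Suc m) + mass {x<..b} / \<delta>"
      using Suc.IH[of x] x by auto
    have "controlled_line \<rho> \<kappa> (n1 + n2) ({a<..x} \<union> {x<..b})" using n1 n2 by (intro controlled_line_Un) auto
    moreover have "{a<..x} \<union> {x<..b} = {a<..b}" using x by auto
    moreover have "real (n1 + n2) \<le> real (Suc (Suc m)) + mass {a<..b} / \<delta>"
      using n1(2) n2(2) mass_split[of a x b] x by (simp add: add_divide_distrib)
    ultimately show ?thesis by (intro exI[of _ "n1 + n2"]) auto
  qed
qed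

text \<open>About \<open>sqrt (B / \<kappa>)\<close> pieces of equal length, further divided into pieces of equal mass, balance the two contributions to the count.\<close>
lemma interval_ctrl:
  assumes ab: "a < b" and B: "(b - a) * mass {a<..b} \<le> B"
  shows "\<exists>n. controlled_line \<rho> \<kappa> n {a<..b} \<and> real n \<le> 2 * sqrt (B / \<kappa>) + 2"
proof -
  have B0: "0 \<le> B" using B mass_nonneg[of "{a<..b}"] ab by (smt (verit) mult_nonneg_nonneg)
  define m where "m = nat \<lceil>sqrt (B / \<kappa>)\<rceil>"
  have s0: "0 \<le> sqrt (B / \<kappa>)" using B0 \<kappa> by simp
  have m: "sqrt (B / \<kappa>) \<le> real (Suc m)" "real (Suc m) \<le> sqrt (B / \<kappa>) + 2"
    unfolding m_def using s0 by linarith+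
  define len where "len = (b - a) / real (Suc m)"
  have len: "0 < len" "b - a = real (Suc m) * len" using ab by (auto simp: len_def)
  obtain n where n: "controlled_line \<rho> \<kappa> n {a<..b}" "real n \<le> real (Suc m) + mass {a<..b} / (\<kappa> / len)"
    using split_by_length[of "\<kappa> / len" len a b m] len \<kappa> ab by auto
  have "mass {a<..b} / (\<kappa> / len) = ((b - a) * mass {a<..b}) / (\<kappa> * real (Suc m))"
    using len(1) \<kappa> by (simp add: len_def field_simps)
  also have "... \<le> B / (\<kappa> * real (Suc m))" using B \<kappa> by (intro divide_right_mono) auto
  also have "... = (B / \<kappa>) / real (Suc m)" by simp
  also have "... \<le> sqrt (B / \<kappa>)"
  proof -
    have "B / \<kappa> = sqrt (B / \<kappa>) * sqrt (B / \<kappa>)" using B0 \<kappa> by simp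
    also have "... \<le> sqrt (B / \<kappa>) * real (Suc m)" using m s0 by (intro mult_left_mono) auto
    finally show ?thesis by (subst pos_divide_le_eq) auto
  qed
  finally show ?thesis using n m by (intro exI[of _ n]) auto
qed

text \<open>The heavy intervals are treated by \<open>interval_ctrl\<close>. For the rest of the line the weight is replaced by \<open>0\<close> on the heavy intervals, and
  the average over \<open>[-1, 1]\<close> is used everywhere.\<close>
theorem longitudinal:
  assumes fin: "finite Bd" and C: "C \<ge> 0" "96 * C \<le> \<kappa>"
    and good: "\<And>k. k \<notin> Bd \<Longrightarrow> mass (dyad k) \<le> 2 * C * (1/2) ^ nat \<bar>k\<bar>"
    and bad: "\<And>k. k \<in> Bd \<Longrightarrow> (dyad_end k - dyad_end (k - 1)) * mass (dyad k) \<le> B k"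
  shows "\<exists>n P j. real n \<le> 1 + (\<Sum>k\<in>Bd. 2 * sqrt (B k / \<kappa>) + 2) \<and>
    (\<forall>i<n. P i \<in> sets borel \<and> bounded (P i) \<and> measure lborel (P i) > 0) \<and>
     j \<in> measurable borel (count_space UNIV) \<and> (\<forall>x. j x < n) \<and>
     (\<forall>f f'. C1_line f f' \<longrightarrow> (\<integral>\<^sup>+x. ennreal (\<rho> x * (cmod (f x - avg (P (j x)) f))\<^sup>2) \<partial>lborel) \<le> ennreal (2 * \<kappa>) * energy1 f' UNIV)"
proof -
  define X where "X = (\<Union>k\<in>Bd. dyad k)"
  have Xm [measurable]: "X \<in> sets borel" unfolding X_def using fin by (intro sets.finite_UN) auto
  have "\<exists>n. controlled_line \<rho> \<kappa> n (\<Union>k\<in>Bd. dyad k) \<and> real n \<le> (\<Sum>k\<in>Bd. 2 * sqrt (B k / \<kappa>) + 2)"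
    using fin bad
  proof (induction Bd rule: finite_induct)
    case empty
    show ?case using controlled_line_empty by auto
  next
    case (insert k S)
    then obtain n where n: "controlled_line \<rho> \<kappa> n (\<Union>k\<in>S. dyad k)" "real n \<le> (\<Sum>k\<in>S. 2 * sqrt (B k / \<kappa>) + 2)" by auto
    obtain n' where n': "controlled_line \<rho> \<kappa> n' (dyad k)" "real n' \<le> 2 * sqrt (B k / \<kappa>) + 2"
      using interval_ctrl[OF dyad_end_less[of k]] insert.prems[of k] unfolding dyad_def by auto
    have "dyad k \<inter> dyad k' = {}" if "k' \<in> S" for k' using dyad_disjoint[of k k'] that insert.hyps by metis
    then have "dyad k \<inter> (\<Union>k\<in>S. dyad k) = {}" by blast
    then have "controlled_line \<rho> \<kappa> (n' + n) (dyad k \<union> (\<Union>k\<in>S. dyad k))"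
      using n n' insert.hyps by (intro controlled_line_Un) (auto intro!: sets.finite_UN)
    then show ?case using n n' insert.hyps by (intro exI[of _ "n' + n"]) auto
  qed
  then obtain n where n: "real n \<le> (\<Sum>k\<in>Bd. 2 * sqrt (B k / \<kappa>) + 2)" and ctrl: "controlled_line \<rho> \<kappa> n X" unfolding X_def by blast
  from ctrl obtain B' j' where True
     and Bj': "\<And>i. i < n \<Longrightarrow> B' i \<in> sets borel \<and> bounded (B' i) \<and> measure lborel (B' i) > 0" "j' \<in> measurable borel (count_space UNIV)" "\<And>z. z \<in> X \<Longrightarrow> j' z < n"
     "\<And>f f'. C1_line f f' \<Longrightarrow> (\<integral>\<^sup>+x. ennreal (\<rho> x * (cmod (f x - avg (B' (j' x)) f))\<^sup>2) * indicator X x \<partial>lborel) \<le> ennreal \<kappa> * energy1 f' X"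
    unfolding controlled_line_def by blast
  note [measurable] = Bj'(2)
  define P where "P i = (if i < n then B' i else {-1..1})" for i
  define j where "j x = (if x \<in> X then j' x else n)" for x
  have jm [measurable]: "j \<in> measurable borel (count_space UNIV)" unfolding j_def by measurable
  have "(\<integral>\<^sup>+x. ennreal (\<rho> x * (cmod (f x - avg (P (j x)) f))\<^sup>2) \<partial>lborel) \<le> ennreal (2 * \<kappa>) * energy1 f' UNIV" if f: "C1_line f f'" for f f'
  proof -
    have [measurable]: "f \<in> borel_measurable borel" "f' \<in> borel_measurable borel"
      using C1_line_cont[OF f] by (auto intro: borel_measurable_continuous_onI)
    define \<rho>' where "\<rho>' x = indicator (- X) x * \<rho> x" for x
    have small: "(\<integral>\<^sup>+x. ennreal (\<rho>' x) * indicator (dyad k) x \<partial>lborel) \<le> ennreal (2 * C * (1/2) ^ nat \<bar>k\<bar>)" for k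
    proof (cases "k \<in> Bd")
      case True
      then have "ennreal (\<rho>' x) * indicator (dyad k) x = 0" for x by (auto simp: \<rho>'_def X_def indicator_def)
      then show ?thesis by (simp only: nn_integral_const mult_zero_left zero_le)
    next
      case False
      have "(\<integral>\<^sup>+x. ennreal (\<rho>' x) * indicator (dyad k) x \<partial>lborel) \<le> (\<integral>\<^sup>+x. ennreal (\<rho> x) * indicator (dyad k) x \<partial>lborel)"
        by (intro nn_integral_mono) (auto simp: \<rho>'_def indicator_def)
      also have "... \<le> ennreal (2 * C * (1/2) ^ nat \<bar>k\<bar>)" using good[OF False] by (simp add: mass_nn ennreal_leI)
      finally show ?thesis .
    qed
    have "(\<integral>\<^sup>+x. ennreal (\<rho>' x * (cmod (f x - avg {-1..1} f))\<^sup>2) \<partial>lborel) \<le> ennreal (96 * C) * energy1 f' UNIV"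
      using \<rho>0 by (intro whole_line[OF f _ _ C(1) small]) (auto simp: \<rho>'_def)
    also have "... \<le> ennreal \<kappa> * energy1 f' UNIV" using C by (intro mult_right_mono ennreal_leI) auto
    finally have good': "(\<integral>\<^sup>+x. ennreal (\<rho>' x * (cmod (f x - avg {-1..1} f))\<^sup>2) \<partial>lborel) \<le> ennreal \<kappa> * energy1 f' UNIV" .
    have "ennreal \<kappa> * energy1 f' X \<le> ennreal \<kappa> * energy1 f' UNIV" by (intro mult_left_mono nn_integral_mono) (auto simp: indicator_def)
    with Bj'(4)[OF f] have bad': "(\<integral>\<^sup>+x. ennreal (\<rho> x * (cmod (f x - avg (B' (j' x)) f))\<^sup>2) * indicator X x \<partial>lborel) \<le> ennreal \<kappa> * energy1 f' UNIV"
      by (rule order_trans)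
    have "(\<integral>\<^sup>+x. ennreal (\<rho> x * (cmod (f x - avg (P (j x)) f))\<^sup>2) \<partial>lborel)
       = (\<integral>\<^sup>+x. ennreal (\<rho> x * (cmod (f x - avg (B' (j' x)) f))\<^sup>2) * indicator X x + ennreal (\<rho>' x * (cmod (f x - avg {-1..1} f))\<^sup>2) \<partial>lborel)"
      using Bj'(3) by (intro nn_integral_cong) (auto simp: indicator_def \<rho>'_def P_def j_def)
    also have "... = (\<integral>\<^sup>+x. ennreal (\<rho> x * (cmod (f x - avg (B' (j' x)) f))\<^sup>2) * indicator X x \<partial>lborel) + (\<integral>\<^sup>+x. ennreal (\<rho>' x * (cmod (f x - avg {-1..1} f))\<^sup>2) \<partial>lborel)"
      unfolding \<rho>'_def by (intro nn_integral_add) measurable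
    also have "... \<le> ennreal \<kappa> * energy1 f' UNIV + ennreal \<kappa> * energy1 f' UNIV" by (intro add_mono good' bad')
    also have "... = ennreal (2 * \<kappa>) * energy1 f' UNIV" using \<kappa> by (simp flip: distrib_right ennreal_plus)
    finally show ?thesis .
  qed
  moreover have "real (Suc n) \<le> 1 + (\<Sum>k\<in>Bd. 2 * sqrt (B k / \<kappa>) + 2)" using n by simp
  moreover have "P i \<in> sets borel \<and> bounded (P i) \<and> measure lborel (P i) > 0" if "i < Suc n" for i
    using that Bj'(1)[of i] by (auto simp: P_def)
  moreover have "j x < Suc n" for x using Bj'(3)[of x] by (auto simp: j_def)
  ultimately show ?thesis using jm by blast
qed

end

section \<open>Finite rank approximation of smooth functions\<close>

lemma sq_norm_add_le: "(cmod (a + b))\<^sup>2 \<le> 2 * (cmod a)\<^sup>2 + 2 * (cmod b)\<^sup>2"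
proof -
  have "(cmod (a + b))\<^sup>2 \<le> (cmod a + cmod b)\<^sup>2" by (intro power_mono norm_triangle_ineq) auto
  also have "... \<le> 2 * (cmod a)\<^sup>2 + 2 * (cmod b)\<^sup>2"
    using sum_squares_bound[of "cmod a" "cmod b"] by (simp add: power2_sum)
  finally show ?thesis .
qed

lemma nn_integral_sum_le:
  assumes [measurable]: "f \<in> borel_measurable M" "g \<in> borel_measurable M"
    and a: "0 \<le> a" and b: "0 \<le> b"
    and le: "\<And>z. z \<in> X \<Longrightarrow> u z \<le> a * f z + b * g z" and nn: "\<And>z. 0 \<le> f z" "\<And>z. 0 \<le> g z" and [measurable]: "X \<in> sets M"
  shows "(\<integral>\<^sup>+z. ennreal (u z) * indicator X z \<partial>M)
    \<le> ennreal a * (\<integral>\<^sup>+z. ennreal (f z) * indicator X z \<partial>M) + ennreal b * (\<integral>\<^sup>+z. ennreal (g z) * indicator X z \<partial>M)"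
proof -
  have "(\<integral>\<^sup>+z. ennreal (u z) * indicator X z \<partial>M) \<le> (\<integral>\<^sup>+z. ennreal a * (ennreal (f z) * indicator X z) + ennreal b * (ennreal (g z) * indicator X z) \<partial>M)"
    using le a b nn by (intro nn_integral_mono) (auto simp: indicator_def ennreal_leI simp flip: ennreal_mult ennreal_plus)
  also have "... = ennreal a * (\<integral>\<^sup>+z. ennreal (f z) * indicator X z \<partial>M) + ennreal b * (\<integral>\<^sup>+z. ennreal (g z) * indicator X z \<partial>M)"
    by (subst nn_integral_add) (auto simp: nn_integral_cmult)
  finally show ?thesis .
qed

lemma section_integral_measurable:
  fixes f :: "real \<times> real \<Rightarrow> ennreal"
  assumes "f \<in> borel_measurable borel"
  shows "(\<lambda>x. \<integral>\<^sup>+y. f (x, y) \<partial>lborel) \<in> borel_measurable borel"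
  using lborel.borel_measurable_nn_integral_fst[of f lborel] assms by (simp add: lborel_prod)

lemma borel_comp_fst: "F \<in> measurable borel N \<Longrightarrow> (\<lambda>z::real \<times> real. F (fst z)) \<in> measurable borel N"
  and borel_comp_snd: "F \<in> measurable borel N \<Longrightarrow> (\<lambda>z::real \<times> real. F (snd z)) \<in> measurable borel N"
  by (auto intro!: measurable_compose[of _ borel borel F N] borel_measurable_continuous_onI continuous_intros)

lemma avg_sq_le:
  fixes w :: "real \<times> real \<Rightarrow> complex"
  assumes w: "continuous_on UNIV w" and A: "A \<in> sets borel" "bounded A" "measure lborel A > 0" and R: "A \<subseteq> R"
  shows "ennreal ((cmod (avg A w))\<^sup>2) \<le> ennreal (1 / measure lborel A) * (\<integral>\<^sup>+z. ennreal ((cmod (w z))\<^sup>2) * indicator R z \<partial>lborel)"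
proof -
  let ?m = "measure lborel A"
  define Y where "Y = (LINT z:A|lborel. (cmod (w z))\<^sup>2)"
  have i: "set_integrable lborel A (\<lambda>z. (cmod (w z))\<^sup>2)" using A by (intro set_integrable_continuous continuous_intros w) auto
  have "(LINT z:A|lborel. 1 * cmod (w z))\<^sup>2 \<le> (LINT z:A|lborel. 1\<^sup>2) * (LINT z:A|lborel. (cmod (w z))\<^sup>2)"
    using A by (intro Cauchy_Schwarz_set_integral set_integrable_continuous continuous_intros w)
      (auto intro!: borel_measurable_continuous_onI continuous_intros w)
  moreover have "(LINT z:A|lborel. (1::real)\<^sup>2) = ?m"
    using A emeasure_bounded_finite[OF A(2)] by (simp add: set_lebesgue_integral_def)
  ultimately have cs: "(LINT z:A|lborel. cmod (w z))\<^sup>2 \<le> ?m * Y" by (simp only: Y_def mult_1)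
  have "cmod (LINT z:A|lborel. w z) \<le> (LINT z:A|lborel. cmod (w z))"
    using A by (intro set_integral_norm_bound set_integrable_continuous w) auto
  then have "(cmod (LINT z:A|lborel. w z))\<^sup>2 \<le> ?m * Y" using power_mono[of _ _ 2] cs by fastforce
  then have "(cmod (avg A w))\<^sup>2 \<le> 1 / ?m * Y"
    using A(3) by (simp add: avg_def norm_divide power_divide field_simps power2_eq_square)
  then have "ennreal ((cmod (avg A w))\<^sup>2) \<le> ennreal (1 / ?m) * ennreal Y"
    by (subst ennreal_mult'[symmetric]) (auto intro: ennreal_leI)
  also have "ennreal Y = (\<integral>\<^sup>+z. ennreal ((cmod (w z))\<^sup>2) * indicator A z \<partial>lborel)"
    using i unfolding Y_def set_integrable_def set_lebesgue_integral_def
    by (subst nn_integral_eq_integral[symmetric]) (auto intro!: nn_integral_cong AE_I2 simp: indicator_def)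
  also have "... \<le> (\<integral>\<^sup>+z. ennreal ((cmod (w z))\<^sup>2) * indicator R z \<partial>lborel)"
    using R by (intro nn_integral_mono) (auto simp: indicator_def)
  finally show ?thesis by (simp add: mult_left_mono)
qed

text \<open>A Borel potential on the whole plane that vanishes outside the strip; \<open>t\<close> is the threshold below which
  the Orlicz norm on a unit rectangle counts as small.\<close>
locale strip_potential = width d + potential d t V for d t :: real and V :: "real \<times> real \<Rightarrow> real" +
  assumes Vout: "\<And>z. z \<notin> strip d \<Longrightarrow> V z = 0"
begin

definition R :: "int \<Rightarrow> (real \<times> real) set" where "R k = {of_int k..<of_int k + 1} \<times> {0..<d}"

lemma R_eq: "R k = sq (of_int k) 0 1 0 0 0"
  using d by (simp add: R_def sq_def cell_0)

lemma R_borel [measurable]: "R k \<in> sets borel" unfolding R_eq by (rule sq_borel)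

lemma R_disjoint: "k \<noteq> k' \<Longrightarrow> R k \<inter> R k' = {}"
proof -
  assume "k \<noteq> k'"
  have "k = \<lfloor>fst z\<rfloor>" if "z \<in> R k" for z k using that unfolding R_def by (auto intro!: floor_unique[symmetric])
  then show ?thesis using \<open>k \<noteq> k'\<close> by blast
qed

lemma band_R: "band = (\<Union>k. R k)"
proof (rule set_eqI)
  fix z show "z \<in> band \<longleftrightarrow> z \<in> (\<Union>k. R k)"
    unfolding band_def R_def by (cases z) (auto intro!: exI[of _ "\<lfloor>fst z\<rfloor>"])
qed

lemma band_borel [measurable]: "band \<in> sets borel"
  unfolding band_R by (intro sets.countable_UN') auto

lemma band_mono:
  assumes [measurable]: "u \<in> borel_measurable borel" "g \<in> borel_measurable borel"
    and le: "\<And>k. (\<integral>\<^sup>+z. u z * indicator (R k) z \<partial>lborel) \<le> (\<integral>\<^sup>+z. g z * indicator (R k) z \<partial>lborel)"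
  shows "(\<integral>\<^sup>+z. u z * indicator band z \<partial>lborel) \<le> (\<integral>\<^sup>+z. g z * indicator band z \<partial>lborel)"
proof -
  define R' where "R' n = R (int_decode n)" for n
  have disj: "disjoint_family R'" unfolding disjoint_family_on_def R'_def
    using R_disjoint inj_int_decode by (simp add: inj_eq)
  have eq: "band = (\<Union>n. R' n)" unfolding band_R R'_def using surj_int_decode by (metis image_image)
  have m: "R' n \<in> sets borel" for n unfolding R'_def by measurable
  have split: "(\<integral>\<^sup>+z. f z * indicator band z \<partial>lborel) = (\<Sum>n. \<integral>\<^sup>+z. f z * indicator (R' n) z \<partial>lborel)"
    if [measurable]: "f \<in> borel_measurable borel" for f :: "real \<times> real \<Rightarrow> ennreal"
  proof -
    note m[measurable]
    have "(\<integral>\<^sup>+z. f z * indicator band z \<partial>lborel) = (\<integral>\<^sup>+z. (\<Sum>n. f z * indicator (R' n) z) \<partial>lborel)"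
      unfolding eq by (intro nn_integral_cong) (simp add: suminf_indicator[OF disj] ennreal_suminf_cmult)
    also have "... = (\<Sum>n. \<integral>\<^sup>+z. f z * indicator (R' n) z \<partial>lborel)" by (intro nn_integral_suminf) measurable
    finally show ?thesis .
  qed
  show ?thesis unfolding split[OF assms(1)] split[OF assms(2)]
    using le by (intro suminf_le) (auto simp: R'_def)
qed

text \<open>The constant function \<open>1\<close> is admissible in the Orlicz norm, as \<open>phi 1 = e - 2 \<le> 1\<close>.\<close>
lemma V_le_J: "(\<integral>\<^sup>+z. ennreal (V z) * indicator (R k) z \<partial>lborel) \<le> J_norm V (R k)"
proof -
  have b: "bounded (R k)" unfolding R_def by (intro bounded_Times) auto
  have pl: "(\<integral>\<^sup>+z. ennreal (V z) * indicator (R k) z \<partial>lborel) = (\<integral>\<^sup>+x. \<integral>\<^sup>+y. ennreal (V (x, y)) * indicator (R k) (x, y) \<partial>lborel \<partial>lborel)"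
    by (intro nn_integral_plane) measurable
  have "AE x in lborel. (\<integral>\<^sup>+y. ennreal (V (x, y)) * indicator (R k) (x, y) \<partial>lborel) \<noteq> \<infinity>"
    using Vfin[OF R_borel b] unfolding pl by (intro nn_integral_PInf_AE) auto
  then show ?thesis unfolding pl J_norm_def
  proof (intro nn_integral_mono_AE, eventually_elim)
    fix x assume fin: "(\<integral>\<^sup>+y. ennreal (V (x, y)) * indicator (R k) (x, y) \<partial>lborel) \<noteq> \<infinity>"
    define S where "S = {y. (x, y) \<in> R k}"
    have ind: "indicator (R k) (x, y) = (indicator S y :: ennreal)" for y by (simp add: S_def indicator_def)
    have Sm: "S \<in> sets borel" unfolding S_def by (rule section_borel) auto
    have p1: "phi 1 \<le> 1" using exp_le by (simp add: phi_def)
    have "(\<integral>\<^sup>+y\<in>S. ennreal (phi 1) \<partial>lborel) \<le> (\<integral>\<^sup>+y\<in>S. ennreal 1 \<partial>lborel)"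
      using p1 by (intro nn_integral_mono mult_right_mono ennreal_leI) auto
    also have "... = emeasure lborel S" using Sm by simp
    finally have phi: "(\<integral>\<^sup>+y\<in>S. ennreal (phi 1) \<partial>lborel) \<le> emeasure lborel S" .
    have "(\<integral>\<^sup>+y\<in>S. ennreal (V (x, y) * 1) \<partial>lborel) \<le> L_psi_norm_av S (\<lambda>y. V (x, y))"
      using fin Sm phi V0 by (intro L_psi_norm_av_bound[where G=1]) (auto simp: ind less_top)
    then show "(\<integral>\<^sup>+y. ennreal (V (x, y)) * indicator (R k) (x, y) \<partial>lborel) \<le> L_psi_norm_av {y. (x, y) \<in> R k} (\<lambda>y. V (x, y))"
      by (simp add: ind S_def)
  qed
qed

abbreviation sobolev where
  "sobolev w p q X \<equiv> (\<integral>\<^sup>+z. ennreal ((cmod (p z))\<^sup>2 + (cmod (q z))\<^sup>2 + (cmod (w z))\<^sup>2) * indicator X z \<partial>lborel)"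

lemma energy_le_sobolev:
  assumes "C1 w p q" and [measurable]: "X \<in> sets borel"
  shows "energy p q X \<le> 2 * sobolev w p q X"
proof -
  have [measurable]: "w \<in> borel_measurable borel" "p \<in> borel_measurable borel" "q \<in> borel_measurable borel"
    using assms(1) by (auto simp: C1_def intro: borel_measurable_continuous_onI)
  have "(a + b)\<^sup>2 \<le> 2 * (a\<^sup>2 + b\<^sup>2 + c\<^sup>2)" for a b c :: real
    using sum_squares_bound[of a b] by (simp add: power2_sum distrib_left) (smt (verit) zero_le_power2)
  then have "ennreal ((cmod (p z) + cmod (q z))\<^sup>2) \<le> ennreal (2 * ((cmod (p z))\<^sup>2 + (cmod (q z))\<^sup>2 + (cmod (w z))\<^sup>2))" for z
    by (intro ennreal_leI)
  then have pt: "ennreal ((cmod (p z) + cmod (q z))\<^sup>2) \<le> 2 * ennreal ((cmod (p z))\<^sup>2 + (cmod (q z))\<^sup>2 + (cmod (w z))\<^sup>2)" for z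
    by (simp only: ennreal_mult'[of 2, simplified] ennreal_numeral)
  have "energy p q X \<le> (\<integral>\<^sup>+z. 2 * (ennreal ((cmod (p z))\<^sup>2 + (cmod (q z))\<^sup>2 + (cmod (w z))\<^sup>2) * indicator X z) \<partial>lborel)"
  proof (rule nn_integral_mono)
    fix z
    show "ennreal ((cmod (p z) + cmod (q z))\<^sup>2) * indicator X z \<le> 2 * (ennreal ((cmod (p z))\<^sup>2 + (cmod (q z))\<^sup>2 + (cmod (w z))\<^sup>2) * indicator X z)"
      using mult_right_mono[OF pt[of z], of "indicator X z"] by (simp only: mult.assoc zero_le)
  qed
  also have "... = 2 * sobolev w p q X" by (intro nn_integral_cmult) measurable
  finally show ?thesis .
qed

text \<open>Here \<open>w\<close> itself, not its deviation from an average, is estimated: the average is bounded by the \<open>L\<^sub>2\<close> norm of \<open>w\<close> on the rectangle,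
  and the mass of \<open>V\<close> by its Orlicz norm. Hence light rectangles need no functionals.\<close>
lemma light_rectangle:
  assumes w: "C1 w p q" and J: "J_norm V (R k) \<le> ennreal t"
  shows "(\<integral>\<^sup>+z. ennreal (V z * (cmod (w z))\<^sup>2) * indicator (R k) z \<partial>lborel) \<le> ennreal (4 * \<kappa> + 8 * t / d) * sobolev w p q (R k)"
proof -
  have c: "continuous_on UNIV w" "continuous_on UNIV p" "continuous_on UNIV q" using w by (auto simp: C1_def)
  have [measurable]: "w \<in> borel_measurable borel" "p \<in> borel_measurable borel" "q \<in> borel_measurable borel"
    using c by (auto intro: borel_measurable_continuous_onI)
  define A where "A = ref (of_int k) 0 1 (of_int k) 0"
  define a where "a = avg A w"
  let ?S = "sobolev w p q (R k)"
  have d': "d * 1 > 0" using d by simp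
  have A: "A \<in> sets borel" "bounded A" "measure lborel A = d / 4"
    unfolding A_def ref_def using d by (auto intro!: bounded_Times borel_Times simp: measure_Times_real measure_sibling)
  have AR: "A \<subseteq> R k"
    using sibling_subset[of "of_int k" 1 "of_int k" 0 "of_int k"] sibling_subset[of 0 "d * 1" 0 0 0]
    unfolding A_def ref_def R_eq sq_def by (auto simp: idx_def)
  have 1: "deviation V w (\<lambda>_. a) (R k) \<le> ennreal \<kappa> * (2 * ?S)"
  proof -
    have "deviation V w (\<lambda>_. a) (R k) \<le> ennreal \<kappa> * energy p q (R k)"
      using no_hole_bound[OF w, of 1 "of_int k" 0] J unfolding a_def A_def R_eq by simp
    also have "... \<le> ennreal \<kappa> * (2 * ?S)" by (intro mult_left_mono energy_le_sobolev[OF w]) auto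
    finally show ?thesis .
  qed
  have 2: "ennreal ((cmod a)\<^sup>2) \<le> ennreal (4 / d) * ?S"
  proof -
    have "ennreal ((cmod a)\<^sup>2) \<le> ennreal (1 / measure lborel A) * (\<integral>\<^sup>+z. ennreal ((cmod (w z))\<^sup>2) * indicator (R k) z \<partial>lborel)"
      unfolding a_def using A d by (intro avg_sq_le[OF c(1) A(1,2) _ AR]) auto
    also have "... \<le> ennreal (4 / d) * ?S"
      unfolding A(3) using d by (intro mult_mono nn_integral_mono) (auto simp: indicator_def intro!: ennreal_leI)
    finally show ?thesis .
  qed
  have vj: "(\<integral>\<^sup>+z. ennreal (V z) * indicator (R k) z \<partial>lborel) \<le> ennreal t" using V_le_J J by (rule order_trans)
  have "(\<integral>\<^sup>+z. ennreal (V z * (cmod (w z))\<^sup>2) * indicator (R k) z \<partial>lborel)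
     \<le> ennreal 2 * deviation V w (\<lambda>_. a) (R k) + ennreal (2 * (cmod a)\<^sup>2) * (\<integral>\<^sup>+z. ennreal (V z) * indicator (R k) z \<partial>lborel)"
  proof (rule nn_integral_sum_le)
    fix z
    have "V z * (cmod ((w z - a) + a))\<^sup>2 \<le> V z * (2 * (cmod (w z - a))\<^sup>2 + 2 * (cmod a)\<^sup>2)"
      by (intro mult_left_mono sq_norm_add_le V0)
    then show "V z * (cmod (w z))\<^sup>2 \<le> 2 * (V z * (cmod (w z - a))\<^sup>2) + 2 * (cmod a)\<^sup>2 * V z" by (simp add: algebra_simps)
  qed (use V0 in auto)
  also have "... \<le> ennreal 2 * (ennreal \<kappa> * (2 * ?S)) + (2 * (ennreal (4 / d) * ?S)) * ennreal t"
  proof (intro add_mono mult_mono 1 vj mult_left_mono)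
    show "ennreal (2 * (cmod a)\<^sup>2) \<le> 2 * (ennreal (4 / d) * ?S)"
      using mult_left_mono[OF 2, of 2] by (simp add: ennreal_mult' ennreal_numeral)
  qed auto
  also have "... = ennreal (4 * \<kappa> + 8 * t / d) * ?S"
  proof -
    have k0: "0 \<le> \<kappa>" using K_loc_pos[OF d] t by simp
    have e1: "ennreal 2 * (ennreal \<kappa> * (2 * ?S)) = ennreal (4 * \<kappa>) * ?S"
    proof -
      have "ennreal (4 * \<kappa>) = ennreal 2 * ennreal \<kappa> * 2"
        using k0 by (simp add: mult_ac flip: ennreal_mult' ennreal_numeral)
      then show ?thesis by (simp only: mult_ac)
    qed
    have e2: "(2 * (ennreal (4 / d) * ?S)) * ennreal t = ennreal (8 * t / d) * ?S"
    proof -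
      have "ennreal (8 * t / d) = 2 * ennreal (4 / d) * ennreal t"
        using t d by (simp add: mult_ac flip: ennreal_mult' ennreal_numeral)
      then show ?thesis by (simp only: mult_ac)
    qed
    show ?thesis unfolding e1 e2 using k0 t d by (simp add: distrib_right)
  qed
  finally show ?thesis .
qed


text \<open>The heavy rectangles are divided by \<open>covering\<close>, and all the light ones are summed without any functional. The function \<open>j\<close>
  takes the value \<open>N\<close>, for which there is no cell, on light rectangles.\<close>
lemma transversal:
  assumes fin: "finite Bc" and light: "\<And>k. k \<notin> Bc \<Longrightarrow> J_norm V (R k) \<le> ennreal t"
    and heavy: "\<And>k. k \<in> Bc \<Longrightarrow> J_norm V (R k) = ennreal (c k) \<and> t < c k"
  shows "\<exists>N B j. real N \<le> (\<Sum>k\<in>Bc. 8 * (c k / t)) \<and> (\<forall>i<N. rect_in d (B i)) \<and> j \<in> measurable borel (count_space UNIV) \<and>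
    (\<forall>w p q. C1 w p q \<longrightarrow> (\<integral>\<^sup>+z. ennreal (V z * (cmod (w z - (if j z < N then avg (B (j z)) w else 0)))\<^sup>2) \<partial>lborel)
       \<le> ennreal (4 * \<kappa> + 8 * t / d) * sobolev w p q band)"
proof -
  define X where "X = (\<Union>k\<in>Bc. R k)"
  have Xm [measurable]: "X \<in> sets borel" unfolding X_def using fin by (intro sets.finite_UN) auto
  have "\<exists>N. controlled d V \<kappa> N (\<Union>k\<in>Bc. R k) \<and> real N \<le> (\<Sum>k\<in>Bc. 8 * (c k / t))"
    using fin heavy
  proof (induction Bc rule: finite_induct)
    case empty
    show ?case using controlled_empty by auto
  next
    case (insert k S)
    then obtain n where n: "controlled d V \<kappa> n (\<Union>k\<in>S. R k)" "real n \<le> (\<Sum>k\<in>S. 8 * (c k / t))" by auto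
    have ck: "J_norm V (R k) = ennreal (c k)" "t < c k" using insert.prems[of k] by auto
    obtain m :: nat where "c k / t \<le> real m" using real_arch_simple by blast
    then have "c k \<le> real m * t" using t by (simp add: field_simps)
    then have "J_norm V (sq (of_int k) 0 1 0 0 0) \<le> ennreal (real m * t)" using ck by (simp add: R_eq ennreal_leI)
    from covering[OF _ _ _ this] obtain n' where n': "controlled d V \<kappa> n' (R k)"
       "enn2real (J_norm V (R k)) / t > 1 \<longrightarrow> real n' \<le> 8 * (enn2real (J_norm V (R k)) / t) - 3" by (auto simp: R_eq)
    have n'': "real n' \<le> 8 * (c k / t)" using n'(2) ck t by (auto simp: field_simps)
    have "R k \<inter> R k' = {}" if "k' \<in> S" for k' using R_disjoint[of k k'] that insert.hyps by metis
    then have "R k \<inter> (\<Union>k\<in>S. R k) = {}" by blast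
    then have "controlled d V \<kappa> (n' + n) (R k \<union> (\<Union>k\<in>S. R k))"
      using n n' insert.hyps by (intro controlled_Un) (auto intro!: sets.finite_UN)
    then show ?case using n n'' insert.hyps by (intro exI[of _ "n' + n"]) auto
  qed
  then obtain N where N: "real N \<le> (\<Sum>k\<in>Bc. 8 * (c k / t))" and ctrl: "controlled d V \<kappa> N X" unfolding X_def by blast
  from ctrl obtain B j' where Bj': "\<And>i. i < N \<Longrightarrow> rect_in d (B i)" and [measurable]: "j' \<in> measurable borel (count_space UNIV)"
     and j'N: "\<And>z. z \<in> X \<Longrightarrow> j' z < N"
     and dev: "\<And>w p q. C1 w p q \<Longrightarrow> deviation V w (\<lambda>z. avg (B (j' z)) w) X \<le> ennreal \<kappa> * energy p q X"
    unfolding controlled_def by blast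
  define j where "j z = (if z \<in> X then j' z else N)" for z
  have jm [measurable]: "j \<in> measurable borel (count_space UNIV)" unfolding j_def by measurable
  have jN: "j z < N \<longleftrightarrow> z \<in> X" for z using j'N by (auto simp: j_def)
  have main: "(\<integral>\<^sup>+z. ennreal (V z * (cmod (w z - (if j z < N then avg (B (j z)) w else 0)))\<^sup>2) \<partial>lborel)
       \<le> ennreal (4 * \<kappa> + 8 * t / d) * sobolev w p q band" if w: "C1 w p q" for w p q
  proof -
    define \<gamma> where "\<gamma> = 4 * \<kappa> + 8 * t / d"
    define e where "e z = ennreal ((cmod (p z))\<^sup>2 + (cmod (q z))\<^sup>2 + (cmod (w z))\<^sup>2)" for z
    have k0: "0 < \<kappa>" using K_loc_pos[OF d] t by simp
    have [measurable]: "w \<in> borel_measurable borel" "p \<in> borel_measurable borel" "q \<in> borel_measurable borel"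
      using w by (auto simp: C1_def intro: borel_measurable_continuous_onI)
    have em [measurable]: "e \<in> borel_measurable borel" unfolding e_def by measurable
    have XX: "deviation V w (\<lambda>z. avg (B (j' z)) w) X \<le> ennreal \<gamma> * (\<integral>\<^sup>+z. e z * indicator X z \<partial>lborel)"
    proof -
      have "deviation V w (\<lambda>z. avg (B (j' z)) w) X \<le> ennreal \<kappa> * energy p q X" by (rule dev[OF w])
      also have "... \<le> ennreal \<kappa> * (2 * sobolev w p q X)" by (intro mult_left_mono energy_le_sobolev[OF w]) auto
      also have "... = ennreal (2 * \<kappa>) * (\<integral>\<^sup>+z. e z * indicator X z \<partial>lborel)"
      proof -
        have "ennreal (2 * \<kappa>) = ennreal \<kappa> * 2" using k0 by (simp add: mult_ac flip: ennreal_mult' ennreal_numeral)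
        then show ?thesis unfolding e_def by (simp only: mult.assoc)
      qed
      also have "... \<le> ennreal \<gamma> * (\<integral>\<^sup>+z. e z * indicator X z \<partial>lborel)"
      proof -
        have "0 \<le> 8 * t / d" using t d by simp
        then have "2 * \<kappa> \<le> \<gamma>" using k0 unfolding \<gamma>_def by linarith
        then show ?thesis by (intro mult_right_mono ennreal_leI) auto
      qed
      finally show ?thesis .
    qed
    have "(\<integral>\<^sup>+z. (ennreal (V z * (cmod (w z))\<^sup>2) * indicator (- X) z) * indicator band z \<partial>lborel)
       \<le> (\<integral>\<^sup>+z. (ennreal \<gamma> * (e z * indicator (- X) z)) * indicator band z \<partial>lborel)"
    proof (rule band_mono)
      fix k
      show "(\<integral>\<^sup>+z. (ennreal (V z * (cmod (w z))\<^sup>2) * indicator (- X) z) * indicator (R k) z \<partial>lborel)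
         \<le> (\<integral>\<^sup>+z. (ennreal \<gamma> * (e z * indicator (- X) z)) * indicator (R k) z \<partial>lborel)"
      proof (cases "k \<in> Bc")
        case True
        then have "(indicator (- X) z * indicator (R k) z :: ennreal) = 0" for z by (auto simp: X_def indicator_def)
        then show ?thesis by (simp only: mult.assoc mult_zero_right nn_integral_0_iff_AE nn_integral_const)
      next
        case False
        have "R k \<inter> R k' = {}" if "k' \<in> Bc" for k' using R_disjoint[of k k'] that False by metis
        then have "R k \<inter> X = {}" unfolding X_def by blast
        then have i: "(indicator (- X) z * indicator (R k) z :: ennreal) = indicator (R k) z" for z by (auto simp: indicator_def)
        show ?thesis unfolding mult.assoc i using light_rectangle[OF w light[OF False]] unfolding \<gamma>_def[symmetric] e_def[symmetric]
          by (subst nn_integral_cmult) auto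
      qed
    qed (measurable)
    also have "... = (\<integral>\<^sup>+z. ennreal \<gamma> * (e z * (indicator (- X) z * indicator band z)) \<partial>lborel)" by (simp add: mult.assoc)
    also have "... = ennreal \<gamma> * (\<integral>\<^sup>+z. e z * (indicator (- X) z * indicator band z) \<partial>lborel)"
      by (intro nn_integral_cmult) measurable
    finally have out: "(\<integral>\<^sup>+z. ennreal (V z * (cmod (w z))\<^sup>2) * indicator (- X) z * indicator band z \<partial>lborel)
       \<le> ennreal \<gamma> * (\<integral>\<^sup>+z. e z * (indicator (- X) z * indicator band z) \<partial>lborel)" .
    have Xband: "X \<subseteq> band" unfolding X_def band_R by blast
    have sb: "strip d \<subseteq> band" by (auto simp: strip_def band_def)
    have "(\<integral>\<^sup>+z. ennreal (V z * (cmod (w z - (if j z < N then avg (B (j z)) w else 0)))\<^sup>2) \<partial>lborel)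
      = (\<integral>\<^sup>+z. ennreal (V z * (cmod (w z - avg (B (j' z)) w))\<^sup>2) * indicator X z + ennreal (V z * (cmod (w z))\<^sup>2) * indicator (- X) z * indicator band z \<partial>lborel)"
    proof (rule nn_integral_cong)
      fix z
      have jX: "z \<in> X \<Longrightarrow> j z = j' z" by (simp add: j_def)
      have Vz: "z \<notin> band \<Longrightarrow> V z = 0" using Vout sb by blast
      show "ennreal (V z * (cmod (w z - (if j z < N then avg (B (j z)) w else 0)))\<^sup>2)
         = ennreal (V z * (cmod (w z - avg (B (j' z)) w))\<^sup>2) * indicator X z + ennreal (V z * (cmod (w z))\<^sup>2) * indicator (- X) z * indicator band z"
        unfolding jN by (cases "z \<in> X"; cases "z \<in> band") (simp_all add: jX Vz)
    qed
    also have "... = deviation V w (\<lambda>z. avg (B (j' z)) w) X + (\<integral>\<^sup>+z. ennreal (V z * (cmod (w z))\<^sup>2) * indicator (- X) z * indicator band z \<partial>lborel)"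
      by (intro nn_integral_add) measurable
    also have "... \<le> ennreal \<gamma> * (\<integral>\<^sup>+z. e z * indicator X z \<partial>lborel) + ennreal \<gamma> * (\<integral>\<^sup>+z. e z * (indicator (- X) z * indicator band z) \<partial>lborel)"
      by (intro add_mono XX out)
    also have "... = ennreal \<gamma> * (\<integral>\<^sup>+z. e z * indicator X z + e z * (indicator (- X) z * indicator band z) \<partial>lborel)"
      by (subst nn_integral_add) (auto simp: distrib_left)
    also have "(\<integral>\<^sup>+z. e z * indicator X z + e z * (indicator (- X) z * indicator band z) \<partial>lborel) = (\<integral>\<^sup>+z. e z * indicator band z \<partial>lborel)"
      using Xband by (intro nn_integral_cong) (auto simp: indicator_def)
    finally show ?thesis by (simp add: \<gamma>_def e_def)
  qed
  show ?thesis using N Bj' jm main by (intro exI[of _ N] exI[of _ B] exI[of _ j]) auto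
qed

definition rho :: "real \<Rightarrow> real" where
  "rho x = enn2real (\<integral>\<^sup>+y. ennreal (V (x, y) * (s y)\<^sup>2) \<partial>lborel)"

lemma s_sq_le: "(s y)\<^sup>2 \<le> 2 / d"
proof -
  have "(sin (\<omega> * y))\<^sup>2 \<le> 1" by (simp add: abs_square_le_1)
  then show ?thesis using d mult_left_mono[of "(sin (\<omega> * y))\<^sup>2" 1 "2 / d"] by (simp add: s_def power_mult_distrib)
qed

lemma s_borel [measurable]: "s \<in> borel_measurable borel"
  using s_cont(1)[of UNIV] by (intro borel_measurable_continuous_onI)

lemmas s_snd_borel [measurable] = borel_comp_snd[OF s_borel]

lemma rho_borel [measurable]: "rho \<in> borel_measurable borel"
proof -
  have "(\<lambda>z. ennreal (V z * (s (snd z))\<^sup>2)) \<in> borel_measurable (borel :: (real \<times> real) measure)" by measurable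
  from section_integral_measurable[OF this] show ?thesis unfolding rho_def[abs_def] by simp
qed

lemma rho_nonneg: "0 \<le> rho x" by (simp add: rho_def)

text \<open>The section integrals are finite for almost every \<open>x\<close> only; elsewhere \<open>enn2real\<close> yields \<open>0\<close>.\<close>
lemma rho_AE: "AE x in lborel. ennreal (rho x) = (\<integral>\<^sup>+y. ennreal (V (x, y) * (s y)\<^sup>2) \<partial>lborel)"
proof -
  have "AE x in lborel. \<forall>n::nat. (\<integral>\<^sup>+y. ennreal (V (x, y)) * indicator ({- real n..real n} \<times> {0..d}) (x, y) \<partial>lborel) \<noteq> \<infinity>"
  proof (subst AE_all_countable, intro allI)
    fix n :: nat
    have b: "{- real n..real n} \<times> {0..d} \<in> sets borel" "bounded ({- real n..real n} \<times> {0..d})"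
      by (auto intro!: borel_Times bounded_Times)
    note b(1)[measurable]
    have "(\<integral>\<^sup>+x. \<integral>\<^sup>+y. ennreal (V (x, y)) * indicator ({- real n..real n} \<times> {0..d}) (x, y) \<partial>lborel \<partial>lborel)
       = (\<integral>\<^sup>+z. ennreal (V z) * indicator ({- real n..real n} \<times> {0..d}) z \<partial>lborel)"
      by (intro nn_integral_plane[symmetric]) measurable
    also have "... < \<infinity>" by (rule Vfin[OF b])
    finally have f: "(\<integral>\<^sup>+x. \<integral>\<^sup>+y. ennreal (V (x, y)) * indicator ({- real n..real n} \<times> {0..d}) (x, y) \<partial>lborel \<partial>lborel) \<noteq> \<infinity>" by simp
    have m: "(\<lambda>z. ennreal (V z) * indicator ({- real n..real n} \<times> {0..d}) z) \<in> borel_measurable (borel :: (real \<times> real) measure)" by measurable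
    have "(\<lambda>x. \<integral>\<^sup>+y. (\<lambda>z. ennreal (V z) * indicator ({- real n..real n} \<times> {0..d}) z) (x, y) \<partial>lborel) \<in> borel_measurable lborel"
      using section_integral_measurable[OF m] by simp
    then show "AE x in lborel. (\<integral>\<^sup>+y. ennreal (V (x, y)) * indicator ({- real n..real n} \<times> {0..d}) (x, y) \<partial>lborel) \<noteq> \<infinity>"
      using f by (intro nn_integral_PInf_AE) auto
  qed
  then show ?thesis
  proof eventually_elim
    fix x assume fin: "\<forall>n::nat. (\<integral>\<^sup>+y. ennreal (V (x, y)) * indicator ({- real n..real n} \<times> {0..d}) (x, y) \<partial>lborel) \<noteq> \<infinity>"
    obtain n :: nat where n: "\<bar>x\<bar> \<le> real n" using real_arch_simple by blast
    have "(\<integral>\<^sup>+y. ennreal (V (x, y) * (s y)\<^sup>2) \<partial>lborel)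
       \<le> (\<integral>\<^sup>+y. ennreal (2 / d) * (ennreal (V (x, y)) * indicator ({- real n..real n} \<times> {0..d}) (x, y)) \<partial>lborel)"
    proof (rule nn_integral_mono)
      fix y
      have "V (x, y) * (s y)\<^sup>2 \<le> 2 / d * V (x, y)" using mult_left_mono[OF s_sq_le V0[of "(x, y)"], of y] by (simp add: mult.commute)
      moreover have ind: "indicator ({- real n..real n} \<times> {0..d}) (x, y) = (indicator {0..d} y :: ennreal)" using n by (auto simp: indicator_def)
      moreover have "V (x, y) = 0" if "y \<notin> {0..d}" using that by (intro Vout) (auto simp: strip_def)
      ultimately show "ennreal (V (x, y) * (s y)\<^sup>2) \<le> ennreal (2 / d) * (ennreal (V (x, y)) * indicator ({- real n..real n} \<times> {0..d}) (x, y))"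
        using d unfolding ind by (cases "y \<in> {0..d}") (auto simp: ennreal_leI simp flip: ennreal_mult')
    qed
    also have "... = ennreal (2 / d) * (\<integral>\<^sup>+y. ennreal (V (x, y)) * indicator ({- real n..real n} \<times> {0..d}) (x, y) \<partial>lborel)"
    proof (rule nn_integral_cmult)
      have "{- real n..real n} \<times> {0..d} \<in> sets borel" by (auto intro!: borel_Times)
      then show "(\<lambda>y. ennreal (V (x, y)) * indicator ({- real n..real n} \<times> {0..d}) (x, y)) \<in> borel_measurable lborel" by measurable
    qed
    also have "... < \<infinity>" using fin[rule_format, of n] by (simp add: ennreal_mult_less_top less_top)
    finally show "ennreal (rho x) = (\<integral>\<^sup>+y. ennreal (V (x, y) * (s y)\<^sup>2) \<partial>lborel)" by (simp add: rho_def)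
  qed
qed

lemma rho_nn:
  assumes [measurable]: "F \<in> borel_measurable borel"
  shows "(\<integral>\<^sup>+z. ennreal (V z * (s (snd z))\<^sup>2) * F (fst z) \<partial>lborel) = (\<integral>\<^sup>+x. ennreal (rho x) * F x \<partial>lborel)"
proof -
  note borel_comp_fst[OF assms, measurable]
  have "(\<integral>\<^sup>+z. ennreal (V z * (s (snd z))\<^sup>2) * F (fst z) \<partial>lborel) = (\<integral>\<^sup>+x. \<integral>\<^sup>+y. ennreal (V (x, y) * (s y)\<^sup>2) * F x \<partial>lborel \<partial>lborel)"
  proof -
    have m: "(\<lambda>z. ennreal (V z * (s (snd z))\<^sup>2) * F (fst z)) \<in> borel_measurable (borel :: (real \<times> real) measure)" by measurable
    show ?thesis unfolding nn_integral_plane[OF m] by simp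
  qed
  also have "... = (\<integral>\<^sup>+x. (\<integral>\<^sup>+y. ennreal (V (x, y) * (s y)\<^sup>2) \<partial>lborel) * F x \<partial>lborel)"
    by (intro nn_integral_cong nn_integral_multc) measurable
  also have "... = (\<integral>\<^sup>+x. ennreal (rho x) * F x \<partial>lborel)"
    using rho_AE by (intro nn_integral_cong_AE) (auto elim: eventually_mono)
  finally show ?thesis .
qed

lemma rho_integrable:
  assumes S: "S \<in> sets borel" "bounded S"
  shows "set_integrable lborel S rho"
proof -
  note S(1)[measurable]
  have b: "S \<times> {0..d} \<in> sets borel" "bounded (S \<times> {0..d})" using S by (auto intro!: borel_Times bounded_Times)
  note b(1)[measurable]
  have "(\<integral>\<^sup>+x. ennreal (rho x) * indicator S x \<partial>lborel) = (\<integral>\<^sup>+z. ennreal (V z * (s (snd z))\<^sup>2) * indicator S (fst z) \<partial>lborel)"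
    by (intro rho_nn[symmetric]) measurable
  also have "... \<le> (\<integral>\<^sup>+z. ennreal (2 / d) * (ennreal (V z) * indicator (S \<times> {0..d}) z) \<partial>lborel)"
  proof (rule nn_integral_mono)
    fix z :: "real \<times> real"
    have "V z * (s (snd z))\<^sup>2 \<le> 2 / d * V z" using mult_left_mono[OF s_sq_le V0[of z], of "snd z"] by (simp add: mult.commute)
    moreover have "V z = 0" if "snd z \<notin> {0..d}" using that by (intro Vout) (auto simp: strip_def)
    ultimately show "ennreal (V z * (s (snd z))\<^sup>2) * indicator S (fst z) \<le> ennreal (2 / d) * (ennreal (V z) * indicator (S \<times> {0..d}) z)"
      using d by (cases z; cases "snd z \<in> {0..d}") (auto simp: indicator_def ennreal_leI simp flip: ennreal_mult')
  qed
  also have "... = ennreal (2 / d) * (\<integral>\<^sup>+z. ennreal (V z) * indicator (S \<times> {0..d}) z \<partial>lborel)" by (intro nn_integral_cmult) measurable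
  also have "... < \<infinity>" using Vfin[OF b] by (simp add: ennreal_mult_less_top)
  finally have "(\<integral>\<^sup>+x. ennreal (indicator S x * rho x) \<partial>lborel) < \<infinity>"
    by (rule order_le_less_trans[rotated]) (auto intro!: nn_integral_mono simp: indicator_def)
  then show ?thesis unfolding set_integrable_def
    using rho_nonneg by (intro integrableI_nonneg) (auto intro!: AE_I2)
qed

end

context width
begin

text \<open>The representing function of averages with respect to \<open>x \<in> S\<close> and weight \<open>g\<close> with respect to \<open>y\<close>.\<close>
definition ker :: "real set \<Rightarrow> (real \<Rightarrow> real) \<Rightarrow> real \<times> real \<Rightarrow> complex" where
  "ker S g z = complex_of_real (indicator S (fst z) * g (snd z))"

lemma s_abs_le: "\<bar>s y\<bar> \<le> sqrt (2 / d)"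
  using d by (simp add: s_def abs_mult mult_left_le)

lemma s_meas: "s \<in> borel_measurable borel"
  using s_cont(1)[of UNIV] by (intro borel_measurable_continuous_onI)

lemma ker_integrable:
  assumes [measurable]: "S \<in> sets borel" "g \<in> borel_measurable borel" and S: "bounded S" and G: "\<And>y. \<bar>g y\<bar> \<le> G"
    and w: "continuous_on UNIV (w :: real \<times> real \<Rightarrow> complex)"
  shows "integrable lborel (\<lambda>z. indicator (strip d) z *\<^sub>R (w z * ker S g z))"
proof -
  note borel_comp_fst[of "indicator S :: real \<Rightarrow> real", measurable] borel_comp_snd[OF assms(2), measurable]
  have [measurable]: "w \<in> borel_measurable borel" using w by (intro borel_measurable_continuous_onI)
  have G0: "0 \<le> G" using G[of 0] by linarith
  have b: "S \<times> {0..d} \<in> sets borel" "bounded (S \<times> {0..d})" using S by (auto intro!: borel_Times bounded_Times)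
  have "set_integrable lborel (S \<times> {0..d}) (\<lambda>z. G * cmod (w z))" by (intro set_integrable_continuous continuous_intros w b)
  then show ?thesis unfolding set_integrable_def
  proof (rule Bochner_Integration.integrable_bound)
    show "(\<lambda>z. indicator (strip d) z *\<^sub>R (w z * ker S g z)) \<in> borel_measurable lborel" unfolding ker_def by measurable
    show "AE z in lborel. norm (indicator (strip d) z *\<^sub>R (w z * ker S g z)) \<le> norm (indicator (S \<times> {0..d}) z *\<^sub>R (G * cmod (w z)))"
    proof (rule AE_I2)
      fix z :: "real \<times> real"
      have "cmod (w z) * \<bar>g (snd z)\<bar> \<le> cmod (w z) * G" using G by (intro mult_left_mono) auto
      then show "norm (indicator (strip d) z *\<^sub>R (w z * ker S g z)) \<le> norm (indicator (S \<times> {0..d}) z *\<^sub>R (G * cmod (w z)))"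
        using G0 by (cases z) (auto simp: ker_def strip_def indicator_def norm_mult mult.commute)
    qed
  qed
qed

lemma ker_L2:
  assumes [measurable]: "S \<in> sets borel" "g \<in> borel_measurable borel" and S: "bounded S" and G: "\<And>y. \<bar>g y\<bar> \<le> G"
  shows "ker S g \<in> L2 (strip d)"
proof -
  note borel_comp_fst[of "indicator S :: real \<Rightarrow> real", measurable] borel_comp_snd[OF assms(2), measurable]
  have km [measurable]: "ker S g \<in> borel_measurable borel" unfolding ker_def[abs_def] by measurable
  have "integrable lborel (\<lambda>z. indicator (strip d) z *\<^sub>R (1 * ker S (\<lambda>y. (g y)\<^sup>2) z))"
  proof (rule ker_integrable[where G="G\<^sup>2"])
    show "\<bar>(g y)\<^sup>2\<bar> \<le> G\<^sup>2" for y using G[of y] by (simp add: abs_le_square_iff[symmetric])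
  qed (use S in auto)
  then have "integrable lborel (\<lambda>z. norm (indicator (strip d) z *\<^sub>R (1 * ker S (\<lambda>y. (g y)\<^sup>2) z)))" by (rule integrable_norm)
  also have "(\<lambda>z. norm (indicator (strip d) z *\<^sub>R (1 * ker S (\<lambda>y. (g y)\<^sup>2) z))) = (\<lambda>z. indicator (strip d) z *\<^sub>R (cmod (ker S g z))\<^sup>2)"
    by (auto simp: fun_eq_iff ker_def indicator_def norm_mult norm_power)
  finally have "integrable lebesgue (\<lambda>z. indicator (strip d) z *\<^sub>R (cmod (ker S g z))\<^sup>2)" by (simp add: integrable_completion)
  then have "integrable (lebesgue_on (strip d)) (\<lambda>z. (cmod (ker S g z))\<^sup>2)" by (simp add: integrable_restrict_space)
  then show ?thesis by (auto simp: L2_def intro!: measurable_restrict_space1 measurable_completion)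
qed

lemma ker_pairing:
  assumes [measurable]: "S \<in> sets borel" "g \<in> borel_measurable borel" and S: "bounded S" and G: "\<And>y. \<bar>g y\<bar> \<le> G"
    and w: "continuous_on UNIV w"
  shows "(LINT z|lebesgue_on (strip d). w z * ker S g z) = (LINT x:S|lborel. LINT y:{0<..<d}|lborel. g y *\<^sub>R w (x, y))"
proof -
  note i = ker_integrable[OF assms]
  have "(LINT z|lebesgue_on (strip d). w z * ker S g z) = (LINT z|lebesgue. indicator (strip d) z *\<^sub>R (w z * ker S g z))"
    by (simp add: integral_restrict_space)
  also have "... = (LINT z|lborel. indicator (strip d) z *\<^sub>R (w z * ker S g z))"
    using i by (intro integral_completion) auto
  also have "... = (LINT x|lborel. LINT y|lborel. indicator (strip d) (x, y) *\<^sub>R (w (x, y) * ker S g (x, y)))"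
    using i unfolding lborel_prod[symmetric] by (intro lborel_pair.integral_fst'[symmetric])
  also have "... = (LINT x:S|lborel. LINT y:{0<..<d}|lborel. g y *\<^sub>R w (x, y))"
    unfolding set_lebesgue_integral_def
  proof (intro Bochner_Integration.integral_cong refl)
    fix x
    have "(LINT y|lborel. indicator (strip d) (x, y) *\<^sub>R (w (x, y) * ker S g (x, y))) = (LINT y|lborel. indicator S x *\<^sub>R (indicator {0<..<d} y *\<^sub>R g y *\<^sub>R w (x, y)))"
      by (intro Bochner_Integration.integral_cong refl) (auto simp: ker_def strip_def indicator_def scaleR_conv_of_real mult.commute)
    then show "(LINT y|lborel. indicator (strip d) (x, y) *\<^sub>R (w (x, y) * ker S g (x, y))) = indicator S x *\<^sub>R (LINT y|lborel. indicator {0<..<d} y *\<^sub>R g y *\<^sub>R w (x, y))"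
      by (simp only: integral_scaleR_right)
  qed
  finally show ?thesis .
qed

lemma mode_Ioo:
  assumes "continuous_on UNIV w"
  shows "mode w x = (LINT y:{0<..<d}|lborel. s y *\<^sub>R w (x, y))"
  unfolding mode_def by (intro lint_Ioo[symmetric] continuous_intros s_cont cont_section assms)

lemma avg_mode_pairing:
  assumes P: "P \<in> sets borel" "bounded P" and w: "continuous_on UNIV w"
  shows "avg P (mode w) = (LINT z|lebesgue_on (strip d). w z * ker P (\<lambda>y. s y / measure lborel P) z)"
proof -
  let ?m = "measure lborel P"
  note s_meas[measurable]
  have b: "\<bar>s y / ?m\<bar> \<le> sqrt (2 / d) / ?m" for y
    using s_abs_le[of y] by (simp add: divide_right_mono)
  have "(LINT z|lebesgue_on (strip d). w z * ker P (\<lambda>y. s y / ?m) z) = (LINT x:P|lborel. LINT y:{0<..<d}|lborel. (s y / ?m) *\<^sub>R w (x, y))"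
    by (intro ker_pairing[OF P(1) _ P(2) b w]) measurable
  also have "... = (LINT x:P|lborel. mode w x / ?m)"
  proof -
    have "(LINT y:{0<..<d}|lborel. (s y / ?m) *\<^sub>R w (x, y)) = mode w x / ?m" for x
    proof -
      have "(LINT y:{0<..<d}|lborel. (s y / ?m) *\<^sub>R w (x, y)) = (LINT y:{0<..<d}|lborel. (s y *\<^sub>R w (x, y)) / ?m)"
        unfolding set_lebesgue_integral_def by (intro Bochner_Integration.integral_cong refl) (simp add: scaleR_conv_of_real)
      then show ?thesis by (simp add: mode_Ioo[OF w] )
    qed
    then show ?thesis by simp
  qed
  also have "... = avg P (mode w)" by (simp add: avg_def)
  finally show ?thesis by simp
qed

text \<open>Averages of the remainder are again pairings of \<open>w\<close> with square integrable functions, since the component removed from \<open>w\<close> is such a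
  pairing for each \<open>x\<close>.\<close>
lemma avg_rest_pairing:
  assumes B: "rect_in d B"
  obtains h where "h \<in> L2 (strip d)" "\<And>w. continuous_on UNIV w \<Longrightarrow> avg B (rest w) = (LINT z|lebesgue_on (strip d). w z * h z)"
proof -
  obtain S T where ST: "B = S \<times> T" and S [measurable]: "S \<in> sets borel" and T [measurable]: "T \<in> sets borel"
    and b: "bounded S" "bounded T" and Td: "T \<subseteq> {0..<d}"
    using B unfolding rect_in_def by blast
  let ?m = "measure lborel S" and ?n = "measure lborel T"
  note s_meas[measurable]
  define \<sigma> where "\<sigma> = (LINT y:T|lborel. s y)"
  define g where "g y = (indicator T y - \<sigma> * s y) / (?n * ?m)" for y
  have gm [measurable]: "g \<in> borel_measurable borel" unfolding g_def by measurable
  have gb: "\<bar>g y\<bar> \<le> (1 + \<bar>\<sigma>\<bar> * sqrt (2 / d)) / (?n * ?m)" for y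
  proof -
    have "\<bar>indicator T y - \<sigma> * s y\<bar> \<le> \<bar>indicator T y\<bar> + \<bar>\<sigma>\<bar> * \<bar>s y\<bar>" using abs_triangle_ineq4[of "indicator T y" "\<sigma> * s y"] by (simp add: abs_mult)
    also have "... \<le> 1 + \<bar>\<sigma>\<bar> * sqrt (2 / d)" using s_abs_le by (intro add_mono mult_left_mono) (auto simp: indicator_def)
    finally show ?thesis unfolding g_def by (simp add: divide_right_mono)
  qed
  have "avg B (rest w) = (LINT z|lebesgue_on (strip d). w z * ker S g z)" if w: "continuous_on UNIV w" for w
  proof -
    have cs: "continuous_on UNIV (\<lambda>z::real\<times>real. s (snd z))"
      by (auto intro!: continuous_on_compose2[OF s_cont(1)[of UNIV]] continuous_intros)
    have cf: "continuous_on UNIV (\<lambda>z::real\<times>real. mode w (fst z))"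
      by (auto intro!: continuous_on_compose2[OF mode_cont[of _ UNIV]] continuous_intros w)
    have cr: "continuous_on UNIV (rest w)" unfolding rest_def[abs_def] by (intro continuous_intros w cs cf)
    have cw: "continuous_on UNIV (\<lambda>y. w (x, y))" for x by (rule cont_section(1)[OF w])
    have in1: "set_integrable lborel T (\<lambda>y. w (x, y))" "set_integrable lborel T s" for x
      using b T by (auto intro!: set_integrable_continuous cw s_cont)
    have in4: "set_integrable lborel T (\<lambda>y. s y *\<^sub>R mode w x)" for x
      using b T by (intro set_integrable_continuous continuous_intros s_cont) auto
    have in2: "set_integrable lborel {0<..<d} (\<lambda>y. s y *\<^sub>R w (x, y))" for x
      by (intro set_integrable_continuous continuous_intros cw s_cont) auto
    have TT: "(LINT y:T|lborel. w (x, y)) = (LINT y:{0<..<d}|lborel. indicator T y *\<^sub>R w (x, y))" for x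
      unfolding set_lebesgue_integral_def
    proof (rule integral_cong_AE)
      have [measurable]: "(\<lambda>y. w (x, y)) \<in> borel_measurable borel" using cw by (intro borel_measurable_continuous_onI)
      show "(\<lambda>y. indicator T y *\<^sub>R w (x, y)) \<in> borel_measurable lborel"
        "(\<lambda>y. indicator {0<..<d} y *\<^sub>R indicator T y *\<^sub>R w (x, y)) \<in> borel_measurable lborel" by measurable
      show "AE y in lborel. indicator T y *\<^sub>R w (x, y) = indicator {0<..<d} y *\<^sub>R indicator T y *\<^sub>R w (x, y)"
        using AE_lborel_singleton[of 0] by eventually_elim (use Td in \<open>auto simp: indicator_def\<close>)
    qed
    have in3: "set_integrable lborel {0<..<d} (\<lambda>y. indicator T y *\<^sub>R w (x, y))" for x
    proof -
      have "set_integrable lborel ({0<..<d} \<inter> T) (\<lambda>y. w (x, y))"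
        using b T by (intro set_integrable_continuous cw bounded_Int) auto
      then show ?thesis unfolding set_integrable_def by (simp add: indicator_inter_arith mult.assoc)
    qed
    have inner: "avg T (\<lambda>y. rest w (x, y)) / ?m = (LINT y:{0<..<d}|lborel. g y *\<^sub>R w (x, y))" for x
    proof -
      have "(LINT y:T|lborel. rest w (x, y)) = (LINT y:T|lborel. w (x, y)) - (LINT y:T|lborel. s y *\<^sub>R mode w x)"
        unfolding rest_def fst_conv snd_conv using in1 in4 by (intro set_integral_diff) auto
      also have "(LINT y:T|lborel. s y *\<^sub>R mode w x) = \<sigma> *\<^sub>R mode w x"
        unfolding \<sigma>_def set_lebesgue_integral_def using in1(2) unfolding set_integrable_def
        by (subst integral_scaleR_left[symmetric]) auto
      also have "(LINT y:T|lborel. w (x, y)) - \<sigma> *\<^sub>R mode w x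
          = (LINT y:{0<..<d}|lborel. indicator T y *\<^sub>R w (x, y)) - (LINT y:{0<..<d}|lborel. \<sigma> *\<^sub>R (s y *\<^sub>R w (x, y)))"
        by (simp only: TT mode_Ioo[OF w] set_integral_scaleR_right)
      also have "... = (LINT y:{0<..<d}|lborel. indicator T y *\<^sub>R w (x, y) - \<sigma> *\<^sub>R (s y *\<^sub>R w (x, y)))"
        by (intro set_integral_diff(2)[symmetric] in3 set_integrable_scaleR_right in2)
      finally have e: "(LINT y:T|lborel. rest w (x, y)) = (LINT y:{0<..<d}|lborel. indicator T y *\<^sub>R w (x, y) - \<sigma> *\<^sub>R (s y *\<^sub>R w (x, y)))" .
      have "avg T (\<lambda>y. rest w (x, y)) / ?m = (LINT y:{0<..<d}|lborel. indicator T y *\<^sub>R w (x, y) - \<sigma> *\<^sub>R (s y *\<^sub>R w (x, y))) / complex_of_real (?n * ?m)"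
        unfolding avg_def e by simp
      also have "... = (LINT y:{0<..<d}|lborel. (indicator T y *\<^sub>R w (x, y) - \<sigma> *\<^sub>R (s y *\<^sub>R w (x, y))) / complex_of_real (?n * ?m))"
        by (rule set_integral_divide_zero[symmetric])
      also have "... = (LINT y:{0<..<d}|lborel. g y *\<^sub>R w (x, y))"
        unfolding set_lebesgue_integral_def g_def
        by (intro Bochner_Integration.integral_cong refl) (simp add: scaleR_conv_of_real diff_divide_distrib left_diff_distrib)
      finally show ?thesis .
    qed
    have "avg B (rest w) = (LINT x:S|lborel. avg T (\<lambda>y. rest w (x, y)) / ?m)"
      unfolding ST avg_Times(1)[OF cr b(1) S b(2) T] by (simp add: avg_def)
    also have "... = (LINT z|lebesgue_on (strip d). w z * ker S g z)"
      unfolding inner by (intro ker_pairing[OF S gm b(1) gb w, symmetric])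
    finally show ?thesis .
  qed
  then show thesis using that ker_L2[OF S gm b(1) gb] by blast
qed

end

lemma sum_split_add: "(\<Sum>i<(n::nat) + m. f i) = (\<Sum>i<n. f i) + (\<Sum>i<m. f (n + i) :: 'a::comm_monoid_add)"
  by (induction m) (auto simp: add.assoc)

context strip_potential
begin

text \<open>The operator of rank \<open>n\<close> is \<open>w \<mapsto> \<Sum>i. f i \<langle>w, h i\<rangle>\<close>; its deviation from the identity is bounded by the lower bound that
  \<open>form_decomposition\<close> gives for the unperturbed form.\<close>
definition rank_bound :: "nat \<Rightarrow> (nat \<Rightarrow> real \<times> real \<Rightarrow> complex) \<Rightarrow> (nat \<Rightarrow> real \<times> real \<Rightarrow> real) \<Rightarrow> bool" where
  "rank_bound n h f \<longleftrightarrow> (\<forall>i<n. h i \<in> L2 (strip d) \<and> f i \<in> borel_measurable borel) \<and>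
     (\<forall>w p q. C1 w p q \<longrightarrow> (\<integral>\<^sup>+z. ennreal (V z * (cmod (w z - (\<Sum>i<n. f i z *\<^sub>R (LINT z|lebesgue_on (strip d). w z * h i z))))\<^sup>2) \<partial>lborel)
       \<le> (\<integral>\<^sup>+x. ennreal ((cmod (mode p x))\<^sup>2) \<partial>lborel) + ennreal c\<^sub>0 * sobolev (rest w) (rest p) (rest_y w q) band)"

text \<open>The longitudinal and the transversal approximation are added. The weight problem is used with \<open>\<kappa> = 1/4\<close>, which makes
  the bound for the longitudinal part, twice \<open>2 * \<kappa>\<close> times the energy, equal to the energy.\<close>
theorem finite_rank_bound:
  assumes fd: "finite Bd" and C: "C \<ge> 0" "384 * C \<le> 1"
    and good: "\<And>k. k \<notin> Bd \<Longrightarrow> (LINT x:dyad k|lborel. rho x) \<le> 2 * C * (1/2) ^ nat \<bar>k\<bar>"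
    and bad: "\<And>k. k \<in> Bd \<Longrightarrow> (dyad_end k - dyad_end (k - 1)) * (LINT x:dyad k|lborel. rho x) \<le> b k"
    and fc: "finite Bc" and light: "\<And>k. k \<notin> Bc \<Longrightarrow> J_norm V (R k) \<le> ennreal t"
    and heavy: "\<And>k. k \<in> Bc \<Longrightarrow> J_norm V (R k) = ennreal (c k) \<and> t < c k"
    and tc: "2 * (4 * \<kappa> + 8 * t / d) \<le> c\<^sub>0"
  shows "\<exists>n h f. real n \<le> 1 + (\<Sum>k\<in>Bd. 2 * sqrt (4 * b k) + 2) + (\<Sum>k\<in>Bc. 8 * (c k / t)) \<and>
     rank_bound n h f"
proof -
  interpret W: weight rho "1/4"
    by unfold_locales (auto simp: rho_nonneg intro: rho_integrable)
  obtain n P j where n: "real n \<le> 1 + (\<Sum>k\<in>Bd. 2 * sqrt (b k / (1/4)) + 2)"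
    and P: "\<And>i. i < n \<Longrightarrow> P i \<in> sets borel \<and> bounded (P i) \<and> measure lborel (P i) > 0"
    and jm: "j \<in> measurable borel (count_space UNIV)" and jn: "\<And>x. j x < n"
    and long: "\<And>f f'. C1_line f f' \<Longrightarrow> (\<integral>\<^sup>+x. ennreal (rho x * (cmod (f x - avg (P (j x)) f))\<^sup>2) \<partial>lborel) \<le> ennreal (2 * (1/4)) * energy1 f' UNIV"
    using W.longitudinal[OF fd C(1) _ good[folded W.mass_def] bad[folded W.mass_def]] C(2) W.mass_def by (auto simp: W.mass_def)
  obtain N B j' where N: "real N \<le> (\<Sum>k\<in>Bc. 8 * (c k / t))" and B: "\<And>i. i < N \<Longrightarrow> rect_in d (B i)"
    and j'm [measurable]: "j' \<in> measurable borel (count_space UNIV)"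
    and trans: "\<And>w p q. C1 w p q \<Longrightarrow> (\<integral>\<^sup>+z. ennreal (V z * (cmod (w z - (if j' z < N then avg (B (j' z)) w else 0)))\<^sup>2) \<partial>lborel)
       \<le> ennreal (4 * \<kappa> + 8 * t / d) * sobolev w p q band"
    using transversal[OF fc light heavy] by blast
  have "\<forall>i. \<exists>h. i < N \<longrightarrow> h \<in> L2 (strip d) \<and> (\<forall>w. continuous_on UNIV w \<longrightarrow> avg (B i) (rest w) = (LINT z|lebesgue_on (strip d). w z * h z))"
    using avg_rest_pairing[OF B] by metis
  then obtain hB where hB: "\<And>i. i < N \<Longrightarrow> hB i \<in> L2 (strip d)"
     "\<And>i w. i < N \<Longrightarrow> continuous_on UNIV w \<Longrightarrow> avg (B i) (rest w) = (LINT z|lebesgue_on (strip d). w z * hB i z)" by metis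
  define h where "h i = (if i < n then ker (P i) (\<lambda>y. s y / measure lborel (P i)) else hB (i - n))" for i
  define f where "f i z = (if i < n then (if j (fst z) = i then s (snd z) else 0) else (if j' z = i - n then 1 else 0))" for i z
  note jm1 [measurable] = borel_comp_fst[OF jm]
  have hL: "h i \<in> L2 (strip d)" if i: "i < n + N" for i
  proof (cases "i < n")
    case True
    have "\<bar>s y / measure lborel (P i)\<bar> \<le> sqrt (2 / d) / measure lborel (P i)" for y
      using s_abs_le[of y] by (simp add: divide_right_mono)
    then show ?thesis using P[OF True] True by (auto simp: h_def intro!: ker_L2)
  qed (use i hB in \<open>auto simp: h_def\<close>)
  have fm: "f i \<in> borel_measurable borel" for i unfolding f_def[abs_def] by measurable
  have main: "(\<integral>\<^sup>+z. ennreal (V z * (cmod (w z - (\<Sum>i<n+N. f i z *\<^sub>R (LINT z|lebesgue_on (strip d). w z * h i z))))\<^sup>2) \<partial>lborel)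
       \<le> (\<integral>\<^sup>+x. ennreal ((cmod (mode p x))\<^sup>2) \<partial>lborel) + ennreal c\<^sub>0 * sobolev (rest w) (rest p) (rest_y w q) band"
    if w: "C1 w p q" for w p q
  proof -
    have c: "continuous_on UNIV w" "continuous_on UNIV p" using w by (auto simp: C1_def)
    have D: "C1_line (mode w) (mode p)" unfolding C1_line_def using mode_deriv[OF w] mode_cont[OF c(2)] by blast
    have C': "C1 (rest w) (rest p) (rest_y w q)" by (rule rest_C1[OF w])
    have [measurable]: "mode w \<in> borel_measurable borel" "rest w \<in> borel_measurable borel"
      using C1_line_cont[OF D] C' by (auto simp: C1_def intro: borel_measurable_continuous_onI)
    define a where "a x = avg (P (j x)) (mode w)" for x
    define m where "m z = (if j' z < N then avg (B (j' z)) (rest w) else 0)" for z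
    have am [measurable]: "a \<in> borel_measurable borel" unfolding a_def using jm by measurable
    note am1 [measurable] = borel_comp_fst[OF am] borel_comp_fst[of "mode w" borel]
    have mm [measurable]: "m \<in> borel_measurable borel" unfolding m_def by measurable
    have \<Phi>: "(\<Sum>i<n+N. f i z *\<^sub>R (LINT z|lebesgue_on (strip d). w z * h i z)) = s (snd z) *\<^sub>R a (fst z) + m z" for z
    proof -
      have "(\<Sum>i<n. f i z *\<^sub>R (LINT z|lebesgue_on (strip d). w z * h i z)) = (\<Sum>i<n. if i = j (fst z) then s (snd z) *\<^sub>R avg (P i) (mode w) else 0)"
        using P c by (intro sum.cong refl) (auto simp: f_def h_def avg_mode_pairing)
      also have "... = s (snd z) *\<^sub>R a (fst z)" using jn by (subst sum.delta) (auto simp: a_def)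
      finally have 1: "(\<Sum>i<n. f i z *\<^sub>R (LINT z|lebesgue_on (strip d). w z * h i z)) = s (snd z) *\<^sub>R a (fst z)" .
      have "(\<Sum>i<N. f (n + i) z *\<^sub>R (LINT z|lebesgue_on (strip d). w z * h (n + i) z)) = (\<Sum>i<N. if i = j' z then avg (B i) (rest w) else 0)"
        using hB(2) c by (intro sum.cong refl) (auto simp: f_def h_def)
      also have "... = m z" by (subst sum.delta) (auto simp: m_def)
      finally show ?thesis using 1 by (simp only: sum_split_add)
    qed
    have "(\<integral>\<^sup>+z. ennreal (V z * (cmod (w z - (s (snd z) *\<^sub>R a (fst z) + m z)))\<^sup>2) * indicator UNIV z \<partial>lborel)
      \<le> ennreal 2 * (\<integral>\<^sup>+z. ennreal (V z * (s (snd z))\<^sup>2 * (cmod (mode w (fst z) - a (fst z)))\<^sup>2) * indicator UNIV z \<partial>lborel)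
        + ennreal 2 * (\<integral>\<^sup>+z. ennreal (V z * (cmod (rest w z - m z))\<^sup>2) * indicator UNIV z \<partial>lborel)"
    proof (rule nn_integral_sum_le)
      fix z
      have "w z - (s (snd z) *\<^sub>R a (fst z) + m z) = s (snd z) *\<^sub>R (mode w (fst z) - a (fst z)) + (rest w z - m z)"
        by (simp add: rest_def algebra_simps)
      then have "(cmod (w z - (s (snd z) *\<^sub>R a (fst z) + m z)))\<^sup>2 \<le> 2 * ((s (snd z))\<^sup>2 * (cmod (mode w (fst z) - a (fst z)))\<^sup>2) + 2 * (cmod (rest w z - m z))\<^sup>2"
        using sq_norm_add_le[of "s (snd z) *\<^sub>R (mode w (fst z) - a (fst z))" "rest w z - m z"] by (simp only: norm_scaleR power_mult_distrib power2_abs)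
      from mult_left_mono[OF this V0[of z]]
      show "V z * (cmod (w z - (s (snd z) *\<^sub>R a (fst z) + m z)))\<^sup>2 \<le> 2 * (V z * (s (snd z))\<^sup>2 * (cmod (mode w (fst z) - a (fst z)))\<^sup>2) + 2 * (V z * (cmod (rest w z - m z))\<^sup>2)"
        by (simp add: algebra_simps)
    qed (use V0 in \<open>auto intro!: mult_nonneg_nonneg\<close>)
    then have "(\<integral>\<^sup>+z. ennreal (V z * (cmod (w z - (s (snd z) *\<^sub>R a (fst z) + m z)))\<^sup>2) \<partial>lborel)
      \<le> ennreal 2 * (\<integral>\<^sup>+z. ennreal (V z * (s (snd z))\<^sup>2 * (cmod (mode w (fst z) - a (fst z)))\<^sup>2) \<partial>lborel)
        + ennreal 2 * (\<integral>\<^sup>+z. ennreal (V z * (cmod (rest w z - m z))\<^sup>2) \<partial>lborel)" by simp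
    also have "... \<le> ennreal 2 * (ennreal (1/2) * energy1 (mode p) UNIV) + ennreal 2 * (ennreal (4 * \<kappa> + 8 * t / d) * sobolev (rest w) (rest p) (rest_y w q) band)"
    proof (intro add_mono mult_left_mono)
      have "(\<integral>\<^sup>+z. ennreal (V z * (s (snd z))\<^sup>2 * (cmod (mode w (fst z) - a (fst z)))\<^sup>2) \<partial>lborel)
        = (\<integral>\<^sup>+z. ennreal (V z * (s (snd z))\<^sup>2) * ennreal ((cmod (mode w (fst z) - a (fst z)))\<^sup>2) \<partial>lborel)"
        using V0 by (intro nn_integral_cong ennreal_mult) auto
      also have "... = (\<integral>\<^sup>+x. ennreal (rho x) * ennreal ((cmod (mode w x - a x))\<^sup>2) \<partial>lborel)"
        by (intro rho_nn[of "\<lambda>x. ennreal ((cmod (mode w x - a x))\<^sup>2)"]) measurable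
      also have "... = (\<integral>\<^sup>+x. ennreal (rho x * (cmod (mode w x - a x))\<^sup>2) \<partial>lborel)"
        using rho_nonneg by (intro nn_integral_cong ennreal_mult[symmetric]) auto
      also have "... \<le> ennreal (1/2) * energy1 (mode p) UNIV" using long[OF D] by (simp add: a_def)
      finally show "(\<integral>\<^sup>+z. ennreal (V z * (s (snd z))\<^sup>2 * (cmod (mode w (fst z) - a (fst z)))\<^sup>2) \<partial>lborel) \<le> ennreal (1/2) * energy1 (mode p) UNIV" .
      show "(\<integral>\<^sup>+z. ennreal (V z * (cmod (rest w z - m z))\<^sup>2) \<partial>lborel) \<le> ennreal (4 * \<kappa> + 8 * t / d) * sobolev (rest w) (rest p) (rest_y w q) band"
        using trans[OF C'] by (simp add: m_def)
    qed auto
    also have "ennreal 2 * (ennreal (1/2) * energy1 (mode p) UNIV) = energy1 (mode p) UNIV"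
    proof -
      have "ennreal 2 * ennreal (1/2) = ennreal (2 * (1/2))" by (rule ennreal_mult'[symmetric]) simp
      also have "... = 1" by simp
      finally have "ennreal 2 * ennreal (1/2) = 1" .
      then show ?thesis by (simp only: mult.assoc[symmetric] mult_1)
    qed
    also have "ennreal 2 * (ennreal (4 * \<kappa> + 8 * t / d) * sobolev (rest w) (rest p) (rest_y w q) band) \<le> ennreal c\<^sub>0 * sobolev (rest w) (rest p) (rest_y w q) band"
    proof -
      have "ennreal 2 * ennreal (4 * \<kappa> + 8 * t / d) \<le> ennreal c\<^sub>0"
        using tc by (subst ennreal_mult'[symmetric]) (auto intro: ennreal_leI)
      then show ?thesis unfolding mult.assoc[symmetric] by (intro mult_right_mono) auto
    qed
    finally show ?thesis unfolding \<Phi> by (simp add: add_left_mono)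
  qed
  show ?thesis
    using n N hL fm main unfolding rank_bound_def by (intro exI[of _ "n + N"] exI[of _ h] exI[of _ f]) (auto simp: mult.commute)
qed

end

section \<open>From finite rank bounds to the negative index\<close>

text \<open>Each functional cuts down the space by at most one dimension.\<close>
lemma span_of_common_kernel:
  fixes \<L> :: "nat \<Rightarrow> ('a \<Rightarrow> complex) \<Rightarrow> complex"
  assumes "cfun.subspace M"
    and "\<And>i u v. i < n \<Longrightarrow> u \<in> M \<Longrightarrow> v \<in> M \<Longrightarrow> \<L> i (u + v) = \<L> i u + \<L> i v"
    and "\<And>i u c. i < n \<Longrightarrow> u \<in> M \<Longrightarrow> \<L> i (cscale c u) = c * \<L> i u"
    and "\<And>u. u \<in> M \<Longrightarrow> (\<And>i. i < n \<Longrightarrow> \<L> i u = 0) \<Longrightarrow> u = 0"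
  shows "\<exists>B. finite B \<and> card B \<le> n \<and> M \<subseteq> cfun.span B"
  using assms
proof (induction n arbitrary: M)
  case 0
  have "M \<subseteq> {0}"
  proof
    fix u assume "u \<in> M"
    then have "u = 0" by (rule 0(4)) simp
    then show "u \<in> {0}" by blast
  qed
  then show ?case by (intro exI[of _ "{}"]) auto
next
  case (Suc n)
  define M' where "M' = {u \<in> M. \<L> n u = 0}"
  have z: "\<L> n 0 = 0"
  proof -
    have "cscale 0 (0 :: 'a \<Rightarrow> complex) = 0" by (simp add: cscale_def fun_eq_iff)
    then show ?thesis using Suc.prems(3)[OF lessI cfun.subspace_0[OF Suc.prems(1)], of 0] by (simp only: mult_zero_left)
  qed
  have sub: "cfun.subspace M'"
  proof -
    have "\<L> n (x + y) = 0" if "x \<in> M" "y \<in> M" "\<L> n x = 0" "\<L> n y = 0" for x y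
      using Suc.prems(2)[OF lessI that(1,2)] that(3,4) by (simp only: add_0)
    moreover have "\<L> n (cscale c x) = 0" if "x \<in> M" "\<L> n x = 0" for c x
      using Suc.prems(3)[OF lessI that(1)] that(2) by (simp only: mult_zero_right)
    ultimately show ?thesis using Suc.prems(1) z unfolding cfun.subspace_def M'_def by blast
  qed
  have "\<exists>B. finite B \<and> card B \<le> n \<and> M' \<subseteq> cfun.span B"
  proof (rule Suc.IH[OF sub])
    fix u assume u: "u \<in> M'" and l: "\<And>i. i < n \<Longrightarrow> \<L> i u = 0"
    have "\<L> i u = 0" if "i < Suc n" for i using u l that by (cases "i = n") (auto simp: M'_def)
    then show "u = 0" using u Suc.prems(4)[of u] by (auto simp: M'_def)
  qed (use Suc.prems(2,3) in \<open>auto simp: M'_def\<close>)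
  then obtain B where B: "finite B" "card B \<le> n" "M' \<subseteq> cfun.span B" by blast
  show ?case
  proof (cases "M \<subseteq> M'")
    case True
    then show ?thesis using B by (intro exI[of _ B]) auto
  next
    case False
    then obtain v where v: "v \<in> M" "\<L> n v \<noteq> 0" by (auto simp: M'_def)
    have "u \<in> cfun.span (insert v B)" if u: "u \<in> M" for u
    proof -
      define a where "a = \<L> n u / \<L> n v"
      have m: "cscale (- a) v \<in> M" using Suc.prems(1) v unfolding cfun.subspace_def by blast
      then have um: "u + cscale (- a) v \<in> M" using Suc.prems(1) u unfolding cfun.subspace_def by blast
      have "\<L> n (u + cscale (- a) v) = 0"
      proof -
        have "\<L> n u + - a * \<L> n v = 0" using v(2) by (simp add: a_def)
        then show ?thesis using Suc.prems(2)[OF lessI u m] Suc.prems(3)[OF lessI v(1), of "- a"] by (simp only:)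
      qed
      then have "u + cscale (- a) v \<in> M'" using um unfolding M'_def by blast
      then have "u + cscale (- a) v \<in> cfun.span (insert v B)"
        using B(3) cfun.span_mono[of B "insert v B"] by blast
      moreover have "cscale a v \<in> cfun.span (insert v B)" by (intro cfun.span_scale cfun.span_base) auto
      ultimately have "(u + cscale (- a) v) + cscale a v \<in> cfun.span (insert v B)" by (rule cfun.span_add)
      moreover have "(u + cscale (- a) v) + cscale a v = u" by (simp add: fun_eq_iff cscale_def)
      ultimately show ?thesis by simp
    qed
    then show ?thesis using B by (intro exI[of _ "insert v B"]) (auto simp: card_insert_if)
  qed
qed

text \<open>Lebesgue measure is complete, so a function that agrees almost everywhere with a measurable one is measurable; otherwise neither
  is integrable and both integrals are \<open>0\<close>.\<close>
lemma lint_lebesgue_on_AE_eq: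
  fixes f g :: "'a::euclidean_space \<Rightarrow> 'b::euclidean_space"
  assumes S: "S \<in> sets lebesgue" and eq: "AE x in lborel. x \<in> S \<longrightarrow> f x = g x"
  shows "(LINT x|lebesgue_on S. f x) = (LINT x|lebesgue_on S. g x)"
proof -
  define F where "F f x = indicator S x *\<^sub>R (f x :: 'b)" for f x
  have FE: "(LINT x|lebesgue_on S. f x) = (LINT x|lebesgue. F f x)" for f
    using S unfolding F_def by (simp add: integral_restrict_space)
  have ae: "AE x in lebesgue. F f x = F g x"
    using eq by (intro AE_completion) (auto elim!: eventually_mono simp: F_def indicator_def)
  show ?thesis
  proof (cases "F f \<in> borel_measurable lebesgue")
    case True
    then have "F g \<in> borel_measurable lebesgue" using ae by (rule borel_measurable_AE)
    then show ?thesis unfolding FE using True ae by (intro integral_cong_AE)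
  next
    case False
    have "AE x in lebesgue. F g x = F f x" using ae by eventually_elim simp
    then have "F g \<notin> borel_measurable lebesgue" using False borel_measurable_AE by blast
    then show ?thesis unfolding FE using False by (metis borel_measurable_integrable not_integrable_integral_eq)
  qed
qed

context strip_potential
begin

text \<open>Approximate \<open>u\<close> by the smooth functions that define its trace. Their coefficients with respect to the \<open>h i\<close> tend to \<open>0\<close>, so
  the approximations \<open>\<Phi>\<close> tend to \<open>0\<close> pointwise and Fatou's lemma gives \<open>\<integral>V\<bar>u\<bar>\<^sup>2 \<le> q\<^sub>0[u] + \<delta> \<integral>\<bar>u\<bar>\<^sup>2\<close> with \<open>q\<^sub>0\<close> the form for \<open>V = 0\<close>: the
  boundary term vanishes in the limit, with \<open>\<delta>\<close> and hence the constant \<open>K\<close> fixed. Finally \<open>\<delta> \<rightarrow> 0\<close>.\<close>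
lemma form_nonneg_on_kernel:
  assumes eq: "AE z in lebesgue_on (strip d). V0 z = V z"
    and rk: "rank_bound n h f"
    and u: "u \<in> form_domain d V0" and ker: "\<And>i. i < n \<Longrightarrow> (LINT z|lebesgue_on (strip d). u z * h i z) = 0"
  shows "0 \<le> qform d V0 u"
proof -
  from rk have L2h: "\<And>i. i < n \<Longrightarrow> h i \<in> L2 (strip d)" and fm: "\<And>i. i < n \<Longrightarrow> f i \<in> borel_measurable borel"
    and bound: "\<And>w p q. C1 w p q \<Longrightarrow> (\<integral>\<^sup>+z. ennreal (V z * (cmod (w z - (\<Sum>i<n. f i z *\<^sub>R (LINT z|lebesgue_on (strip d). w z * h i z))))\<^sup>2) \<partial>lborel)
       \<le> (\<integral>\<^sup>+x. ennreal ((cmod (mode p x))\<^sup>2) \<partial>lborel) + ennreal c\<^sub>0 * sobolev (rest w) (rest p) (rest_y w q) band"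
    unfolding rank_bound_def by blast+
  let ?M = "lebesgue_on (strip d)"
  define U1 where "U1 = weak_deriv (strip d) (1, 0) u"
  define U2 where "U2 = weak_deriv (strip d) (0, 1) u"
  have uW: "u \<in> W12 (strip d)" and Vi: "integrable ?M (\<lambda>z. V0 z * (cmod (u z))\<^sup>2)"
    using u by (auto simp: form_domain_def)
  have uL: "u \<in> L2 (strip d)" using uW by (simp add: W12_def)
  have UL: "U1 \<in> L2 (strip d)" "U2 \<in> L2 (strip d)"
    unfolding U1_def U2_def using weak_deriv_props[OF uW] by (auto simp: Basis_plane)
  obtain w where w: "\<And>k. w k \<in> test_functions UNIV" and wlim: "(\<lambda>k. W12_norm (strip d) (w k - u)) \<longlonglongrightarrow> 0"
    and tlim: "(\<lambda>k. LINT x|lebesgue. (cmod (w k (x, 0) - 0))\<^sup>2) \<longlonglongrightarrow> 0"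
    using u unfolding form_domain_def has_trace_def by blast
  have "\<exists>p q S. C1 (w k) p q \<and> bounded S \<and> (\<forall>z. z \<notin> S \<longrightarrow> w k z = 0 \<and> p z = 0 \<and> q z = 0)" for k
    using test_C1[OF w[of k]] by metis
  then obtain p q S where C: "\<And>k. C1 (w k) (p k) (q k)" and bS: "\<And>k. bounded (S k)"
    and out: "\<And>k z. z \<notin> S k \<Longrightarrow> w k z = 0 \<and> p k z = 0 \<and> q k z = 0" by metis
  note wL = test_L2[OF w C]
  have int_sq: "integrable ?M (\<lambda>z. (cmod (v z))\<^sup>2)" if "v \<in> L2 (strip d)" for v using that by (simp add: L2_def)
  have int_diff: "integrable ?M (\<lambda>z. (cmod (v z - v' z))\<^sup>2)" if "v \<in> L2 (strip d)" "v' \<in> L2 (strip d)" for v v'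
    using L2_diff[OF that] by (simp add: L2_def)
  have nrm: "(\<lambda>k. (W12_norm (strip d) (w k - u))\<^sup>2) \<longlonglongrightarrow> 0" using tendsto_power[OF wlim, of 2] by simp
  have split: "(W12_norm (strip d) (w k - u))\<^sup>2 = (LINT z|?M. (cmod (p k z - U1 z))\<^sup>2) + (LINT z|?M. (cmod (q k z - U2 z))\<^sup>2) + (LINT z|?M. (cmod (w k z - u z))\<^sup>2)" for k
    unfolding U1_def U2_def by (rule W12_norm_diff[OF uW w C])
  have nn: "0 \<le> (LINT z|?M. (cmod (v z - v' z))\<^sup>2)" for v v' by (intro integral_nonneg_AE AE_I2) auto
  have lims: "(\<lambda>k. LINT z|?M. (cmod (p k z - U1 z))\<^sup>2) \<longlonglongrightarrow> 0" "(\<lambda>k. LINT z|?M. (cmod (q k z - U2 z))\<^sup>2) \<longlonglongrightarrow> 0"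
    "(\<lambda>k. LINT z|?M. (cmod (w k z - u z))\<^sup>2) \<longlonglongrightarrow> 0"
    by (rule tendsto_sandwich[OF _ _ tendsto_const nrm]; intro always_eventually allI; use nn[of "p _" U1] nn[of "q _" U2] nn[of "w _" u] in \<open>simp add: split\<close>)+
  define A where "A = (LINT z|?M. (cmod (U1 z))\<^sup>2) + (LINT z|?M. (cmod (U2 z))\<^sup>2)"
  define N where "N = (LINT z|?M. (cmod (u z))\<^sup>2)"
  have P: "(\<lambda>k. LINT z|?M. (cmod (p k z))\<^sup>2) \<longlonglongrightarrow> (LINT z|?M. (cmod (U1 z))\<^sup>2)"
    by (rule L2_limit_norm[OF int_sq[OF wL(2)] int_sq[OF UL(1)] int_diff[OF wL(2) UL(1)] lims(1)])
  have Q: "(\<lambda>k. LINT z|?M. (cmod (q k z))\<^sup>2) \<longlonglongrightarrow> (LINT z|?M. (cmod (U2 z))\<^sup>2)"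
    by (rule L2_limit_norm[OF int_sq[OF wL(3)] int_sq[OF UL(2)] int_diff[OF wL(3) UL(2)] lims(2)])
  have W: "(\<lambda>k. LINT z|?M. (cmod (w k z))\<^sup>2) \<longlonglongrightarrow> N" unfolding N_def
    by (rule L2_limit_norm[OF int_sq[OF wL(1)] int_sq[OF uL] int_diff[OF wL(1) uL] lims(3)])
  have T: "(\<lambda>k. LINT x|lborel. (cmod (w k (x, 0)))\<^sup>2) \<longlonglongrightarrow> 0"
  proof -
    have "(LINT x|lebesgue. (cmod (w k (x, 0) - 0))\<^sup>2) = (LINT x|lborel. (cmod (w k (x, 0)))\<^sup>2)" for k
    proof -
      have "continuous_on UNIV (\<lambda>x. (cmod (w k (x, 0)))\<^sup>2)" using C[of k] by (auto simp: C1_def intro!: continuous_intros cont_section)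
      then have "(\<lambda>x. (cmod (w k (x, 0)))\<^sup>2) \<in> borel_measurable borel" by (intro borel_measurable_continuous_onI)
      then show ?thesis by (simp add: integral_completion)
    qed
    then show ?thesis using tlim by simp
  qed
  have pair: "(\<lambda>k. LINT z|?M. w k z * h i z) \<longlonglongrightarrow> 0" if i: "i < n" for i
    using L2_limit_pairing[OF _ _ _ _ lims(3), of "h i"] ker[OF i]
    by (simp add: int_sq[OF L2h[OF i]] int_diff[OF wL(1) uL] L2_lint_mult[OF wL(1) L2h[OF i]] L2_lint_mult[OF uL L2h[OF i]])
  obtain r :: "nat \<Rightarrow> nat" where r: "strict_mono r" and ae: "AE z in ?M. (\<lambda>k. w (r k) z) \<longlonglongrightarrow> u z"
    using L2_limit_subseq[OF int_diff[OF wL(1) uL] lims(3)] by blast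
  define \<Phi> where "\<Phi> k z = (\<Sum>i<n. f i z *\<^sub>R (LINT z|?M. w k z * h i z))" for k z
  have \<Phi>lim: "(\<lambda>k. \<Phi> (r k) z) \<longlonglongrightarrow> 0" for z
  proof -
    have "(\<lambda>k. \<Phi> (r k) z) \<longlonglongrightarrow> (\<Sum>i<n. f i z *\<^sub>R 0)"
      unfolding \<Phi>_def using LIMSEQ_subseq_LIMSEQ[OF pair r] by (intro tendsto_sum tendsto_scaleR tendsto_const) (auto simp: o_def)
    then show ?thesis by simp
  qed
  define e where "e k z = ennreal (V z * (cmod (w k z - \<Phi> k z))\<^sup>2)" for k z
  have em: "e k \<in> borel_measurable borel" for k
  proof -
    have [measurable]: "w k \<in> borel_measurable borel" using C[of k] by (auto simp: C1_def intro: borel_measurable_continuous_onI)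
    have [measurable]: "\<Phi> k \<in> borel_measurable borel" unfolding \<Phi>_def[abs_def] using fm by (intro borel_measurable_sum borel_measurable_scaleR) auto
    show ?thesis unfolding e_def[abs_def] by measurable
  qed
  have e_lim: "AE z in ?M. ennreal (V z * (cmod (u z))\<^sup>2) = liminf (\<lambda>k. e (r k) z)"
    using ae
  proof eventually_elim
    fix z assume "(\<lambda>k. w (r k) z) \<longlonglongrightarrow> u z"
    then have "(\<lambda>k. e (r k) z) \<longlonglongrightarrow> ennreal (V z * (cmod (u z - 0))\<^sup>2)"
      unfolding e_def by (intro tendsto_intros \<Phi>lim)
    then show "ennreal (V z * (cmod (u z))\<^sup>2) = liminf (\<lambda>k. e (r k) z)"
      using lim_imp_Liminf[OF sequentially_bot, of "\<lambda>k. e (r k) z" "ennreal (V z * (cmod (u z))\<^sup>2)"] by simp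
  qed
  have step: "0 \<le> A - \<omega>\<^sup>2 * N + \<delta> * N \<and> (\<integral>\<^sup>+z. ennreal (V z * (cmod (u z))\<^sup>2) \<partial>?M) \<le> ennreal (A - \<omega>\<^sup>2 * N + \<delta> * N)" if \<delta>: "0 < \<delta>" for \<delta>
  proof -
    obtain K where K: "\<forall>w p q S. C1 w p q \<longrightarrow> bounded S \<longrightarrow> (\<forall>z. z \<notin> S \<longrightarrow> w z = 0 \<and> p z = 0 \<and> q z = 0) \<longrightarrow>
      (\<exists>r\<ge>0. r = (LINT z|?M. (cmod (p z))\<^sup>2) + (LINT z|?M. (cmod (q z))\<^sup>2)
          - \<omega>\<^sup>2 * (LINT z|?M. (cmod (w z))\<^sup>2) + \<delta> * (LINT z|?M. (cmod (w z))\<^sup>2) + K * (LINT x|lborel. (cmod (w (x, 0)))\<^sup>2) \<and>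
      (\<integral>\<^sup>+x. ennreal ((cmod (mode p x))\<^sup>2) \<partial>lborel) + ennreal c\<^sub>0 * sobolev (rest w) (rest p) (rest_y w q) band \<le> ennreal r)"
      using form_decomposition[OF \<delta>] by blast
    define \<rho> where "\<rho> k = (LINT z|?M. (cmod (p k z))\<^sup>2) + (LINT z|?M. (cmod (q k z))\<^sup>2)
          - \<omega>\<^sup>2 * (LINT z|?M. (cmod (w k z))\<^sup>2) + \<delta> * (LINT z|?M. (cmod (w k z))\<^sup>2) + K * (LINT x|lborel. (cmod (w k (x, 0)))\<^sup>2)" for k
    have \<rho>: "0 \<le> \<rho> k" "(\<integral>\<^sup>+x. ennreal ((cmod (mode (p k) x))\<^sup>2) \<partial>lborel) + ennreal c\<^sub>0 * sobolev (rest (w k)) (rest (p k)) (rest_y (w k) (q k)) band \<le> ennreal (\<rho> k)" for k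
      using K[rule_format, OF C[of k] bS[of k] out[of _ k]] unfolding \<rho>_def by auto
    have \<rho>lim: "\<rho> \<longlonglongrightarrow> A - \<omega>\<^sup>2 * N + \<delta> * N"
    proof -
      have "\<rho> \<longlonglongrightarrow> (LINT z|?M. (cmod (U1 z))\<^sup>2) + (LINT z|?M. (cmod (U2 z))\<^sup>2) - \<omega>\<^sup>2 * N + \<delta> * N + K * 0"
        unfolding \<rho>_def[abs_def] by (intro tendsto_intros P Q W T)
      then show ?thesis by (simp add: A_def)
    qed
    have \<rho>rlim: "(\<lambda>k. \<rho> (r k)) \<longlonglongrightarrow> A - \<omega>\<^sup>2 * N + \<delta> * N" using LIMSEQ_subseq_LIMSEQ[OF \<rho>lim r] by (simp add: o_def)
    have eb: "(\<integral>\<^sup>+z. e k z \<partial>?M) \<le> ennreal (\<rho> k)" for k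
    proof -
      have "(\<integral>\<^sup>+z. e k z \<partial>?M) = (\<integral>\<^sup>+z. e k z * indicator (strip d) z \<partial>lborel)" by (intro nn_integral_lebesgue_on strip_borel)
      also have "... \<le> (\<integral>\<^sup>+z. e k z \<partial>lborel)" by (intro nn_integral_mono) (auto simp: indicator_def)
      also have "... \<le> ennreal (\<rho> k)" unfolding e_def \<Phi>_def by (rule order_trans[OF bound[OF C] \<rho>(2)])
      finally show ?thesis .
    qed
    have "(\<integral>\<^sup>+z. ennreal (V z * (cmod (u z))\<^sup>2) \<partial>?M) = (\<integral>\<^sup>+z. liminf (\<lambda>k. e (r k) z) \<partial>?M)"
      by (rule nn_integral_cong_AE[OF e_lim])
    also have "... \<le> liminf (\<lambda>k. \<integral>\<^sup>+z. e (r k) z \<partial>?M)"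
      using em by (intro nn_integral_liminf) (auto intro!: measurable_restrict_space1 measurable_completion)
    also have "... \<le> liminf (\<lambda>k. ennreal (\<rho> (r k)))" by (intro Liminf_mono always_eventually allI eb)
    also have "... = ennreal (A - \<omega>\<^sup>2 * N + \<delta> * N)"
      by (intro lim_imp_Liminf sequentially_bot tendsto_ennrealI \<rho>rlim)
    finally show ?thesis using LIMSEQ_le_const[OF \<rho>lim, of 0] \<rho>(1) by auto
  qed
  define X where "X = (LINT z|?M. V0 z * (cmod (u z))\<^sup>2)"
  have "ennreal X = (\<integral>\<^sup>+z. ennreal (V0 z * (cmod (u z))\<^sup>2) \<partial>?M)"
  proof -
    have "AE z in ?M. 0 \<le> V0 z * (cmod (u z))\<^sup>2" using eq by eventually_elim (simp add: V0)
    then show ?thesis unfolding X_def using Vi by (intro nn_integral_eq_integral[symmetric])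
  qed
  also have "... = (\<integral>\<^sup>+z. ennreal (V z * (cmod (u z))\<^sup>2) \<partial>?M)"
    using eq by (intro nn_integral_cong_AE) (auto elim: eventually_mono)
  finally have XV: "ennreal X = (\<integral>\<^sup>+z. ennreal (V z * (cmod (u z))\<^sup>2) \<partial>?M)" .
  have XA: "X \<le> A - \<omega>\<^sup>2 * N + \<delta> * N" if "0 < \<delta>" for \<delta>
    using step[OF that] unfolding XV[symmetric] by (auto simp: ennreal_le_iff)
  have N0: "0 \<le> N" unfolding N_def by (intro integral_nonneg_AE AE_I2) auto
  have "X \<le> A - \<omega>\<^sup>2 * N"
  proof (rule field_le_epsilon)
    fix \<epsilon> :: real assume \<epsilon>: "0 < \<epsilon>"
    have "X \<le> A - \<omega>\<^sup>2 * N + \<epsilon> / (N + 1) * N" using \<epsilon> N0 by (intro XA) auto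
    also have "\<epsilon> / (N + 1) * N \<le> \<epsilon>" using \<epsilon> N0 by (simp add: field_simps)
    finally show "X \<le> A - \<omega>\<^sup>2 * N + \<epsilon>" by simp
  qed
  moreover have "qform d V0 u = A - \<omega>\<^sup>2 * N - X"
  proof -
    have "grad_sq (strip d) u z = (cmod (U1 z))\<^sup>2 + (cmod (U2 z))\<^sup>2" for z
      by (simp add: grad_sq_def Basis_plane U1_def U2_def)
    then have "(LINT z|?M. grad_sq (strip d) u z - pi\<^sup>2 / (4 * d\<^sup>2) * (cmod (u z))\<^sup>2) = A - \<omega>\<^sup>2 * N"
      using int_sq[OF uL] int_sq[OF UL(1)] int_sq[OF UL(2)]
      by (simp add: A_def N_def \<omega>_def power_divide power_mult_distrib)
    then show ?thesis by (simp add: qform_def X_def)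
  qed
  ultimately show ?thesis by simp
qed

lemma N_minus_le_rank:
  assumes eq: "AE z in lebesgue_on (strip d). V0 z = V z"
    and rk: "rank_bound n h f"
  shows "N_minus d V0 \<le> enat n"
  unfolding N_minus_def
proof (rule SUP_least)
  fix M assume *: "M \<in> {M. cfun.subspace M \<and> M \<subseteq> form_domain d V0 \<and> (\<forall>u\<in>M - {0}. qform d V0 u < 0)}"
  have L2h: "h i \<in> L2 (strip d)" if "i < n" for i using rk that unfolding rank_bound_def by blast
  from * have M: "cfun.subspace M" "M \<subseteq> form_domain d V0" and neg: "\<And>u. u \<in> M \<Longrightarrow> u \<noteq> 0 \<Longrightarrow> qform d V0 u < 0" by auto
  have ML2: "u \<in> L2 (strip d)" if "u \<in> M" for u using that M by (auto simp: form_domain_def W12_def)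
  have "\<exists>B. finite B \<and> card B \<le> n \<and> M \<subseteq> cfun.span B"
  proof (rule span_of_common_kernel[OF M(1), of n "\<lambda>i u. LINT z|lebesgue_on (strip d). u z * h i z"])
    fix i u v assume i: "i < n" and "u \<in> M" "v \<in> M"
    then show "(LINT z|lebesgue_on (strip d). (u + v) z * h i z) = (LINT z|lebesgue_on (strip d). u z * h i z) + (LINT z|lebesgue_on (strip d). v z * h i z)"
      using L2_lint_mult[OF ML2 L2h[OF i]] by (simp add: distrib_right)
  next
    fix i u c
    show "(LINT z|lebesgue_on (strip d). cscale c u z * h i z) = c * (LINT z|lebesgue_on (strip d). u z * h i z)"
      by (simp add: cscale_def mult.assoc)
  next
    fix u assume "u \<in> M" and k: "\<And>i. i < n \<Longrightarrow> (LINT z|lebesgue_on (strip d). u z * h i z) = 0"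
    then have "u \<in> form_domain d V0" using M by blast
    from form_nonneg_on_kernel[OF eq rk this k] neg[OF \<open>u \<in> M\<close>] show "u = 0" by fastforce
  qed
  then obtain B where B: "finite B" "card B \<le> n" "M \<subseteq> cfun.span B" by blast
  have "cfun.dim M \<le> card B" using B by (intro cfun.dim_le_card)
  then show "edim M \<le> enat n" using B by (auto simp: edim_def)
qed

end

section \<open>Passage to a Borel potential\<close>

text \<open>The Orlicz norm is insensitive to null sets: to a change of the function and to the end point \<open>0\<close>.\<close>
lemma L_psi_norm_av_cong_le:
  assumes eq: "AE y in lborel. y \<in> {0<..<d} \<longrightarrow> g y = f y" and d: "0 < d"
  shows "L_psi_norm_av {0..<d} f \<le> L_psi_norm_av {0<..<d} g"
  unfolding L_psi_norm_av_def
proof (rule SUP_least)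
  fix k assume "k \<in> {g. g \<in> borel_measurable (lebesgue_on {0..<d}) \<and> (\<integral>\<^sup>+ y. ennreal (phi (g y)) \<partial>lebesgue_on {0..<d}) \<le> emeasure lebesgue {0..<d}}"
  then have k: "k \<in> borel_measurable (lebesgue_on {0..<d})" "(\<integral>\<^sup>+ y. ennreal (phi (k y)) \<partial>lebesgue_on {0..<d}) \<le> emeasure lebesgue {0..<d}" by auto
  have "k \<in> borel_measurable (lebesgue_on {0<..<d})" using k(1) by (rule measurable_restrict_mono) auto
  moreover have "(\<integral>\<^sup>+ y. ennreal (phi (k y)) \<partial>lebesgue_on {0<..<d}) \<le> emeasure lebesgue {0<..<d}"
  proof -
    have "(\<integral>\<^sup>+ y. ennreal (phi (k y)) \<partial>lebesgue_on {0<..<d}) \<le> (\<integral>\<^sup>+ y. ennreal (phi (k y)) \<partial>lebesgue_on {0..<d})"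
      by (simp add: nn_integral_lebesgue_on) (intro nn_integral_mono, auto simp: indicator_def)
    also have "... \<le> emeasure lebesgue {0..<d}" by (rule k(2))
    also have "... = emeasure lebesgue {0<..<d}" using d by simp
    finally show ?thesis .
  qed
  moreover have "(LINT y|lebesgue_on {0..<d}. f y * k y) = (LINT y|lebesgue_on {0<..<d}. g y * k y)"
  proof -
    have "(LINT y|lebesgue_on {0..<d}. f y * k y) = (LINT y|lebesgue_on {0..<d}. indicator {0<..<d} y *\<^sub>R (g y * k y))"
      using eq AE_lborel_singleton[of 0] by (intro lint_lebesgue_on_AE_eq) (auto elim!: eventually_elim2 simp: indicator_def)
    also have "... = (LINT y|lebesgue. indicator {0..<d} y *\<^sub>R (indicator {0<..<d} y *\<^sub>R (g y * k y)))"
      by (simp add: integral_restrict_space)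
    also have "... = (LINT y|lebesgue. indicator {0<..<d} y *\<^sub>R (g y * k y))"
      by (intro Bochner_Integration.integral_cong refl) (auto simp: indicator_def)
    also have "... = (LINT y|lebesgue_on {0<..<d}. g y * k y)" by (simp add: integral_restrict_space)
    finally show ?thesis .
  qed
  ultimately show "ennreal \<bar>LINT y|lebesgue_on {0..<d}. f y * k y\<bar> \<le> (SUP g'\<in>{g. g \<in> borel_measurable (lebesgue_on {0<..<d}) \<and> (\<integral>\<^sup>+ y. ennreal (phi (g y)) \<partial>lebesgue_on {0<..<d}) \<le> emeasure lebesgue {0<..<d}}.
     ennreal \<bar>LINT y|lebesgue_on {0<..<d}. g y * g' y\<bar>)"
    by (intro SUP_upper2[of k]) auto
qed

text \<open>A Lebesgue measurable function agrees with a Borel function almost everywhere. The averages, sections and products are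
  measurable without further care once the potential is Borel.\<close>
lemma Borel_representative:
  assumes V0: "admissible_potential d V0" and d: "0 < d" and t: "0 < t"
  obtains V where "strip_potential d t V" "AE z in lborel. z \<in> strip d \<longrightarrow> V0 z = V z"
proof -
  have m: "V0 \<in> borel_measurable (lebesgue_on (strip d))" and nn: "\<And>z. z \<in> strip d \<Longrightarrow> 0 \<le> V0 z"
    and int: "\<And>B. B \<in> sets lebesgue \<Longrightarrow> B \<subseteq> strip d \<Longrightarrow> bounded B \<Longrightarrow> integrable (lebesgue_on B) V0"
    using V0 by (auto simp: admissible_potential_def)
  define g where "g z = (if z \<in> strip d then V0 z else 0)" for z
  have "g \<in> borel_measurable (completion lborel)" unfolding g_def using m by (intro borel_measurable_if_I) auto
  from completion_ex_borel_measurable_real[OF this] obtain g' where g': "g' \<in> borel_measurable lborel" "AE z in lborel. g z = g' z" by blast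
  define V where "V z = (if z \<in> strip d then max 0 (g' z) else 0)" for z
  have Vm [measurable]: "V \<in> borel_measurable borel" unfolding V_def[abs_def] using g'(1) by measurable
  have ae: "AE z in lborel. z \<in> strip d \<longrightarrow> V0 z = V z"
    using g'(2) by eventually_elim (use nn in \<open>fastforce simp: g_def V_def\<close>)
  have "strip_potential d t V"
  proof unfold_locales
    fix S :: "(real \<times> real) set" assume S [measurable]: "S \<in> sets borel" and b: "bounded S"
    define B where "B = S \<inter> strip d"
    have Bm [measurable]: "B \<in> sets borel" unfolding B_def by measurable
    have B: "B \<in> sets lebesgue" "B \<subseteq> strip d" "bounded B" using Bm b by (auto simp: B_def intro: sets_completionI_sets)
    have "(\<integral>\<^sup>+z. ennreal (V z) * indicator S z \<partial>lborel) = (\<integral>\<^sup>+z. ennreal (norm (V0 z)) * indicator B z \<partial>lborel)"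
      using ae by (intro nn_integral_cong_AE) (auto elim!: eventually_mono simp: B_def V_def indicator_def)
    also have "... = (\<integral>\<^sup>+z. ennreal (norm (V0 z)) \<partial>lebesgue_on B)" by (intro nn_integral_lebesgue_on[symmetric] Bm)
    also have "... < \<infinity>" using int[OF B] unfolding integrable_iff_bounded by blast
    finally show "(\<integral>\<^sup>+z. ennreal (V z) * indicator S z \<partial>lborel) < \<infinity>" .
  qed (use d t Vm in \<open>auto simp: V_def\<close>)
  then show thesis using that ae by blast
qed

lemma C_norm_ge_J_norm:
  assumes "strip_potential d t V" and ae: "AE z in lborel. z \<in> strip d \<longrightarrow> V0 z = V z"
  shows "J_norm V (strip_potential.R d k) \<le> C_norm d V0 k"
proof -
  interpret strip_potential d t V by fact
  have sec: "AE x in lborel. AE y in lborel. y \<in> {0<..<d} \<longrightarrow> V0 (x, y) = V (x, y)"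
    using lborel_pair.AE_pair[OF ae[folded lborel_prod]] by (simp add: strip_def)
  have "J_norm V (R k) \<le> (\<integral>\<^sup>+x. L_psi_norm_av {0<..<d} (\<lambda>y. V0 (x, y)) * indicator {of_int k<..<of_int k + 1} x \<partial>lborel)"
    unfolding J_norm_def
  proof (rule nn_integral_mono_AE, use sec AE_lborel_singleton[of "of_int k"] in eventually_elim)
    fix x :: real assume s: "AE y in lborel. y \<in> {0<..<d} \<longrightarrow> V0 (x, y) = V (x, y)" and x: "x \<noteq> of_int k"
    show "L_psi_norm_av {y. (x, y) \<in> R k} (\<lambda>y. V (x, y)) \<le> L_psi_norm_av {0<..<d} (\<lambda>y. V0 (x, y)) * indicator {of_int k<..<of_int k + 1} x"
    proof (cases "x \<in> {of_int k<..<of_int k + 1}")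
      case True
      then have "{y. (x, y) \<in> R k} = {0..<d}" by (auto simp: R_def)
      then show ?thesis using L_psi_norm_av_cong_le[OF s d] True by simp
    next
      case False
      then have e: "{y. (x, y) \<in> R k} = {}" using x by (auto simp: R_def)
      show ?thesis unfolding e by (simp add: L_psi_norm_av_empty)
    qed
  qed
  also have "... = C_norm d V0 k"
    unfolding C_norm_def L1_L_psi_norm_def by (intro nn_integral_lebesgue_on[symmetric]) auto
  finally show ?thesis .
qed

lemma dyad_dyadic: "dyad k \<subseteq> dyadic k" and dyadic_borel [measurable]: "dyadic k \<in> sets borel"
  and dyadic_bounded: "bounded (dyadic k)"
  and dyadic_ge: "k \<noteq> 0 \<Longrightarrow> x \<in> dyadic k \<Longrightarrow> 2 ^ nat (\<bar>k\<bar> - 1) \<le> \<bar>x\<bar>"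
proof -
  have p: "(2::real) powi j = 2 ^ nat j" if "0 \<le> j" for j using that by (simp add: power_int_def)
  consider "k = 0" | "k > 0" | "k < 0" by linarith
  then show "dyad k \<subseteq> dyadic k"
  proof cases
    case 2
    then show ?thesis by (auto simp: dyad_def dyad_end_def dyadic_def p)
  next
    case 3
    then have "nat (- (k - 1) - 1) = nat \<bar>k\<bar>" "nat (- k - 1) = nat (\<bar>k\<bar> - 1)" by auto
    then show ?thesis using 3 unfolding dyad_def dyad_end_def dyadic_def by (auto simp: p)
  qed (auto simp: dyad_def dyad_end_def dyadic_def)
  show "dyadic k \<in> sets borel" "bounded (dyadic k)" by (auto simp: dyadic_def)
  show "2 ^ nat (\<bar>k\<bar> - 1) \<le> \<bar>x\<bar>" if "k \<noteq> 0" "x \<in> dyadic k"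
    using that by (auto simp: dyadic_def p split: if_splits)
qed

text \<open>On the \<open>k\<close>-th dyadic interval the weight \<open>\<bar>x\<bar>\<close> is at least \<open>2 ^ (\<bar>k\<bar> - 1)\<close> for \<open>k \<noteq> 0\<close>, and it is \<open>1\<close> for \<open>k = 0\<close>.\<close>
lemma beta_ge_mass:
  assumes "strip_potential d t V" and ae: "AE z in lborel. z \<in> strip d \<longrightarrow> V0 z = V z"
  shows "(LINT x:dyad k|lborel. strip_potential.rho d V x) \<le> 2 * beta d V0 k * (1/2) ^ nat \<bar>k\<bar>"
proof -
  interpret strip_potential d t V by fact
  let ?c = "\<lambda>x::real. if k = 0 then 1 else \<bar>x\<bar>"
  have c0: "0 \<le> ?c x" for x by simp
  have sec: "AE x in lborel. AE y in lborel. y \<in> {0<..<d} \<longrightarrow> V0 (x, y) = V (x, y)"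
    using lborel_pair.AE_pair[OF ae[folded lborel_prod]] by (simp add: strip_def)
  have inner: "(LINT y|lebesgue_on {0<..<d}. ?c x * V (x, y) * (sin (pi / (2 * d) * y))\<^sup>2) = d / 2 * (?c x * rho x)" for x
  proof -
    have s2: "(sin (pi / (2 * d) * y))\<^sup>2 = d / 2 * (s y)\<^sup>2" for y using d by (simp add: s_def \<omega>_def power_mult_distrib)
    have m [measurable]: "(\<lambda>y. V (x, y) * (s y)\<^sup>2) \<in> borel_measurable borel"
    proof -
      have "(\<lambda>y. V (x, y)) \<in> borel_measurable borel"
        by (rule measurable_compose[OF _ V]) (intro borel_measurable_continuous_onI continuous_intros)
      then show ?thesis by measurable
    qed
    have "(LINT y|lebesgue_on {0<..<d}. ?c x * V (x, y) * (sin (pi / (2 * d) * y))\<^sup>2) = (LINT y|lebesgue. indicator {0<..<d} y *\<^sub>R (?c x * V (x, y) * (sin (pi / (2 * d) * y))\<^sup>2))"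
      by (simp add: integral_restrict_space)
    also have "... = (LINT y|lebesgue. (d / 2 * ?c x) * (V (x, y) * (s y)\<^sup>2))"
    proof (intro Bochner_Integration.integral_cong refl)
      fix y
      have "V (x, y) = 0" if "y \<notin> {0<..<d}" using that by (intro Vout) (auto simp: strip_def)
      then show "indicator {0<..<d} y *\<^sub>R (?c x * V (x, y) * (sin (pi / (2 * d) * y))\<^sup>2) = (d / 2 * ?c x) * (V (x, y) * (s y)\<^sup>2)"
        unfolding s2 by (cases "y \<in> {0<..<d}") simp_all
    qed
    also have "... = d / 2 * ?c x * (LINT y|lebesgue. V (x, y) * (s y)\<^sup>2)" by (rule integral_mult_right_zero)
    also have "(LINT y|lebesgue. V (x, y) * (s y)\<^sup>2) = (LINT y|lborel. V (x, y) * (s y)\<^sup>2)" by (intro integral_completion) measurable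
    also have "... = rho x" unfolding rho_def using V0 by (intro integral_eq_nn_integral AE_I2) auto
    finally show ?thesis by simp
  qed
  have "beta d V0 k = 2 / d * (LINT x|lebesgue_on (dyadic k). d / 2 * (?c x * rho x))"
    unfolding beta_def
  proof (intro arg_cong[where f="\<lambda>x. 2 / d * x"] lint_lebesgue_on_AE_eq)
    show "dyadic k \<in> sets lebesgue" using dyadic_borel by (auto intro: sets_completionI_sets)
    show "AE x in lborel. x \<in> dyadic k \<longrightarrow> (LINT y|lebesgue_on {0<..<d}. ?c x * V0 (x, y) * (sin (pi / (2 * d) * y))\<^sup>2) = d / 2 * (?c x * rho x)"
      using sec
    proof eventually_elim
      fix x assume "AE y in lborel. y \<in> {0<..<d} \<longrightarrow> V0 (x, y) = V (x, y)"
      then have "(LINT y|lebesgue_on {0<..<d}. ?c x * V0 (x, y) * (sin (pi / (2 * d) * y))\<^sup>2) = (LINT y|lebesgue_on {0<..<d}. ?c x * V (x, y) * (sin (pi / (2 * d) * y))\<^sup>2)"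
        by (intro lint_lebesgue_on_AE_eq) (auto elim: eventually_mono)
      then show "x \<in> dyadic k \<longrightarrow> (LINT y|lebesgue_on {0<..<d}. ?c x * V0 (x, y) * (sin (pi / (2 * d) * y))\<^sup>2) = d / 2 * (?c x * rho x)"
        unfolding inner by simp
    qed
  qed
  also have "... = (LINT x|lebesgue_on (dyadic k). ?c x * rho x)" using d by simp
  also have "... = (LINT x|lebesgue. indicator (dyadic k) x *\<^sub>R (?c x * rho x))"
    using dyadic_borel[of k] by (subst integral_restrict_space) (auto intro: sets_completionI_sets)
  also have "... = (LINT x:dyadic k|lborel. ?c x * rho x)"
    unfolding set_lebesgue_integral_def by (intro integral_completion) measurable
  finally have \<beta>: "beta d V0 k = (LINT x:dyadic k|lborel. ?c x * rho x)" .
  define a :: real where "a = (if k = 0 then 1 else 2 ^ nat (\<bar>k\<bar> - 1))"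
  have ri: "set_integrable lborel (dyadic k) rho" by (intro rho_integrable dyadic_borel dyadic_bounded)
  have ci: "set_integrable lborel (dyadic k) (\<lambda>x. ?c x * rho x)"
  proof -
    obtain b where b: "\<And>x. x \<in> dyadic k \<Longrightarrow> \<bar>x\<bar> \<le> b" using dyadic_bounded[of k] unfolding bounded_iff by auto
    have "set_integrable lborel (dyadic k) (\<lambda>x. (1 + \<bar>b\<bar>) * rho x)" by (intro set_integrable_mult_right ri)
    then show ?thesis unfolding set_integrable_def
    proof (rule Bochner_Integration.integrable_bound)
      show "AE x in lborel. norm (indicator (dyadic k) x *\<^sub>R (?c x * rho x)) \<le> norm (indicator (dyadic k) x *\<^sub>R ((1 + \<bar>b\<bar>) * rho x))"
      proof (rule AE_I2)
        fix x
        have "?c x * rho x \<le> (1 + \<bar>b\<bar>) * rho x" if "x \<in> dyadic k" using b[OF that] rho_nonneg by (intro mult_right_mono) auto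
        then show "norm (indicator (dyadic k) x *\<^sub>R (?c x * rho x)) \<le> norm (indicator (dyadic k) x *\<^sub>R ((1 + \<bar>b\<bar>) * rho x))"
          using rho_nonneg[of x] c0[of x] by (auto simp: indicator_def abs_mult)
      qed
    qed measurable
  qed
  have "a * (LINT x:dyad k|lborel. rho x) \<le> a * (LINT x:dyadic k|lborel. rho x)"
    using dyad_dyadic ri rho_nonneg by (intro mult_left_mono set_integral_subset_le) (auto simp: a_def)
  also have "... = (LINT x:dyadic k|lborel. a * rho x)" by simp
  also have "... \<le> (LINT x:dyadic k|lborel. ?c x * rho x)"
    using ri ci dyadic_ge[of k] rho_nonneg by (intro set_integral_mono mult_right_mono) (auto simp: a_def)
  finally have am: "a * (LINT x:dyad k|lborel. rho x) \<le> beta d V0 k" unfolding \<beta> .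
  have m0: "0 \<le> (LINT x:dyad k|lborel. rho x)"
    unfolding set_lebesgue_integral_def using rho_nonneg by (intro integral_nonneg_AE AE_I2) auto
  have "1 \<le> a * (2 * (1/2) ^ nat \<bar>k\<bar>)"
  proof (cases "k = 0")
    case False
    then have "nat \<bar>k\<bar> = Suc (nat (\<bar>k\<bar> - 1))" by auto
    then show ?thesis using False by (simp add: a_def power_one_over)
  qed (simp add: a_def)
  from mult_right_mono[OF this m0] have "(LINT x:dyad k|lborel. rho x) \<le> (2 * (1/2) ^ nat \<bar>k\<bar>) * (a * (LINT x:dyad k|lborel. rho x))" by (simp add: mult_ac)
  also have "... \<le> (2 * (1/2) ^ nat \<bar>k\<bar>) * beta d V0 k" using am by (intro mult_left_mono) auto
  finally show ?thesis by (simp add: mult_ac)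
qed

section \<open>The eigenvalue estimate\<close>

text \<open>The terms of both sums are bounded away from \<open>0\<close> by the thresholds. Hence a finite sum has finitely many terms.\<close>
lemma finite_of_infsum:
  fixes f :: "'a \<Rightarrow> ennreal"
  assumes fin: "infsum f A < \<infinity>" and c: "0 < c" and ge: "\<And>k. k \<in> A \<Longrightarrow> ennreal c \<le> f k"
  shows "finite A"
proof (rule ccontr)
  assume inf: "infinite A"
  obtain X where X: "infsum f A = ennreal X" "0 \<le> X" using fin by (cases "infsum f A") auto
  obtain n :: nat where n: "X / c < real n" using reals_Archimedean2 by blast
  obtain F where F: "finite F" "F \<subseteq> A" "card F = n" using infinite_arbitrarily_large[OF inf, of n] by blast
  have "ennreal (real n * c) = (\<Sum>k\<in>F. ennreal c)" using F c by (simp add: ennreal_mult' ennreal_of_nat_eq_real_of_nat)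
  also have "... \<le> sum f F" using F ge by (intro sum_mono) auto
  also have "... \<le> infsum f A" unfolding nonneg_infsum_complete[of A f, simplified] using F by (intro SUP_upper) auto
  finally have "real n * c \<le> X" unfolding X(1) using X(2) by (simp add: ennreal_le_iff)
  then show False using n c by (simp add: field_simps)
qed

lemma dyad_end_diff_le: "dyad_end k - dyad_end (k - 1) \<le> 2 * 2 ^ nat \<bar>k\<bar>"
proof -
  consider "k = 0" | "k > 0" | "k < 0" by linarith
  then show ?thesis
  proof cases
    case 2
    have "- ((2::real) ^ nat (k - 1)) \<le> 2 ^ nat k" by (rule order_trans[of _ 0]) auto
    with 2 show ?thesis by (simp add: dyad_end_def)
  next
    case 3
    then have "nat (- (k - 1) - 1) = nat \<bar>k\<bar>" by auto
    moreover have "- ((2::real) ^ nat (- k - 1)) \<le> 2 ^ nat (- k)" by (rule order_trans[of _ 0]) auto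
    ultimately show ?thesis using 3 by (simp add: dyad_end_def)
  qed (simp add: dyad_end_def)
qed

theorem theorem3p5:
  fixes d :: real
  assumes "d > 0"
  shows "\<exists>C\<^sub>4>0. \<exists>C\<^sub>5>0. \<exists>C\<^sub>6>0. \<forall>V :: real \<times> real \<Rightarrow> real. admissible_potential d V \<longrightarrow>
    ennreal_of_enat (N_minus d V) \<le>
      1 + ennreal C\<^sub>6 * ((\<Sum>\<^sub>\<infinity>k\<in>{k. beta d V k > C\<^sub>4}. ennreal (sqrt (beta d V k)))
                        + (\<Sum>\<^sub>\<infinity>k\<in>{k. C_norm d V k > ennreal C\<^sub>5}. C_norm d V k))"
proof -
  interpret width d by unfold_locales (rule assms)
  \<comment> \<open>\<open>longitudinal\<close> with \<open>\<kappa> = 1/4\<close> requires \<open>96 * C4 \<le> 1/4\<close>; \<open>t\<close> is such that the transversal bound uses up exactly \<open>c\<^sub>0\<close>.\<close>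
  define C4 :: real where "C4 = 1 / 384"
  define t where "t = c\<^sub>0 / (8 * K_loc d + 16 / d)"
  have den: "0 < 8 * K_loc d + 16 / d" using K_loc_pos[OF d] d by (simp add: add_pos_pos)
  have t: "0 < t" unfolding t_def using c0_pos den by simp
  have tc: "2 * (4 * (K_loc d * t) + 8 * t / d) \<le> c\<^sub>0"
  proof -
    have "2 * (4 * (K_loc d * t) + 8 * t / d) = t * (8 * K_loc d + 16 / d)" by (simp add: algebra_simps)
    also have "... = c\<^sub>0" using den unfolding t_def by simp
    finally show ?thesis by simp
  qed
  \<comment> \<open>The summand \<open>2\<close> per heavy dyadic interval is absorbed by \<open>sqrt (beta d V k)\<close>, which exceeds \<open>sqrt C4\<close>.\<close>
  define C6 where "C6 = 8 + 2 / sqrt C4 + 8 / t"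
  have C4: "0 < C4" "0 < sqrt C4" by (auto simp: C4_def)
  have C6: "0 < C6" unfolding C6_def using C4 t by (intro add_pos_pos divide_pos_pos) auto
  have main: "ennreal_of_enat (N_minus d V0) \<le>
      1 + ennreal C6 * ((\<Sum>\<^sub>\<infinity>k\<in>{k. beta d V0 k > C4}. ennreal (sqrt (beta d V0 k)))
                        + (\<Sum>\<^sub>\<infinity>k\<in>{k. C_norm d V0 k > ennreal t}. C_norm d V0 k))"
    (is "_ \<le> 1 + ennreal C6 * (?S1 + ?S2)") if adm: "admissible_potential d V0" for V0
  proof (cases "?S1 + ?S2 = \<infinity>")
    case True
    have "ennreal C6 * \<infinity> = \<infinity>" using C6 by (simp add: ennreal_mult_top)
    then show ?thesis unfolding True by simp
  next
    case False
    then have S1: "?S1 < \<infinity>" and S2: "?S2 < \<infinity>" by (auto simp: less_top)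
    define Bd where "Bd = {k. beta d V0 k > C4}"
    define CC where "CC = {k. C_norm d V0 k > ennreal t}"
    have fB: "finite Bd" unfolding Bd_def
      by (rule finite_of_infsum[OF S1 C4(2)]) (auto intro!: ennreal_leI)
    have fC: "finite CC" unfolding CC_def
      by (rule finite_of_infsum[OF S2 t]) auto
    have S1eq: "?S1 = ennreal (\<Sum>k\<in>Bd. sqrt (beta d V0 k))"
      using fB C4 unfolding Bd_def by (subst infsum_finite) (auto intro!: sum_ennreal)
    have S2eq: "?S2 = (\<Sum>k\<in>CC. C_norm d V0 k)" using fC unfolding CC_def by simp
    obtain V where sp: "strip_potential d t V" and ae: "AE z in lborel. z \<in> strip d \<longrightarrow> V0 z = V z"
      using Borel_representative[OF adm d t] by blast
    interpret P: strip_potential d t V by (rule sp)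
    note JC = C_norm_ge_J_norm[OF sp ae]
    note \<beta>m = beta_ge_mass[OF sp ae]
    define Bc where "Bc = {k. J_norm V (P.R k) > ennreal t}"
    have BC: "Bc \<subseteq> CC" unfolding Bc_def CC_def using JC by (auto intro: less_le_trans)
    then have fBc: "finite Bc" using fC finite_subset by blast
    have Cfin: "C_norm d V0 k < \<infinity>" if "k \<in> CC" for k
    proof -
      have "C_norm d V0 k \<le> (\<Sum>k\<in>CC. C_norm d V0 k)" using fC that by (intro member_le_sum) auto
      then show ?thesis using S2[unfolded S2eq] by (rule le_less_trans)
    qed
    define c where "c k = enn2real (J_norm V (P.R k))" for k
    have ck: "J_norm V (P.R k) = ennreal (c k) \<and> t < c k" if k: "k \<in> Bc" for k
    proof -
      have "J_norm V (P.R k) < \<infinity>" using Cfin[of k] JC[of k] k BC by (auto intro: le_less_trans)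
      then have e: "J_norm V (P.R k) = ennreal (c k)" by (simp add: c_def)
      then show ?thesis using k t by (simp add: Bc_def ennreal_less_iff)
    qed
    have mass0: "0 \<le> (LINT x:dyad k|lborel. P.rho x)" for k
      unfolding set_lebesgue_integral_def using P.rho_nonneg by (intro integral_nonneg_AE AE_I2) auto
    have "\<exists>n h f. real n \<le> 1 + (\<Sum>k\<in>Bd. 2 * sqrt (4 * (4 * beta d V0 k)) + 2) + (\<Sum>k\<in>Bc. 8 * (c k / t)) \<and> P.rank_bound n h f"
    proof (rule P.finite_rank_bound[where C=C4])
      fix k assume "k \<notin> Bd"
      then have b: "beta d V0 k \<le> C4" by (simp add: Bd_def)
      have "(LINT x:dyad k|lborel. P.rho x) \<le> 2 * beta d V0 k * (1/2) ^ nat \<bar>k\<bar>" by (rule \<beta>m)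
      also have "... \<le> 2 * C4 * (1/2) ^ nat \<bar>k\<bar>" using b by (intro mult_right_mono) auto
      finally show "(LINT x:dyad k|lborel. P.rho x) \<le> 2 * C4 * (1/2) ^ nat \<bar>k\<bar>" .
    next
      fix k
      have "(dyad_end k - dyad_end (k - 1)) * (LINT x:dyad k|lborel. P.rho x) \<le> (2 * 2 ^ nat \<bar>k\<bar>) * (2 * beta d V0 k * (1/2) ^ nat \<bar>k\<bar>)"
        using dyad_end_diff_le[of k] \<beta>m[of k] mass0 by (intro mult_mono) auto
      also have "... = 4 * beta d V0 k" by (simp add: power_one_over)
      finally show "(dyad_end k - dyad_end (k - 1)) * (LINT x:dyad k|lborel. P.rho x) \<le> 4 * beta d V0 k" .
    next
      fix k assume "k \<notin> Bc"
      then show "J_norm V (P.R k) \<le> ennreal t" by (simp add: Bc_def not_less)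
    next
      fix k assume "k \<in> Bc"
      then show "J_norm V (P.R k) = ennreal (c k) \<and> t < c k" by (rule ck)
    qed (use fB fBc tc in \<open>auto simp: C4_def\<close>)
    then obtain n h f where n: "real n \<le> 1 + (\<Sum>k\<in>Bd. 2 * sqrt (4 * (4 * beta d V0 k)) + 2) + (\<Sum>k\<in>Bc. 8 * (c k / t))"
     and rk: "P.rank_bound n h f"
      by blast
    have "AE z in lebesgue_on (strip d). V0 z = V z"
      using ae by (simp add: AE_restrict_space_iff AE_completion_iff)
    from P.N_minus_le_rank[OF this rk] have Nn: "N_minus d V0 \<le> enat n" by blast
    have "(\<Sum>k\<in>Bd. 2 * sqrt (4 * (4 * beta d V0 k)) + 2) \<le> (\<Sum>k\<in>Bd. C6 * sqrt (beta d V0 k))"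
    proof (rule sum_mono)
      fix k assume "k \<in> Bd"
      then have b: "sqrt C4 \<le> sqrt (beta d V0 k)" by (simp add: Bd_def)
      have "sqrt (4 * (4 * beta d V0 k)) = sqrt 16 * sqrt (beta d V0 k)" by (subst real_sqrt_mult[symmetric]) simp
      also have "sqrt 16 = (4::real)" by (rule real_sqrt_unique) auto
      finally have e: "sqrt (4 * (4 * beta d V0 k)) = 4 * sqrt (beta d V0 k)" .
      have "2 \<le> 2 / sqrt C4 * sqrt (beta d V0 k)" using b C4 by (simp add: field_simps)
      moreover have "0 \<le> 8 / t * sqrt (beta d V0 k)" using t b C4 by simp
      ultimately show "2 * sqrt (4 * (4 * beta d V0 k)) + 2 \<le> C6 * sqrt (beta d V0 k)"
        unfolding e C6_def distrib_right by linarith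
    qed
    moreover have "(\<Sum>k\<in>Bc. 8 * (c k / t)) \<le> (\<Sum>k\<in>Bc. C6 * c k)"
    proof (rule sum_mono)
      fix k assume "k \<in> Bc"
      then have "0 \<le> c k" using ck[of k] t by auto
      then have "8 / t * c k \<le> C6 * c k" using C4 by (intro mult_right_mono) (auto simp: C6_def)
      then show "8 * (c k / t) \<le> C6 * c k" by simp
    qed
    ultimately have n': "real n \<le> 1 + C6 * ((\<Sum>k\<in>Bd. sqrt (beta d V0 k)) + (\<Sum>k\<in>Bc. c k))"
      using n by (simp add: sum_distrib_left distrib_left)
    have s0: "0 \<le> (\<Sum>k\<in>Bd. sqrt (beta d V0 k))" "0 \<le> (\<Sum>k\<in>Bc. c k)"
      using C4 ck t by (auto intro!: sum_nonneg simp: Bd_def c_def)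
    have "ennreal_of_enat (N_minus d V0) \<le> ennreal_of_enat (enat n)" using Nn by (simp only: ennreal_of_enat_le_iff)
    also have "... = ennreal (real n)" by (simp add: ennreal_of_nat_eq_real_of_nat)
    also have "... \<le> ennreal (1 + C6 * ((\<Sum>k\<in>Bd. sqrt (beta d V0 k)) + (\<Sum>k\<in>Bc. c k)))" by (rule ennreal_leI[OF n'])
    also have "... = 1 + ennreal C6 * (ennreal (\<Sum>k\<in>Bd. sqrt (beta d V0 k)) + ennreal (\<Sum>k\<in>Bc. c k))"
      using s0 C6 by (simp add: ennreal_mult)
    also have "ennreal (\<Sum>k\<in>Bc. c k) = (\<Sum>k\<in>Bc. ennreal (c k))" by (intro sum_ennreal[symmetric]) (simp add: c_def)
    also have "... = (\<Sum>k\<in>Bc. J_norm V (P.R k))" using ck by (intro sum.cong) auto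
    also have "1 + ennreal C6 * (ennreal (\<Sum>k\<in>Bd. sqrt (beta d V0 k)) + (\<Sum>k\<in>Bc. J_norm V (P.R k))) \<le> 1 + ennreal C6 * (?S1 + ?S2)"
    proof (intro add_left_mono mult_left_mono add_mono)
      show "ennreal (\<Sum>k\<in>Bd. sqrt (beta d V0 k)) \<le> ?S1" by (simp only: S1eq)
      have "(\<Sum>k\<in>Bc. J_norm V (P.R k)) \<le> (\<Sum>k\<in>Bc. C_norm d V0 k)" by (intro sum_mono JC)
      also have "... \<le> (\<Sum>k\<in>CC. C_norm d V0 k)" using fC BC by (intro sum_mono2) auto
      finally show "(\<Sum>k\<in>Bc. J_norm V (P.R k)) \<le> ?S2" by (simp only: S2eq)
    qed auto
    finally show ?thesis .
  qed
  show ?thesis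
    using C4(1) t C6 main by (intro exI[of _ C4] exI[of _ t] exI[of _ C6] conjI allI impI) auto
qed

end
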